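(* Let $B$ be a standard Brownian motion on $[0,1]$ with $B(0)=0$, let $h=\max_{0\le u\le1}B(u)$ and let $\theta\in(0,1)$ be the smallest $u$ with $B(u)=h$. Let $M_1$ and $G_{11}$ be as defined in the context. For $0\le t<\theta$, with $s=1-\frac t\theta$, $$E[B(t)\mid\theta]=\int_0^\infty E[B(t)\mid\theta,h]\,p(h\mid\theta)\,dh=\sqrt{\frac{\pi\theta}{2}}-\int_0^\infty M_1\Big(1-\frac t\theta,\frac h{\sqrt\theta}\Big)\frac{h}{\sqrt\theta}\,e^{-h^2/(2\theta)}\,dh$$ $$=\sqrt{\frac{\pi\theta}2}-\sqrt\theta\,G_{11}(s)=\sqrt{\frac{\pi\theta}{2}}-\sqrt{\frac{2\theta}{\pi}}\Big[\tan^{-1}\Big(\sqrt{\frac s{1-s}}\Big)+\sqrt{s(1-s)}\Big].$$ For $\theta\le t\le1$, with $s=\frac{t-\theta}{1-\theta}$, $$E[B(t)\mid\theta]=\sqrt{\frac{\pi\theta}{2}}-\sqrt{\frac{2(1-\theta)}{\pi}}\Big[\tan^{-1}\Big(\sqrt{\frac s{1-s}}\Big)+\sqrt{s(1-s)}\Big].$$ For $0\le t\le\theta$, with $s=1-\frac t\theta$, the second moment is $$E[B^2(t)\mid\theta]=2\theta-4\theta\sqrt s+\theta\,[3s-s^2],$$ and the conditional variance is $\mathrm{Var}[B(t)\mid\theta]=E[B^2(t)\mid\theta]-E[B(t)\mid\theta]^2$. For $\theta\le t\le1$, with $s=\frac{t-\theta}{1-\theta}$, $$\mathrm{Var}[B(t)\mid\theta]=\mathrm{Var}[h\mid\theta]+(1-\theta)\big[3s-s^2-G_{11}(s)^2\big],\qquad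 \mathrm{Var}[h\mid\theta]=\Big(2-\frac\pi2\Big)\theta.$$
   Context: For $0\le s\le1$ and $y>0$ define $$M_1(s,y)=\frac1y\big[1-s+sy^2\big]\,\mathrm{erf}\Big(\frac{y\sqrt s}{\sqrt{2(1-s)}}\Big)+\sqrt{\frac{2s(1-s)}{\pi}}\exp\Big(-\frac{sy^2}{2(1-s)}\Big),$$ $$G_{11}(s)=\sqrt{\frac2\pi}\Big[\tan^{-1}\Big(\sqrt{\frac{s}{1-s}}\Big)+\sqrt{s(1-s)}\Big],$$ where expressions singular at an endpoint are read as their limits ($M_1(1,y)=y$, $\tan^{-1}(\infty)=\pi/2$). Here $\mathrm{erf}(z)=\frac2{\sqrt\pi}\int_0^ze^{-u^2}du$. The letters $\theta,h$ denote both the random variables (first argmax, maximum of $B$ on $[0,1]$) and their values. $p(h\mid\theta)$ is the conditional density of the maximum given the argmax, known to be $p(h\mid\theta)=\frac h\theta e^{-h^2/(2\theta)}$, $h>0$. Conditional expectations and variances are with respect to the regular conditional distributions given the stated values, the formulas giving a version (valid for Lebesgue-almost every value of the conditioning variables). *)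

theory Defs
  imports "HOL-Probability.Probability"
begin

text \<open>Only the values of \<open>B\<close> on \<open>{0..1}\<close> matter. All paths (not merely almost all)
  start at 0 and are continuous, so that the maximum and its location are defined at
  every sample point.\<close>

locale brownian_motion_01 = prob_space M for M :: "'a measure" +
  fixes B :: "real \<Rightarrow> 'a \<Rightarrow> real"
  assumes random_variable_B: "0 \<le> t \<Longrightarrow> t \<le> 1 \<Longrightarrow> random_variable borel (B t)"
    and start_zero: "\<omega> \<in> space M \<Longrightarrow> B 0 \<omega> = 0"
    and continuous_paths: "\<omega> \<in> space M \<Longrightarrow> continuous_on {0..1} (\<lambda>t. B t \<omega>)"
    and gaussian_increments: "0 \<le> s \<Longrightarrow> s < t \<Longrightarrow> t \<le> 1 \<Longrightarrow>
      distributed M lborel (\<lambda>\<omega>. B t \<omega> - B s \<omega>) (\<lambda>x. ennreal (normal_density 0 (sqrt (t - s)) x))"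
    and independent_increments: "0 \<le> \<tau> 0 \<Longrightarrow> (\<forall>i<n. \<tau> i \<le> \<tau> (Suc i)) \<Longrightarrow> \<tau> n \<le> 1 \<Longrightarrow>
      indep_vars (\<lambda>_. borel) (\<lambda>i \<omega>. B (\<tau> (Suc i)) \<omega> - B (\<tau> i) \<omega>) {..<n}"

definition path_max :: "(real \<Rightarrow> 'a \<Rightarrow> real) \<Rightarrow> 'a \<Rightarrow> real" where
  "path_max B \<omega> = (SUP u\<in>{0..1}. B u \<omega>)"

definition first_argmax :: "(real \<Rightarrow> 'a \<Rightarrow> real) \<Rightarrow> 'a \<Rightarrow> real" where
  "first_argmax B \<omega> = (LEAST u. 0 \<le> u \<and> u \<le> 1 \<and> B u \<omega> = path_max B \<omega>)"

text \<open>\<open>\<kappa>\<close> is a version of the regular conditional distribution of the real random variable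
  \<open>Y\<close> given \<open>X\<close>: a probability kernel \<open>x \<mapsto> P(Y \<in> \<cdot> | X = x)\<close> disintegrating the joint law.
  It is determined up to a null set of the law of \<open>X\<close>, and exists
  whenever \<open>X\<close> and \<open>Y\<close> are measurable, since \<open>Y\<close> is real-valued.\<close>

definition regular_cond_distr ::
  "'a measure \<Rightarrow> ('a \<Rightarrow> 'b::topological_space) \<Rightarrow> ('a \<Rightarrow> real) \<Rightarrow> ('b \<Rightarrow> real measure) \<Rightarrow> bool" where
  "regular_cond_distr M X Y \<kappa> \<longleftrightarrow>
     \<kappa> \<in> measurable borel (prob_algebra borel) \<and>
     (\<forall>A\<in>sets borel. \<forall>C\<in>sets borel.
        emeasure M {\<omega> \<in> space M. X \<omega> \<in> A \<and> Y \<omega> \<in> C} =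
        (\<integral>\<^sup>+ x\<in>A. emeasure (\<kappa> x) C \<partial>distr M borel X))"

definition mean :: "real measure \<Rightarrow> real" where
  "mean \<mu> = (\<integral>b. b \<partial>\<mu>)"

definition second_moment :: "real measure \<Rightarrow> real" where
  "second_moment \<mu> = (\<integral>b. b\<^sup>2 \<partial>\<mu>)"

definition var :: "real measure \<Rightarrow> real" where
  "var \<mu> = (\<integral>b. (b - mean \<mu>)\<^sup>2 \<partial>\<mu>)"

definition erf :: "real \<Rightarrow> real" where
  "erf z = 2 / sqrt pi * (LBINT u=0..z. exp (- u\<^sup>2))"

text \<open>At \<open>s = 1\<close> the quotients below divide by zero; the value there is the limit \<open>s \<rightarrow> 1\<close>.\<close>

definition M1 :: "real \<Rightarrow> real \<Rightarrow> real" where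
  "M1 s y = (if s = 1 then y else
     1 / y * (1 - s + s * y\<^sup>2) * erf (y * sqrt s / sqrt (2 * (1 - s)))
     + sqrt (2 * s * (1 - s) / pi) * exp (- (s * y\<^sup>2) / (2 * (1 - s))))"

definition arctan_odds :: "real \<Rightarrow> real" where
  "arctan_odds s = (if s = 1 then pi / 2 else arctan (sqrt (s / (1 - s))))"

definition G11 :: "real \<Rightarrow> real" where
  "G11 s = sqrt (2 / pi) * (arctan_odds s + sqrt (s * (1 - s)))"

text \<open>\<open>max_density \<theta> h\<close> is \<open>p(h | \<theta>)\<close>.\<close>

definition max_density :: "real \<Rightarrow> real \<Rightarrow> real" where
  "max_density \<theta> h = (if 0 < h then h / \<theta> * exp (- h\<^sup>2 / (2 * \<theta>)) else 0)"

end

theory Submission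
  imports Defs "HOL-Real_Asymp.Real_Asymp"
begin

text \<open>
  The reflection principle gives the joint law of the running maximum and the endpoint. The event
  that the argmax is at most \<open>u\<close> compares the maximum before \<open>u\<close> with that of the independent
  path restarted at \<open>u\<close>; differentiating its probability in \<open>u\<close> yields the law of the
  argmax \<open>\<theta>\<close>, the maximum \<open>h\<close> and the gap at the end, which has a product form in \<open>h\<close> and the gap.
  Cutting the path at \<open>t\<close> gives the conditional moments of \<open>Z = h - B(t)\<close>, \<open>Z\<^sup>2\<close> and \<open>h Z\<close>
  given \<open>\<theta>\<close>, and \<open>B = h - Z\<close> turns them into the moments of \<open>B(t)\<close>. To stay with nonnegative
  integrals, the last step uses \<open>B\<^sup>+ + Z = B\<^sup>- + h\<close> and \<open>B\<^sup>2 + 2 h Z = h\<^sup>2 + Z\<^sup>2\<close>.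
  Writing \<open>erf\<close> as a Gaussian integral reduces the integral of \<open>M\<^sub>1\<close> to that of a rational function.
\<close>

text \<open>The law of the argmax is not obtained by differentiating a measure. For fixed m and z,
  the weight of the event that the argmax is at most u, the maximum exceeds m and the final gap is z
  is a closed expression in \<open>erf\<close>. Its pointwise derivative in u contains a
  first-passage density, and integrating it back turns the event into an integral over the argmax.
  So the path is cut at deterministic times only, where past and future are independent;
  independence at the argmax is read off from the product density.

  No formula for the mean of B(t) given both \<theta> and h is derived. Its integral over h is the
  mean given \<theta> by the tower property, the integral of \<open>M1\<close> has a closed form,
  and both sides of the middle equality come out as the same number.

  After the argmax, h and Z are independent given \<theta>, so the variance splits into two
  summands. Before it they are not; there the moment of h Z comes from a martingale identity for
  motion killed at 0, the origin of the square root in the second moment.\<close>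

subsection \<open>The error function\<close>

lemma DERIV_erf: "DERIV erf z :> 2 / sqrt pi * exp (- z\<^sup>2)"
proof -
  \<comment> \<open>\<open>interval_integral_FTC2\<close> works on a closed interval containing the
    base point 0. One unit of slack on each side puts \<open>z\<close> in the interior, so the
    derivative within the interval is a full derivative.\<close>
  define a where "a = - \<bar>z\<bar> - 1"
  define b where "b = \<bar>z\<bar> + 1"
  have "((\<lambda>u. LBINT y=ereal 0..ereal u. exp (- y\<^sup>2)) has_vector_derivative (exp (- z\<^sup>2))) (at z within {a..b})"
    by (rule interval_integral_FTC2) (auto simp: a_def b_def intro!: continuous_intros)
  then have "((\<lambda>u. LBINT y=ereal 0..ereal u. exp (- y\<^sup>2)) has_vector_derivative (exp (- z\<^sup>2))) (at z)"
    by (subst (asm) at_within_interior) (auto simp: a_def b_def)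
  then have "DERIV (\<lambda>u. LBINT y=ereal 0..ereal u. exp (- y\<^sup>2)) z :> exp (- z\<^sup>2)"
    by (simp add: has_real_derivative_iff_has_vector_derivative)
  from DERIV_cmult[OF this, of "2 / sqrt pi"] show ?thesis
    by (simp add: erf_def[abs_def] zero_ereal_def)
qed

lemma DERIV_erf' [derivative_intros]:
  "(f has_real_derivative D) (at x within A) \<Longrightarrow>
   ((\<lambda>x. erf (f x)) has_real_derivative (2 / sqrt pi * exp (- (f x)\<^sup>2) * D)) (at x within A)"
  by (rule DERIV_chain2[OF DERIV_erf])

lemma isCont_erf: "isCont erf x"
  using DERIV_erf DERIV_isCont by blast

lemma continuous_on_erf: "continuous_on A erf"
  using isCont_erf by (simp add: continuous_at_imp_continuous_on)

lemma borel_measurable_erf [measurable]: "erf \<in> borel_measurable borel"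
  by (rule borel_measurable_continuous_onI[OF continuous_on_erf])

lemma erf_0 [simp]: "erf 0 = 0"
  by (simp add: erf_def zero_ereal_def)

lemma erf_mono: "x \<le> y \<Longrightarrow> erf x \<le> erf y"
  by (rule DERIV_nonneg_imp_nondecreasing) (use DERIV_erf in fastforce)+

lemma erf_nonneg: "0 \<le> x \<Longrightarrow> 0 \<le> erf x"
  using erf_mono[of 0 x] by simp

text \<open>The sum \<open>erf (- x) + erf x\<close> has derivative 0 everywhere and vanishes at
  0.\<close>

lemma erf_minus: "erf (- x) = - erf x"
proof -
  have "DERIV (\<lambda>x. erf (- x) + erf x) y :> 0" for y
    by (auto intro!: derivative_eq_intros)
  then have "(\<lambda>x. erf (- x) + erf x) x = (\<lambda>x. erf (- x) + erf x) 0"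
    by (intro DERIV_isconst_all) auto
  then show ?thesis by simp
qed

lemma tendsto_erf_at_top: "(erf \<longlongrightarrow> 1) at_top"
proof -
  have g: "has_bochner_integral lborel (\<lambda>x. indicator {0..} x *\<^sub>R exp (- x\<^sup>2)) (sqrt pi / 2)"
    by (rule gaussian_moment_0)
  then have "((\<lambda>b. LBINT x:{0..b}. exp (- x\<^sup>2)) \<longlongrightarrow> (LBINT x:{0..}. exp (- x\<^sup>2 :: real))) at_top"
    by (intro tendsto_set_lebesgue_integral_at_top)
       (auto simp: set_integrable_def intro: integrable.intros)
  also have "(LBINT x:{0..}. exp (- x\<^sup>2 :: real)) = sqrt pi / 2"
    using g by (simp add: set_lebesgue_integral_def has_bochner_integral_iff)
  finally have "((\<lambda>b. 2 / sqrt pi * (LBINT x:{0..b}. exp (- x\<^sup>2))) \<longlongrightarrow> 2 / sqrt pi * (sqrt pi / 2)) at_top"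
    by (intro tendsto_intros)
  then have "((\<lambda>b. 2 / sqrt pi * (LBINT x:{0..b}. exp (- x\<^sup>2))) \<longlongrightarrow> 1) at_top"
    by simp
  then show ?thesis
    by (rule Lim_transform_eventually)
       (auto intro!: eventually_mono[OF eventually_ge_at_top[of 0]] simp: erf_def zero_ereal_def interval_integral_Icc)
qed

lemma tendsto_erf_at_bot: "(erf \<longlongrightarrow> - 1) at_bot"
proof -
  have "((\<lambda>x. - erf (- x)) \<longlongrightarrow> - 1) at_bot"
    by (intro tendsto_minus filterlim_compose[OF tendsto_erf_at_top] filterlim_uminus_at_top_at_bot)
  then show ?thesis by (simp add: erf_minus)
qed

subsection \<open>The fundamental theorem of calculus for nonnegative integrals\<close>

text \<open>One-sided limits of \<open>F\<close> replace its values at the ends, because the main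
  antiderivative divides by zero there: \<open>split_weight\<close> has
  \<open>sqrt (2 * u * (T - u) * T)\<close> in a denominator, and its HOL value at
  \<open>u = 0\<close> or \<open>u = T\<close> is in general not the limit.\<close>

lemma nn_integral_FTC_Ioo:
  fixes f F :: "real \<Rightarrow> real"
  assumes "a < b"
    and F: "\<And>x. a < x \<Longrightarrow> x < b \<Longrightarrow> DERIV F x :> f x"
    and f: "\<And>x. a < x \<Longrightarrow> x < b \<Longrightarrow> isCont f x"
    and nn: "\<And>x. a < x \<Longrightarrow> x < b \<Longrightarrow> 0 \<le> f x"
    and A: "(F \<longlongrightarrow> A) (at_right a)" and B: "(F \<longlongrightarrow> B) (at_left b)"
  shows "(\<integral>\<^sup>+x. ennreal (f x) * indicator {a<..<b} x \<partial>lborel) = ennreal (B - A)"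
proof -
  have lim: "((F \<circ> real_of_ereal) \<longlongrightarrow> A) (at_right (ereal a))" "((F \<circ> real_of_ereal) \<longlongrightarrow> B) (at_left (ereal b))"
    using A B by (simp_all add: ereal_tendsto_simps)
  have i: "set_integrable lborel (einterval a b) f" "(LBINT x=a..b. f x) = B - A"
    using interval_integral_FTC_nonneg[of "ereal a" "ereal b" F f A B] lim assms by auto
  have "(\<integral>\<^sup>+x. ennreal (f x) * indicator {a<..<b} x \<partial>lborel)
      = (\<integral>\<^sup>+x. ennreal (indicator {a<..<b} x *\<^sub>R f x) \<partial>lborel)"
    by (intro nn_integral_cong) (auto split: split_indicator)
  also have "\<dots> = ennreal (\<integral>x. indicator {a<..<b} x *\<^sub>R f x \<partial>lborel)"
    using i(1) nn by (intro nn_integral_eq_integral) (auto simp: set_integrable_def split: split_indicator)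
  also have "(\<integral>x. indicator {a<..<b} x *\<^sub>R f x \<partial>lborel) = B - A"
    using i(2) \<open>a < b\<close> by (simp add: interval_lebesgue_integral_def set_lebesgue_integral_def)
  finally show ?thesis .
qed

text \<open>The open half-line matches the strict inequalities in the densities below; it differs
  from the closed one by a null point.\<close>

lemma nn_integral_FTC_Ioi:
  fixes f F :: "real \<Rightarrow> real"
  assumes [measurable]: "f \<in> borel_measurable borel"
    and "\<And>x. a \<le> x \<Longrightarrow> DERIV F x :> f x" "\<And>x. a \<le> x \<Longrightarrow> 0 \<le> f x" "(F \<longlongrightarrow> B) at_top"
  shows "(\<integral>\<^sup>+x. ennreal (f x) * indicator {a<..} x \<partial>lborel) = ennreal (B - F a)"
proof -
  have "(\<integral>\<^sup>+x. ennreal (f x) * indicator {a<..} x \<partial>lborel) = (\<integral>\<^sup>+x. ennreal (f x) * indicator {a..} x \<partial>lborel)"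
    by (intro nn_integral_cong_AE eventually_mono[OF AE_lborel_singleton[of a]]) (auto split: split_indicator)
  then show ?thesis using nn_integral_FTC_atLeast[OF assms] by simp
qed

lemma nn_integral_Ioi_scale:
  fixes F :: "real \<Rightarrow> ennreal"
  assumes [measurable]: "F \<in> borel_measurable borel" and "c > 0"
  shows "(\<integral>\<^sup>+z. F z * indicator {0<..} z \<partial>lborel) = ennreal c * (\<integral>\<^sup>+y. F (c * y) * indicator {0<..} y \<partial>lborel)"
  using \<open>c > 0\<close> by (subst nn_integral_real_affine[of _ c 0])
    (auto intro!: arg_cong[where f = "\<lambda>x. ennreal c * x"] nn_integral_cong simp: zero_less_mult_iff split: split_indicator)

subsection \<open>Gaussian integrals\<close>

abbreviation gauss :: "real \<Rightarrow> real \<Rightarrow> real" where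
  "gauss v \<equiv> normal_density 0 (sqrt v)"

lemma gauss_eq: "v > 0 \<Longrightarrow> gauss v x = exp (- x\<^sup>2 / (2 * v)) / sqrt (2 * pi * v)"
  by (simp add: normal_density_def)

lemma gauss_minus [simp]: "gauss v (- x) = gauss v x"
  by (simp add: normal_density_def)

lemma DERIV_gauss [derivative_intros]:
  assumes "v > 0" "(f has_real_derivative D) (at x within A)"
  shows "((\<lambda>x. gauss v (f x)) has_real_derivative (- (f x / v) * gauss v (f x) * D)) (at x within A)"
proof -
  have "DERIV (gauss v) y :> - (y / v) * gauss v y" for y
    unfolding normal_density_def by (rule derivative_eq_intros refl | use \<open>v > 0\<close> in simp)+
  from DERIV_chain2[OF this assms(2)] show ?thesis .
qed

lemma tendsto_gauss_at_top:
  assumes "v > 0"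
  shows "(gauss v \<longlongrightarrow> 0) at_top"
proof -
  have "filterlim (\<lambda>x::real. x\<^sup>2) at_top at_top"
    by (intro filterlim_pow_at_top filterlim_ident) auto
  then have "filterlim (\<lambda>x::real. x\<^sup>2 * (1 / (2 * v))) at_top at_top"
    by (intro filterlim_at_top_mult_tendsto_pos[OF tendsto_const]) (use assms in auto)
  then have "filterlim (\<lambda>x. - (x\<^sup>2 * (1 / (2 * v)))) at_bot at_top"
    by (simp add: filterlim_uminus_at_bot)
  then have "((\<lambda>x. exp (- (x\<^sup>2 * (1 / (2 * v)))) / sqrt (2 * pi * v)) \<longlongrightarrow> 0 / sqrt (2 * pi * v)) at_top"
    by (intro tendsto_divide filterlim_compose[OF exp_at_bot] tendsto_const) (use assms in auto)
  moreover have "gauss v = (\<lambda>x. exp (- (x\<^sup>2 * (1 / (2 * v)))) / sqrt (2 * pi * v))"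
    using assms by (simp add: gauss_eq fun_eq_iff)
  ultimately show ?thesis by simp
qed

lemma nn_integral_gauss_shift_Ioi:
  assumes "v > 0"
  shows "(\<integral>\<^sup>+x. ennreal (gauss v (x - b)) * indicator {a<..} x \<partial>lborel) = ennreal ((1 - erf ((a - b) / sqrt (2 * v))) / 2)"
proof -
  have "(\<integral>\<^sup>+x. ennreal (gauss v (x - b)) * indicator {a<..} x \<partial>lborel) = ennreal (1 / 2 - erf ((a - b) / sqrt (2 * v)) / 2)"
  proof (rule nn_integral_FTC_Ioi)
    show "DERIV (\<lambda>x. erf ((x - b) / sqrt (2 * v)) / 2) x :> gauss v (x - b)" for x
      using assms by (auto intro!: derivative_eq_intros simp: gauss_eq power_divide real_sqrt_mult field_simps)
    have "filterlim (\<lambda>x. x - b) at_top at_top"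
      using filterlim_tendsto_add_at_top[OF tendsto_const filterlim_ident, of "-b"] by simp
    then have "((\<lambda>x. erf ((x - b) * (1 / sqrt (2 * v))) / 2) \<longlongrightarrow> 1 / 2) at_top"
      by (intro tendsto_divide filterlim_compose[OF tendsto_erf_at_top] filterlim_at_top_mult_tendsto_pos[OF tendsto_const])
         (use assms in auto)
    then show "((\<lambda>x. erf ((x - b) / sqrt (2 * v)) / 2) \<longlongrightarrow> 1 / 2) at_top" by simp
  qed auto
  then show ?thesis by (simp add: diff_divide_distrib)
qed

text \<open>The identity of exponents behind \<open>gauss_mult\<close>. A Brownian bridge of length
  \<open>u + s\<close> from \<open>- m\<close> to \<open>z\<close> has at time \<open>u\<close> the
  mean \<open>(z * u - m * s) / (u + s)\<close> and the variance
  \<open>u * s / (u + s)\<close>.\<close>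

lemma complete_square:
  fixes m a u s z :: real
  assumes "u > 0" "s > 0"
  shows "(m + a)\<^sup>2 / (2 * u) + (a - z)\<^sup>2 / (2 * s)
      = (m + z)\<^sup>2 / (2 * (u + s)) + (a - (z * u - m * s) / (u + s))\<^sup>2 / (2 * (u * s / (u + s)))"
proof -
  define T where "T = u + s"
  have T: "T > 0" "T \<noteq> 0" "u \<noteq> 0" "s \<noteq> 0" using assms by (auto simp: T_def)
  have "(m + a)\<^sup>2 / (2 * u) + (a - z)\<^sup>2 / (2 * s) = ((m + a)\<^sup>2 * (s * T) + (a - z)\<^sup>2 * (u * T)) / (2 * u * s * T)"
    using T by (simp add: add_divide_distrib)
  also have "(m + a)\<^sup>2 * (s * T) + (a - z)\<^sup>2 * (u * T) = (m + z)\<^sup>2 * (u * s) + (a * T - (z * u - m * s))\<^sup>2"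
    unfolding T_def by algebra
  also have "\<dots> / (2 * u * s * T) = (m + z)\<^sup>2 / (2 * T) + ((a * T - (z * u - m * s)) / T)\<^sup>2 / (2 * (u * s / T))"
    using T by (simp add: add_divide_distrib power_divide power2_eq_square)
  also have "(a * T - (z * u - m * s)) / T = a - (z * u - m * s) / T"
    using T by (simp add: diff_divide_distrib)
  finally show ?thesis unfolding T_def .
qed

text \<open>The Chapman-Kolmogorov equation before integration: going from \<open>- m\<close> to
  \<open>a\<close> in time \<open>u\<close> and on to \<open>z\<close> in time \<open>s\<close> is
  the whole transition from \<open>- m\<close> to \<open>z\<close> times the bridge density at time
  \<open>u\<close>.\<close>

lemma gauss_mult:
  assumes "u > 0" "s > 0"
  shows "gauss u (m + a) * gauss s (a - z)
    = gauss (u + s) (m + z) * gauss (u * s / (u + s)) (a - (z * u - m * s) / (u + s))"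
proof -
  have "u + s \<noteq> 0" using assms by simp
  then have "sqrt (2 * pi * u) * sqrt (2 * pi * s) = sqrt (2 * pi * (u + s)) * sqrt (2 * pi * (u * s / (u + s)))"
    unfolding real_sqrt_mult[symmetric] by (auto simp: field_simps intro!: arg_cong[where f=sqrt])
  moreover have "exp (- (m + a)\<^sup>2 / (2 * u)) * exp (- (a - z)\<^sup>2 / (2 * s))
      = exp (- (m + z)\<^sup>2 / (2 * (u + s))) * exp (- (a - (z * u - m * s) / (u + s))\<^sup>2 / (2 * (u * s / (u + s))))"
    using complete_square[OF assms, of m a z] unfolding exp_add[symmetric] minus_divide_left[symmetric]
    by (simp only: minus_add_distrib[symmetric])
  moreover have "u * s / (u + s) > 0" using assms by simp
  ultimately show ?thesis
    using assms by (simp only: gauss_eq add_pos_pos times_divide_times_eq)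
qed

lemma gauss_diff_nonneg:
  assumes "v > 0" "a \<ge> 0" "z \<ge> 0"
  shows "gauss v (a + z) \<le> gauss v (a - z)"
proof -
  have "(a - z)\<^sup>2 \<le> (a + z)\<^sup>2"
    using assms by (simp add: power2_eq_square algebra_simps)
  then show ?thesis using assms by (auto simp: gauss_eq intro!: divide_right_mono)
qed

section \<open>First-passage densities and the decomposition at the argmax\<close>

text \<open>For \<open>z > 0\<close> the density at time \<open>s\<close> of the first passage of
  Brownian motion to the level \<open>z\<close>. As a function of \<open>z\<close> it is minus the
  derivative of \<open>gauss s\<close>.\<close>

definition passage_density :: "real \<Rightarrow> real \<Rightarrow> real" where
  "passage_density s z = z / s * gauss s z"

lemma borel_measurable_passage_density [measurable]:
  "(\<lambda>p. passage_density (fst p) (snd p)) \<in> borel_measurable (borel \<Otimes>\<^sub>M borel)"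
  unfolding passage_density_def normal_density_def by measurable

text \<open>Half the density in \<open>z\<close> of the event that the path has a maximum above
  \<open>m\<close>, attains it by time \<open>u\<close> and is \<open>z\<close> below it at time
  \<open>T\<close>. Each term is a transition density times the probability that a bridge is
  positive at time \<open>u\<close>; the bridges start at \<open>- m\<close> and end at
  \<open>z\<close> and at the mirror image \<open>- z\<close>.\<close>

definition split_weight :: "real \<Rightarrow> real \<Rightarrow> real \<Rightarrow> real \<Rightarrow> real" where
  "split_weight T m z u =
     gauss T (m + z) * ((1 + erf ((z * u - m * (T - u)) / sqrt (2 * u * (T - u) * T))) / 2)
     - gauss T (m - z) * ((1 - erf ((z * u + m * (T - u)) / sqrt (2 * u * (T - u) * T))) / 2)"

text \<open>\<open>gauss_mult\<close> reduces the integral to a Gaussian tail, the mass of the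
  bridge density on \<open>a > 0\<close>. The sign of \<open>z\<close> is left open so that the
  reflected endpoint \<open>- z\<close> is covered too.\<close>

lemma nn_integral_gauss_mult:
  assumes "0 < u" "u < T"
  shows "(\<integral>\<^sup>+a. ennreal (gauss u (m + a) * gauss (T - u) (a - z)) * indicator {0<..} a \<partial>lborel)
    = ennreal (gauss T (m + z) * ((1 + erf ((z * u - m * (T - u)) / sqrt (2 * u * (T - u) * T))) / 2))"
proof -
  define c where "c = (z * u - m * (T - u)) / T"
  have T: "T > 0" using assms by simp
  have "(\<integral>\<^sup>+a. ennreal (gauss u (m + a) * gauss (T - u) (a - z)) * indicator {0<..} a \<partial>lborel)
      = (\<integral>\<^sup>+a. ennreal (gauss T (m + z)) * (ennreal (gauss (u * (T - u) / T) (a - c)) * indicator {0<..} a) \<partial>lborel)"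
    using assms gauss_mult[of u "T - u" m _ z]
    by (intro nn_integral_cong) (auto simp: c_def ennreal_mult' split: split_indicator)
  also have "\<dots> = ennreal (gauss T (m + z)) * ennreal ((1 - erf ((0 - c) / sqrt (2 * (u * (T - u) / T)))) / 2)"
    using assms by (subst nn_integral_cmult) (auto simp: nn_integral_gauss_shift_Ioi)
  also have "(0 - c) / sqrt (2 * (u * (T - u) / T)) = - ((z * u - m * (T - u)) / sqrt (2 * u * (T - u) * T))"
  proof -
    have "T * sqrt (2 * (u * (T - u) / T)) = sqrt (T\<^sup>2) * sqrt (2 * (u * (T - u) / T))" using T by simp
    also have "\<dots> = sqrt (T\<^sup>2 * (2 * (u * (T - u) / T)))" by (rule real_sqrt_mult[symmetric])
    also have "T\<^sup>2 * (2 * (u * (T - u) / T)) = 2 * u * (T - u) * T"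
      using T by (simp add: power2_eq_square)
    finally show ?thesis by (simp add: c_def)
  qed
  finally show ?thesis
    by (simp only: ennreal_mult'[of "gauss T (m + z)"] normal_density_nonneg erf_minus diff_minus_eq_add)
qed

text \<open>The decomposition at the fixed time \<open>u\<close>: the gap to the maximum is
  \<open>a\<close> at time \<open>u\<close>, and the difference of Gaussians is the density of a
  second leg from \<open>a\<close> to \<open>z\<close> killed at 0, which means that no new maximum
  occurs.\<close>

lemma nn_integral_split_weight:
  assumes "0 < u" "u < T" "z > 0"
  shows "(\<integral>\<^sup>+a. ennreal (gauss u (m + a) * (gauss (T - u) (a - z) - gauss (T - u) (a + z))) * indicator {0<..} a \<partial>lborel)
    = ennreal (split_weight T m z u)"
proof -
  \<comment> \<open>\<open>erf\<close> stays below its limit 1. The subtracted term is therefore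
    nonnegative, and the difference of the \<open>ennreal\<close> values is that of the
    reals.\<close>
  have "eventually (\<lambda>y. erf x \<le> erf y) at_top" for x
    using eventually_ge_at_top[of x] by (rule eventually_mono) (rule erf_mono)
  then have erf1: "erf x \<le> 1" for x
    by (intro tendsto_lowerbound[OF tendsto_erf_at_top]) auto
  define f where "f b a = ennreal (gauss u (m + a) * gauss (T - u) (a - b)) * indicator {0<..} a" for a b
  have [measurable]: "f b \<in> borel_measurable borel" for b
    unfolding f_def[abs_def] by measurable
  have f: "(\<integral>\<^sup>+a. f b a \<partial>lborel)
      = ennreal (gauss T (m + b) * ((1 + erf ((b * u - m * (T - u)) / sqrt (2 * u * (T - u) * T))) / 2))" for b
    unfolding f_def by (rule nn_integral_gauss_mult) (use assms in auto)
  have le: "f (- z) a \<le> f z a" for a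
    using gauss_diff_nonneg[of "T - u" a z] assms
    by (auto simp: f_def intro!: ennreal_leI mult_left_mono split: split_indicator)
  have "(\<integral>\<^sup>+a. ennreal (gauss u (m + a) * (gauss (T - u) (a - z) - gauss (T - u) (a + z))) * indicator {0<..} a \<partial>lborel)
      = (\<integral>\<^sup>+a. f z a - f (- z) a \<partial>lborel)"
    by (intro nn_integral_cong) (auto simp: f_def right_diff_distrib ennreal_minus split: split_indicator)
  also have "\<dots> = (\<integral>\<^sup>+a. f z a \<partial>lborel) - (\<integral>\<^sup>+a. f (- z) a \<partial>lborel)"
    using le by (intro nn_integral_diff AE_I2) (auto simp: f)
  also have "\<dots> = ennreal (gauss T (m + z) * ((1 + erf ((z * u - m * (T - u)) / sqrt (2 * u * (T - u) * T))) / 2))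
      - ennreal (gauss T (m + - z) * ((1 + erf ((- z * u - m * (T - u)) / sqrt (2 * u * (T - u) * T))) / 2))"
    by (simp only: f)
  also have "(- z * u - m * (T - u)) / sqrt (2 * u * (T - u) * T) = - ((z * u + m * (T - u)) / sqrt (2 * u * (T - u) * T))"
    by (simp only: minus_divide_left) (simp add: algebra_simps)
  also have "1 + erf (- ((z * u + m * (T - u)) / sqrt (2 * u * (T - u) * T))) = 1 - erf ((z * u + m * (T - u)) / sqrt (2 * u * (T - u) * T))"
    by (simp only: erf_minus diff_conv_add_uminus)
  finally show ?thesis
    using erf1 by (simp add: split_weight_def ennreal_minus)
qed

text \<open>Only the arguments of the two \<open>erf\<close> depend on \<open>u\<close>. Multiplied
  with the Gaussian in front, both chain rule terms carry one and the same exponential, so their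
  factors \<open>z * u + m * s\<close> and \<open>z * u - m * s\<close> add up to
  \<open>2 * z * u\<close>, and \<open>m\<close> survives only in the exponential.\<close>

lemma DERIV_split_weight:
  assumes "0 < u" "u < T"
  shows "DERIV (split_weight T m z) u :> gauss u m * passage_density (T - u) z"
proof -
  define s where "s = T - u"
  have s: "s > 0" "T = u + s" "T > 0" using assms by (auto simp: s_def)
  define c where "c = sqrt (2 * u * s * T)"
  have c: "c > 0" "c\<^sup>2 = 2 * u * s * T" using s assms by (auto simp: c_def)
  \<comment> \<open>A free \<open>k\<close> serves both arguments, as \<open>k = m\<close> and
    \<open>k = - m\<close>.\<close>
  have D: "DERIV (\<lambda>u. (z * u + k * (T - u)) / sqrt (2 * u * (T - u) * T)) u :> T\<^sup>2 * (z * u - k * s) / c ^ 3" for k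
  proof -
    have "DERIV (\<lambda>u. 2 * u * (T - u) * T) u :> 2 * (T * (s - u))"
      by (rule derivative_eq_intros refl)+ (simp add: s_def algebra_simps)
    then have "DERIV (\<lambda>u. sqrt (2 * u * (T - u) * T)) u :> (inverse (sqrt (2 * u * (T - u) * T)) / 2) * (2 * (T * (s - u)))"
      by (rule DERIV_chain2[OF DERIV_real_sqrt, rotated]) (use assms in simp)
    then have "DERIV (\<lambda>u. sqrt (2 * u * (T - u) * T)) u :> T * (s - u) / c"
      by (simp add: c_def s_def inverse_eq_divide)
    moreover have "DERIV (\<lambda>u. z * u + k * (T - u)) u :> z - k"
      by (rule derivative_eq_intros refl)+ simp
    ultimately have "DERIV (\<lambda>u. (z * u + k * (T - u)) / sqrt (2 * u * (T - u) * T)) u :>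
       ((z - k) * sqrt (2 * u * (T - u) * T) - (z * u + k * (T - u)) * (T * (s - u) / c))
         / (sqrt (2 * u * (T - u) * T) * sqrt (2 * u * (T - u) * T))"
      by (intro DERIV_divide) (use assms in auto)
    also have "((z - k) * sqrt (2 * u * (T - u) * T) - (z * u + k * (T - u)) * (T * (s - u) / c))
         / (sqrt (2 * u * (T - u) * T) * sqrt (2 * u * (T - u) * T))
       = ((z - k) * c - (z * u + k * s) * (T * (s - u) / c)) / (c * c)"
      unfolding c_def s_def ..
    also have "((z - k) * c - (z * u + k * s) * (T * (s - u) / c)) / (c * c)
        = ((z - k) * c\<^sup>2 - (z * u + k * s) * (T * (s - u))) / c ^ 3"
      using c(1) by (simp add: field_simps power2_eq_square power3_eq_cube)
    also have "(z - k) * c\<^sup>2 - (z * u + k * s) * (T * (s - u)) = T\<^sup>2 * (z * u - k * s)"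
      unfolding c(2) s(2) by (simp add: power2_eq_square algebra_simps)
    finally show ?thesis .
  qed
  \<comment> \<open>The common exponential: the right-hand side is even in \<open>k\<close>, hence
    the same for \<open>m\<close> and \<open>- m\<close>.\<close>
  have E: "gauss T (k + z) * exp (- ((z * u - k * s) / c)\<^sup>2) = exp (- k\<^sup>2 / (2 * u)) * exp (- z\<^sup>2 / (2 * s)) / sqrt (2 * pi * T)" for k
  proof -
    have "(k + z)\<^sup>2 / (2 * T) + ((z * u - k * s) / c)\<^sup>2 = ((k + z)\<^sup>2 * (u * s) + (z * u - k * s)\<^sup>2) / (2 * u * s * T)"
      unfolding power_divide c(2) using assms s by (simp add: add_divide_distrib)
    also have "(k + z)\<^sup>2 * (u * s) + (z * u - k * s)\<^sup>2 = k\<^sup>2 * (s * T) + z\<^sup>2 * (u * T)"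
      unfolding s(2) by algebra
    also have "\<dots> / (2 * u * s * T) = k\<^sup>2 / (2 * u) + z\<^sup>2 / (2 * s)"
      using assms s by (simp add: add_divide_distrib)
    finally have "exp (- (k + z)\<^sup>2 / (2 * T)) * exp (- ((z * u - k * s) / c)\<^sup>2)
        = exp (- k\<^sup>2 / (2 * u)) * exp (- z\<^sup>2 / (2 * s))"
      unfolding exp_add[symmetric] minus_divide_left[symmetric] by (simp only: minus_add_distrib[symmetric])
    then show ?thesis
      using s by (simp add: gauss_eq)
  qed
  have "DERIV (split_weight T m z) u :>
     gauss T (m + z) * ((2 / sqrt pi * exp (- ((z * u - m * s) / c)\<^sup>2) * (T\<^sup>2 * (z * u + m * s) / c ^ 3)) / 2)
     + gauss T (m - z) * ((2 / sqrt pi * exp (- ((z * u + m * s) / c)\<^sup>2) * (T\<^sup>2 * (z * u - m * s) / c ^ 3)) / 2)"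
  proof -
    have "DERIV (\<lambda>u. (z * u - m * (T - u)) / sqrt (2 * u * (T - u) * T)) u :> T\<^sup>2 * (z * u + m * s) / c ^ 3"
      using D[of "- m"] by (simp only: mult_minus_left diff_minus_eq_add add_uminus_conv_diff)
    note D1 = DERIV_erf'[OF this, folded s_def, folded c_def]
      and D2 = DERIV_erf'[OF D[of m], folded s_def, folded c_def]
    note d = DERIV_diff[OF
        DERIV_cmult[OF DERIV_cdivide[OF DERIV_add[OF DERIV_const[of 1] D1]], of "gauss T (m + z)" 2]
        DERIV_cmult[OF DERIV_cdivide[OF DERIV_diff[OF DERIV_const[of 1] D2]], of "gauss T (m - z)" 2]]
    show ?thesis
      unfolding split_weight_def[abs_def] by (rule DERIV_cong[OF d]) (simp add: s_def c_def)
  qed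
  also have "gauss T (m - z) = gauss T (-m + z)"
    using gauss_minus[of T "m - z"] by (simp add: add.commute)
  also have "gauss T (m + z) * ((2 / sqrt pi * exp (- ((z * u - m * s) / c)\<^sup>2) * (T\<^sup>2 * (z * u + m * s) / c ^ 3)) / 2)
     + gauss T (-m + z) * ((2 / sqrt pi * exp (- ((z * u + m * s) / c)\<^sup>2) * (T\<^sup>2 * (z * u - m * s) / c ^ 3)) / 2)
    = (gauss T (m + z) * exp (- ((z * u - m * s) / c)\<^sup>2)) * (T\<^sup>2 * (z * u + m * s) / c ^ 3 / sqrt pi)
     + (gauss T (-m + z) * exp (- ((z * u - (-m) * s) / c)\<^sup>2)) * (T\<^sup>2 * (z * u - m * s) / c ^ 3 / sqrt pi)"
    by (simp add: ac_simps)
  also have "\<dots> = exp (- m\<^sup>2 / (2 * u)) * exp (- z\<^sup>2 / (2 * s)) / sqrt (2 * pi * T) * (T\<^sup>2 * (2 * z * u) / c ^ 3 / sqrt pi)"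
    unfolding E by (simp add: algebra_simps add_divide_distrib[symmetric] diff_divide_distrib[symmetric])
  also have "\<dots> = exp (- m\<^sup>2 / (2 * u)) * exp (- z\<^sup>2 / (2 * s)) * z * (T\<^sup>2 * (2 * u) / (sqrt (2 * pi * T) * c ^ 3 * sqrt pi))"
    by (simp add: ac_simps)
  also have "sqrt (2 * pi * T) * c ^ 3 * sqrt pi = 4 * pi * T\<^sup>2 * u * s * sqrt (u * s)"
  proof -
    have "sqrt (2 * pi * T) * c ^ 3 * sqrt pi = c\<^sup>2 * (sqrt (2 * pi * T) * sqrt (2 * u * s * T) * sqrt pi)"
      by (simp add: c_def power3_eq_cube power2_eq_square)
    also have "sqrt (2 * pi * T) * sqrt (2 * u * s * T) * sqrt pi = sqrt ((2 * pi * T)\<^sup>2 * (u * s))"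
      by (simp add: real_sqrt_mult[symmetric] power2_eq_square ac_simps)
    also have "\<dots> = 2 * pi * T * sqrt (u * s)"
      unfolding real_sqrt_mult using s by simp
    finally show ?thesis unfolding c(2) by (simp add: power2_eq_square)
  qed
  also have "exp (- m\<^sup>2 / (2 * u)) * exp (- z\<^sup>2 / (2 * s)) * z * (T\<^sup>2 * (2 * u) / (4 * pi * T\<^sup>2 * u * s * sqrt (u * s)))
     = gauss u m * passage_density s z"
  proof -
    have "sqrt (2 * pi * u) * sqrt (2 * pi * s) = sqrt ((2 * pi)\<^sup>2 * (u * s))"
      by (simp add: real_sqrt_mult[symmetric] power2_eq_square ac_simps)
    also have "\<dots> = 2 * pi * sqrt (u * s)"
      unfolding real_sqrt_mult[of "(2 * pi)\<^sup>2"] real_sqrt_abs by simp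
    finally have "gauss u m * passage_density s z
        = exp (- m\<^sup>2 / (2 * u)) * exp (- z\<^sup>2 / (2 * s)) * z / (s * (2 * pi * sqrt (u * s)))"
      using assms s by (simp add: gauss_eq passage_density_def ac_simps)
    also have "\<dots> = exp (- m\<^sup>2 / (2 * u)) * exp (- z\<^sup>2 / (2 * s)) * z * (T\<^sup>2 * (2 * u) / (4 * pi * T\<^sup>2 * u * s * sqrt (u * s)))"
      using assms s(1,3) by (simp add: ac_simps)
    finally show ?thesis ..
  qed
  finally show ?thesis by (simp add: s_def)
qed

text \<open>For \<open>m > 0\<close> the arguments of \<open>erf\<close> tend to minus and plus
  infinity, and each term vanishes. For \<open>m = 0\<close> both tend to 0, and the terms cancel
  because \<open>gauss T\<close> is even.\<close>

lemma tendsto_split_weight_0: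
  assumes "T > 0" "m \<ge> 0" "z > 0"
  shows "(split_weight T m z \<longlongrightarrow> 0) (at_right 0)"
proof (cases "m = 0")
  case True
  have "((\<lambda>u. z * u / sqrt (2 * u * (T - u) * T)) \<longlongrightarrow> 0) (at_right 0)"
    using assms by real_asymp
  then have "((\<lambda>u. erf (z * u / sqrt (2 * u * (T - u) * T))) \<longlongrightarrow> erf 0) (at_right 0)"
    by (rule isCont_tendsto_compose[OF isCont_erf])
  then have "((\<lambda>u. gauss T z * ((1 + erf (z * u / sqrt (2 * u * (T - u) * T))) / 2)
       - gauss T z * ((1 - erf (z * u / sqrt (2 * u * (T - u) * T))) / 2)) \<longlongrightarrow>
       gauss T z * ((1 + erf 0) / 2) - gauss T z * ((1 - erf 0) / 2)) (at_right 0)"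
    by (intro tendsto_intros) auto
  then show ?thesis using True by (simp add: split_weight_def[abs_def])
next
  case False
  then have "m > 0" using assms by simp
  have "filterlim (\<lambda>u. (z * u - m * (T - u)) / sqrt (2 * u * (T - u) * T)) at_bot (at_right 0)"
    using assms \<open>m > 0\<close> by real_asymp
  note l1 = filterlim_compose[OF tendsto_erf_at_bot this]
  have "filterlim (\<lambda>u. (z * u + m * (T - u)) / sqrt (2 * u * (T - u) * T)) at_top (at_right 0)"
    using assms \<open>m > 0\<close> by real_asymp
  note l2 = filterlim_compose[OF tendsto_erf_at_top this]
  have "((\<lambda>u. split_weight T m z u) \<longlongrightarrow> gauss T (m + z) * ((1 + -1) / 2) - gauss T (m - z) * ((1 - 1) / 2)) (at_right 0)"
    unfolding split_weight_def by (intro tendsto_intros l1 l2) auto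
  then show ?thesis by simp
qed

text \<open>At \<open>u = T\<close> both numerators equal \<open>z * T > 0\<close> while the
  denominators vanish, so both arguments tend to plus infinity.\<close>

lemma tendsto_split_weight_T:
  assumes "T > 0" "m \<ge> 0" "z > 0"
  shows "(split_weight T m z \<longlongrightarrow> gauss T (m + z)) (at_left T)"
proof -
  have "filterlim (\<lambda>u. (z * u - m * (T - u)) / sqrt (2 * u * (T - u) * T)) at_top (at_left T)"
    using assms by real_asymp
  note l1 = filterlim_compose[OF tendsto_erf_at_top this]
  have "filterlim (\<lambda>u. (z * u + m * (T - u)) / sqrt (2 * u * (T - u) * T)) at_top (at_left T)"
    using assms by real_asymp
  note l2 = filterlim_compose[OF tendsto_erf_at_top this]
  have "((\<lambda>u. split_weight T m z u) \<longlongrightarrow> gauss T (m + z) * ((1 + 1) / 2) - gauss T (m - z) * ((1 - 1) / 2)) (at_left T)"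
    unfolding split_weight_def by (intro tendsto_intros l1 l2) auto
  then show ?thesis by simp
qed

lemma isCont_gauss_passage_density:
  assumes "0 < u" "u < T"
  shows "isCont (\<lambda>v. gauss v m * passage_density (T - v) z) u"
  using assms unfolding passage_density_def normal_density_def by (auto intro!: continuous_intros)

lemma passage_density_nonneg: "s \<ge> 0 \<Longrightarrow> z \<ge> 0 \<Longrightarrow> 0 \<le> passage_density s z"
  by (simp add: passage_density_def)

text \<open>Decomposing at the argmax instead of at a fixed time \<open>u\<close>.\<close>
lemma nn_integral_passage:
  assumes "m \<ge> 0" "z > 0" "0 < u" "u < T"
  shows "(\<integral>\<^sup>+v. ennreal (gauss v m * passage_density (T - v) z) * indicator {0<..<u} v \<partial>lborel) = ennreal (split_weight T m z u)"
proof -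
  have "(split_weight T m z \<longlongrightarrow> split_weight T m z u) (at_left u)"
    using DERIV_isCont[OF DERIV_split_weight[of u T m z]] assms
    by (simp add: isCont_def filterlim_at_split)
  with nn_integral_FTC_Ioo[of 0 u "split_weight T m z" _ 0 "split_weight T m z u"] show ?thesis
    using assms DERIV_split_weight isCont_gauss_passage_density tendsto_split_weight_0
    by (auto simp: passage_density_nonneg)
qed

text \<open>The endpoint \<open>u = T\<close> of the preceding decomposition: there the quotients in
  \<open>split_weight\<close> divide by zero, and the left limit takes the place of the
  value.\<close>

lemma nn_integral_passage_T:
  assumes "m \<ge> 0" "z > 0" "0 < T"
  shows "(\<integral>\<^sup>+v. ennreal (gauss v m * passage_density (T - v) z) * indicator {0<..<T} v \<partial>lborel) = ennreal (gauss T (m + z))"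
proof -
  show ?thesis
    using assms DERIV_split_weight isCont_gauss_passage_density tendsto_split_weight_0 tendsto_split_weight_T
      nn_integral_FTC_Ioo[of 0 T "split_weight T m z" _ 0 "gauss T (m + z)"]
    by (auto simp: passage_density_nonneg)
qed

section \<open>Gaussian moments on the half-line, without and with an error function\<close>

lemma two_div_sqrt_2: "2 / sqrt 2 = sqrt 2"
  by (simp add: real_div_sqrt)

lemma sqrt_two_div_pi_mult: "sqrt (2 / pi) * sqrt (pi / 2) = 1"
proof -
  have "sqrt (2 / pi) * sqrt (pi / 2) = sqrt (2 / pi * (pi / 2))"
    by (rule real_sqrt_mult[symmetric])
  then show ?thesis by simp
qed

lemma pos_1_plus_sq: "0 < 1 + (v::real)\<^sup>2"
  by (simp add: add_pos_nonneg)

text \<open>The substitution by the factor \<open>sqrt (2 / l)\<close> normalises the exponent to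
  that of \<open>gaussian_moment_even_pos\<close> and \<open>gaussian_moment_odd_pos\<close>, which
  supply \<open>I\<close> in the four instances below.\<close>

lemma nn_integral_power_exp:
  assumes I: "has_bochner_integral lborel (\<lambda>x::real. indicator {0..} x *\<^sub>R (exp (- x\<^sup>2) * x ^ k)) I" and "l > 0"
  shows "(\<integral>\<^sup>+y. ennreal (y ^ k * exp (- (l * y\<^sup>2 / 2))) * indicator {0<..} y \<partial>lborel) = ennreal (sqrt (2 / l) ^ Suc k * I)"
proof -
  define c where "c = sqrt (2 / l)"
  have c: "c > 0" "l * c\<^sup>2 = 2" using \<open>l > 0\<close> by (auto simp: c_def)
  have "(\<integral>\<^sup>+y. ennreal (y ^ k * exp (- (l * y\<^sup>2 / 2))) * indicator {0<..} y \<partial>lborel)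
      = ennreal c * (\<integral>\<^sup>+y. ennreal ((c * y) ^ k * exp (- (l * (c * y)\<^sup>2 / 2))) * indicator {0<..} y \<partial>lborel)"
    by (rule nn_integral_Ioi_scale) (use c in auto)
  also have "(\<integral>\<^sup>+y. ennreal ((c * y) ^ k * exp (- (l * (c * y)\<^sup>2 / 2))) * indicator {0<..} y \<partial>lborel)
      = (\<integral>\<^sup>+y. ennreal (c ^ k) * ennreal (indicator {0..} y *\<^sub>R (exp (- y\<^sup>2) * y ^ k)) \<partial>lborel)"
  proof (intro nn_integral_cong_AE eventually_mono[OF AE_lborel_singleton[of 0]])
    fix y :: real assume "y \<noteq> 0"
    have "l * (c * y)\<^sup>2 / 2 = y\<^sup>2"
      using c by (simp add: power_mult_distrib mult.assoc[symmetric])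
    then show "ennreal ((c * y) ^ k * exp (- (l * (c * y)\<^sup>2 / 2))) * indicator {0<..} y
        = ennreal (c ^ k) * ennreal (indicator {0..} y *\<^sub>R (exp (- y\<^sup>2) * y ^ k))"
      using \<open>y \<noteq> 0\<close> c by (auto simp: power_mult_distrib ennreal_mult'[symmetric] ac_simps split: split_indicator)
  qed
  also have "\<dots> = ennreal (c ^ k) * (\<integral>\<^sup>+y. ennreal (indicator {0..} y *\<^sub>R (exp (- y\<^sup>2) * y ^ k)) \<partial>lborel)"
    by (rule nn_integral_cmult) simp
  also have "(\<integral>\<^sup>+y. ennreal (indicator {0..} y *\<^sub>R (exp (- y\<^sup>2) * y ^ k)) \<partial>lborel) = ennreal I"
    using I by (subst nn_integral_eq_integral)
      (auto simp: has_bochner_integral_iff split: split_indicator)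
  finally show ?thesis
    using c by (simp add: c_def[symmetric] ennreal_mult'[symmetric] mult.assoc[symmetric])
qed

lemma nn_integral_exp_1:
  assumes "l > 0"
  shows "(\<integral>\<^sup>+y. ennreal (y * exp (- (l * y\<^sup>2 / 2))) * indicator {0<..} y \<partial>lborel) = ennreal (1 / l)"
proof -
  have "sqrt (2 / l) ^ Suc 1 * (1 / 2) = 1 / l"
    using assms by (simp add: power2_eq_square[symmetric])
  with nn_integral_power_exp[of 1 "1 / 2" l] gaussian_moment_odd_pos[of 0] assms show ?thesis by simp
qed

lemma nn_integral_exp_2:
  assumes "l > 0"
  shows "(\<integral>\<^sup>+y. ennreal (y ^ 2 * exp (- (l * y\<^sup>2 / 2))) * indicator {0<..} y \<partial>lborel) = ennreal (sqrt (pi / 2) / (l * sqrt l))"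
proof -
  have "sqrt (2 / l) ^ Suc 2 * (sqrt pi / 4) = (sqrt (2 / l))\<^sup>2 * (sqrt (2 / l) * sqrt pi) / 4"
    by (simp add: numeral_3_eq_3 power2_eq_square)
  also have "\<dots> = 1 / (2 * l) * (sqrt (2 / l) * sqrt pi)"
    using assms by simp
  also have "sqrt (2 / l) * sqrt pi = 2 / sqrt 2 * (sqrt pi / sqrt l)"
    unfolding real_sqrt_divide two_div_sqrt_2 by simp
  also have "\<dots> = 2 * (sqrt (pi / 2) / sqrt l)"
    unfolding real_sqrt_divide by simp
  finally have "sqrt (2 / l) ^ Suc 2 * (sqrt pi / 4) = sqrt (pi / 2) / (l * sqrt l)" by simp
  with nn_integral_power_exp[of 2 "sqrt pi / 4" l] gaussian_moment_even_pos[of 1] assms show ?thesis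
    by (simp add: fact_numeral)
qed

lemma nn_integral_exp_3:
  assumes "l > 0"
  shows "(\<integral>\<^sup>+y. ennreal (y ^ 3 * exp (- (l * y\<^sup>2 / 2))) * indicator {0<..} y \<partial>lborel) = ennreal (2 / l\<^sup>2)"
proof -
  have "sqrt (2 / l) ^ Suc 3 * (1 / 2) = ((sqrt (2 / l))\<^sup>2)\<^sup>2 * (1 / 2)"
    by (simp add: power2_eq_square numeral_3_eq_3)
  also have "\<dots> = 2 / l\<^sup>2"
    using assms by (simp add: power_divide)
  finally show ?thesis
    using nn_integral_power_exp[of 3 "1 / 2" l] gaussian_moment_odd_pos[of 1] assms by simp
qed

lemma nn_integral_exp_4:
  assumes "l > 0"
  shows "(\<integral>\<^sup>+y. ennreal (y ^ 4 * exp (- (l * y\<^sup>2 / 2))) * indicator {0<..} y \<partial>lborel) = ennreal (3 * sqrt (pi / 2) / (l\<^sup>2 * sqrt l))"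
proof -
  have "sqrt (2 / l) ^ Suc 4 * (3 * sqrt pi / 8) = ((sqrt (2 / l))\<^sup>2)\<^sup>2 * (sqrt (2 / l) * sqrt pi) * (3 / 8)"
    by (simp add: power2_eq_square eval_nat_numeral)
  also have "\<dots> = 3 / (2 * l\<^sup>2) * (sqrt (2 / l) * sqrt pi)"
    using assms by (simp add: power_divide)
  also have "sqrt (2 / l) * sqrt pi = 2 / sqrt 2 * (sqrt pi / sqrt l)"
    unfolding real_sqrt_divide two_div_sqrt_2 by simp
  also have "\<dots> = 2 * (sqrt (pi / 2) / sqrt l)"
    unfolding real_sqrt_divide by simp
  finally have *: "sqrt (2 / l) ^ Suc 4 * (3 * sqrt pi / 8) = 3 * sqrt (pi / 2) / (l\<^sup>2 * sqrt l)" by simp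
  have "sqrt pi / 2 * (fact (2 * 2) / (2 ^ (2 * 2) * fact 2)) = 3 * sqrt pi / 8"
    by (simp add: fact_numeral)
  with gaussian_moment_even_pos[of 2]
  have "has_bochner_integral lborel (\<lambda>x::real. indicator {0..} x *\<^sub>R (exp (- x\<^sup>2) * x ^ 4)) (3 * sqrt pi / 8)"
    by simp
  from nn_integral_power_exp[OF this assms] show ?thesis unfolding * .
qed

text \<open>Writing \<open>erf (c y / \<surd>2)\<close> as an integral over \<open>v \<in> [0, c]\<close> of a Gaussian in \<open>v y\<close>
  leaves a Gaussian moment with weight \<open>1 + v\<^sup>2\<close> as the inner integral.\<close>
lemma nn_integral_power_exp_erf:
  assumes J: "\<And>l. l > 0 \<Longrightarrow>
      (\<integral>\<^sup>+y. ennreal (y ^ Suc k * exp (- (l * y\<^sup>2 / 2))) * indicator {0<..} y \<partial>lborel) = ennreal (J l)"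
    and "\<And>l. l > 0 \<Longrightarrow> J l \<ge> 0"
    and F: "\<And>v. v \<ge> 0 \<Longrightarrow> DERIV F v :> sqrt (2 / pi) * J (1 + v\<^sup>2)"
    and [measurable]: "J \<in> borel_measurable borel"
    and "F 0 = 0" "c \<ge> 0"
  shows "(\<integral>\<^sup>+y. ennreal (y ^ k * exp (- y\<^sup>2 / 2) * erf (c * y / sqrt 2)) * indicator {0<..} y \<partial>lborel) = ennreal (F c)"
proof -
  \<comment> \<open>\<open>sqrt (2 / pi) * y * exp (- (v * y / sqrt 2)\<^sup>2)\<close> is the
    derivative of \<open>erf (v * y / sqrt 2)\<close> in \<open>v\<close>; its factor
    \<open>y\<close> raises the power from \<open>k\<close> to \<open>Suc k\<close>.\<close>
  define g where "g y v = ennreal (sqrt (2 / pi)) * (ennreal (y ^ Suc k * exp (- ((1 + v\<^sup>2) * y\<^sup>2 / 2))) * indicator {0<..} y)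
       * indicator {0..c} v" for y v :: real
  have [measurable]: "(\<lambda>(y, v). g y v) \<in> borel_measurable (lborel \<Otimes>\<^sub>M lborel)"
    unfolding g_def by measurable
  have *: "ennreal (y ^ k * exp (- y\<^sup>2 / 2) * erf (c * y / sqrt 2)) * indicator {0<..} y = (\<integral>\<^sup>+v. g y v \<partial>lborel)" for y
  proof (cases "y > 0")
    case True
    have "(\<integral>\<^sup>+v. ennreal (sqrt (2 / pi) * y * exp (- (v * y / sqrt 2)\<^sup>2)) * indicator {0..c} v \<partial>lborel)
        = ennreal (erf (c * y / sqrt 2) - erf (0 * y / sqrt 2))"
    proof (rule nn_integral_FTC_Icc)
      fix v :: real
      have "2 / sqrt pi * exp (- (v * y / sqrt 2)\<^sup>2) * (y / sqrt 2) = sqrt (2 / pi) * y * exp (- (v * y / sqrt 2)\<^sup>2)"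
      proof -
        have "2 / sqrt pi * exp (- (v * y / sqrt 2)\<^sup>2) * (y / sqrt 2) = 2 / sqrt 2 / sqrt pi * y * exp (- (v * y / sqrt 2)\<^sup>2)"
          by (simp add: ac_simps)
        then show ?thesis unfolding real_sqrt_divide two_div_sqrt_2 .
      qed
      moreover have "DERIV (\<lambda>v. erf (v * y / sqrt 2)) v :> 2 / sqrt pi * exp (- (v * y / sqrt 2)\<^sup>2) * (y / sqrt 2)"
        using DERIV_erf'[OF DERIV_cdivide[OF DERIV_cmult_right[OF DERIV_ident, of y], of "sqrt 2"]] by (simp only: mult_1)
      ultimately show "DERIV (\<lambda>v. erf (v * y / sqrt 2)) v :> sqrt (2 / pi) * y * exp (- (v * y / sqrt 2)\<^sup>2)"
        by simp
    qed (use True \<open>c \<ge> 0\<close> in auto)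
    then have "ennreal (y ^ k * exp (- y\<^sup>2 / 2) * erf (c * y / sqrt 2)) =
      ennreal (y ^ k * exp (- y\<^sup>2 / 2)) * (\<integral>\<^sup>+v. ennreal (sqrt (2 / pi) * y * exp (- (v * y / sqrt 2)\<^sup>2)) * indicator {0..c} v \<partial>lborel)"
      using True by (simp add: ennreal_mult')
    also have "\<dots> = (\<integral>\<^sup>+v. ennreal (y ^ k * exp (- y\<^sup>2 / 2)) * (ennreal (sqrt (2 / pi) * y * exp (- (v * y / sqrt 2)\<^sup>2)) * indicator {0..c} v) \<partial>lborel)"
      by (rule nn_integral_cmult[symmetric]) simp
    also have "\<dots> = (\<integral>\<^sup>+v. g y v \<partial>lborel)"
    proof (intro nn_integral_cong)
      fix v :: real
      have "exp (- ((1 + v\<^sup>2) * y\<^sup>2 / 2)) = exp (- y\<^sup>2 / 2) * exp (- (v * y / sqrt 2)\<^sup>2)"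
        unfolding exp_add[symmetric] by (simp add: power_divide power_mult_distrib field_simps)
      then show "ennreal (y ^ k * exp (- y\<^sup>2 / 2)) * (ennreal (sqrt (2 / pi) * y * exp (- (v * y / sqrt 2)\<^sup>2)) * indicator {0..c} v) = g y v"
        using True by (auto simp: g_def ennreal_mult'[symmetric] ac_simps split: split_indicator)
    qed
    finally show ?thesis using True by simp
  qed (simp add: g_def)
  have "(\<integral>\<^sup>+y. ennreal (y ^ k * exp (- y\<^sup>2 / 2) * erf (c * y / sqrt 2)) * indicator {0<..} y \<partial>lborel)
     = (\<integral>\<^sup>+y. \<integral>\<^sup>+v. g y v \<partial>lborel \<partial>lborel)"
    unfolding * ..
  also have "\<dots> = (\<integral>\<^sup>+v. \<integral>\<^sup>+y. g y v \<partial>lborel \<partial>lborel)"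
    by (rule lborel_pair.Fubini') simp
  also have "\<dots> = (\<integral>\<^sup>+v. ennreal (sqrt (2 / pi) * J (1 + v\<^sup>2)) * indicator {0..c} v \<partial>lborel)"
    unfolding g_def
    by (intro nn_integral_cong, subst nn_integral_multc, simp, subst nn_integral_cmult, simp, subst J)
       (auto simp: ennreal_mult' add_pos_nonneg)
  also have "\<dots> = ennreal (F c - F 0)"
    using assms(2) by (intro nn_integral_FTC_Icc F) (auto simp: \<open>c \<ge> 0\<close> add_pos_nonneg)
  finally show ?thesis using \<open>F 0 = 0\<close> by simp
qed

text \<open>The inner moment is \<open>1 / (1 + v\<^sup>2)\<close>, the derivative of the
  arctangent.\<close>

lemma nn_integral_exp_erf_0:
  assumes "c \<ge> 0"
  shows "(\<integral>\<^sup>+y. ennreal (exp (- y\<^sup>2 / 2) * erf (c * y / sqrt 2)) * indicator {0<..} y \<partial>lborel) = ennreal (sqrt (2 / pi) * arctan c)"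
proof -
  have "DERIV (\<lambda>c. sqrt (2 / pi) * arctan c) v :> sqrt (2 / pi) * (1 / (1 + v\<^sup>2))" for v
    using DERIV_cmult[OF DERIV_arctan, of "sqrt (2 / pi)" v] by (simp add: inverse_eq_divide)
  then show ?thesis
    using nn_integral_power_exp_erf[where k = 0 and J = "\<lambda>l. 1 / l" and F = "\<lambda>c. sqrt (2 / pi) * arctan c", OF _ _ _ _ _ assms]
      nn_integral_exp_1 by auto
qed

lemma DERIV_sin_arctan: "DERIV (\<lambda>v. v / sqrt (1 + v\<^sup>2)) v :> 1 / ((1 + v\<^sup>2) * sqrt (1 + v\<^sup>2))" for v :: real
proof -
  define r where "r = sqrt (1 + v\<^sup>2)"
  have r: "r > 0" "r\<^sup>2 = 1 + v\<^sup>2" using pos_1_plus_sq[of v] by (auto simp: r_def)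
  have "DERIV (\<lambda>v. 1 + v\<^sup>2) v :> 2 * v"
    by (auto intro!: derivative_eq_intros)
  then have "DERIV (\<lambda>v. sqrt (1 + v\<^sup>2)) v :> inverse (sqrt (1 + v\<^sup>2)) / 2 * (2 * v)"
    by (rule DERIV_chain2[where f = sqrt and g = "\<lambda>v. 1 + v\<^sup>2", OF DERIV_real_sqrt[OF pos_1_plus_sq]])
  from DERIV_divide[OF DERIV_ident this]
  have "DERIV (\<lambda>v. v / sqrt (1 + v\<^sup>2)) v :> (1 * r - v * (inverse r / 2 * (2 * v))) / (r * r)"
    using r(1) by (simp add: r_def)
  also have "(1 * r - v * (inverse r / 2 * (2 * v))) / (r * r) = (r\<^sup>2 - v\<^sup>2) / (r\<^sup>2 * r)"
    using r(1) by (simp add: field_simps power2_eq_square)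
  finally show ?thesis using r(2) by (simp add: r_def)
qed

text \<open>The inner moment \<open>2 / (1 + v\<^sup>2)\<^sup>2\<close> has the antiderivative
  \<open>v / (1 + v\<^sup>2) + arctan v\<close>; these are the two summands of
  \<open>G11\<close>.\<close>

lemma nn_integral_exp_erf_2:
  assumes "c \<ge> 0"
  shows "(\<integral>\<^sup>+y. ennreal (y ^ 2 * exp (- y\<^sup>2 / 2) * erf (c * y / sqrt 2)) * indicator {0<..} y \<partial>lborel)
    = ennreal (sqrt (2 / pi) * (c / (1 + c\<^sup>2) + arctan c))"
proof -
  have D: "DERIV (\<lambda>c. sqrt (2 / pi) * (c / (1 + c\<^sup>2) + arctan c)) v :> sqrt (2 / pi) * (2 / (1 + v\<^sup>2)\<^sup>2)" for v :: real
  proof -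
    have "DERIV (\<lambda>v. 1 + v\<^sup>2) v :> 2 * v"
      by (auto intro!: derivative_eq_intros)
    from DERIV_add[OF DERIV_divide[OF DERIV_ident this] DERIV_arctan[of v]]
    have "DERIV (\<lambda>v. v / (1 + v\<^sup>2) + arctan v) v :> (1 * (1 + v\<^sup>2) - v * (2 * v)) / ((1 + v\<^sup>2) * (1 + v\<^sup>2)) + inverse (1 + v\<^sup>2)"
      using pos_1_plus_sq[of v] by simp
    also have "(1 * (1 + v\<^sup>2) - v * (2 * v)) / ((1 + v\<^sup>2) * (1 + v\<^sup>2)) + inverse (1 + v\<^sup>2)
      = ((1 * (1 + v\<^sup>2) - v * (2 * v)) + (1 + v\<^sup>2)) / (1 + v\<^sup>2)\<^sup>2"
    proof -
      have "inverse (1 + v\<^sup>2) = (1 + v\<^sup>2) / (1 + v\<^sup>2)\<^sup>2"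
        using pos_1_plus_sq[of v] by (simp add: power2_eq_square[of "1 + v\<^sup>2"] inverse_eq_divide)
      then show ?thesis
        by (simp only: add_divide_distrib power2_eq_square[of "1 + v\<^sup>2"])
    qed
    also have "(1 * (1 + v\<^sup>2) - v * (2 * v)) + (1 + v\<^sup>2) = 2"
      by (simp add: power2_eq_square)
    finally show ?thesis by (rule DERIV_cmult)
  qed
  show ?thesis
    using nn_integral_power_exp_erf[where k = 2 and J = "\<lambda>l. 2 / l\<^sup>2" and F = "\<lambda>c. sqrt (2 / pi) * (c / (1 + c\<^sup>2) + arctan c)",
      OF _ _ _ _ _ assms] nn_integral_exp_3 D
    by (auto simp: numeral_3_eq_3 numeral_2_eq_2)
qed

text \<open>With \<open>x = v / sqrt (1 + v\<^sup>2)\<close>, the sine of \<open>arctan v\<close>,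
  one has \<open>1 - x\<^sup>2 = 1 / (1 + v\<^sup>2)\<close>. Hence the derivative
  \<open>3 * x' * (1 - x\<^sup>2)\<close> of \<open>3 * x - x ^ 3\<close> is the inner
  moment.\<close>

lemma nn_integral_exp_erf_3:
  assumes "c \<ge> 0"
  shows "(\<integral>\<^sup>+y. ennreal (y ^ 3 * exp (- y\<^sup>2 / 2) * erf (c * y / sqrt 2)) * indicator {0<..} y \<partial>lborel)
    = ennreal (3 * (c / sqrt (1 + c\<^sup>2)) - (c / sqrt (1 + c\<^sup>2)) ^ 3)"
proof -
  have D: "DERIV (\<lambda>c. 3 * (c / sqrt (1 + c\<^sup>2)) - (c / sqrt (1 + c\<^sup>2)) ^ 3) v :> sqrt (2 / pi) * (3 * sqrt (pi / 2) / ((1 + v\<^sup>2)\<^sup>2 * sqrt (1 + v\<^sup>2)))" for v :: real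
  proof -
    have p: "sqrt (2 / pi) * (3 * sqrt (pi / 2) / x) = 3 / x" for x
      by (simp add: sqrt_two_div_pi_mult mult.assoc[symmetric] mult.left_commute)
    have q: "1 - (v / sqrt (1 + v\<^sup>2))\<^sup>2 = 1 / (1 + v\<^sup>2)"
      using pos_1_plus_sq[of v] by (simp add: power_divide field_simps)
    have "DERIV (\<lambda>c. 3 * (c / sqrt (1 + c\<^sup>2)) - (c / sqrt (1 + c\<^sup>2)) ^ 3) v :>
       3 * (1 / ((1 + v\<^sup>2) * sqrt (1 + v\<^sup>2))) - of_nat 3 * (1 / ((1 + v\<^sup>2) * sqrt (1 + v\<^sup>2)) * (v / sqrt (1 + v\<^sup>2)) ^ (3 - Suc 0))"
      by (intro DERIV_diff DERIV_cmult DERIV_power DERIV_sin_arctan)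
    also have "3 * (1 / ((1 + v\<^sup>2) * sqrt (1 + v\<^sup>2))) - of_nat 3 * (1 / ((1 + v\<^sup>2) * sqrt (1 + v\<^sup>2)) * (v / sqrt (1 + v\<^sup>2)) ^ (3 - Suc 0))
       = 3 / ((1 + v\<^sup>2) * sqrt (1 + v\<^sup>2)) * (1 - (v / sqrt (1 + v\<^sup>2))\<^sup>2)"
      by (simp add: right_diff_distrib)
    also have "\<dots> = 3 / ((1 + v\<^sup>2)\<^sup>2 * sqrt (1 + v\<^sup>2))"
      unfolding q by (simp add: power2_eq_square[of "1 + v\<^sup>2"] ac_simps)
    finally show ?thesis unfolding p .
  qed
  show ?thesis
    using nn_integral_power_exp_erf[where k = 3 and J = "\<lambda>l. 3 * sqrt (pi / 2) / (l\<^sup>2 * sqrt l)" and F = "\<lambda>c. 3 * (c / sqrt (1 + c\<^sup>2)) - (c / sqrt (1 + c\<^sup>2)) ^ 3",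
      OF _ _ _ _ _ assms] nn_integral_exp_4 D
    by (auto simp: numeral_3_eq_3 numeral_2_eq_2 eval_nat_numeral)
qed


section \<open>Moments of the gap weighted by a survival probability\<close>

text \<open>For \<open>z > 0\<close> the probability that the running maximum over a time
  \<open>r\<close> is at most \<open>z\<close>. At \<open>r = 0\<close> the quotient
  \<open>z / sqrt 0\<close> is 0 in HOL and would give the probability 0 instead of 1.\<close>

definition max_cdf :: "real \<Rightarrow> real \<Rightarrow> real" where
  "max_cdf r z = (if r = 0 then 1 else erf (z / sqrt (2 * r)))"

lemma borel_measurable_max_cdf [measurable]: "max_cdf r \<in> borel_measurable borel"
  unfolding max_cdf_def by measurable

text \<open>Brownian scaling \<open>z = sqrt w * y\<close>. The passage density contributes a factor
  \<open>y\<close>, whence the power \<open>Suc k\<close>, and a Gaussian of variance 1.\<close>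

lemma nn_integral_passage_density_scale:
  assumes "w > 0" and [measurable]: "\<psi> \<in> borel_measurable borel"
  shows "(\<integral>\<^sup>+z. ennreal (z ^ k * passage_density w z * \<psi> z) * indicator {0<..} z \<partial>lborel)
    = ennreal (sqrt w ^ k / sqrt (2 * pi * w)) *
      (\<integral>\<^sup>+y. ennreal (y ^ Suc k * exp (- y\<^sup>2 / 2) * \<psi> (sqrt w * y)) * indicator {0<..} y \<partial>lborel)"
proof -
  have "(\<integral>\<^sup>+z. ennreal (z ^ k * passage_density w z * \<psi> z) * indicator {0<..} z \<partial>lborel)
    = ennreal (sqrt w) * (\<integral>\<^sup>+y. ennreal ((sqrt w * y) ^ k * passage_density w (sqrt w * y) * \<psi> (sqrt w * y)) * indicator {0<..} y \<partial>lborel)"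
    by (rule nn_integral_Ioi_scale) (use assms in \<open>auto simp: passage_density_def\<close>)
  also have "\<dots> = (\<integral>\<^sup>+y. ennreal (sqrt w) * (ennreal ((sqrt w * y) ^ k * passage_density w (sqrt w * y) * \<psi> (sqrt w * y)) * indicator {0<..} y) \<partial>lborel)"
    by (rule nn_integral_cmult[symmetric]) (simp add: passage_density_def)
  also have "\<dots> = (\<integral>\<^sup>+y. ennreal (sqrt w ^ k / sqrt (2 * pi * w)) *
      (ennreal (y ^ Suc k * exp (- y\<^sup>2 / 2) * \<psi> (sqrt w * y)) * indicator {0<..} y) \<partial>lborel)"
  proof (intro nn_integral_cong)
    fix y :: real
    have "gauss w (sqrt w * y) = exp (- y\<^sup>2 / 2) / sqrt (2 * pi * w)"
      using assms by (simp add: gauss_eq power_mult_distrib)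
    then have "sqrt w * passage_density w (sqrt w * y) = (sqrt w * sqrt w) / w * (y * exp (- y\<^sup>2 / 2) / sqrt (2 * pi * w))"
      by (simp only: passage_density_def times_divide_eq_left times_divide_eq_right ac_simps)
    then have "sqrt w * passage_density w (sqrt w * y) = y * exp (- y\<^sup>2 / 2) / sqrt (2 * pi * w)"
      using assms by simp
    moreover have "sqrt w * ((sqrt w * y) ^ k * passage_density w (sqrt w * y) * \<psi> (sqrt w * y))
       = (sqrt w * y) ^ k * (sqrt w * passage_density w (sqrt w * y)) * \<psi> (sqrt w * y)"
      by (simp only: ac_simps)
    ultimately have "sqrt w * ((sqrt w * y) ^ k * passage_density w (sqrt w * y) * \<psi> (sqrt w * y))
       = (sqrt w * y) ^ k * (y * exp (- y\<^sup>2 / 2) / sqrt (2 * pi * w)) * \<psi> (sqrt w * y)"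
      by (simp only:)
    also have "\<dots> = (sqrt w ^ k / sqrt (2 * pi * w)) * (y ^ Suc k * exp (- y\<^sup>2 / 2) * \<psi> (sqrt w * y))"
      by (simp add: power_mult_distrib)
    finally show "ennreal (sqrt w) * (ennreal ((sqrt w * y) ^ k * passage_density w (sqrt w * y) * \<psi> (sqrt w * y)) * indicator {0<..} y)
       = ennreal (sqrt w ^ k / sqrt (2 * pi * w)) * (ennreal (y ^ Suc k * exp (- y\<^sup>2 / 2) * \<psi> (sqrt w * y)) * indicator {0<..} y)"
      using assms by (simp add: ennreal_mult'[symmetric] mult.assoc[symmetric] del: power_Suc real_sqrt_mult)
  qed
  also have "\<dots> = ennreal (sqrt w ^ k / sqrt (2 * pi * w)) *
      (\<integral>\<^sup>+y. ennreal (y ^ Suc k * exp (- y\<^sup>2 / 2) * \<psi> (sqrt w * y)) * indicator {0<..} y \<partial>lborel)"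
    by (rule nn_integral_cmult) simp
  finally show ?thesis .
qed

lemma max_cdf_scale:
  assumes "w > 0" "r > 0"
  shows "max_cdf r (sqrt w * y) = erf (sqrt (w / r) * y / sqrt 2)"
  using assms by (simp add: max_cdf_def real_sqrt_divide real_sqrt_mult field_simps)

lemma sin_arctan_odds:
  assumes "w > 0" "r > (0::real)"
  shows "sqrt (w / r) / sqrt (1 + (sqrt (w / r))\<^sup>2) = sqrt (w / (w + r))"
proof -
  have "(w / r) / (1 + w / r) = w / (w + r)"
    using assms by (simp add: field_simps)
  then show ?thesis
    using assms unfolding real_sqrt_divide[symmetric] by simp
qed

text \<open>For \<open>s = w / (w + r)\<close> the odds \<open>s / (1 - s)\<close> are
  \<open>w / r\<close>. With \<open>c = sqrt (w / r)\<close> this makes \<open>arctan c\<close>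
  equal to \<open>arctan_odds s\<close> and \<open>c / (1 + c\<^sup>2)\<close> equal to
  \<open>sqrt (s * (1 - s))\<close>.\<close>

lemma G11_odds:
  assumes "w > 0" "r > 0"
  shows "G11 (w / (w + r)) = sqrt (2 / pi) * (sqrt (w / r) / (1 + (sqrt (w / r))\<^sup>2) + arctan (sqrt (w / r)))"
proof -
  have s: "1 - w / (w + r) = r / (w + r)" "w / (w + r) \<noteq> 1" using assms by (auto simp: field_simps)
  have "sqrt (w / r) / (1 + (sqrt (w / r))\<^sup>2) = sqrt (w / r) * (r / (w + r))"
    using assms by (simp add: field_simps)
  also have "\<dots> = sqrt (w / r) * sqrt ((r / (w + r))\<^sup>2)"
    using assms by simp
  also have "\<dots> = sqrt (w / (w + r) * (1 - w / (w + r)))"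
    unfolding real_sqrt_mult[symmetric] s using assms by (simp add: power2_eq_square)
  finally have eq: "sqrt (w / r) / (1 + (sqrt (w / r))\<^sup>2) = sqrt (w / (w + r) * (1 - w / (w + r)))" .
  have "arctan_odds (w / (w + r)) = arctan (sqrt (w / r))"
    using assms s by (simp add: arctan_odds_def)
  then show ?thesis
    unfolding G11_def eq by (simp only: add.commute)
qed

text \<open>Here \<open>w\<close> is the time between \<open>t\<close> and the argmax, weighted by
  \<open>passage_density w z\<close>, and \<open>r\<close> the time on the other side of
  \<open>t\<close>, during which the path must not rise above the maximum; this has probability
  \<open>max_cdf r z\<close>. The case \<open>r = 0\<close> puts \<open>t\<close> at an end of the
  time interval, where \<open>G11\<close> takes its limit value at 1.\<close>

lemma nn_integral_bridge_max_1:
  assumes "w > 0" "r \<ge> 0"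
  shows "(\<integral>\<^sup>+z. ennreal (z * passage_density w z * max_cdf r z) * indicator {0<..} z \<partial>lborel) = ennreal (G11 (w / (w + r)) / sqrt (2 * pi))"
proof (cases "r = 0")
  case True
  have "sqrt (2 / pi) * (pi / 2) = sqrt (2 / pi) * sqrt (pi / 2) * sqrt (pi / 2)"
    by (simp add: mult.assoc)
  then have G: "G11 1 = sqrt (pi / 2)"
    unfolding sqrt_two_div_pi_mult by (simp add: G11_def arctan_odds_def)
  have "sqrt w / sqrt (2 * pi * w) = 1 / sqrt (2 * pi)"
    using assms by (simp add: real_sqrt_mult)
  then show ?thesis
    using nn_integral_passage_density_scale[of w "max_cdf r" 1] nn_integral_exp_2[of 1] assms True
    by (simp add: max_cdf_def G numeral_2_eq_2[symmetric] ennreal_mult'[symmetric])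
next
  case False
  then have "r > 0" using assms by simp
  have "sqrt w / sqrt (2 * pi * w) = 1 / sqrt (2 * pi)"
    using assms by (simp add: real_sqrt_mult)
  then show ?thesis
    using nn_integral_passage_density_scale[of w "max_cdf r" 1] nn_integral_exp_erf_2[of "sqrt (w / r)"] assms \<open>r > 0\<close>
    by (simp add: max_cdf_scale G11_odds numeral_2_eq_2[symmetric] ennreal_mult'[symmetric] del: real_sqrt_pow2)
qed

text \<open>The sine of \<open>arctan (sqrt (w / r))\<close> is \<open>sqrt s\<close>, and
  \<open>3 * x - x ^ 3\<close> at \<open>x = sqrt s\<close> is \<open>sqrt s * (3 - s)\<close>. This
  is the origin of \<open>3 * s - s\<^sup>2\<close> in the second moment and in the
  variance.\<close>

lemma nn_integral_bridge_max_2: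
  assumes "w > 0" "r \<ge> 0"
  defines "s \<equiv> w / (w + r)"
  shows "(\<integral>\<^sup>+z. ennreal (z\<^sup>2 * passage_density w z * max_cdf r z) * indicator {0<..} z \<partial>lborel)
    = ennreal ((w + r) * (3 * s - s\<^sup>2) / sqrt (2 * pi * (w + r)))"
proof (cases "r = 0")
  case True
  then show ?thesis
    using nn_integral_passage_density_scale[of w "max_cdf r" 2] nn_integral_exp_3[of 1] assms
      ennreal_mult''[of 2 "w / sqrt (2 * pi * w)"]
    by (simp add: max_cdf_def numeral_3_eq_3[symmetric] ennreal_mult'[symmetric])
next
  case False
  then have "r > 0" using assms by simp
  have s: "s > 0" "(w + r) * s = w" using assms by (auto simp: s_def)
  have "(sqrt w)\<^sup>2 / sqrt (2 * pi * w) * (3 * sqrt s - sqrt s ^ 3) = sqrt s * ((sqrt w)\<^sup>2 / sqrt (2 * pi * w)) * (3 - (sqrt s)\<^sup>2)"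
    by (simp add: algebra_simps power2_eq_square power3_eq_cube diff_divide_distrib)
  also have "\<dots> = sqrt s * (w / sqrt (2 * pi * w)) * (3 - s)"
    using assms s(1) by simp
  also have "w / sqrt (2 * pi * w) = (w + r) * s / (sqrt (2 * pi * (w + r)) * sqrt s)"
    by (simp only: real_sqrt_mult[symmetric] mult.assoc s(2))
  also have "sqrt s * ((w + r) * s / (sqrt (2 * pi * (w + r)) * sqrt s)) * (3 - s) = (w + r) * s / sqrt (2 * pi * (w + r)) * (3 - s)"
    using s(1) by simp
  also have "\<dots> = (w + r) * (3 * s - s\<^sup>2) / sqrt (2 * pi * (w + r))"
    by (simp add: power2_eq_square right_diff_distrib mult.commute mult.left_commute)
  finally show ?thesis
    using nn_integral_passage_density_scale[of w "max_cdf r" 2] nn_integral_exp_erf_3[of "sqrt (w / r)"] assms(1,2) \<open>r > 0\<close>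
    by (simp add: max_cdf_scale sin_arctan_odds s_def[symmetric] numeral_3_eq_3[symmetric] ennreal_mult'[symmetric] del: real_sqrt_pow2)
qed

text \<open>The case \<open>r = 0\<close>, where the survival factor is 1.\<close>

lemma nn_integral_sq_passage_density:
  assumes "w > 0"
  shows "(\<integral>\<^sup>+z. ennreal (z\<^sup>2 * passage_density w z) * indicator {0<..} z \<partial>lborel) = ennreal (2 * w / sqrt (2 * pi * w))"
  using nn_integral_bridge_max_2[of w 0] assms by (simp add: max_cdf_def)

section \<open>The Rayleigh density of the maximum given the argmax\<close>

text \<open>\<open>sqrt (2 * pi * \<theta>)\<close> is the reciprocal of the mass of
  \<open>passage_density \<theta>\<close> on the positive half-line, so
  \<open>max_density \<theta>\<close> is that density normalised.\<close>

lemma max_density_eq: "\<theta> > 0 \<Longrightarrow> h > 0 \<Longrightarrow> max_density \<theta> h = passage_density \<theta> h * sqrt (2 * pi * \<theta>)"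
  by (simp add: max_density_def passage_density_def gauss_eq)

lemma max_density_nonneg: "\<theta> > 0 \<Longrightarrow> 0 \<le> max_density \<theta> h"
  by (simp add: max_density_def)

lemma borel_measurable_max_density [measurable]:
  "(\<lambda>p. max_density (fst p) (snd p)) \<in> borel_measurable (borel \<Otimes>\<^sub>M borel)"
  unfolding max_density_def by measurable

lemma nn_integral_max_density:
  assumes "\<theta> > 0"
  shows "(\<integral>\<^sup>+h. ennreal (max_density \<theta> h) \<partial>lborel) = 1"
    and "(\<integral>\<^sup>+h. ennreal (h * max_density \<theta> h) \<partial>lborel) = ennreal (sqrt (pi * \<theta> / 2))"
    and "(\<integral>\<^sup>+h. ennreal (h\<^sup>2 * max_density \<theta> h) \<partial>lborel) = ennreal (2 * \<theta>)"
proof -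
  \<comment> \<open>The scaling lemma with a constant \<open>\<psi>\<close>: the normalising
    constant cancels, and the three moments are the cases \<open>k = 0\<close>, \<open>k = 1\<close>
    and \<open>k = 2\<close>.\<close>
  have *: "(\<integral>\<^sup>+h. ennreal (h ^ k * max_density \<theta> h) \<partial>lborel) =
     ennreal (sqrt \<theta> ^ k) * (\<integral>\<^sup>+y. ennreal (y ^ Suc k * exp (- y\<^sup>2 / 2)) * indicator {0<..} y \<partial>lborel)" for k
  proof -
    have "(\<integral>\<^sup>+h. ennreal (h ^ k * max_density \<theta> h) \<partial>lborel)
      = (\<integral>\<^sup>+h. ennreal (h ^ k * passage_density \<theta> h * sqrt (2 * pi * \<theta>)) * indicator {0<..} h \<partial>lborel)"
    proof (intro nn_integral_cong)
      fix h :: real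
      show "ennreal (h ^ k * max_density \<theta> h) = ennreal (h ^ k * passage_density \<theta> h * sqrt (2 * pi * \<theta>)) * indicator {0<..} h"
        using assms by (cases "h > 0") (auto simp: max_density_eq mult.assoc, auto simp: max_density_def)
    qed
    also have "\<dots> = ennreal (sqrt \<theta> ^ k / sqrt (2 * pi * \<theta>)) *
      (\<integral>\<^sup>+y. ennreal (y ^ Suc k * exp (- y\<^sup>2 / 2) * sqrt (2 * pi * \<theta>)) * indicator {0<..} y \<partial>lborel)"
      by (rule nn_integral_passage_density_scale) (use assms in auto)
    also have "\<dots> = ennreal (sqrt \<theta> ^ k / sqrt (2 * pi * \<theta>)) *
      (\<integral>\<^sup>+y. ennreal (sqrt (2 * pi * \<theta>)) * (ennreal (y ^ Suc k * exp (- y\<^sup>2 / 2)) * indicator {0<..} y) \<partial>lborel)"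
    proof -
      have "ennreal (x * sqrt (2 * pi * \<theta>)) * i = ennreal (sqrt (2 * pi * \<theta>)) * (ennreal x * i)" for x and i :: ennreal
        using assms by (simp add: mult.commute[of x] ennreal_mult' mult.assoc)
      then show ?thesis by (simp only:)
    qed
    also have "\<dots> = ennreal (sqrt \<theta> ^ k / sqrt (2 * pi * \<theta>)) * (ennreal (sqrt (2 * pi * \<theta>)) *
      (\<integral>\<^sup>+y. ennreal (y ^ Suc k * exp (- y\<^sup>2 / 2)) * indicator {0<..} y \<partial>lborel))"
      by (subst nn_integral_cmult) auto
    also have "\<dots> = ennreal (sqrt \<theta> ^ k / sqrt (2 * pi * \<theta>) * sqrt (2 * pi * \<theta>)) *
      (\<integral>\<^sup>+y. ennreal (y ^ Suc k * exp (- y\<^sup>2 / 2)) * indicator {0<..} y \<partial>lborel)"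
      using assms by (subst ennreal_mult) (auto simp: mult.assoc)
    finally show ?thesis using assms by simp
  qed
  show "(\<integral>\<^sup>+h. ennreal (max_density \<theta> h) \<partial>lborel) = 1"
    using *[of 0] nn_integral_exp_1[of 1] by simp
  show "(\<integral>\<^sup>+h. ennreal (h * max_density \<theta> h) \<partial>lborel) = ennreal (sqrt (pi * \<theta> / 2))"
    using *[of 1] nn_integral_exp_2[of 1] assms
    by (simp add: numeral_2_eq_2[symmetric] ennreal_mult'[symmetric] real_sqrt_mult real_sqrt_divide)
  show "(\<integral>\<^sup>+h. ennreal (h\<^sup>2 * max_density \<theta> h) \<partial>lborel) = ennreal (2 * \<theta>)"
    using *[of 2] nn_integral_exp_3[of 1] assms ennreal_mult''[of 2 \<theta>]
    by (simp add: numeral_3_eq_3[symmetric] mult.commute)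
qed

section \<open>The integral of \<open>M1\<close>\<close>

text \<open>The factor \<open>y\<close> cancels \<open>1 / y\<close>, and in the last term the
  exponents add up by \<open>s / (1 - s) + 1 = 1 / (1 - s)\<close>. There remain two integrals with
  \<open>erf\<close>, with powers 0 and 2 of \<open>y\<close>, and one plain Gaussian
  moment.\<close>

lemma nn_integral_M1:
  assumes "0 < s" "s \<le> 1"
  shows "(\<integral>\<^sup>+y. ennreal (M1 s y * y * exp (- y\<^sup>2 / 2)) * indicator {0<..} y \<partial>lborel) = ennreal (G11 s)"
proof (cases "s = 1")
  case True
  have "sqrt (2 / pi) * (pi / 2) = sqrt (2 / pi) * sqrt (pi / 2) * sqrt (pi / 2)"
    by (simp add: mult.assoc)
  then have "G11 1 = sqrt (pi / 2)"
    unfolding sqrt_two_div_pi_mult by (simp add: G11_def arctan_odds_def)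
  then show ?thesis
    using True nn_integral_exp_2[of 1] by (simp add: M1_def power2_eq_square)
next
  case False
  then have "s < 1" using assms by simp
  define c where "c = sqrt (s / (1 - s))"
  define a where "a = sqrt (2 * s * (1 - s) / pi)"
  have c: "c \<ge> 0" "c\<^sup>2 = s / (1 - s)" using assms \<open>s < 1\<close> by (auto simp: c_def)
  have c1: "1 + c\<^sup>2 = 1 / (1 - s)" using \<open>s < 1\<close> by (simp add: c(2) field_simps)
  have a0: "a \<ge> 0" using assms by (auto simp: a_def)
  define f where "f y = ennreal (exp (- y\<^sup>2 / 2) * erf (c * y / sqrt 2)) * indicator {0<..} y" for y
  define g where "g y = ennreal (y\<^sup>2 * exp (- y\<^sup>2 / 2) * erf (c * y / sqrt 2)) * indicator {0<..} y" for y
  define k where "k y = ennreal (y * exp (- (1 / (1 - s) * y\<^sup>2 / 2))) * indicator {0<..} y" for y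
  have [measurable]: "f \<in> borel_measurable borel" "g \<in> borel_measurable borel" "k \<in> borel_measurable borel"
    unfolding f_def[abs_def] g_def[abs_def] k_def[abs_def] by measurable
  have "(\<integral>\<^sup>+y. ennreal (M1 s y * y * exp (- y\<^sup>2 / 2)) * indicator {0<..} y \<partial>lborel)
      = (\<integral>\<^sup>+y. ennreal (1 - s) * f y + (ennreal s * g y + ennreal a * k y) \<partial>lborel)"
  proof (intro nn_integral_cong)
    fix y :: real
    show "ennreal (M1 s y * y * exp (- y\<^sup>2 / 2)) * indicator {0<..} y
        = ennreal (1 - s) * f y + (ennreal s * g y + ennreal a * k y)"
    proof (cases "y > 0")
      case True
      have e: "y * sqrt s / sqrt (2 * (1 - s)) = c * y / sqrt 2"
        unfolding c_def real_sqrt_divide real_sqrt_mult by (simp add: ac_simps)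
      have "s * y\<^sup>2 / (2 * (1 - s)) + y\<^sup>2 / 2 = 1 / (1 - s) * y\<^sup>2 / 2"
        using \<open>s < 1\<close> by (simp add: field_simps)
      then have x: "exp (- (s * y\<^sup>2) / (2 * (1 - s))) * exp (- y\<^sup>2 / 2) = exp (- (1 / (1 - s) * y\<^sup>2 / 2))"
        unfolding exp_add[symmetric] minus_divide_left[symmetric] by (simp only: minus_add_distrib[symmetric])
      have "M1 s y * y * exp (- y\<^sup>2 / 2) = (1 - s + s * y\<^sup>2) * erf (c * y / sqrt 2) * exp (- y\<^sup>2 / 2)
          + a * (y * (exp (- (s * y\<^sup>2) / (2 * (1 - s))) * exp (- y\<^sup>2 / 2)))"
        using True False unfolding M1_def a_def[symmetric] e by (simp add: algebra_simps)
      also have "\<dots> = (1 - s) * (exp (- y\<^sup>2 / 2) * erf (c * y / sqrt 2)) + (s * (y\<^sup>2 * exp (- y\<^sup>2 / 2) * erf (c * y / sqrt 2))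
          + a * (y * exp (- (1 / (1 - s) * y\<^sup>2 / 2))))"
        unfolding x by (simp add: algebra_simps)
      finally show ?thesis
        using True assms c a0
        by (simp add: f_def g_def k_def ennreal_plus[symmetric] ennreal_mult'[symmetric] erf_nonneg del: ennreal_plus)
    qed (simp add: f_def g_def k_def)
  qed
  also have "\<dots> = ennreal (1 - s) * (\<integral>\<^sup>+y. f y \<partial>lborel) + (ennreal s * (\<integral>\<^sup>+y. g y \<partial>lborel) + ennreal a * (\<integral>\<^sup>+y. k y \<partial>lborel))"
    by (simp add: nn_integral_add nn_integral_cmult)
  also have "(\<integral>\<^sup>+y. f y \<partial>lborel) = ennreal (sqrt (2 / pi) * arctan c)"
    unfolding f_def by (rule nn_integral_exp_erf_0[OF c(1)])
  also have "(\<integral>\<^sup>+y. g y \<partial>lborel) = ennreal (sqrt (2 / pi) * (c / (1 + c\<^sup>2) + arctan c))"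
    unfolding g_def by (rule nn_integral_exp_erf_2[OF c(1)])
  also have "(\<integral>\<^sup>+y. k y \<partial>lborel) = ennreal (1 - s)"
    unfolding k_def using nn_integral_exp_1[of "1 / (1 - s)"] \<open>s < 1\<close> by simp
  also have "ennreal (1 - s) * ennreal (sqrt (2 / pi) * arctan c)
      + (ennreal s * ennreal (sqrt (2 / pi) * (c / (1 + c\<^sup>2) + arctan c)) + ennreal a * ennreal (1 - s))
     = ennreal ((1 - s) * (sqrt (2 / pi) * arctan c) + (s * (sqrt (2 / pi) * (c / (1 + c\<^sup>2) + arctan c)) + a * (1 - s)))"
    using assms c a0 by (simp add: ennreal_plus[symmetric] ennreal_mult'[symmetric] del: ennreal_plus)
  \<comment> \<open>The weights recombine: \<open>1 - s\<close> and \<open>s\<close> times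
    \<open>arctan c\<close> give one arctangent, and \<open>s\<close> and \<open>1 - s\<close> times
    \<open>sqrt (s * (1 - s))\<close> give one square root.\<close>
  also have "(1 - s) * (sqrt (2 / pi) * arctan c) + (s * (sqrt (2 / pi) * (c / (1 + c\<^sup>2) + arctan c)) + a * (1 - s)) = G11 s"
  proof -
    have "c / (1 + c\<^sup>2) = c * sqrt ((1 - s)\<^sup>2)"
      using \<open>s < 1\<close> unfolding c1 by simp
    also have "\<dots> = sqrt (s * (1 - s))"
      using \<open>s < 1\<close> unfolding c_def real_sqrt_mult[symmetric] by (simp add: power2_eq_square)
    finally have e: "c / (1 + c\<^sup>2) = sqrt (s * (1 - s))" .
    have "a = sqrt (2 / pi) * sqrt (s * (1 - s))"
      unfolding a_def real_sqrt_mult[symmetric] by simp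
    moreover have "arctan c = arctan_odds s"
      using \<open>s < 1\<close> by (simp add: c_def arctan_odds_def)
    ultimately show ?thesis unfolding e G11_def by (simp add: algebra_simps)
  qed
  finally show ?thesis .
qed

lemma nn_integral_M1_scale:
  assumes "0 < s" "s \<le> 1" "\<theta> > 0"
  shows "(\<integral>\<^sup>+h. ennreal (M1 s (h / sqrt \<theta>) * (h / sqrt \<theta>) * exp (- h\<^sup>2 / (2 * \<theta>))) * indicator {0<..} h \<partial>lborel)
    = ennreal (sqrt \<theta> * G11 s)"
proof -
  have [measurable]: "M1 s \<in> borel_measurable borel"
    unfolding M1_def[abs_def] by measurable
  have "(\<integral>\<^sup>+h. ennreal (M1 s (h / sqrt \<theta>) * (h / sqrt \<theta>) * exp (- h\<^sup>2 / (2 * \<theta>))) * indicator {0<..} h \<partial>lborel)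
     = ennreal (sqrt \<theta>) * (\<integral>\<^sup>+y. ennreal (M1 s (sqrt \<theta> * y / sqrt \<theta>) * (sqrt \<theta> * y / sqrt \<theta>) * exp (- (sqrt \<theta> * y)\<^sup>2 / (2 * \<theta>))) * indicator {0<..} y \<partial>lborel)"
    by (rule nn_integral_Ioi_scale) (use assms in auto)
  also have "(\<lambda>y. ennreal (M1 s (sqrt \<theta> * y / sqrt \<theta>) * (sqrt \<theta> * y / sqrt \<theta>) * exp (- (sqrt \<theta> * y)\<^sup>2 / (2 * \<theta>))) * indicator {0<..} y)
     = (\<lambda>y. ennreal (M1 s y * y * exp (- y\<^sup>2 / 2)) * indicator {0<..} y)"
    using assms by (simp add: power_mult_distrib)
  finally show ?thesis
    using assms unfolding nn_integral_M1[OF assms(1,2)] by (simp only: ennreal_mult' real_sqrt_ge_zero less_imp_le)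
qed

lemma M1_nonneg:
  assumes "0 < s" "s \<le> 1" "y > 0"
  shows "M1 s y \<ge> 0"
proof -
  have "0 \<le> erf (y * sqrt s / sqrt (2 * (1 - s)))"
    using assms by (intro erf_nonneg) simp
  then show ?thesis
    using assms unfolding M1_def by (auto intro!: add_nonneg_nonneg mult_nonneg_nonneg divide_nonneg_nonneg)
qed

section \<open>Integrals of the Gaussian kernel with its mirror image\<close>

text \<open>\<open>passage_density u\<close> is minus the derivative of \<open>gauss u\<close>, and
  \<open>gauss u\<close> vanishes at infinity.\<close>

lemma nn_integral_passage_density_Ioi:
  assumes "u > 0" "a + b \<ge> 0"
  shows "(\<integral>\<^sup>+x. ennreal (passage_density u (x + b)) * indicator {a<..} x \<partial>lborel) = ennreal (gauss u (a + b))"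
proof -
  have "(\<integral>\<^sup>+x. ennreal (passage_density u (x + b)) * indicator {a<..} x \<partial>lborel) = ennreal (0 - - gauss u (a + b))"
  proof (rule nn_integral_FTC_Ioi)
    show "DERIV (\<lambda>x. - gauss u (x + b)) x :> passage_density u (x + b)" for x
      unfolding passage_density_def using assms by (auto intro!: derivative_eq_intros)
    have "filterlim (\<lambda>x. x + b) at_top at_top"
      using filterlim_tendsto_add_at_top[OF tendsto_const filterlim_ident, of b] by (simp add: add.commute)
    from filterlim_compose[OF tendsto_gauss_at_top[OF assms(1)] this]
    show "((\<lambda>x. - gauss u (x + b)) \<longlongrightarrow> 0) at_top"
      using tendsto_minus by force
  qed (use assms in \<open>auto simp: passage_density_def\<close>)
  then show ?thesis by simp
qed

lemma gauss_0: "u > 0 \<Longrightarrow> gauss u 0 = 1 / sqrt (2 * pi * u)"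
  by (simp add: gauss_eq)

lemma DERIV_erf_gauss:
  assumes "v > 0"
  shows "DERIV (\<lambda>y. erf ((y + b) / sqrt (2 * v)) / 2) y :> gauss v (y + b)"
  using assms by (auto intro!: derivative_eq_intros simp: gauss_eq power_divide real_sqrt_mult field_simps)

lemma tendsto_erf_affine_at_top:
  assumes "v > 0"
  shows "((\<lambda>y. erf ((y + b) / sqrt (2 * v)) / 2) \<longlongrightarrow> 1 / 2) at_top"
proof -
  have "filterlim (\<lambda>x. x + b) at_top at_top"
    using filterlim_tendsto_add_at_top[OF tendsto_const filterlim_ident, of b] by (simp add: add.commute)
  then have "((\<lambda>x. erf ((x + b) * (1 / sqrt (2 * v))) / 2) \<longlongrightarrow> 1 / 2) at_top"
    by (intro tendsto_divide filterlim_compose[OF tendsto_erf_at_top] filterlim_at_top_mult_tendsto_pos[OF tendsto_const])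
       (use assms in auto)
  then show ?thesis by simp
qed

text \<open>The integrand is the density at time \<open>v\<close> of Brownian motion started at
  \<open>z\<close> and killed at 0; the integral is its survival probability.\<close>

lemma nn_integral_gauss_diff:
  assumes "v > 0" "z > 0"
  shows "(\<integral>\<^sup>+y. ennreal (gauss v (y - z) - gauss v (y + z)) * indicator {0<..} y \<partial>lborel) = ennreal (erf (z / sqrt (2 * v)))"
proof -
  define F where "F y = erf ((y + - z) / sqrt (2 * v)) / 2 - erf ((y + z) / sqrt (2 * v)) / 2" for y
  have "(\<integral>\<^sup>+y. ennreal (gauss v (y - z) - gauss v (y + z)) * indicator {0<..} y \<partial>lborel) = ennreal (1 / 2 - 1 / 2 - F 0)"
  proof (rule nn_integral_FTC_Ioi)
    show "DERIV F y :> gauss v (y - z) - gauss v (y + z)" for y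
      unfolding F_def[abs_def] using DERIV_diff[OF DERIV_erf_gauss[OF assms(1), of "-z"] DERIV_erf_gauss[OF assms(1), of z]] by simp
    show "(F \<longlongrightarrow> 1 / 2 - 1 / 2) at_top"
      unfolding F_def[abs_def] by (intro tendsto_diff tendsto_erf_affine_at_top assms)
  qed (use assms gauss_diff_nonneg in auto)
  then show ?thesis by (simp add: F_def erf_minus)
qed

text \<open>Brownian motion stopped at 0 is a martingale, and stopped paths contribute nothing to
  its mean; so the mean is \<open>z\<close> whatever \<open>v\<close> is. Analytically,
  \<open>y = (y - z) + z\<close> and \<open>y = (y + z) - z\<close> split off the derivatives of the
  two Gaussians, and what is left integrates to error functions.\<close>

lemma nn_integral_mult_gauss_diff:
  assumes "v > 0" "z > 0"
  shows "(\<integral>\<^sup>+y. ennreal (y * (gauss v (y - z) - gauss v (y + z))) * indicator {0<..} y \<partial>lborel) = ennreal z"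
proof -
  define F where "F y = z * (erf ((y + - z) / sqrt (2 * v)) / 2 + erf ((y + z) / sqrt (2 * v)) / 2)
     + v * (gauss v (y + z) - gauss v (y + - z))" for y
  have g: "DERIV (\<lambda>y. v * gauss v (y + b)) y :> - ((y + b) * gauss v (y + b))" for b y
  proof -
    have "DERIV (\<lambda>y. gauss v (y + b)) y :> - ((y + b) / v) * gauss v (y + b)"
      using assms by (auto intro!: derivative_eq_intros)
    from DERIV_cmult[OF this, of v] show ?thesis using assms by simp
  qed
  have tg: "((\<lambda>y. gauss v (y + b)) \<longlongrightarrow> 0) at_top" for b
  proof -
    have "filterlim (\<lambda>x. x + b) at_top at_top"
      using filterlim_tendsto_add_at_top[OF tendsto_const filterlim_ident, of b] by (simp add: add.commute)
    from filterlim_compose[OF tendsto_gauss_at_top[OF assms(1)] this] show ?thesis .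
  qed
  have "(\<integral>\<^sup>+y. ennreal (y * (gauss v (y - z) - gauss v (y + z))) * indicator {0<..} y \<partial>lborel)
     = ennreal (z * (1 / 2 + 1 / 2) + v * (0 - 0) - F 0)"
  proof (rule nn_integral_FTC_Ioi)
    fix y :: real
    have "DERIV (\<lambda>y. z * (erf ((y + - z) / sqrt (2 * v)) / 2 + erf ((y + z) / sqrt (2 * v)) / 2)
         + (v * gauss v (y + z) - v * gauss v (y + - z))) y :>
        z * (gauss v (y + - z) + gauss v (y + z)) + (- ((y + z) * gauss v (y + z)) - - ((y + - z) * gauss v (y + - z)))"
      by (intro DERIV_add DERIV_diff DERIV_cmult DERIV_erf_gauss g assms)
    then show "DERIV F y :> y * (gauss v (y - z) - gauss v (y + z))"
      unfolding F_def[abs_def] by (simp add: algebra_simps)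
    show "(F \<longlongrightarrow> z * (1 / 2 + 1 / 2) + v * (0 - 0)) at_top"
      unfolding F_def[abs_def] by (intro tendsto_intros tendsto_erf_affine_at_top tg assms)
  qed (use assms gauss_diff_nonneg in auto)
  moreover have "F 0 = 0"
    using gauss_minus[of v z] by (simp add: F_def erf_minus)
  ultimately show ?thesis by simp
qed

subsection \<open>Brownian motion on a bounded interval\<close>

text \<open>The length \<open>T\<close> is a parameter because the path restarted at a fixed time
  and the path stopped at one are again models, for shorter intervals; every law proved here is
  applied to them as well.\<close>

locale brownian = prob_space M for M :: "'a measure" +
  fixes B :: "real \<Rightarrow> 'a \<Rightarrow> real" and T :: real
  assumes random_variable_B: "0 \<le> t \<Longrightarrow> t \<le> T \<Longrightarrow> random_variable borel (B t)"
    and start_zero: "\<omega> \<in> space M \<Longrightarrow> B 0 \<omega> = 0"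
    and continuous_paths: "\<omega> \<in> space M \<Longrightarrow> continuous_on {0..T} (\<lambda>t. B t \<omega>)"
    and gaussian_increments: "0 \<le> s \<Longrightarrow> s < t \<Longrightarrow> t \<le> T \<Longrightarrow>
      distributed M lborel (\<lambda>\<omega>. B t \<omega> - B s \<omega>) (\<lambda>x. ennreal (gauss (t - s) x))"
    and independent_increments: "0 \<le> \<tau> 0 \<Longrightarrow> (\<forall>i<n. \<tau> i \<le> \<tau> (Suc i)) \<Longrightarrow> \<tau> n \<le> T \<Longrightarrow>
      indep_vars (\<lambda>_. borel) (\<lambda>i \<omega>. B (\<tau> (Suc i)) \<omega> - B (\<tau> i) \<omega>) {..<n}"

lemma brownian_of_brownian_motion_01: "brownian_motion_01 M B \<Longrightarrow> brownian M B 1"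
  unfolding brownian_motion_01_def brownian_motion_01_axioms_def brownian_def brownian_axioms_def by blast

definition restart :: "(real \<Rightarrow> 'a \<Rightarrow> real) \<Rightarrow> real \<Rightarrow> real \<Rightarrow> 'a \<Rightarrow> real" where
  "restart B a t \<omega> = B (a + t) \<omega> - B a \<omega>"

definition run_max :: "(real \<Rightarrow> 'a \<Rightarrow> real) \<Rightarrow> real \<Rightarrow> 'a \<Rightarrow> real" where
  "run_max B t \<omega> = (SUP u\<in>{0..t}. B u \<omega>)"

definition run_argmax :: "(real \<Rightarrow> 'a \<Rightarrow> real) \<Rightarrow> real \<Rightarrow> 'a \<Rightarrow> real" where
  "run_argmax B t \<omega> = (LEAST u. 0 \<le> u \<and> u \<le> t \<and> B u \<omega> = run_max B t \<omega>)"

text \<open>The process is an argument so that one construction gives both the past of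
  \<open>B\<close> and, for the restarted process, its future.\<close>

definition generated :: "'a measure \<Rightarrow> (real \<Rightarrow> 'a \<Rightarrow> real) \<Rightarrow> real \<Rightarrow> 'a measure" where
  "generated M X t = sigma (space M) {X v -` A \<inter> space M | v A. v \<in> {0..t} \<and> A \<in> sets borel}"

lemma space_generated [simp]: "space (generated M X t) = space M"
  unfolding generated_def by (intro space_measure_of) auto

lemma sets_generated:
  "sets (generated M X t) = sigma_sets (space M) {X v -` A \<inter> space M | v A. v \<in> {0..t} \<and> A \<in> sets borel}"
  unfolding generated_def by (intro sets_measure_of) auto

lemma measurable_generated: "v \<in> {0..t} \<Longrightarrow> X v \<in> borel_measurable (generated M X t)"
  by (rule measurableI) (auto simp: sets_generated intro!: sigma_sets.Basic)

context brownian
begin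

lemma brownian_restart:
  assumes "0 \<le> a" "a \<le> T"
  shows "brownian M (restart B a) (T - a)"
proof
  fix t :: real assume "0 \<le> t" "t \<le> T - a"
  then show "random_variable borel (restart B a t)"
    unfolding restart_def[abs_def] using assms by (intro borel_measurable_diff random_variable_B) auto
next
  fix \<omega> assume "\<omega> \<in> space M"
  then have "continuous_on {0..T} (\<lambda>t. B t \<omega>)" by (rule continuous_paths)
  then have "continuous_on {0..T - a} (\<lambda>t. B (a + t) \<omega>)"
    by (rule continuous_on_compose2) (use assms in \<open>auto intro!: continuous_intros\<close>)
  then show "continuous_on {0..T - a} (\<lambda>t. restart B a t \<omega>)"
    unfolding restart_def by (intro continuous_intros)
next
  fix s t :: real assume "0 \<le> s" "s < t" "t \<le> T - a"
  then show "distributed M lborel (\<lambda>\<omega>. restart B a t \<omega> - restart B a s \<omega>) (\<lambda>x. ennreal (gauss (t - s) x))"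
    using gaussian_increments[of "a + s" "a + t"] assms by (simp add: restart_def)
next
  fix \<tau> :: "nat \<Rightarrow> real" and n :: nat
  assume "0 \<le> \<tau> 0" "\<forall>i<n. \<tau> i \<le> \<tau> (Suc i)" "\<tau> n \<le> T - a"
  then show "indep_vars (\<lambda>_. borel) (\<lambda>i \<omega>. restart B a (\<tau> (Suc i)) \<omega> - restart B a (\<tau> i) \<omega>) {..<n}"
    using independent_increments[of "\<lambda>i. a + \<tau> i" n] assms by (simp add: restart_def)
qed (simp add: restart_def)

lemma brownian_stop:
  assumes "t \<le> T"
  shows "brownian M B t"
proof
  show "continuous_on {0..t} (\<lambda>u. B u \<omega>)" if "\<omega> \<in> space M" for \<omega>
    by (rule continuous_on_subset[OF continuous_paths[OF that]]) (use assms in auto)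
  show "indep_vars (\<lambda>_. borel) (\<lambda>i \<omega>. B (\<tau> (Suc i)) \<omega> - B (\<tau> i) \<omega>) {..<n}"
    if "0 \<le> \<tau> 0" "\<forall>i<n. \<tau> i \<le> \<tau> (Suc i)" "\<tau> n \<le> t" for \<tau> n
    by (rule independent_increments[OF that(1,2)]) (use that assms in simp)
  show "distributed M lborel (\<lambda>\<omega>. B v \<omega> - B s \<omega>) (\<lambda>x. ennreal (gauss (v - s) x))"
    if "0 \<le> s" "s < v" "v \<le> t" for s v
    by (rule gaussian_increments[OF that(1,2)]) (use that assms in simp)
  show "random_variable borel (B v)" if "0 \<le> v" "v \<le> t" for v
    by (rule random_variable_B[OF that(1)]) (use that assms in simp)
qed (rule start_zero)

lemma distributed_B:
  assumes "0 < t" "t \<le> T"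
  shows "distributed M lborel (B t) (\<lambda>x. ennreal (gauss t x))"
proof -
  have eq: "distr M lborel (\<lambda>\<omega>. B t \<omega> - B 0 \<omega>) = distr M lborel (B t)"
    by (rule distr_cong) (auto simp: start_zero)
  have "distributed M lborel (\<lambda>\<omega>. B t \<omega> - B 0 \<omega>) (\<lambda>x. ennreal (gauss t x))"
    using gaussian_increments[of 0 t] assms by simp
  then show ?thesis
    using random_variable_B[of t] assms unfolding distributed_def eq by simp
qed

subsubsection \<open>Independence of past and future\<close>

lemma sets_generated_subset: "t \<le> T \<Longrightarrow> sets (generated M B t) \<subseteq> events"
  unfolding sets_generated by (rule sets.sigma_sets_subset) (auto intro!: measurable_sets[OF random_variable_B])

lemma measurable_generatedD:
  assumes "X \<in> measurable (generated M B t) N" "t \<le> T"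
  shows "X \<in> measurable M N"
  using assms sets_generated_subset[of t] unfolding measurable_def by auto

text \<open>Events about finitely many times are stable under intersection, which the single-time
  generator in \<open>generated\<close> is not. The extension of independence to the sigma-algebras
  needs such a generator.\<close>

definition cylinders :: "'a measure \<Rightarrow> (real \<Rightarrow> 'a \<Rightarrow> real) \<Rightarrow> real \<Rightarrow> 'a set set" where
  "cylinders M' X t = {{\<omega> \<in> space M'. \<forall>v\<in>J. X v \<omega> \<in> A v} | J A. finite J \<and> J \<subseteq> {0..t} \<and> (\<forall>v. A v \<in> sets borel)}"

lemma sets_generated_cylinders: "sets (generated M X t) \<subseteq> sigma_sets (space M) (cylinders M X t)"
  unfolding sets_generated
proof (rule sigma_sets_mono')
  show "{X v -` A \<inter> space M | v A. v \<in> {0..t} \<and> A \<in> sets borel} \<subseteq> cylinders M X t"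
  proof safe
    fix v A assume "v \<in> {0..t}" "A \<in> sets (borel :: real measure)"
    then show "X v -` A \<inter> space M \<in> cylinders M X t"
      unfolding cylinders_def by (intro CollectI exI[of _ "{v}"] exI[of _ "\<lambda>_. A"]) auto
  qed
qed

lemma Int_stable_cylinders: "Int_stable (cylinders M X t)"
proof (rule Int_stableI)
  fix a b assume "a \<in> cylinders M X t" "b \<in> cylinders M X t"
  then obtain J A K C where
    a: "a = {\<omega> \<in> space M. \<forall>v\<in>J. X v \<omega> \<in> A v}" "finite J" "J \<subseteq> {0..t}" "\<And>v. A v \<in> sets borel" and
    b: "b = {\<omega> \<in> space M. \<forall>v\<in>K. X v \<omega> \<in> C v}" "finite K" "K \<subseteq> {0..t}" "\<And>v. C v \<in> sets borel"
    unfolding cylinders_def by auto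
  \<comment> \<open>\<open>UNIV\<close> is the trivial constraint at a time that only one of the two
    cylinders mentions.\<close>
  define D where "D v = (if v \<in> J then A v else UNIV) \<inter> (if v \<in> K then C v else UNIV)" for v
  have "a \<inter> b = {\<omega> \<in> space M. \<forall>v\<in>J \<union> K. X v \<omega> \<in> D v}"
    using a(1) b(1) by (auto simp: D_def)
  moreover have "D v \<in> sets borel" for v
    using a(4) b(4) by (auto simp: D_def)
  ultimately show "a \<inter> b \<in> cylinders M X t"
    unfolding cylinders_def using a b by (intro CollectI exI[of _ "J \<union> K"] exI[of _ D]) auto
qed

lemma cylinders_subset: "t \<le> T \<Longrightarrow> cylinders M B t \<subseteq> events"
proof safe
  fix a assume "t \<le> T" "a \<in> cylinders M B t"
  then obtain J A where
    a: "a = {\<omega> \<in> space M. \<forall>v\<in>J. B v \<omega> \<in> A v}" "finite J" "J \<subseteq> {0..t}" "\<And>v. A v \<in> sets borel"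
    unfolding cylinders_def by auto
  have *: "{\<omega> \<in> space M. B v \<omega> \<in> A v} \<in> events" if "v \<in> J" for v
    using measurable_sets[OF random_variable_B a(4), of v v] that a(3) \<open>t \<le> T\<close>
    by (auto simp: vimage_def Int_def conj_commute)
  show "a \<in> events"
    unfolding a(1) by (rule sets.sets_Collect_finite_All[OF * a(2)])
qed

text \<open>The locale provides independence of consecutive increments along one grid only. So all
  times of both cylinders are merged into one sorted list: the past consists of sums of increments
  before the position of \<open>t\<close>, the future of sums from that position on, and disjoint
  blocks of independent variables are independent.\<close>

lemma indep_cylinders:
  assumes "0 \<le> t" "t \<le> T"
  shows "indep_set (cylinders M B t) (cylinders M (restart B t) (T - t))"
proof (rule indep_setI)
  interpret R: brownian M "restart B t" "T - t" using assms by (rule brownian_restart)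
  show "cylinders M B t \<subseteq> events" "cylinders M (restart B t) (T - t) \<subseteq> events"
    using cylinders_subset R.cylinders_subset assms by auto
  fix a b assume "a \<in> cylinders M B t" "b \<in> cylinders M (restart B t) (T - t)"
  then obtain J A K C where
    a: "a = {\<omega> \<in> space M. \<forall>v\<in>J. B v \<omega> \<in> A v}" "finite J" "J \<subseteq> {0..t}" "\<And>v. A v \<in> sets borel" and
    b: "b = {\<omega> \<in> space M. \<forall>v\<in>K. restart B t v \<omega> \<in> C v}" "finite K" "K \<subseteq> {0..T - t}" "\<And>v. C v \<in> sets borel"
    unfolding cylinders_def by auto
  \<comment> \<open>With 0 in the list the sums for the past telescope down to
    \<open>B 0 = 0\<close>; with \<open>t\<close> in it the cut falls on an entry.\<close>
  define S where "S = J \<union> {0, t} \<union> (\<lambda>v. t + v) ` K"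
  have S: "finite S" "S \<subseteq> {0..T}" "0 \<in> S" "t \<in> S" using a b assms by (auto simp: S_def)
  define l where "l = sorted_list_of_set S"
  have l: "set l = S" "sorted l" "distinct l" using S by (auto simp: l_def)
  then have "l \<noteq> []" using S by auto
  define n where "n = length l - 1"
  have len: "length l = Suc n" using \<open>l \<noteq> []\<close> by (simp add: n_def)
  \<comment> \<open>The position of a time in the list. It is monotone, so the times in
    \<open>J\<close> have positions up to \<open>p\<close> and the shifted times
    \<open>t + v\<close> positions from \<open>p\<close> on.\<close>
  define idx where "idx v = (SOME i. i < length l \<and> l ! i = v)" for v
  have idx: "idx v < length l" "l ! idx v = v" if "v \<in> S" for v
    using someI_ex[of "\<lambda>i. i < length l \<and> l ! i = v"] that l(1) by (auto simp: idx_def in_set_conv_nth)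
  have idx_le: "idx v \<le> idx w" if "v \<in> S" "w \<in> S" "v \<le> w" for v w
  proof (rule ccontr)
    assume "\<not> idx v \<le> idx w"
    then have "l ! idx w \<le> l ! idx v" "idx w \<noteq> idx v"
      using sorted_nth_mono[OF l(2), of "idx w" "idx v"] idx that by auto
    then show False
      using idx that nth_eq_iff_index_eq[OF l(3), of "idx w" "idx v"] by auto
  qed
  have l0: "l ! 0 = 0"
    using sorted_nth_mono[OF l(2), of 0 "idx 0"] idx[of 0] S len l(1) nth_mem[of 0 l]
    by (metis antisym atLeastAtMost_iff le0 subset_eq zero_less_Suc)
  define inc where "inc i \<omega> = B (l ! Suc i) \<omega> - B (l ! i) \<omega>" for i \<omega>
  have "indep_vars (\<lambda>_. borel) inc {..<n}"
    unfolding inc_def[abs_def]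
  proof (rule independent_increments)
    show "0 \<le> l ! 0" by (simp add: l0)
    show "\<forall>i<n. l ! i \<le> l ! Suc i" using len l(2) by (auto intro: sorted_nth_mono)
    show "l ! n \<le> T" using S l(1) len nth_mem[of n l] by (auto simp: subset_eq)
  qed
  moreover define p where "p = idx t"
  ultimately have ind: "indep_var (PiM {..<p} (\<lambda>_. borel)) (\<lambda>\<omega>. restrict (\<lambda>i. inc i \<omega>) {..<p})
      (PiM {p..<n} (\<lambda>_. borel)) (\<lambda>\<omega>. restrict (\<lambda>i. inc i \<omega>) {p..<n})"
    using idx[of t] S len by (intro indep_var_restrict) auto
  define PA where "PA = {x \<in> space (PiM {..<p} (\<lambda>_. borel)). \<forall>v\<in>J. (\<Sum>i=0..<idx v. x i :: real) \<in> A v}"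
  define PC where "PC = {x \<in> space (PiM {p..<n} (\<lambda>_. borel)). \<forall>v\<in>K. (\<Sum>i=p..<idx (t + v). x i :: real) \<in> C v}"
  have J: "v \<in> S" "idx v \<le> p" if "v \<in> J" for v
    using that a(3) S idx_le[of v t] by (auto simp: S_def p_def)
  have K: "t + v \<in> S" "p \<le> idx (t + v)" "idx (t + v) \<le> n" if "v \<in> K" for v
    using that b(3) S idx_le[of t "t + v"] idx[of "t + v"] len by (auto simp: S_def p_def)
  have PA: "PA \<in> sets (PiM {..<p} (\<lambda>_. borel))"
    unfolding PA_def
  proof (rule sets.sets_Collect_finite_All[OF _ a(2)])
    fix v assume "v \<in> J"
    have "(\<lambda>x. \<Sum>i=0..<idx v. x i) \<in> borel_measurable (PiM {..<p} (\<lambda>_. borel :: real measure))"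
      using J[OF \<open>v \<in> J\<close>] by (intro borel_measurable_sum measurable_component_singleton) auto
    from measurable_sets[OF this a(4)[of v]]
    show "{x \<in> space (PiM {..<p} (\<lambda>_. borel)). (\<Sum>i=0..<idx v. x i) \<in> A v} \<in> sets (PiM {..<p} (\<lambda>_. borel))"
      by (simp add: vimage_def Int_def conj_commute)
  qed
  have PC: "PC \<in> sets (PiM {p..<n} (\<lambda>_. borel))"
    unfolding PC_def
  proof (rule sets.sets_Collect_finite_All[OF _ b(2)])
    fix v assume "v \<in> K"
    have "(\<lambda>x. \<Sum>i=p..<idx (t + v). x i) \<in> borel_measurable (PiM {p..<n} (\<lambda>_. borel :: real measure))"
      using K[OF \<open>v \<in> K\<close>] by (intro borel_measurable_sum measurable_component_singleton) auto
    from measurable_sets[OF this b(4)[of v]]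
    show "{x \<in> space (PiM {p..<n} (\<lambda>_. borel)). (\<Sum>i=p..<idx (t + v). x i) \<in> C v} \<in> sets (PiM {p..<n} (\<lambda>_. borel))"
      by (simp add: vimage_def Int_def conj_commute)
  qed
  have sumJ: "(\<Sum>i=0..<idx v. restrict (\<lambda>i. inc i \<omega>) {..<p} i) = B v \<omega>" if "v \<in> J" "\<omega> \<in> space M" for v \<omega>
  proof -
    have "(\<Sum>i=0..<idx v. restrict (\<lambda>i. inc i \<omega>) {..<p} i) = (\<Sum>i=0..<idx v. B (l ! Suc i) \<omega> - B (l ! i) \<omega>)"
      using J[OF that(1)] by (intro sum.cong) (auto simp: inc_def)
    also have "\<dots> = B (l ! idx v) \<omega> - B (l ! 0) \<omega>"
      by (rule sum_Suc_diff') simp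
    finally show ?thesis using J[OF that(1)] idx start_zero that(2) by (simp add: l0)
  qed
  have sumK: "(\<Sum>i=p..<idx (t + v). restrict (\<lambda>i. inc i \<omega>) {p..<n} i) = restart B t v \<omega>" if "v \<in> K" for v \<omega>
  proof -
    have "(\<Sum>i=p..<idx (t + v). restrict (\<lambda>i. inc i \<omega>) {p..<n} i) = (\<Sum>i=p..<idx (t + v). B (l ! Suc i) \<omega> - B (l ! i) \<omega>)"
      using K[OF that(1)] by (intro sum.cong) (auto simp: inc_def)
    also have "\<dots> = B (l ! idx (t + v)) \<omega> - B (l ! p) \<omega>"
      by (rule sum_Suc_diff') (use K[OF that(1)] in simp)
    finally show ?thesis using K[OF that(1)] idx S by (simp add: p_def restart_def)
  qed
  have a': "a = (\<lambda>\<omega>. restrict (\<lambda>i. inc i \<omega>) {..<p}) -` PA \<inter> space M"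
    unfolding a(1) PA_def using sumJ by (auto simp: space_PiM)
  have b': "b = (\<lambda>\<omega>. restrict (\<lambda>i. inc i \<omega>) {p..<n}) -` PC \<inter> space M"
    unfolding b(1) PC_def using sumK by (auto simp: space_PiM)
  have "prob (a \<inter> b) = prob ((\<lambda>\<omega>. (restrict (\<lambda>i. inc i \<omega>) {..<p}, restrict (\<lambda>i. inc i \<omega>) {p..<n})) -` (PA \<times> PC) \<inter> space M)"
    unfolding a' b' by (rule arg_cong[where f = prob]) auto
  also have "\<dots> = prob a * prob b"
    unfolding a' b' by (rule indep_varD[OF ind PA PC])
  finally show "prob (a \<inter> b) = prob a * prob b" .
qed

lemma prob_past_future:
  assumes "0 \<le> t" "t \<le> T"
    and "a \<in> sets (generated M B t)" "b \<in> sets (generated M (restart B t) (T - t))"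
  shows "prob (a \<inter> b) = prob a * prob b"
proof -
  interpret R: brownian M "restart B t" "T - t" using assms(1,2) by (rule brownian_restart)
  have "indep_set (sigma_sets (space M) (cylinders M B t)) (sigma_sets (space M) (cylinders M (restart B t) (T - t)))"
    using assms by (intro indep_set_sigma_sets indep_cylinders Int_stable_cylinders R.Int_stable_cylinders)
  moreover have "a \<in> sigma_sets (space M) (cylinders M B t)"
    by (rule subsetD[OF sets_generated_cylinders assms(3)])
  moreover have "b \<in> sigma_sets (space M) (cylinders M (restart B t) (T - t))"
    by (rule subsetD[OF R.sets_generated_cylinders assms(4)])
  ultimately show ?thesis
    by (rule indep_setD)
qed


text \<open>Independence makes the joint law of \<open>X\<close> and \<open>Y\<close> a product, and
  Tonelli's theorem gives both orders. The inner integral is again over the sample space, with the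
  other variable frozen, so that the formulas for \<open>B\<close> and for the restarted path apply
  to it directly.\<close>

lemma nn_integral_past_future:
  assumes "0 \<le> t" "t \<le> T"
    and X: "X \<in> measurable (generated M B t) N" and Y: "Y \<in> measurable (generated M (restart B t) (T - t)) N'"
    and [measurable]: "F \<in> borel_measurable (N \<Otimes>\<^sub>M N')"
  shows "(\<integral>\<^sup>+\<omega>. F (X \<omega>, Y \<omega>) \<partial>M) = (\<integral>\<^sup>+\<omega>. (\<integral>\<^sup>+\<omega>'. F (X \<omega>, Y \<omega>') \<partial>M) \<partial>M)"
    and "(\<integral>\<^sup>+\<omega>. F (X \<omega>, Y \<omega>) \<partial>M) = (\<integral>\<^sup>+\<omega>'. (\<integral>\<^sup>+\<omega>. F (X \<omega>, Y \<omega>') \<partial>M) \<partial>M)"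
proof -
  interpret R: brownian M "restart B t" "T - t" using assms(1,2) by (rule brownian_restart)
  have [measurable]: "X \<in> measurable M N" "Y \<in> measurable M N'"
    using measurable_generatedD[OF X assms(2)] R.measurable_generatedD[OF Y] by auto
  interpret X: prob_space "distr M N X" by (rule prob_space_distr) simp
  interpret Y: prob_space "distr M N' Y" by (rule prob_space_distr) simp
  interpret P: pair_sigma_finite "distr M N X" "distr M N' Y" ..
  have seteq: "sets (distr M N X \<Otimes>\<^sub>M distr M N' Y) = sets (N \<Otimes>\<^sub>M N')"
    by (rule sets_pair_measure_cong) simp_all
  have "(\<integral>\<^sup>+\<omega>. F (X \<omega>, Y \<omega>) \<partial>M) = (\<integral>\<^sup>+p. F p \<partial>distr M (N \<Otimes>\<^sub>M N') (\<lambda>\<omega>. (X \<omega>, Y \<omega>)))"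
    by (subst nn_integral_distr) simp_all
  also have "distr M (N \<Otimes>\<^sub>M N') (\<lambda>\<omega>. (X \<omega>, Y \<omega>)) = distr M N X \<Otimes>\<^sub>M distr M N' Y"
  proof (rule pair_measure_eqI[symmetric])
    fix A C assume A: "A \<in> sets (distr M N X)" and C: "C \<in> sets (distr M N' Y)"
    have "emeasure (distr M (N \<Otimes>\<^sub>M N') (\<lambda>\<omega>. (X \<omega>, Y \<omega>))) (A \<times> C)
        = prob ((X -` A \<inter> space M) \<inter> (Y -` C \<inter> space M))"
      using A C by (subst emeasure_distr) (auto simp: emeasure_eq_measure intro!: arg_cong[where f = prob])
    also have "\<dots> = prob (X -` A \<inter> space M) * prob (Y -` C \<inter> space M)"
      using A C measurable_sets[OF X] measurable_sets[OF Y] by (subst prob_past_future[OF assms(1,2)]) auto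
    finally show "emeasure (distr M N X) A * emeasure (distr M N' Y) C
        = emeasure (distr M (N \<Otimes>\<^sub>M N') (\<lambda>\<omega>. (X \<omega>, Y \<omega>))) (A \<times> C)"
      using A C by (simp add: emeasure_distr emeasure_eq_measure ennreal_mult)
  qed (use seteq X.sigma_finite_measure_axioms Y.sigma_finite_measure_axioms in simp_all)
  finally have *: "(\<integral>\<^sup>+\<omega>. F (X \<omega>, Y \<omega>) \<partial>M) = (\<integral>\<^sup>+p. F p \<partial>(distr M N X \<Otimes>\<^sub>M distr M N' Y))" .
  have XN: "X \<omega> \<in> space N" "Y \<omega> \<in> space N'" if "\<omega> \<in> space M" for \<omega>
    using that by (auto intro: measurable_space)
  have F: "F \<in> borel_measurable (distr M N X \<Otimes>\<^sub>M distr M N' Y)"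
    using assms(5) measurable_cong_sets[OF seteq refl] by blast
  have F1: "(\<lambda>y. F (X \<omega>, y)) \<in> borel_measurable N'" "(\<lambda>x. F (x, Y \<omega>)) \<in> borel_measurable N" if "\<omega> \<in> space M" for \<omega>
    using XN[OF that] by (auto intro!: measurable_compose[OF measurable_Pair1' assms(5)] measurable_compose[OF measurable_Pair2' assms(5)])
  have "(\<integral>\<^sup>+p. F p \<partial>(distr M N X \<Otimes>\<^sub>M distr M N' Y)) = (\<integral>\<^sup>+x. (\<integral>\<^sup>+y. F (x, y) \<partial>distr M N' Y) \<partial>distr M N X)"
    by (rule Y.nn_integral_fst[OF F, symmetric])
  also have "\<dots> = (\<integral>\<^sup>+\<omega>. (\<integral>\<^sup>+y. F (X \<omega>, y) \<partial>distr M N' Y) \<partial>M)"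
    using Y.borel_measurable_nn_integral_fst[OF F] by (intro nn_integral_distr) simp_all
  also have "\<dots> = (\<integral>\<^sup>+\<omega>. (\<integral>\<^sup>+\<omega>'. F (X \<omega>, Y \<omega>') \<partial>M) \<partial>M)"
    by (intro nn_integral_cong nn_integral_distr F1) simp_all
  finally show "(\<integral>\<^sup>+\<omega>. F (X \<omega>, Y \<omega>) \<partial>M) = (\<integral>\<^sup>+\<omega>. (\<integral>\<^sup>+\<omega>'. F (X \<omega>, Y \<omega>') \<partial>M) \<partial>M)"
    unfolding * .
  have "(\<integral>\<^sup>+p. F p \<partial>(distr M N X \<Otimes>\<^sub>M distr M N' Y)) = (\<integral>\<^sup>+y. (\<integral>\<^sup>+x. F (x, y) \<partial>distr M N X) \<partial>distr M N' Y)"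
    by (rule P.nn_integral_snd[OF F, symmetric])
  also have "\<dots> = (\<integral>\<^sup>+\<omega>'. (\<integral>\<^sup>+x. F (x, Y \<omega>') \<partial>distr M N X) \<partial>M)"
    using X.borel_measurable_nn_integral_fst[OF measurable_pair_swap[OF F]] by (intro nn_integral_distr) simp_all
  also have "\<dots> = (\<integral>\<^sup>+\<omega>'. (\<integral>\<^sup>+\<omega>. F (X \<omega>, Y \<omega>') \<partial>M) \<partial>M)"
    by (intro nn_integral_cong nn_integral_distr F1) simp_all
  finally show "(\<integral>\<^sup>+\<omega>. F (X \<omega>, Y \<omega>) \<partial>M) = (\<integral>\<^sup>+\<omega>'. (\<integral>\<^sup>+\<omega>. F (X \<omega>, Y \<omega>') \<partial>M) \<partial>M)"
    unfolding * .
qed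

subsubsection \<open>Running maximum and its location\<close>

lemma run_max_attained:
  assumes "\<omega> \<in> space M" "0 \<le> t" "t \<le> T"
  obtains u where "u \<in> {0..t}" "B u \<omega> = run_max B t \<omega>" "\<And>v. v \<in> {0..t} \<Longrightarrow> B v \<omega> \<le> B u \<omega>"
proof -
  have "continuous_on {0..t} (\<lambda>t. B t \<omega>)"
    by (rule continuous_on_subset[OF continuous_paths[OF assms(1)]]) (use assms in auto)
  then obtain u where u: "u \<in> {0..t}" "\<And>v. v \<in> {0..t} \<Longrightarrow> B v \<omega> \<le> B u \<omega>"
    using continuous_attains_sup[of "{0..t}" "\<lambda>t. B t \<omega>"] assms by auto
  then have "run_max B t \<omega> = B u \<omega>"
    unfolding run_max_def by (intro cSup_eq_maximum) auto
  with u show ?thesis by (intro that) auto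
qed

lemma le_run_max:
  assumes "\<omega> \<in> space M" "0 \<le> u" "u \<le> t" "t \<le> T"
  shows "B u \<omega> \<le> run_max B t \<omega>"
proof -
  have "0 \<le> t" using assms by simp
  from run_max_attained[OF assms(1) this assms(4)] obtain v where
    "B v \<omega> = run_max B t \<omega>" "\<And>w. w \<in> {0..t} \<Longrightarrow> B w \<omega> \<le> B v \<omega>" by blast
  then show ?thesis using assms by (metis atLeastAtMost_iff)
qed

lemma run_max_le_iff:
  assumes "\<omega> \<in> space M" "0 \<le> t" "t \<le> T"
  shows "run_max B t \<omega> \<le> a \<longleftrightarrow> (\<forall>u\<in>{0..t}. B u \<omega> \<le> a)"
  using run_max_attained[OF assms] le_run_max[OF assms(1) _ _ assms(3)]
  by (metis atLeastAtMost_iff order_trans)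

lemma less_run_max_iff:
  assumes "\<omega> \<in> space M" "0 \<le> t" "t \<le> T"
  shows "a < run_max B t \<omega> \<longleftrightarrow> (\<exists>u\<in>{0..t}. a < B u \<omega>)"
  using run_max_le_iff[OF assms, of a] by (simp add: not_le[symmetric] del: not_le)

lemma run_max_nonneg:
  assumes "\<omega> \<in> space M" "0 \<le> t" "t \<le> T"
  shows "0 \<le> run_max B t \<omega>"
  using le_run_max[OF assms(1) order_refl assms(2,3)] start_zero[OF assms(1)] by simp

lemma run_max_0: "\<omega> \<in> space M \<Longrightarrow> 0 \<le> T \<Longrightarrow> run_max B 0 \<omega> = 0"
  using start_zero by (simp add: run_max_def)

lemma run_max_mono:
  assumes "\<omega> \<in> space M" "0 \<le> s" "s \<le> t" "t \<le> T"
  shows "run_max B s \<omega> \<le> run_max B t \<omega>"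
  using run_max_le_iff[OF assms(1,2), of "run_max B t \<omega>"] le_run_max[OF assms(1)] assms by auto

text \<open>Both sides have the same upper bounds, because \<open>{0..T}\<close> is the union of
  \<open>{0..t}\<close> and \<open>{t..T}\<close>.\<close>

lemma run_max_restart:
  assumes "\<omega> \<in> space M" "0 \<le> t" "t \<le> T"
  shows "run_max B T \<omega> = max (run_max B t \<omega>) (B t \<omega> + run_max (restart B t) (T - t) \<omega>)"
proof -
  interpret R: brownian M "restart B t" "T - t" using assms(2,3) by (rule brownian_restart)
  have T: "0 \<le> T" "0 \<le> T - t" using assms by auto
  have "run_max B T \<omega> \<le> a \<longleftrightarrow> run_max B t \<omega> \<le> a \<and> B t \<omega> + run_max (restart B t) (T - t) \<omega> \<le> a" for a
  proof -
    have "run_max (restart B t) (T - t) \<omega> \<le> a - B t \<omega> \<longleftrightarrow> (\<forall>u\<in>{0..T - t}. B (t + u) \<omega> \<le> a)"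
      unfolding R.run_max_le_iff[OF assms(1) T(2) order_refl] by (simp add: restart_def algebra_simps)
    also have "\<dots> \<longleftrightarrow> (\<forall>u\<in>{t..T}. B u \<omega> \<le> a)"
    proof safe
      fix u assume *: "\<forall>u\<in>{0..T - t}. B (t + u) \<omega> \<le> a" and "u \<in> {t..T}"
      then show "B u \<omega> \<le> a" using bspec[OF *, of "u - t"] by simp
    qed auto
    finally have r: "B t \<omega> + run_max (restart B t) (T - t) \<omega> \<le> a \<longleftrightarrow> (\<forall>u\<in>{t..T}. B u \<omega> \<le> a)"
      by (simp add: algebra_simps)
    have "{0..T} = {0..t} \<union> {t..T}" using assms by auto
    then show ?thesis
      unfolding r run_max_le_iff[OF assms(1) T(1) order_refl] run_max_le_iff[OF assms] by (simp add: ball_Un)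
  qed
  from this[of "run_max B T \<omega>"] this[of "max (run_max B t \<omega>) (B t \<omega> + run_max (restart B t) (T - t) \<omega>)"]
  show ?thesis by (intro antisym) auto
qed

text \<open>By continuity the maximisers form a nonempty closed set, so their infimum is a maximiser
  and is the \<open>LEAST\<close> of the definition.\<close>

lemma run_argmax:
  assumes "\<omega> \<in> space M" "0 \<le> t" "t \<le> T"
  shows "0 \<le> run_argmax B t \<omega>" "run_argmax B t \<omega> \<le> t" "B (run_argmax B t \<omega>) \<omega> = run_max B t \<omega>"
    and "0 \<le> u \<Longrightarrow> u \<le> t \<Longrightarrow> B u \<omega> = run_max B t \<omega> \<Longrightarrow> run_argmax B t \<omega> \<le> u"
proof -
  define A where "A = {u \<in> {0..t}. B u \<omega> = run_max B t \<omega>}"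
  have "continuous_on {0..t} (\<lambda>t. B t \<omega>)"
    by (rule continuous_on_subset[OF continuous_paths[OF assms(1)]]) (use assms in auto)
  then have "closed A"
    unfolding A_def by (intro continuous_closed_preimage_constant) auto
  have "A \<noteq> {}" using run_max_attained[OF assms] unfolding A_def by blast
  have "bdd_below A" by (rule bdd_belowI[of _ 0]) (simp add: A_def)
  have "Inf A \<in> A" by (rule closed_contains_Inf) fact+
  moreover have "Inf A \<le> u" if "u \<in> A" for u
    by (rule cInf_lower) fact+
  ultimately have "run_argmax B t \<omega> = Inf A"
    unfolding run_argmax_def by (intro Least_equality) (auto simp: A_def)
  with \<open>Inf A \<in> A\<close> show "0 \<le> run_argmax B t \<omega>" "run_argmax B t \<omega> \<le> t" "B (run_argmax B t \<omega>) \<omega> = run_max B t \<omega>"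
    by (auto simp: A_def)
  show "0 \<le> u \<Longrightarrow> u \<le> t \<Longrightarrow> B u \<omega> = run_max B t \<omega> \<Longrightarrow> run_argmax B t \<omega> \<le> u"
    using \<open>run_argmax B t \<omega> = Inf A\<close> \<open>\<And>u. u \<in> A \<Longrightarrow> Inf A \<le> u\<close> by (simp add: A_def)
qed

text \<open>Replaces the location of the maximum by a comparison of two running maxima. Both the
  measurability of the argmax and its law rest on this.\<close>

lemma run_argmax_le_iff:
  assumes "\<omega> \<in> space M" "0 \<le> u" "u \<le> t" "t \<le> T"
  shows "run_argmax B t \<omega> \<le> u \<longleftrightarrow> run_max B t \<omega> \<le> run_max B u \<omega>"
proof
  have t: "0 \<le> t" "u \<le> T" using assms by auto
  note am = run_argmax[OF assms(1) t(1) assms(4)]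
  {
    assume "run_argmax B t \<omega> \<le> u"
    then show "run_max B t \<omega> \<le> run_max B u \<omega>"
      using le_run_max[OF assms(1) am(1) _ t(2)] am(3) by simp
  next
    assume *: "run_max B t \<omega> \<le> run_max B u \<omega>"
    obtain v where v: "v \<in> {0..u}" "B v \<omega> = run_max B u \<omega>"
      using run_max_attained[OF assms(1,2) t(2)] by blast
    with * run_max_mono[OF assms] have "B v \<omega> = run_max B t \<omega>" by simp
    then have "run_argmax B t \<omega> \<le> v" using am(4) v assms by simp
    then show "run_argmax B t \<omega> \<le> u" using v by simp
  }
qed

lemma run_argmax_past:
  assumes "\<omega> \<in> space M" "0 \<le> t" "t \<le> T" "run_argmax B T \<omega> \<le> t"
  shows "run_argmax B T \<omega> = run_argmax B t \<omega>" "run_max B T \<omega> = run_max B t \<omega>"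
proof -
  have T: "0 \<le> T" using assms by simp
  note am = run_argmax[OF assms(1) T order_refl] and am' = run_argmax[OF assms(1-3)]
  show eq: "run_max B T \<omega> = run_max B t \<omega>"
    using run_argmax_le_iff[OF assms(1-3) order_refl] run_max_mono[OF assms(1-3) order_refl] assms(4) by simp
  have "run_argmax B T \<omega> \<le> run_argmax B t \<omega>"
    using am(4)[of "run_argmax B t \<omega>"] am' eq assms by simp
  moreover have "run_argmax B t \<omega> \<le> run_argmax B T \<omega>"
    using am'(4)[of "run_argmax B T \<omega>"] am eq assms by simp
  ultimately show "run_argmax B T \<omega> = run_argmax B t \<omega>" by simp
qed

lemma run_argmax_future:
  assumes "\<omega> \<in> space M" "0 \<le> t" "t \<le> T" "t < run_argmax B T \<omega>"
  shows "run_argmax B T \<omega> = t + run_argmax (restart B t) (T - t) \<omega>"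
    and "run_max B T \<omega> = B t \<omega> + run_max (restart B t) (T - t) \<omega>"
proof -
  interpret R: brownian M "restart B t" "T - t" using assms(2,3) by (rule brownian_restart)
  have T: "0 \<le> T" "0 \<le> T - t" using assms by auto
  note am = run_argmax[OF assms(1) T(1) order_refl] and am' = R.run_argmax[OF assms(1) T(2) order_refl]
  have "\<not> run_max B T \<omega> \<le> run_max B t \<omega>"
    using run_argmax_le_iff[OF assms(1-3) order_refl] assms(4) by simp
  then show eq: "run_max B T \<omega> = B t \<omega> + run_max (restart B t) (T - t) \<omega>"
    using run_max_restart[OF assms(1-3)] by (auto simp: max_def split: if_splits)
  have "run_argmax B T \<omega> \<le> t + run_argmax (restart B t) (T - t) \<omega>"
    using am(4)[of "t + run_argmax (restart B t) (T - t) \<omega>"] am'(1-3) eq assms by (simp add: restart_def)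
  moreover have "run_argmax (restart B t) (T - t) \<omega> \<le> run_argmax B T \<omega> - t"
    using am'(4)[of "run_argmax B T \<omega> - t"] am(1-3) eq assms by (simp add: restart_def)
  ultimately show "run_argmax B T \<omega> = t + run_argmax (restart B t) (T - t) \<omega>" by simp
qed

text \<open>The right-hand side compares the gap at \<open>t\<close>, a functional of the past, with
  a functional of the restarted path; the two are independent.\<close>

lemma run_argmax_le_iff_restart:
  assumes "\<omega> \<in> space M" "0 \<le> t" "t \<le> T"
  shows "run_argmax B T \<omega> \<le> t \<longleftrightarrow> run_max (restart B t) (T - t) \<omega> \<le> run_max B t \<omega> - B t \<omega>"
  unfolding run_argmax_le_iff[OF assms order_refl] run_max_restart[OF assms] by auto

text \<open>A time at which the path exceeds \<open>a\<close> is approximated by grid points, and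
  continuity does the rest. That it holds for all sufficiently fine grids, not just for one, is what
  the limits in the reflection principle use.\<close>

lemma eventually_grid_exceeds:
  assumes "\<omega> \<in> space M" "0 \<le> t" "t \<le> T" "a < run_max B t \<omega>"
  shows "eventually (\<lambda>n. \<exists>k\<le>Suc n. a < B (t * real k / real (Suc n)) \<omega>) sequentially"
proof -
  obtain u where u: "u \<in> {0..t}" "a < B u \<omega>"
    using assms less_run_max_iff[OF assms(1-3)] by blast
  \<comment> \<open>The index of the last grid point not after \<open>u\<close>. For
    \<open>t = 0\<close> the quotient is 0 and so is \<open>u\<close>.\<close>
  define k where "k n = nat \<lfloor>u / t * real (Suc n)\<rfloor>" for n
  define x where "x n = t * real (k n) / real (Suc n)" for n
  have k: "k n \<le> Suc n" for n
  proof -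
    have "u / t \<le> 1" using u assms by (auto simp: divide_le_eq_1)
    then have "u / t * real (Suc n) \<le> 1 * real (Suc n)" by (rule mult_right_mono) simp
    then show ?thesis unfolding k_def by (simp add: nat_le_iff floor_le_iff)
  qed
  have x: "x n \<in> {0..t}" for n
  proof -
    have "t * (real (k n) / real (Suc n)) \<le> t * 1"
      using k[of n] assms(2) by (intro mult_left_mono) (auto simp del: of_nat_Suc)
    then show ?thesis using assms(2) by (auto simp: x_def)
  qed
  have xu: "\<bar>x n - u\<bar> \<le> t * inverse (real (Suc n))" for n
  proof (cases "t = 0")
    case True
    then show ?thesis using u by (simp add: x_def)
  next
    case False
    have p: "0 \<le> u / t * real (Suc n)" using u assms by simp
    have "real (k n) = of_int \<lfloor>u / t * real (Suc n)\<rfloor>"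
      unfolding k_def using p by simp
    then have "\<bar>real (k n) - u / t * real (Suc n)\<bar> \<le> 1" by linarith
    then have "t * \<bar>real (k n) - u / t * real (Suc n)\<bar> / real (Suc n) \<le> t * 1 / real (Suc n)"
      using assms by (intro divide_right_mono mult_left_mono) auto
    also have "t * \<bar>real (k n) - u / t * real (Suc n)\<bar> / real (Suc n)
        = \<bar>t * (real (k n) - u / t * real (Suc n)) / real (Suc n)\<bar>"
      using assms by (simp add: abs_mult)
    also have "t * (real (k n) - u / t * real (Suc n)) / real (Suc n) = x n - u"
      using False by (simp add: x_def field_simps del: of_nat_Suc)
    finally show ?thesis by (simp add: divide_inverse)
  qed
  have "(\<lambda>n. t * inverse (real (Suc n))) \<longlonglongrightarrow> t * 0"
    by (intro tendsto_intros LIMSEQ_inverse_real_of_nat)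
  then have "(\<lambda>n. x n - u) \<longlonglongrightarrow> 0"
    using xu by (intro Lim_null_comparison[of "\<lambda>n. x n - u" "\<lambda>n. t * inverse (real (Suc n))"]) (auto simp del: of_nat_Suc)
  then have "x \<longlonglongrightarrow> u" by (simp add: LIM_zero_iff)
  moreover have "continuous_on {0..t} (\<lambda>t. B t \<omega>)"
    by (rule continuous_on_subset[OF continuous_paths[OF assms(1)]]) (use assms in auto)
  ultimately have "(\<lambda>n. B (x n) \<omega>) \<longlonglongrightarrow> B u \<omega>"
    using continuous_on_tendsto_compose[of "{0..t}" "\<lambda>t. B t \<omega>" x u sequentially] u x by simp
  then have "eventually (\<lambda>n. a < B (x n) \<omega>) sequentially"
    using u by (intro order_tendstoD)
  then show ?thesis
  proof (rule eventually_mono)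
    fix n assume "a < B (x n) \<omega>"
    then show "\<exists>k\<le>Suc n. a < B (t * real k / real (Suc n)) \<omega>"
      using k unfolding x_def by blast
  qed
qed

lemma less_run_max_iff_grid:
  assumes "\<omega> \<in> space M" "0 \<le> t" "t \<le> T"
  shows "a < run_max B t \<omega> \<longleftrightarrow> (\<exists>n. \<exists>k\<le>Suc n. a < B (t * real k / real (Suc n)) \<omega>)"
proof
  assume "a < run_max B t \<omega>"
  from eventually_grid_exceeds[OF assms this] show "\<exists>n. \<exists>k\<le>Suc n. a < B (t * real k / real (Suc n)) \<omega>"
    unfolding eventually_sequentially by blast
next
  assume "\<exists>n. \<exists>k\<le>Suc n. a < B (t * real k / real (Suc n)) \<omega>"
  then obtain n k where nk: "k \<le> Suc n" "a < B (t * real k / real (Suc n)) \<omega>" by blast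
  have "t * (real k / real (Suc n)) \<le> t * 1"
    using nk assms(2) by (intro mult_left_mono) (auto simp del: of_nat_Suc)
  then show "a < run_max B t \<omega>"
    using le_run_max[OF assms(1), of "t * real k / real (Suc n)" t] nk assms by simp
qed

lemma grid_in_interval:
  assumes "k \<le> Suc n" "0 \<le> t"
  shows "t * real k / real (Suc n) \<in> {0..t}"
proof -
  have "t * (real k / real (Suc n)) \<le> t * 1"
    using assms by (intro mult_left_mono) (auto simp del: of_nat_Suc)
  then show ?thesis using assms by simp
qed

text \<open>The grids replace the supremum over uncountably many times by countably many
  conditions.\<close>

lemma measurable_run_max_generated:
  assumes "0 \<le> t" "t \<le> s" "s \<le> T"
  shows "run_max B t \<in> borel_measurable (generated M B s)"
proof (rule borel_measurableI_greater)
  fix a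
  have "{\<omega> \<in> space M. a < run_max B t \<omega>}
      = (\<Union>n. \<Union>k\<in>{..Suc n}. {\<omega> \<in> space M. a < B (t * real k / real (Suc n)) \<omega>})"
  proof (rule set_eqI)
    fix \<omega>
    have "\<omega> \<in> space M \<Longrightarrow> a < run_max B t \<omega> \<longleftrightarrow> (\<exists>n. \<exists>k\<in>{..Suc n}. a < B (t * real k / real (Suc n)) \<omega>)"
      using less_run_max_iff_grid[OF _ assms(1), of \<omega> a] assms by (simp only: Bex_def atMost_iff)
    then show "\<omega> \<in> {\<omega> \<in> space M. a < run_max B t \<omega>} \<longleftrightarrow>
        \<omega> \<in> (\<Union>n. \<Union>k\<in>{..Suc n}. {\<omega> \<in> space M. a < B (t * real k / real (Suc n)) \<omega>})"
      by blast
  qed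
  moreover have "{\<omega> \<in> space M. a < B (t * real k / real (Suc n)) \<omega>} \<in> sets (generated M B s)" if "k \<le> Suc n" for n k
  proof -
    have "B (t * real k / real (Suc n)) \<in> borel_measurable (generated M B s)"
      using grid_in_interval[OF that assms(1)] assms by (intro measurable_generated) auto
    then have "{\<omega> \<in> space (generated M B s). a < B (t * real k / real (Suc n)) \<omega>} \<in> sets (generated M B s)"
      by (rule borel_measurable_less[OF borel_measurable_const])
    then show ?thesis by simp
  qed
  ultimately show "{\<omega> \<in> space (generated M B s). a < run_max B t \<omega>} \<in> sets (generated M B s)"
    by (auto intro!: sets.countable_UN sets.finite_UN)
qed

lemma measurable_run_argmax_generated:
  assumes "0 \<le> t" "t \<le> T"
  shows "run_argmax B t \<in> borel_measurable (generated M B t)"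
proof (rule borel_measurableI_le)
  fix a
  consider "a < 0" | "0 \<le> a" "a \<le> t" | "t < a" by linarith
  then show "{\<omega> \<in> space (generated M B t). run_argmax B t \<omega> \<le> a} \<in> sets (generated M B t)"
  proof cases
    case 1
    then have "\<not> run_argmax B t \<omega> \<le> a" if "\<omega> \<in> space M" for \<omega>
      using run_argmax(1)[OF that assms] by simp
    then have "{\<omega> \<in> space (generated M B t). run_argmax B t \<omega> \<le> a} = {}"
      by auto
    then show ?thesis by (simp only: sets.empty_sets)
  next
    case 2
    then have "{\<omega> \<in> space (generated M B t). run_argmax B t \<omega> \<le> a} = {\<omega> \<in> space (generated M B t). run_max B t \<omega> \<le> run_max B a \<omega>}"
      using run_argmax_le_iff[OF _ 2 assms(2)] by auto
    also have "\<dots> \<in> sets (generated M B t)"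
      using 2 assms by (intro borel_measurable_le measurable_run_max_generated) auto
    finally show ?thesis .
  next
    case 3
    then have "run_argmax B t \<omega> \<le> a" if "\<omega> \<in> space M" for \<omega>
      using run_argmax(2)[OF that assms] by simp
    then have "{\<omega> \<in> space (generated M B t). run_argmax B t \<omega> \<le> a} = space (generated M B t)"
      by auto
    then show ?thesis by (simp only: sets.top)
  qed
qed

lemma measurable_run_max: "0 \<le> t \<Longrightarrow> t \<le> T \<Longrightarrow> run_max B t \<in> borel_measurable M"
  using measurable_generatedD[OF measurable_run_max_generated[of t t]] by simp

lemma measurable_run_argmax: "0 \<le> t \<Longrightarrow> t \<le> T \<Longrightarrow> run_argmax B t \<in> borel_measurable M"
  using measurable_generatedD[OF measurable_run_argmax_generated[of t]] by simp


subsubsection \<open>The reflection principle\<close>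

lemma nn_integral_increment_symmetric:
  assumes "0 \<le> a" "a \<le> b" "b \<le> T" and [measurable]: "h \<in> borel_measurable borel"
  shows "(\<integral>\<^sup>+\<omega>. h (B b \<omega> - B a \<omega>) \<partial>M) = (\<integral>\<^sup>+\<omega>. h (- (B b \<omega> - B a \<omega>)) \<partial>M)"
proof (cases "a = b")
  case True
  then show ?thesis by simp
next
  case False
  with assms have D: "distributed M lborel (\<lambda>\<omega>. B b \<omega> - B a \<omega>) (\<lambda>x. ennreal (gauss (b - a) x))"
    by (intro gaussian_increments) auto
  have "(\<integral>\<^sup>+\<omega>. h (B b \<omega> - B a \<omega>) \<partial>M) = (\<integral>\<^sup>+x. ennreal (gauss (b - a) x) * h x \<partial>lborel)"
    by (rule distributed_nn_integral[OF D, symmetric]) simp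
  also have "\<dots> = ennreal \<bar>- 1\<bar> * (\<integral>\<^sup>+x. ennreal (gauss (b - a) (0 + - 1 * x)) * h (0 + - 1 * x) \<partial>lborel)"
    by (rule nn_integral_real_affine) simp_all
  also have "\<dots> = (\<integral>\<^sup>+x. ennreal (gauss (b - a) x) * h (- x) \<partial>lborel)"
    by simp
  also have "\<dots> = (\<integral>\<^sup>+\<omega>. h (- (B b \<omega> - B a \<omega>)) \<partial>M)"
    by (rule distributed_nn_integral[OF D]) simp
  finally show ?thesis .
qed

definition grid :: "real \<Rightarrow> nat \<Rightarrow> nat \<Rightarrow> real" where
  "grid t n k = t * real k / real (Suc n)"

definition first_exceeds :: "real \<Rightarrow> real \<Rightarrow> nat \<Rightarrow> nat \<Rightarrow> 'a set" where
  "first_exceeds t m n k = {\<omega> \<in> space M. m < B (grid t n k) \<omega> \<and> (\<forall>j<k. B (grid t n j) \<omega> \<le> m)}"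

lemma grid_bounds: "k \<le> Suc n \<Longrightarrow> 0 \<le> t \<Longrightarrow> 0 \<le> grid t n k \<and> grid t n k \<le> t"
  using grid_in_interval[of k n t] by (simp add: grid_def)

lemma first_exceeds_generated:
  assumes "0 \<le> t" "t \<le> T" "k \<le> Suc n"
  shows "first_exceeds t m n k \<in> sets (generated M B (grid t n k))"
proof -
  have meas: "B (grid t n j) \<in> borel_measurable (generated M B (grid t n k))" if "j \<le> k" for j
  proof (rule measurable_generated)
    have "grid t n j \<le> grid t n k"
      unfolding grid_def using that assms by (intro divide_right_mono mult_left_mono) auto
    moreover have "0 \<le> grid t n j" using grid_bounds[of j n t] that assms by simp
    ultimately show "grid t n j \<in> {0..grid t n k}" by simp
  qed
  have 1: "{\<omega> \<in> space (generated M B (grid t n k)). m < B (grid t n k) \<omega>} \<in> sets (generated M B (grid t n k))"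
    by (rule borel_measurable_less[OF borel_measurable_const meas]) simp
  have 2: "{\<omega> \<in> space (generated M B (grid t n k)). B (grid t n j) \<omega> \<le> m} \<in> sets (generated M B (grid t n k))" if "j \<in> {..<k}" for j
    by (rule borel_measurable_le[OF meas borel_measurable_const]) (use that in simp)
  have "{\<omega> \<in> space (generated M B (grid t n k)). \<forall>j\<in>{..<k}. B (grid t n j) \<omega> \<le> m} \<in> sets (generated M B (grid t n k))"
    by (rule sets.sets_Collect_finite_All[OF 2]) auto
  from sets.Int[OF 1 this] show ?thesis
    unfolding first_exceeds_def by (rule back_subst[where P = "\<lambda>A. A \<in> _"]) auto
qed

text \<open>The event is determined by the path up to the grid time \<open>g\<close>, and the
  increment from \<open>g\<close> to \<open>t\<close> is independent of that path and symmetric.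
  Reversing its sign turns \<open>B t\<close> into \<open>2 * B g - B t\<close>.\<close>

lemma nn_integral_reflect_first_exceeds:
  assumes "0 \<le> t" "t \<le> T" "k \<le> Suc n" and [measurable]: "f \<in> borel_measurable borel"
  shows "(\<integral>\<^sup>+\<omega>. f (B t \<omega>) * indicator (first_exceeds t m n k) \<omega> \<partial>M)
    = (\<integral>\<^sup>+\<omega>. f (2 * B (grid t n k) \<omega> - B t \<omega>) * indicator (first_exceeds t m n k) \<omega> \<partial>M)"
proof -
  define g where "g = grid t n k"
  have g: "0 \<le> g" "g \<le> t" "g \<le> T" using grid_bounds[OF assms(3,1)] assms(2) by (auto simp: g_def)
  \<comment> \<open>The indicator of the event travels as a component of the past variable.\<close>
  define D :: "'a \<Rightarrow> ennreal" where "D = indicator (first_exceeds t m n k)"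
  have D: "D \<in> borel_measurable (generated M B g)"
    unfolding D_def g_def by (rule borel_measurable_indicator[OF first_exceeds_generated[OF assms(1-3)]])
  have X: "(\<lambda>\<omega>. (B g \<omega>, D \<omega>)) \<in> measurable (generated M B g) (borel \<Otimes>\<^sub>M borel)"
    using g D by (intro measurable_Pair measurable_generated) auto
  have Y: "restart B g (t - g) \<in> borel_measurable (generated M (restart B g) (T - g))"
    using g assms by (intro measurable_generated) auto
  have Y': "(\<lambda>\<omega>. - restart B g (t - g) \<omega>) \<in> borel_measurable (generated M (restart B g) (T - g))"
    using Y by (rule borel_measurable_uminus)
  define F :: "(real \<times> ennreal) \<times> real \<Rightarrow> ennreal" where "F = (\<lambda>p. f (fst (fst p) + snd p) * snd (fst p))"
  have F: "F \<in> borel_measurable ((borel \<Otimes>\<^sub>M borel) \<Otimes>\<^sub>M borel)"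
    unfolding F_def by measurable
  have "(\<integral>\<^sup>+\<omega>. f (B t \<omega>) * D \<omega> \<partial>M) = (\<integral>\<^sup>+\<omega>. F ((B g \<omega>, D \<omega>), restart B g (t - g) \<omega>) \<partial>M)"
    by (simp add: F_def restart_def)
  also have "\<dots> = (\<integral>\<^sup>+\<omega>. \<integral>\<^sup>+\<omega>'. F ((B g \<omega>, D \<omega>), restart B g (t - g) \<omega>') \<partial>M \<partial>M)"
    by (rule nn_integral_past_future(1)[OF g(1,3) X Y F])
  also have "\<dots> = (\<integral>\<^sup>+\<omega>. \<integral>\<^sup>+\<omega>'. F ((B g \<omega>, D \<omega>), - restart B g (t - g) \<omega>') \<partial>M \<partial>M)"
  proof (rule nn_integral_cong)
    fix \<omega>
    show "(\<integral>\<^sup>+\<omega>'. F ((B g \<omega>, D \<omega>), restart B g (t - g) \<omega>') \<partial>M) = (\<integral>\<^sup>+\<omega>'. F ((B g \<omega>, D \<omega>), - restart B g (t - g) \<omega>') \<partial>M)"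
      using nn_integral_increment_symmetric[of g t "\<lambda>y. f (B g \<omega> + y) * D \<omega>"] g assms(2)
      by (simp add: F_def restart_def)
  qed
  also have "\<dots> = (\<integral>\<^sup>+\<omega>. F ((B g \<omega>, D \<omega>), - restart B g (t - g) \<omega>) \<partial>M)"
    by (rule nn_integral_past_future(1)[OF g(1,3) X Y' F, symmetric])
  also have "\<dots> = (\<integral>\<^sup>+\<omega>. f (2 * B g \<omega> - B t \<omega>) * D \<omega> \<partial>M)"
    by (simp add: F_def restart_def)
  finally show ?thesis by (simp add: D_def g_def)
qed

definition grid_exceeds :: "real \<Rightarrow> real \<Rightarrow> nat \<Rightarrow> 'a set" where
  "grid_exceeds t m n = {\<omega> \<in> space M. \<exists>k\<le>Suc n. m < B (grid t n k) \<omega>}"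

text \<open>Always used together with the indicator of \<open>grid_exceeds\<close>; outside that
  event the \<open>LEAST\<close> need not be an index of the grid.\<close>

definition first_value :: "real \<Rightarrow> real \<Rightarrow> nat \<Rightarrow> 'a \<Rightarrow> real" where
  "first_value t m n \<omega> = B (grid t n (LEAST k. m < B (grid t n k) \<omega>)) \<omega>"

lemma grid_exceeds_eq: "grid_exceeds t m n = (\<Union>k\<le>Suc n. first_exceeds t m n k)"
proof (intro set_eqI iffI)
  fix \<omega> assume "\<omega> \<in> grid_exceeds t m n"
  then obtain k where k: "\<omega> \<in> space M" "k \<le> Suc n" "m < B (grid t n k) \<omega>" unfolding grid_exceeds_def by blast
  define l where "l = (LEAST k. m < B (grid t n k) \<omega>)"
  have "m < B (grid t n l) \<omega>" unfolding l_def by (rule LeastI[of _ k]) (rule k)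
  moreover have "l \<le> k" unfolding l_def by (rule Least_le) (rule k)
  moreover have "B (grid t n j) \<omega> \<le> m" if "j < l" for j
    using not_less_Least[of j "\<lambda>k. m < B (grid t n k) \<omega>"] that unfolding l_def by simp
  ultimately show "\<omega> \<in> (\<Union>k\<le>Suc n. first_exceeds t m n k)"
    using k unfolding first_exceeds_def by (intro UN_I[of l]) auto
qed (auto simp: grid_exceeds_def first_exceeds_def)

lemma first_exceeds_value: "\<omega> \<in> first_exceeds t m n k \<Longrightarrow> first_value t m n \<omega> = B (grid t n k) \<omega>"
  unfolding first_value_def first_exceeds_def
  by (rule arg_cong[where f = "\<lambda>k. B (grid t n k) \<omega>"], rule Least_equality) (auto simp: not_le[symmetric])

lemma disjoint_first_exceeds: "disjoint_family_on (first_exceeds t m n) I"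
  unfolding disjoint_family_on_def
proof (intro ballI impI)
  fix i j :: nat assume "i \<noteq> j"
  then show "first_exceeds t m n i \<inter> first_exceeds t m n j = {}"
    by (cases i j rule: linorder_cases) (auto simp: first_exceeds_def not_le[symmetric])
qed

lemma first_exceeds_events:
  assumes "0 \<le> t" "t \<le> T" "k \<le> Suc n"
  shows "first_exceeds t m n k \<in> events"
  using first_exceeds_generated[OF assms, of m] sets_generated_subset[of "grid t n k"] grid_bounds[OF assms(3,1)] assms(2) by auto

lemma grid_exceeds_events: "0 \<le> t \<Longrightarrow> t \<le> T \<Longrightarrow> grid_exceeds t m n \<in> events"
  unfolding grid_exceeds_eq using first_exceeds_events by (intro sets.finite_UN) auto

text \<open>The events of first exceedance at the various grid times are disjoint, so the
  reflections can be summed.\<close>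

lemma nn_integral_reflect_grid:
  assumes "0 \<le> t" "t \<le> T" and f [measurable]: "f \<in> borel_measurable borel"
  shows "(\<integral>\<^sup>+\<omega>. f (B t \<omega>) * indicator (grid_exceeds t m n) \<omega> \<partial>M)
    = (\<integral>\<^sup>+\<omega>. f (2 * first_value t m n \<omega> - B t \<omega>) * indicator (grid_exceeds t m n) \<omega> \<partial>M)"
proof -
  have [measurable]: "B t \<in> borel_measurable M" using random_variable_B assms by simp
  have [measurable]: "B (grid t n k) \<in> borel_measurable M" if "k \<le> Suc n" for k
    using random_variable_B[of "grid t n k"] grid_bounds[OF that assms(1)] assms(2) by simp
  have ind: "indicator (grid_exceeds t m n) \<omega> = (\<Sum>k\<le>Suc n. indicator (first_exceeds t m n k) \<omega> :: ennreal)" for \<omega>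
    unfolding grid_exceeds_eq by (rule indicator_UN_disjoint[OF _ disjoint_first_exceeds]) simp
  have "(\<integral>\<^sup>+\<omega>. f (B t \<omega>) * indicator (grid_exceeds t m n) \<omega> \<partial>M)
      = (\<integral>\<^sup>+\<omega>. (\<Sum>k\<le>Suc n. f (B t \<omega>) * indicator (first_exceeds t m n k) \<omega>) \<partial>M)"
    unfolding ind sum_distrib_left ..
  also have "\<dots> = (\<Sum>k\<le>Suc n. \<integral>\<^sup>+\<omega>. f (B t \<omega>) * indicator (first_exceeds t m n k) \<omega> \<partial>M)"
    using first_exceeds_events[OF assms(1,2)] by (intro nn_integral_sum) auto
  also have "\<dots> = (\<Sum>k\<le>Suc n. \<integral>\<^sup>+\<omega>. f (2 * B (grid t n k) \<omega> - B t \<omega>) * indicator (first_exceeds t m n k) \<omega> \<partial>M)"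
    by (intro sum.cong refl nn_integral_reflect_first_exceeds assms) simp
  also have "\<dots> = (\<integral>\<^sup>+\<omega>. (\<Sum>k\<le>Suc n. f (2 * B (grid t n k) \<omega> - B t \<omega>) * indicator (first_exceeds t m n k) \<omega>) \<partial>M)"
    using first_exceeds_events[OF assms(1,2)] by (intro nn_integral_sum[symmetric]) auto
  also have "\<dots> = (\<integral>\<^sup>+\<omega>. f (2 * first_value t m n \<omega> - B t \<omega>) * indicator (grid_exceeds t m n) \<omega> \<partial>M)"
    unfolding ind sum_distrib_left
    by (intro nn_integral_cong sum.cong refl) (auto simp: first_exceeds_value split: split_indicator)
  finally show ?thesis .
qed

text \<open>At the grid point before the first exceedance the path is at most \<open>m\<close>. The
  overshoot is therefore bounded by the oscillation over one mesh width, which tends to 0 by uniform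
  continuity.\<close>

lemma tendsto_first_value:
  assumes "\<omega> \<in> space M" "0 \<le> t" "t \<le> T" "0 \<le> m" "m < run_max B t \<omega>"
  shows "(\<lambda>n. first_value t m n \<omega>) \<longlonglongrightarrow> m"
    and "eventually (\<lambda>n. \<omega> \<in> grid_exceeds t m n) sequentially"
proof -
  show ev: "eventually (\<lambda>n. \<omega> \<in> grid_exceeds t m n) sequentially"
    using eventually_grid_exceeds[OF assms(1-3,5)]
    by (rule eventually_mono) (simp add: grid_exceeds_def grid_def assms(1) del: of_nat_Suc)
  have "uniformly_continuous_on {0..t} (\<lambda>t. B t \<omega>)"
    by (intro compact_uniformly_continuous continuous_on_subset[OF continuous_paths[OF assms(1)]]) (use assms in auto)
  show "(\<lambda>n. first_value t m n \<omega>) \<longlonglongrightarrow> m"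
  proof (rule tendstoI)
    fix e :: real assume "e > 0"
    then obtain d where d: "d > 0" "\<And>x y. x \<in> {0..t} \<Longrightarrow> y \<in> {0..t} \<Longrightarrow> dist x y < d \<Longrightarrow> dist (B x \<omega>) (B y \<omega>) < e"
      using \<open>uniformly_continuous_on {0..t} (\<lambda>t. B t \<omega>)\<close> unfolding uniformly_continuous_on_def by metis
    have "(\<lambda>n. t * inverse (real (Suc n))) \<longlonglongrightarrow> t * 0"
      by (intro tendsto_intros LIMSEQ_inverse_real_of_nat)
    then have "eventually (\<lambda>n. t * inverse (real (Suc n)) < d) sequentially"
      using d by (intro order_tendstoD(2)) auto
    with ev show "eventually (\<lambda>n. dist (first_value t m n \<omega>) m < e) sequentially"
    proof eventually_elim
      case (elim n)
      then obtain k where k: "k \<le> Suc n" "\<omega> \<in> first_exceeds t m n k" unfolding grid_exceeds_eq by blast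
      then have Bk: "m < B (grid t n k) \<omega>" "\<And>j. j < k \<Longrightarrow> B (grid t n j) \<omega> \<le> m" by (auto simp: first_exceeds_def)
      \<comment> \<open>The path starts at 0, which does not exceed \<open>m\<close>, so a preceding
        grid point exists.\<close>
      have "k \<noteq> 0"
      proof
        assume "k = 0"
        then show False using Bk(1) start_zero[OF assms(1)] assms(4) by (simp add: grid_def)
      qed
      then obtain j where j: "k = Suc j" by (cases k) auto
      have "grid t n k - grid t n j = (t * real (Suc j) - t * real j) / real (Suc n)"
        unfolding grid_def j by (simp only: diff_divide_distrib)
      also have "t * real (Suc j) - t * real j = t"
        by (simp add: algebra_simps)
      finally have "grid t n k - grid t n j = t * inverse (real (Suc n))"
        by (simp only: divide_inverse)
      then have "dist (grid t n k) (grid t n j) < d"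
        using elim(2) assms(2) by (simp add: dist_real_def)
      then have "dist (B (grid t n k) \<omega>) (B (grid t n j) \<omega>) < e"
        using grid_bounds[of k n t] grid_bounds[of j n t] k(1) j assms(2) by (intro d) auto
      then show ?case
        using Bk(1) Bk(2)[of j] j unfolding first_exceeds_value[OF k(2)] by (simp add: dist_real_def)
    qed
  qed
qed

lemma grid_exceeds_subset:
  assumes "\<omega> \<in> grid_exceeds t m n" "0 \<le> t" "t \<le> T"
  shows "m < run_max B t \<omega>"
  using assms less_run_max_iff_grid[OF _ assms(2,3)] unfolding grid_exceeds_def grid_def by blast

text \<open>On a grid the path is reflected at \<open>first_value\<close>, which overshoots
  \<open>m\<close> and only converges to it. Hence the test function is continuous; its bound 1 is
  the dominating function in both limits.\<close>

lemma nn_integral_reflect_continuous: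
  assumes "0 \<le> t" "t \<le> T" "0 \<le> m" and f: "\<And>x. isCont f x" "\<And>x. 0 \<le> f x" "\<And>x. f x \<le> (1::real)"
  shows "(\<integral>\<^sup>+\<omega>. ennreal (f (B t \<omega>)) * indicator {\<omega>. m < run_max B t \<omega>} \<omega> \<partial>M)
    = (\<integral>\<^sup>+\<omega>. ennreal (f (2 * m - B t \<omega>)) * indicator {\<omega>. m < run_max B t \<omega>} \<omega> \<partial>M)"
proof -
  have [measurable]: "B t \<in> borel_measurable M" "run_max B t \<in> borel_measurable M"
    using random_variable_B measurable_run_max assms by auto
  have [measurable]: "f \<in> borel_measurable borel"
    using f(1) by (intro borel_measurable_continuous_onI) (simp add: continuous_at_imp_continuous_on)
  have [measurable]: "grid_exceeds t m n \<in> events" for n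
    using assms by (intro grid_exceeds_events)
  \<comment> \<open>\<open>first_value\<close> depends on a random index; summing over the events of
    first exceedance leaves one fixed time in each summand.\<close>
  have fv: "(\<lambda>\<omega>. ennreal (f (2 * first_value t m n \<omega> - B t \<omega>)) * indicator (grid_exceeds t m n) \<omega>) \<in> borel_measurable M" for n
  proof -
    have [measurable]: "first_exceeds t m n k \<in> events" "B (grid t n k) \<in> borel_measurable M" if "k \<le> Suc n" for k
      using first_exceeds_events[OF assms(1,2) that] random_variable_B[of "grid t n k"] grid_bounds[OF that assms(1)] assms(2) by auto
    have ind: "indicator (grid_exceeds t m n) \<omega> = (\<Sum>k\<le>Suc n. indicator (first_exceeds t m n k) \<omega> :: ennreal)" for \<omega>
      unfolding grid_exceeds_eq by (rule indicator_UN_disjoint[OF _ disjoint_first_exceeds]) simp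
    have eq: "ennreal (f (2 * first_value t m n \<omega> - B t \<omega>)) * indicator (grid_exceeds t m n) \<omega>
      = (\<Sum>k\<le>Suc n. ennreal (f (2 * B (grid t n k) \<omega> - B t \<omega>)) * indicator (first_exceeds t m n k) \<omega>)" for \<omega>
      unfolding ind sum_distrib_left
      by (intro sum.cong refl) (auto simp: first_exceeds_value split: split_indicator)
    show ?thesis unfolding eq by (intro borel_measurable_sum) auto
  qed
  have lim1: "(\<lambda>n. \<integral>\<^sup>+\<omega>. ennreal (f (B t \<omega>)) * indicator (grid_exceeds t m n) \<omega> \<partial>M)
     \<longlonglongrightarrow> (\<integral>\<^sup>+\<omega>. ennreal (f (B t \<omega>)) * indicator {\<omega>. m < run_max B t \<omega>} \<omega> \<partial>M)"
  proof (rule nn_integral_dominated_convergence[where w = "\<lambda>_. 1"])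
    show "AE \<omega> in M. (\<lambda>n. ennreal (f (B t \<omega>)) * indicator (grid_exceeds t m n) \<omega>)
       \<longlonglongrightarrow> ennreal (f (B t \<omega>)) * indicator {\<omega>. m < run_max B t \<omega>} \<omega>"
    proof (rule AE_I2)
      fix \<omega> assume "\<omega> \<in> space M"
      show "(\<lambda>n. ennreal (f (B t \<omega>)) * indicator (grid_exceeds t m n) \<omega>)
         \<longlonglongrightarrow> ennreal (f (B t \<omega>)) * indicator {\<omega>. m < run_max B t \<omega>} \<omega>"
      proof (cases "m < run_max B t \<omega>")
        case True
        then show ?thesis
          using tendsto_first_value(2)[OF \<open>\<omega> \<in> space M\<close> assms(1-3)]
          by (intro tendsto_eventually) (auto elim: eventually_mono)
      next
        case False
        then have "\<omega> \<notin> grid_exceeds t m n" for n using grid_exceeds_subset assms by blast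
        then show ?thesis using False by simp
      qed
    qed
  qed (use f in \<open>auto simp: indicator_def emeasure_space_1\<close>)
  have lim2: "(\<lambda>n. \<integral>\<^sup>+\<omega>. ennreal (f (2 * first_value t m n \<omega> - B t \<omega>)) * indicator (grid_exceeds t m n) \<omega> \<partial>M)
     \<longlonglongrightarrow> (\<integral>\<^sup>+\<omega>. ennreal (f (2 * m - B t \<omega>)) * indicator {\<omega>. m < run_max B t \<omega>} \<omega> \<partial>M)"
  proof (rule nn_integral_dominated_convergence[where w = "\<lambda>_. 1"])
    show "AE \<omega> in M. (\<lambda>n. ennreal (f (2 * first_value t m n \<omega> - B t \<omega>)) * indicator (grid_exceeds t m n) \<omega>)
       \<longlonglongrightarrow> ennreal (f (2 * m - B t \<omega>)) * indicator {\<omega>. m < run_max B t \<omega>} \<omega>"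
    proof (rule AE_I2)
      fix \<omega> assume "\<omega> \<in> space M"
      show "(\<lambda>n. ennreal (f (2 * first_value t m n \<omega> - B t \<omega>)) * indicator (grid_exceeds t m n) \<omega>)
         \<longlonglongrightarrow> ennreal (f (2 * m - B t \<omega>)) * indicator {\<omega>. m < run_max B t \<omega>} \<omega>"
      proof (cases "m < run_max B t \<omega>")
        case True
        note tv = tendsto_first_value[OF \<open>\<omega> \<in> space M\<close> assms(1-3) True]
        have "(\<lambda>n. f (2 * first_value t m n \<omega> - B t \<omega>)) \<longlonglongrightarrow> f (2 * m - B t \<omega>)"
          by (rule isCont_tendsto_compose[OF f(1)]) (intro tendsto_intros tv)
        then have "(\<lambda>n. ennreal (f (2 * first_value t m n \<omega> - B t \<omega>))) \<longlonglongrightarrow> ennreal (f (2 * m - B t \<omega>))"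
          by (rule tendsto_ennrealI)
        moreover have "eventually (\<lambda>n. ennreal (f (2 * first_value t m n \<omega> - B t \<omega>)) =
            ennreal (f (2 * first_value t m n \<omega> - B t \<omega>)) * indicator (grid_exceeds t m n) \<omega>) sequentially"
          using tv(2) by (rule eventually_mono) simp
        ultimately have "(\<lambda>n. ennreal (f (2 * first_value t m n \<omega> - B t \<omega>)) * indicator (grid_exceeds t m n) \<omega>)
            \<longlonglongrightarrow> ennreal (f (2 * m - B t \<omega>))"
          by (rule Lim_transform_eventually)
        then show ?thesis using True by simp
      next
        case False
        then have "\<omega> \<notin> grid_exceeds t m n" for n using grid_exceeds_subset assms by blast
        then show ?thesis using False by simp
      qed
    qed
  qed (use f fv in \<open>auto simp: indicator_def emeasure_space_1\<close>)
  have "(\<integral>\<^sup>+\<omega>. ennreal (f (B t \<omega>)) * indicator (grid_exceeds t m n) \<omega> \<partial>M)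
     = (\<integral>\<^sup>+\<omega>. ennreal (f (2 * first_value t m n \<omega> - B t \<omega>)) * indicator (grid_exceeds t m n) \<omega> \<partial>M)" for n
    using nn_integral_reflect_grid[of t "\<lambda>x. ennreal (f x)" m n] assms(1,2) by simp
  then show ?thesis using LIMSEQ_unique[OF lim1] lim2 by simp
qed


lemma tendsto_ramp: "(\<lambda>j. max 0 (min 1 (real j * (y - x)))) \<longlonglongrightarrow> indicator {x<..} (y::real)"
proof (cases "x < y")
  case True
  obtain N :: nat where N: "1 / (y - x) < real N" using reals_Archimedean2 by blast
  have "max 0 (min 1 (real j * (y - x))) = 1" if "j \<ge> N" for j
  proof -
    have "1 / (y - x) \<le> real j" using N that by linarith
    then have "1 \<le> real j * (y - x)" using True by (simp add: field_simps)
    then show ?thesis by simp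
  qed
  then have "eventually (\<lambda>j. max 0 (min 1 (real j * (y - x))) = indicator {x<..} y) sequentially"
    using True by (intro eventually_sequentiallyI[of N]) simp
  then show ?thesis by (rule tendsto_eventually)
next
  case False
  then have "real j * (y - x) \<le> 0" for j by (simp add: mult_nonneg_nonpos)
  then have "min 1 (real j * (y - x)) \<le> 0" for j by (rule min.coboundedI2)
  then have "max 0 (min 1 (real j * (y - x))) = indicator {x<..} y" for j
    using False by (simp only: max_absorb1) simp
  then show ?thesis by simp
qed

text \<open>Ramps carry the reflection from continuous functions to the half-lines
  \<open>{x<..}\<close>, and finite measures on the reals that agree on these are equal.\<close>

lemma nn_integral_reflect:
  assumes "0 \<le> t" "t \<le> T" "0 \<le> m" and [measurable]: "g \<in> borel_measurable borel"
  shows "(\<integral>\<^sup>+\<omega>. g (B t \<omega>) * indicator {m<..} (run_max B t \<omega>) \<partial>M)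
    = (\<integral>\<^sup>+\<omega>. g (2 * m - B t \<omega>) * indicator {m<..} (run_max B t \<omega>) \<partial>M)"
proof -
  have [measurable]: "B t \<in> borel_measurable M" "run_max B t \<in> borel_measurable M"
    using random_variable_B measurable_run_max assms by auto
  define N where "N = density M (\<lambda>\<omega>. indicator {m<..} (run_max B t \<omega>))"
  have [measurable]: "B t \<in> borel_measurable N" "(\<lambda>\<omega>. 2 * m - B t \<omega>) \<in> borel_measurable N"
    by (auto simp: N_def)
  have N: "(\<integral>\<^sup>+\<omega>. f (X \<omega>) \<partial>N) = (\<integral>\<^sup>+\<omega>. f (X \<omega>) * indicator {m<..} (run_max B t \<omega>) \<partial>M)"
    if "f \<in> borel_measurable borel" "X \<in> borel_measurable M" for f :: "real \<Rightarrow> ennreal" and X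
    unfolding N_def using that by (subst nn_integral_density) (auto simp: mult.commute)
  have "distr N borel (B t) = distr N borel (\<lambda>\<omega>. 2 * m - B t \<omega>)"
  proof (rule measure_eqI_lessThan)
    fix x :: real
    have em: "emeasure (distr N borel X) {x<..} = (\<integral>\<^sup>+\<omega>. indicator {x<..} (X \<omega>) * indicator {m<..} (run_max B t \<omega>) \<partial>M)"
      if "X \<in> borel_measurable M" for X
    proof -
      have "X \<in> borel_measurable N" using that by (simp add: N_def)
      then have "emeasure (distr N borel X) {x<..} = (\<integral>\<^sup>+\<omega>. indicator {x<..} (X \<omega>) \<partial>N)"
        by (subst nn_integral_indicator[symmetric], simp, subst nn_integral_distr) auto
      then show ?thesis using N[OF _ that] by simp
    qed
    have lim: "(\<lambda>j. \<integral>\<^sup>+\<omega>. ennreal (max 0 (min 1 (real j * (X \<omega> - x)))) * indicator {\<omega>. m < run_max B t \<omega>} \<omega> \<partial>M)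
       \<longlonglongrightarrow> emeasure (distr N borel X) {x<..}" if [measurable]: "X \<in> borel_measurable M" for X
      unfolding em[OF that]
    proof (rule nn_integral_dominated_convergence[where w = "\<lambda>_. 1"])
      show "AE \<omega> in M. (\<lambda>j. ennreal (max 0 (min 1 (real j * (X \<omega> - x)))) * indicator {\<omega>. m < run_max B t \<omega>} \<omega>)
         \<longlonglongrightarrow> indicator {x<..} (X \<omega>) * indicator {m<..} (run_max B t \<omega>)"
      proof (rule AE_I2)
        fix \<omega>
        have "(\<lambda>j. ennreal (max 0 (min 1 (real j * (X \<omega> - x))))) \<longlonglongrightarrow> ennreal (indicator {x<..} (X \<omega>))"
          by (intro tendsto_ennrealI tendsto_ramp)
        then show "(\<lambda>j. ennreal (max 0 (min 1 (real j * (X \<omega> - x)))) * indicator {\<omega>. m < run_max B t \<omega>} \<omega>)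
         \<longlonglongrightarrow> indicator {x<..} (X \<omega>) * indicator {m<..} (run_max B t \<omega>)"
          by (cases "m < run_max B t \<omega>"; cases "x < X \<omega>") simp_all
      qed
    qed (auto simp: indicator_def emeasure_space_1)
    have "(\<integral>\<^sup>+\<omega>. ennreal (max 0 (min 1 (real j * (B t \<omega> - x)))) * indicator {\<omega>. m < run_max B t \<omega>} \<omega> \<partial>M)
       = (\<integral>\<^sup>+\<omega>. ennreal (max 0 (min 1 (real j * (2 * m - B t \<omega> - x)))) * indicator {\<omega>. m < run_max B t \<omega>} \<omega> \<partial>M)" for j
    proof (rule nn_integral_reflect_continuous[OF assms(1-3)])
      show "isCont (\<lambda>y. max 0 (min 1 (real j * (y - x)))) z" for z
        unfolding isCont_def by (intro tendsto_intros)
    qed auto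
    then show "emeasure (distr N borel (B t)) {x<..} = emeasure (distr N borel (\<lambda>\<omega>. 2 * m - B t \<omega>)) {x<..}"
      using LIMSEQ_unique[OF lim[of "B t"]] lim[of "\<lambda>\<omega>. 2 * m - B t \<omega>"] by simp
    have "emeasure (distr N borel (B t)) {x<..} \<le> (\<integral>\<^sup>+\<omega>. 1 \<partial>M)"
      unfolding em[OF \<open>B t \<in> borel_measurable M\<close>] by (intro nn_integral_mono) (simp split: split_indicator)
    also have "\<dots> < \<infinity>" by (simp add: emeasure_space_1)
    finally show "emeasure (distr N borel (B t)) {x<..} < \<infinity>" .
  qed simp_all
  then have "(\<integral>\<^sup>+x. g x \<partial>distr N borel (B t)) = (\<integral>\<^sup>+x. g x \<partial>distr N borel (\<lambda>\<omega>. 2 * m - B t \<omega>))"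
    by simp
  then show ?thesis
    using N[of g "B t"] N[of g "\<lambda>\<omega>. 2 * m - B t \<omega>"] by (simp add: nn_integral_distr)
qed

lemma nn_integral_B:
  assumes "0 < t" "t \<le> T" "g \<in> borel_measurable borel"
  shows "(\<integral>\<^sup>+\<omega>. g (B t \<omega>) \<partial>M) = (\<integral>\<^sup>+x. ennreal (gauss t x) * g x \<partial>lborel)"
  using distributed_nn_integral[OF distributed_B[OF assms(1,2)], of g] assms(3) by simp

text \<open>If the endpoint lies above \<open>m\<close>, it witnesses the event itself. If it does
  not, reflection maps it to \<open>2 * m - x\<close>, which lies above \<open>m\<close> up to a
  null event. The two Gaussians \<open>gauss t x\<close> and \<open>gauss t (2 * m - x)\<close> are
  written as one by \<open>max\<close>.\<close>

lemma nn_integral_B_run_max_greater: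
  assumes "0 < t" "t \<le> T" "0 \<le> m" and [measurable]: "g \<in> borel_measurable borel"
  shows "(\<integral>\<^sup>+\<omega>. g (B t \<omega>) * indicator {m<..} (run_max B t \<omega>) \<partial>M) = (\<integral>\<^sup>+x. g x * ennreal (gauss t (2 * max m x - x)) \<partial>lborel)"
proof -
  have t: "0 \<le> t" using assms by simp
  have [measurable]: "B t \<in> borel_measurable M" "run_max B t \<in> borel_measurable M"
    using random_variable_B measurable_run_max assms by auto
  define g1 where "g1 x = g x * indicator {m<..} x" for x
  define g2 where "g2 x = g x * indicator {..m} x" for x
  have [measurable]: "g1 \<in> borel_measurable borel" "g2 \<in> borel_measurable borel"
    unfolding g1_def[abs_def] g2_def[abs_def] by measurable
  have ne: "AE \<omega> in M. B t \<omega> \<noteq> m"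
  proof -
    have "AE x in distr M lborel (B t). x \<noteq> m"
      unfolding distributed_distr_eq_density[OF distributed_B[OF assms(1,2)]]
      by (subst AE_density) (auto intro: eventually_mono[OF AE_lborel_singleton])
    then show ?thesis by (subst (asm) AE_distr_iff) auto
  qed
  have run_max: "B t \<omega> \<le> run_max B t \<omega>" if "\<omega> \<in> space M" for \<omega>
    using le_run_max[OF that t order_refl assms(2)] .
  have "(\<integral>\<^sup>+\<omega>. g (B t \<omega>) * indicator {m<..} (run_max B t \<omega>) \<partial>M)
     = (\<integral>\<^sup>+\<omega>. g1 (B t \<omega>) + g2 (B t \<omega>) * indicator {m<..} (run_max B t \<omega>) \<partial>M)"
    using run_max by (intro nn_integral_cong) (auto simp: g1_def g2_def split: split_indicator dest: less_le_trans)
  also have "\<dots> = (\<integral>\<^sup>+\<omega>. g1 (B t \<omega>) \<partial>M) + (\<integral>\<^sup>+\<omega>. g2 (B t \<omega>) * indicator {m<..} (run_max B t \<omega>) \<partial>M)"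
    by (rule nn_integral_add) auto
  also have "(\<integral>\<^sup>+\<omega>. g2 (B t \<omega>) * indicator {m<..} (run_max B t \<omega>) \<partial>M)
     = (\<integral>\<^sup>+\<omega>. g2 (2 * m - B t \<omega>) * indicator {m<..} (run_max B t \<omega>) \<partial>M)"
    by (rule nn_integral_reflect[OF t assms(2,3)]) simp
  also have "\<dots> = (\<integral>\<^sup>+\<omega>. g2 (2 * m - B t \<omega>) \<partial>M)"
  proof (rule nn_integral_cong_AE)
    show "AE \<omega> in M. g2 (2 * m - B t \<omega>) * indicator {m<..} (run_max B t \<omega>) = g2 (2 * m - B t \<omega>)"
      using ne AE_space
    proof eventually_elim
      case (elim \<omega>)
      then show ?case using run_max[of \<omega>] by (auto simp: g2_def split: split_indicator)
    qed
  qed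
  also have "\<dots> = (\<integral>\<^sup>+x. ennreal (gauss t x) * g2 (2 * m - x) \<partial>lborel)"
    by (rule nn_integral_B[OF assms(1,2)]) simp
  also have "\<dots> = ennreal \<bar>- 1\<bar> * (\<integral>\<^sup>+x. ennreal (gauss t (2 * m + - 1 * x)) * g2 (2 * m - (2 * m + - 1 * x)) \<partial>lborel)"
    by (rule nn_integral_real_affine) auto
  also have "\<dots> = (\<integral>\<^sup>+x. ennreal (gauss t (2 * m - x)) * g2 x \<partial>lborel)"
    by simp
  also have "(\<integral>\<^sup>+\<omega>. g1 (B t \<omega>) \<partial>M) = (\<integral>\<^sup>+x. ennreal (gauss t x) * g1 x \<partial>lborel)"
    by (rule nn_integral_B[OF assms(1,2)]) simp
  also have "(\<integral>\<^sup>+x. ennreal (gauss t x) * g1 x \<partial>lborel) + (\<integral>\<^sup>+x. ennreal (gauss t (2 * m - x)) * g2 x \<partial>lborel)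
     = (\<integral>\<^sup>+x. ennreal (gauss t x) * g1 x + ennreal (gauss t (2 * m - x)) * g2 x \<partial>lborel)"
    by (rule nn_integral_add[symmetric]) auto
  also have "\<dots> = (\<integral>\<^sup>+x. g x * ennreal (gauss t (2 * max m x - x)) \<partial>lborel)"
    by (intro nn_integral_cong) (auto simp: g1_def g2_def max_def mult.commute split: split_indicator)
  finally show ?thesis .
qed

end

section \<open>The joint law of the running maximum and the endpoint\<close>

text \<open>The integrand is minus the derivative of \<open>gauss u (2 * k - x)\<close> in
  \<open>k\<close>; the factor 2 is that of the chain rule.\<close>

lemma nn_integral_passage_density_double:
  assumes "u > 0" "2 * c - x \<ge> 0"
  shows "(\<integral>\<^sup>+k. ennreal (2 * passage_density u (2 * k - x)) * indicator {c<..} k \<partial>lborel) = ennreal (gauss u (2 * c - x))"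
proof -
  have [measurable]: "passage_density u \<in> borel_measurable borel"
    unfolding passage_density_def[abs_def] by measurable
  have "ennreal (gauss u (2 * c + - x)) = (\<integral>\<^sup>+y. ennreal (passage_density u (y + - x)) * indicator {2 * c<..} y \<partial>lborel)"
    by (rule nn_integral_passage_density_Ioi[symmetric]) (use assms in auto)
  also have "\<dots> = ennreal \<bar>2\<bar> * (\<integral>\<^sup>+k. ennreal (passage_density u (0 + 2 * k + - x)) * indicator {2 * c<..} (0 + 2 * k) \<partial>lborel)"
    by (rule nn_integral_real_affine) auto
  also have "\<dots> = (\<integral>\<^sup>+k. ennreal 2 * (ennreal (passage_density u (0 + 2 * k + - x)) * indicator {2 * c<..} (0 + 2 * k)) \<partial>lborel)"
    by (subst nn_integral_cmult) auto
  also have "\<dots> = (\<integral>\<^sup>+k. ennreal (2 * passage_density u (2 * k - x)) * indicator {c<..} k \<partial>lborel)"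
    by (intro nn_integral_cong) (auto simp: ennreal_mult' split: split_indicator)
  finally show ?thesis by simp
qed

text \<open>At the lower end \<open>2 * max 0 x - x\<close> is the absolute value of
  \<open>x\<close>, so the boundary term there is \<open>gauss u x\<close>.\<close>

lemma nn_integral_passage_density_double_Ioo:
  assumes "u > 0" "max 0 x < c"
  shows "(\<integral>\<^sup>+k. ennreal (2 * passage_density u (2 * k - x)) * indicator {max 0 x<..<c} k \<partial>lborel) = ennreal (gauss u x - gauss u (2 * c - x))"
proof -
  have D: "DERIV (\<lambda>k. - gauss u (2 * k - x)) k :> 2 * passage_density u (2 * k - x)" for k
    unfolding passage_density_def using assms by (auto intro!: derivative_eq_intros)
  have C: "isCont (\<lambda>k. - gauss u (2 * k - x)) k" for k
    using D by (rule DERIV_isCont)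
  have "(\<integral>\<^sup>+k. ennreal (2 * passage_density u (2 * k - x)) * indicator {max 0 x<..<c} k \<partial>lborel)
     = ennreal (- gauss u (2 * c - x) - - gauss u (2 * max 0 x - x))"
  proof (rule nn_integral_FTC_Ioo[OF assms(2) D])
    show "isCont (\<lambda>k. 2 * passage_density u (2 * k - x)) k" for k
      unfolding passage_density_def normal_density_def using assms(1) by (auto intro!: continuous_intros)
    show "0 \<le> 2 * passage_density u (2 * k - x)" if "max 0 x < k" for k
      using that assms(1) by (auto intro!: passage_density_nonneg)
    show "((\<lambda>k. - gauss u (2 * k - x)) \<longlongrightarrow> - gauss u (2 * max 0 x - x)) (at_right (max 0 x))"
      using C[of "max 0 x"] unfolding isCont_def filterlim_at_split by blast
    show "((\<lambda>k. - gauss u (2 * k - x)) \<longlongrightarrow> - gauss u (2 * c - x)) (at_left c)"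
      using C[of c] unfolding isCont_def filterlim_at_split by blast
  qed
  also have "gauss u (2 * max 0 x - x) = gauss u x"
    using gauss_minus[of u x] by (simp add: max_def)
  finally show ?thesis by simp
qed

text \<open>For fixed \<open>D\<close> the restriction to \<open>UNIV \<times> D\<close> projects to
  a finite measure on the reals, which is determined by half-lines. This settles all rectangles, and
  they form an intersection-stable generator.\<close>

lemma measure_eqI_halflines_times:
  fixes \<mu> \<nu> :: "(real \<times> 'b) measure"
  assumes sets: "sets \<mu> = sets (borel \<Otimes>\<^sub>M N)" "sets \<nu> = sets (borel \<Otimes>\<^sub>M N)"
    and fin: "emeasure \<mu> (space \<mu>) < \<infinity>"
    and eq: "\<And>x D. D \<in> sets N \<Longrightarrow> emeasure \<mu> ({x<..} \<times> D) = emeasure \<nu> ({x<..} \<times> D)"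
  shows "\<mu> = \<nu>"
proof -
  have rect: "emeasure \<mu> (A \<times> D) = emeasure \<nu> (A \<times> D)" if A: "A \<in> sets borel" and D: "D \<in> sets N" for A D
  proof -
    define m where "m \<rho> = distr (density \<rho> (indicator (UNIV \<times> D))) borel fst" for \<rho> :: "(real \<times> 'b) measure"
    have em: "emeasure (m \<rho>) A = emeasure \<rho> (A \<times> D)" if "sets \<rho> = sets (borel \<Otimes>\<^sub>M N)" "A \<in> sets borel" for \<rho> A
    proof -
      have UD: "UNIV \<times> D \<in> sets \<rho>" unfolding that(1) using D by simp
      have fst: "fst \<in> measurable \<rho> borel"
        unfolding measurable_cong_sets[OF that(1) refl] by simp
      have sp: "space \<rho> = UNIV \<times> space N"
        using sets_eq_imp_space_eq[OF that(1)] by (simp add: space_pair_measure)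
      have "fst -` A \<inter> space \<rho> \<in> sets \<rho>" using measurable_sets[OF fst that(2)] .
      then have "emeasure (m \<rho>) A = emeasure \<rho> ((UNIV \<times> D) \<inter> (fst -` A \<inter> space \<rho>))"
        unfolding m_def using fst UD that(2)
        by (subst emeasure_distr) (auto simp: emeasure_restricted Int_commute)
      also have "(UNIV \<times> D) \<inter> (fst -` A \<inter> space \<rho>) = A \<times> D"
        using sets.sets_into_space[OF D] by (auto simp: sp)
      finally show ?thesis .
    qed
    have "m \<mu> = m \<nu>"
    proof (rule measure_eqI_lessThan)
      fix x :: real
      show "emeasure (m \<mu>) {x<..} = emeasure (m \<nu>) {x<..}"
        using em[OF sets(1)] em[OF sets(2)] eq[OF D] by simp
      have "emeasure \<mu> ({x<..} \<times> D) \<le> emeasure \<mu> (space \<mu>)" by (rule emeasure_space)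
      then show "emeasure (m \<mu>) {x<..} < \<infinity>"
        using em[OF sets(1)] fin by (simp add: order_le_less_trans)
    qed (simp_all add: m_def)
    then show ?thesis using em[OF sets(1) A] em[OF sets(2) A] by simp
  qed
  show ?thesis
  proof (rule measure_eqI_generator_eq)
    show "Int_stable {a \<times> b | a b. a \<in> sets borel \<and> b \<in> sets N}"
      by (rule Int_stable_pair_measure_generator)
    show "{a \<times> b | a b. a \<in> sets borel \<and> b \<in> sets N} \<subseteq> Pow (space (borel \<Otimes>\<^sub>M N))"
      by (rule pair_measure_closed[THEN order_trans]) (simp add: space_pair_measure)
    show "sets \<mu> = sigma_sets (space (borel \<Otimes>\<^sub>M N)) {a \<times> b | a b. a \<in> sets borel \<and> b \<in> sets N}"
      "sets \<nu> = sigma_sets (space (borel \<Otimes>\<^sub>M N)) {a \<times> b | a b. a \<in> sets borel \<and> b \<in> sets N}"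
      unfolding sets by (simp_all add: sets_pair_measure space_pair_measure)
    show "range (\<lambda>_::nat. UNIV \<times> space N) \<subseteq> {a \<times> b | a b. a \<in> sets (borel :: real measure) \<and> b \<in> sets N}"
      by (auto intro!: exI[of _ UNIV] exI[of _ "space N"])
    show "(\<Union>i::nat. UNIV \<times> space N) = space ((borel :: real measure) \<Otimes>\<^sub>M N)"
      by (simp add: space_pair_measure)
    show "emeasure \<mu> (UNIV \<times> space N) \<noteq> \<infinity>"
      using fin sets_eq_imp_space_eq[OF sets(1)] by (simp add: space_pair_measure)
  qed (use rect in auto)
qed

lemma borel_measurable_passage_density1 [measurable]: "passage_density u \<in> borel_measurable borel"
  unfolding passage_density_def[abs_def] by measurable

text \<open>Minus the derivative in the level of the tail \<open>gauss t (2 * max m x - x)\<close>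
  given by the reflection principle.\<close>

definition max_end_density :: "real \<Rightarrow> real \<times> real \<Rightarrow> ennreal" where
  "max_end_density t p = ennreal (2 * passage_density t (2 * fst p - snd p)) * indicator {max 0 (snd p)<..} (fst p)"

lemma borel_measurable_max_end_density [measurable]: "max_end_density t \<in> borel_measurable (borel \<Otimes>\<^sub>M borel)"
  unfolding max_end_density_def indicator_def greaterThan_iff by measurable

context brownian
begin

text \<open>Reflection handles levels \<open>m \<ge> 0\<close>. A negative level is exceeded by
  every path, since the maximum is at least \<open>B 0 = 0\<close>; so \<open>max 0 m\<close> may
  replace \<open>m\<close>.\<close>

lemma distr_run_max_B:
  assumes "0 < t" "t \<le> T"
  shows "distr M (borel \<Otimes>\<^sub>M borel) (\<lambda>\<omega>. (run_max B t \<omega>, B t \<omega>)) = density (lborel \<Otimes>\<^sub>M lborel) (max_end_density t)"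
proof (rule measure_eqI_halflines_times)
  have t: "0 \<le> t" using assms by simp
  have [measurable]: "B t \<in> borel_measurable M" "run_max B t \<in> borel_measurable M"
    using random_variable_B measurable_run_max assms by auto
  show "emeasure (distr M (borel \<Otimes>\<^sub>M borel) (\<lambda>\<omega>. (run_max B t \<omega>, B t \<omega>))) (space (distr M (borel \<Otimes>\<^sub>M borel) (\<lambda>\<omega>. (run_max B t \<omega>, B t \<omega>)))) < \<infinity>"
    by (subst emeasure_distr) (auto simp: less_top[symmetric])
  show "sets (distr M (borel \<Otimes>\<^sub>M borel) (\<lambda>\<omega>. (run_max B t \<omega>, B t \<omega>))) = sets (borel \<Otimes>\<^sub>M borel)"
    by simp
  show "sets (density (lborel \<Otimes>\<^sub>M lborel) (max_end_density t)) = sets (borel \<Otimes>\<^sub>M borel)"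
    by (simp cong: sets_pair_measure_cong)
  fix m :: real and D :: "real set" assume D [measurable]: "D \<in> sets borel"
  have "emeasure (distr M (borel \<Otimes>\<^sub>M borel) (\<lambda>\<omega>. (run_max B t \<omega>, B t \<omega>))) ({m<..} \<times> D)
      = (\<integral>\<^sup>+\<omega>. indicator D (B t \<omega>) * indicator {m<..} (run_max B t \<omega>) \<partial>M)"
    by (subst nn_integral_indicator[symmetric], simp, subst nn_integral_distr)
       (auto simp: indicator_times mult.commute)
  also have "\<dots> = (\<integral>\<^sup>+x. indicator D x * ennreal (gauss t (2 * max (max 0 m) x - x)) \<partial>lborel)"
  proof (cases "0 \<le> m")
    case True
    then show ?thesis
      using nn_integral_B_run_max_greater[OF assms True, of "indicator D"] by (simp add: max_absorb2)
  next
    case False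
    have "(\<integral>\<^sup>+\<omega>. indicator D (B t \<omega>) * indicator {m<..} (run_max B t \<omega>) \<partial>M) = (\<integral>\<^sup>+\<omega>. indicator D (B t \<omega>) \<partial>M)"
    proof (rule nn_integral_cong)
      fix \<omega> assume "\<omega> \<in> space M"
      then have "m < run_max B t \<omega>" using run_max_nonneg[OF _ t assms(2)] False by force
      then show "indicator D (B t \<omega>) * indicator {m<..} (run_max B t \<omega>) = (indicator D (B t \<omega>) :: ennreal)" by simp
    qed
    also have "\<dots> = (\<integral>\<^sup>+x. ennreal (gauss t x) * indicator D x \<partial>lborel)"
      by (rule nn_integral_B[OF assms]) simp
    also have "\<dots> = (\<integral>\<^sup>+x. indicator D x * ennreal (gauss t (2 * max (max 0 m) x - x)) \<partial>lborel)"
    proof (rule nn_integral_cong)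
      fix x :: real
      have "gauss t (2 * max (max 0 m) x - x) = gauss t x"
        using gauss_minus[of t x] False by (simp add: max_def)
      then show "ennreal (gauss t x) * indicator D x = indicator D x * ennreal (gauss t (2 * max (max 0 m) x - x))"
        by (simp add: mult.commute)
    qed
    finally show ?thesis .
  qed
  also have "\<dots> = (\<integral>\<^sup>+x. (\<integral>\<^sup>+k. max_end_density t (k, x) * indicator ({m<..} \<times> D) (k, x) \<partial>lborel) \<partial>lborel)"
  proof (rule nn_integral_cong)
    fix x :: real
    define c where "c = max (max 0 m) x"
    have c: "2 * c - x \<ge> 0" unfolding c_def by linarith
    have "(\<integral>\<^sup>+k. max_end_density t (k, x) * indicator ({m<..} \<times> D) (k, x) \<partial>lborel)
       = (\<integral>\<^sup>+k. indicator D x * (ennreal (2 * passage_density t (2 * k - x)) * indicator {c<..} k) \<partial>lborel)"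
      by (intro nn_integral_cong) (auto simp: max_end_density_def c_def split: split_indicator)
    also have "\<dots> = indicator D x * ennreal (gauss t (2 * c - x))"
      by (subst nn_integral_cmult) (auto simp: nn_integral_passage_density_double[OF assms(1) c])
    finally show "indicator D x * ennreal (gauss t (2 * max (max 0 m) x - x))
       = (\<integral>\<^sup>+k. max_end_density t (k, x) * indicator ({m<..} \<times> D) (k, x) \<partial>lborel)"
      by (simp add: c_def)
  qed
  also have "\<dots> = (\<integral>\<^sup>+p. max_end_density t p * indicator ({m<..} \<times> D) p \<partial>(lborel \<Otimes>\<^sub>M lborel))"
    by (rule lborel_pair.nn_integral_snd) simp
  also have "\<dots> = emeasure (density (lborel \<Otimes>\<^sub>M lborel) (max_end_density t)) ({m<..} \<times> D)"
    by (subst emeasure_density) auto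
  finally show "emeasure (distr M (borel \<Otimes>\<^sub>M borel) (\<lambda>\<omega>. (run_max B t \<omega>, B t \<omega>))) ({m<..} \<times> D)
     = emeasure (density (lborel \<Otimes>\<^sub>M lborel) (max_end_density t)) ({m<..} \<times> D)" .
qed

lemma nn_integral_run_max_B:
  assumes "0 < t" "t \<le> T" and [measurable]: "F \<in> borel_measurable (borel \<Otimes>\<^sub>M borel)"
  shows "(\<integral>\<^sup>+\<omega>. F (run_max B t \<omega>, B t \<omega>) \<partial>M) = (\<integral>\<^sup>+x. (\<integral>\<^sup>+k. max_end_density t (k, x) * F (k, x) \<partial>lborel) \<partial>lborel)"
proof -
  have [measurable]: "B t \<in> borel_measurable M" "run_max B t \<in> borel_measurable M"
    using random_variable_B measurable_run_max assms by auto
  have "(\<integral>\<^sup>+\<omega>. F (run_max B t \<omega>, B t \<omega>) \<partial>M) = (\<integral>\<^sup>+p. F p \<partial>distr M (borel \<Otimes>\<^sub>M borel) (\<lambda>\<omega>. (run_max B t \<omega>, B t \<omega>)))"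
    by (subst nn_integral_distr) auto
  also have "\<dots> = (\<integral>\<^sup>+p. max_end_density t p * F p \<partial>(lborel \<Otimes>\<^sub>M lborel))"
    unfolding distr_run_max_B[OF assms(1,2)] by (subst nn_integral_density) auto
  also have "\<dots> = (\<integral>\<^sup>+x. (\<integral>\<^sup>+k. max_end_density t (k, x) * F (k, x) \<partial>lborel) \<partial>lborel)"
    by (rule lborel_pair.nn_integral_snd[symmetric]) simp
  finally show ?thesis .
qed

lemma AE_run_max_pos:
  assumes "0 < t" "t \<le> T"
  shows "AE \<omega> in M. 0 < run_max B t \<omega>"
proof -
  have [measurable]: "run_max B t \<in> borel_measurable M"
    using measurable_run_max assms by auto
  have "(\<integral>\<^sup>+\<omega>. indicator {..0} (run_max B t \<omega>) \<partial>M) = (\<integral>\<^sup>+\<omega>. (\<lambda>p. indicator {..0} (fst p)) (run_max B t \<omega>, B t \<omega>) \<partial>M)"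
    by simp
  also have "\<dots> = (\<integral>\<^sup>+x. (\<integral>\<^sup>+k. max_end_density t (k, x) * indicator {..0} (fst (k, x)) \<partial>lborel) \<partial>lborel)"
    by (rule nn_integral_run_max_B[OF assms]) simp
  also have "\<dots> = (\<integral>\<^sup>+(x::real). (\<integral>\<^sup>+(k::real). 0 \<partial>lborel) \<partial>lborel)"
    by (intro nn_integral_cong) (auto simp: max_end_density_def split: split_indicator)
  finally have "AE \<omega> in M. indicator {..0} (run_max B t \<omega>) = (0 :: ennreal)"
    by (simp add: nn_integral_0_iff_AE)
  then show ?thesis
    by (rule eventually_mono) (auto simp: not_le[symmetric])
qed

section \<open>Laws of the gap between the running maximum and the path\<close>

text \<open>In terms of the gap \<open>a = k - x\<close> the argument \<open>2 * k - x\<close> is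
  \<open>k + a\<close>, and integrating over \<open>k > m\<close> leaves a Gaussian.\<close>

lemma nn_integral_gap_run_max_greater:
  assumes "0 < t" "t \<le> T" "0 \<le> m" and [measurable]: "h \<in> borel_measurable borel"
  shows "(\<integral>\<^sup>+\<omega>. h (run_max B t \<omega> - B t \<omega>) * indicator {m<..} (run_max B t \<omega>) \<partial>M)
    = (\<integral>\<^sup>+a. h a * ennreal (2 * gauss t (m + a)) * indicator {0<..} a \<partial>lborel)"
proof -
  define F where "F p = h (fst p - snd p) * indicator {m<..} (fst p)" for p :: "real \<times> real"
  have [measurable]: "F \<in> borel_measurable (borel \<Otimes>\<^sub>M borel)"
    unfolding F_def[abs_def] by measurable
  define G where "G k a = h a * ennreal (2 * passage_density t (k + a)) * indicator {m<..} k * indicator {0<..} a" for k a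
  have [measurable]: "(\<lambda>(k, a). G k a) \<in> borel_measurable (lborel \<Otimes>\<^sub>M lborel)"
    unfolding G_def[abs_def] by measurable
  have "(\<integral>\<^sup>+\<omega>. h (run_max B t \<omega> - B t \<omega>) * indicator {m<..} (run_max B t \<omega>) \<partial>M) = (\<integral>\<^sup>+\<omega>. F (run_max B t \<omega>, B t \<omega>) \<partial>M)"
    by (simp add: F_def)
  also have "\<dots> = (\<integral>\<^sup>+x. (\<integral>\<^sup>+k. max_end_density t (k, x) * F (k, x) \<partial>lborel) \<partial>lborel)"
    by (rule nn_integral_run_max_B[OF assms(1,2)]) simp
  also have "\<dots> = (\<integral>\<^sup>+k. (\<integral>\<^sup>+x. max_end_density t (k, x) * F (k, x) \<partial>lborel) \<partial>lborel)"
    by (rule lborel_pair.Fubini') simp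
  also have "\<dots> = (\<integral>\<^sup>+k. (\<integral>\<^sup>+a. G k a \<partial>lborel) \<partial>lborel)"
  proof (rule nn_integral_cong)
    fix k :: real
    have "(\<integral>\<^sup>+x. max_end_density t (k, x) * F (k, x) \<partial>lborel)
        = ennreal \<bar>- 1\<bar> * (\<integral>\<^sup>+a. max_end_density t (k, k + - 1 * a) * F (k, k + - 1 * a) \<partial>lborel)"
      by (rule nn_integral_real_affine) auto
    also have "\<dots> = (\<integral>\<^sup>+a. max_end_density t (k, k - a) * F (k, k - a) \<partial>lborel)"
      by simp
    also have "\<dots> = (\<integral>\<^sup>+a. G k a \<partial>lborel)"
      using assms(3) by (intro nn_integral_cong) (auto simp: max_end_density_def F_def G_def mult_ac split: split_indicator)
    finally show "(\<integral>\<^sup>+x. max_end_density t (k, x) * F (k, x) \<partial>lborel) = (\<integral>\<^sup>+a. G k a \<partial>lborel)" .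
  qed
  also have "\<dots> = (\<integral>\<^sup>+a. (\<integral>\<^sup>+k. G k a \<partial>lborel) \<partial>lborel)"
    by (rule lborel_pair.Fubini'[symmetric]) simp
  also have "\<dots> = (\<integral>\<^sup>+a. h a * ennreal (2 * gauss t (m + a)) * indicator {0<..} a \<partial>lborel)"
  proof (rule nn_integral_cong)
    fix a :: real
    show "(\<integral>\<^sup>+k. G k a \<partial>lborel) = h a * ennreal (2 * gauss t (m + a)) * indicator {0<..} a"
    proof (cases "0 < a")
      case True
      have "(\<integral>\<^sup>+k. G k a \<partial>lborel) = (\<integral>\<^sup>+k. h a * (ennreal 2 * (ennreal (passage_density t (k + a)) * indicator {m<..} k)) \<partial>lborel)"
        using True by (intro nn_integral_cong) (auto simp: G_def ennreal_mult' mult_ac)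
      also have "\<dots> = h a * (ennreal 2 * ennreal (gauss t (m + a)))"
        using True assms(3) by (simp add: nn_integral_cmult nn_integral_passage_density_Ioi[OF assms(1)])
      finally show ?thesis using True by (simp add: ennreal_mult')
    qed (simp add: G_def)
  qed
  finally show ?thesis .
qed

text \<open>Under time reversal the gap at \<open>t\<close> becomes a running maximum, so on this
  event \<open>B t + z\<close> is distributed like Brownian motion started at \<open>z\<close> and
  killed at 0. The proof integrates the joint density over \<open>k < x + z\<close> and shifts by
  \<open>z\<close>.\<close>

lemma nn_integral_B_gap_less:
  assumes "0 < t" "t \<le> T" "0 < z" and [measurable]: "G \<in> borel_measurable borel"
  shows "(\<integral>\<^sup>+\<omega>. G (B t \<omega> + z) * indicator {..<z} (run_max B t \<omega> - B t \<omega>) \<partial>M)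
    = (\<integral>\<^sup>+y. G y * ennreal (gauss t (y - z) - gauss t (y + z)) * indicator {0<..} y \<partial>lborel)"
proof -
  define F where "F p = G (snd p + z) * indicator {..<z} (fst p - snd p)" for p :: "real \<times> real"
  have [measurable]: "F \<in> borel_measurable (borel \<Otimes>\<^sub>M borel)"
    unfolding F_def[abs_def] by measurable
  have "(\<integral>\<^sup>+\<omega>. G (B t \<omega> + z) * indicator {..<z} (run_max B t \<omega> - B t \<omega>) \<partial>M) = (\<integral>\<^sup>+\<omega>. F (run_max B t \<omega>, B t \<omega>) \<partial>M)"
    by (simp add: F_def)
  also have "\<dots> = (\<integral>\<^sup>+x. (\<integral>\<^sup>+k. max_end_density t (k, x) * F (k, x) \<partial>lborel) \<partial>lborel)"
    by (rule nn_integral_run_max_B[OF assms(1,2)]) simp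
  also have "\<dots> = (\<integral>\<^sup>+x. G (x + z) * ennreal (gauss t x - gauss t (2 * (x + z) - x)) * indicator {0<..} (x + z) \<partial>lborel)"
  proof (rule nn_integral_cong)
    fix x :: real
    have "(\<integral>\<^sup>+k. max_end_density t (k, x) * F (k, x) \<partial>lborel)
       = (\<integral>\<^sup>+k. G (x + z) * (ennreal (2 * passage_density t (2 * k - x)) * indicator {max 0 x<..<x + z} k) \<partial>lborel)"
      by (intro nn_integral_cong) (auto simp: max_end_density_def F_def mult_ac split: split_indicator)
    also have "\<dots> = G (x + z) * (\<integral>\<^sup>+k. ennreal (2 * passage_density t (2 * k - x)) * indicator {max 0 x<..<x + z} k \<partial>lborel)"
      by (rule nn_integral_cmult) simp
    also have "(\<integral>\<^sup>+k. ennreal (2 * passage_density t (2 * k - x)) * indicator {max 0 x<..<x + z} k \<partial>lborel)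
       = ennreal (gauss t x - gauss t (2 * (x + z) - x)) * indicator {0<..} (x + z)"
    proof (cases "0 < x + z")
      case True
      then show ?thesis
        using nn_integral_passage_density_double_Ioo[OF assms(1), of x "x + z"] assms(3) by simp
    qed simp
    finally show "(\<integral>\<^sup>+k. max_end_density t (k, x) * F (k, x) \<partial>lborel)
       = G (x + z) * ennreal (gauss t x - gauss t (2 * (x + z) - x)) * indicator {0<..} (x + z)"
      by (simp add: mult.assoc)
  qed
  also have "\<dots> = ennreal \<bar>1\<bar> * (\<integral>\<^sup>+y. G (- z + 1 * y + z) * ennreal (gauss t (- z + 1 * y) - gauss t (2 * (- z + 1 * y + z) - (- z + 1 * y)))
       * indicator {0<..} (- z + 1 * y + z) \<partial>lborel)"
    by (rule nn_integral_real_affine) auto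
  also have "\<dots> = (\<integral>\<^sup>+y. G y * ennreal (gauss t (y - z) - gauss t (y + z)) * indicator {0<..} y \<partial>lborel)"
    by (simp add: algebra_simps)
  finally show ?thesis .
qed

text \<open>Seen from the level \<open>a\<close>, the path is Brownian motion started at the
  distance \<open>a\<close> and killed when the distance reaches 0.\<close>

lemma nn_integral_B_run_max_le:
  assumes "0 < t" "t \<le> T" "0 < a" and [measurable]: "h \<in> borel_measurable borel"
  shows "(\<integral>\<^sup>+\<omega>. h (a - B t \<omega>) * indicator {..a} (run_max B t \<omega>) \<partial>M)
    = (\<integral>\<^sup>+z. h z * ennreal (gauss t (a - z) - gauss t (a + z)) * indicator {0<..} z \<partial>lborel)"
proof -
  define F where "F p = h (a - snd p) * indicator {..a} (fst p)" for p :: "real \<times> real"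
  have [measurable]: "F \<in> borel_measurable (borel \<Otimes>\<^sub>M borel)"
    unfolding F_def[abs_def] by measurable
  have "(\<integral>\<^sup>+\<omega>. h (a - B t \<omega>) * indicator {..a} (run_max B t \<omega>) \<partial>M) = (\<integral>\<^sup>+\<omega>. F (run_max B t \<omega>, B t \<omega>) \<partial>M)"
    by (simp add: F_def)
  also have "\<dots> = (\<integral>\<^sup>+x. (\<integral>\<^sup>+k. max_end_density t (k, x) * F (k, x) \<partial>lborel) \<partial>lborel)"
    by (rule nn_integral_run_max_B[OF assms(1,2)]) simp
  also have "\<dots> = (\<integral>\<^sup>+x. h (a - x) * ennreal (gauss t x - gauss t (2 * a - x)) * indicator {0<..} (a - x) \<partial>lborel)"
  proof (rule nn_integral_cong)
    fix x :: real
    have "(\<integral>\<^sup>+k. max_end_density t (k, x) * F (k, x) \<partial>lborel)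
       = (\<integral>\<^sup>+k. h (a - x) * (ennreal (2 * passage_density t (2 * k - x)) * indicator {max 0 x<..<a} k) \<partial>lborel)"
      by (intro nn_integral_cong_AE eventually_mono[OF AE_lborel_singleton[of a]])
         (auto simp: max_end_density_def F_def mult_ac split: split_indicator)
    also have "\<dots> = h (a - x) * (\<integral>\<^sup>+k. ennreal (2 * passage_density t (2 * k - x)) * indicator {max 0 x<..<a} k \<partial>lborel)"
      by (rule nn_integral_cmult) simp
    also have "(\<integral>\<^sup>+k. ennreal (2 * passage_density t (2 * k - x)) * indicator {max 0 x<..<a} k \<partial>lborel)
       = ennreal (gauss t x - gauss t (2 * a - x)) * indicator {0<..} (a - x)"
    proof (cases "0 < a - x")
      case True
      then show ?thesis
        using nn_integral_passage_density_double_Ioo[OF assms(1), of x a] assms(3) by simp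
    qed simp
    finally show "(\<integral>\<^sup>+k. max_end_density t (k, x) * F (k, x) \<partial>lborel)
       = h (a - x) * ennreal (gauss t x - gauss t (2 * a - x)) * indicator {0<..} (a - x)"
      by (simp add: mult.assoc)
  qed
  also have "\<dots> = ennreal \<bar>- 1\<bar> * (\<integral>\<^sup>+z. h (a - (a + - 1 * z)) * ennreal (gauss t (a + - 1 * z) - gauss t (2 * a - (a + - 1 * z)))
       * indicator {0<..} (a - (a + - 1 * z)) \<partial>lborel)"
    by (rule nn_integral_real_affine) auto
  also have "\<dots> = (\<integral>\<^sup>+z. h z * ennreal (gauss t (a - z) - gauss t (a + z)) * indicator {0<..} z \<partial>lborel)"
    by (simp add: algebra_simps)
  finally show ?thesis .
qed

lemma run_max_cdf:
  assumes "0 \<le> t" "t \<le> T" "0 < z"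
  shows "(\<integral>\<^sup>+\<omega>. indicator {..z} (run_max B t \<omega>) \<partial>M) = ennreal (max_cdf t z)"
proof (cases "t = 0")
  case True
  have "(\<integral>\<^sup>+\<omega>. indicator {..z} (run_max B t \<omega>) \<partial>M) = (\<integral>\<^sup>+\<omega>. 1 \<partial>M)"
    using True assms by (intro nn_integral_cong) (simp add: run_max_0)
  then show ?thesis using True by (simp add: max_cdf_def emeasure_space_1)
next
  case False
  then have "0 < t" using assms by simp
  have "gauss t (z - y) = gauss t (y - z)" for y
    using gauss_minus[of t "z - y"] by simp
  then show ?thesis
    using nn_integral_B_run_max_le[OF \<open>0 < t\<close> assms(2,3), of "\<lambda>_. 1"] nn_integral_gauss_diff[OF \<open>0 < t\<close> assms(3)] False
    by (simp add: max_cdf_def add.commute)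
qed

text \<open>The gap has the law of the running maximum, which shows here as the same Gaussian
  integral. The second equation is the martingale identity for killed motion; it will give the
  conditional moment of h Z before the argmax.\<close>

lemma gap_cdf:
  assumes "0 \<le> t" "t \<le> T" "0 < z"
  shows "(\<integral>\<^sup>+\<omega>. indicator {..<z} (run_max B t \<omega> - B t \<omega>) \<partial>M) = ennreal (max_cdf t z)"
    and "(\<integral>\<^sup>+\<omega>. ennreal (B t \<omega> + z) * indicator {..<z} (run_max B t \<omega> - B t \<omega>) \<partial>M) = ennreal z"
proof (atomize(full), cases "t = 0")
  case True
  have "(\<integral>\<^sup>+\<omega>. indicator {..<z} (run_max B t \<omega> - B t \<omega>) \<partial>M) = (\<integral>\<^sup>+\<omega>. 1 \<partial>M)"
    using True assms by (intro nn_integral_cong) (simp add: run_max_0 start_zero)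
  moreover have "(\<integral>\<^sup>+\<omega>. ennreal (B t \<omega> + z) * indicator {..<z} (run_max B t \<omega> - B t \<omega>) \<partial>M) = (\<integral>\<^sup>+\<omega>. ennreal z \<partial>M)"
    using True assms by (intro nn_integral_cong) (simp add: run_max_0 start_zero)
  ultimately show "(\<integral>\<^sup>+\<omega>. indicator {..<z} (run_max B t \<omega> - B t \<omega>) \<partial>M) = ennreal (max_cdf t z) \<and>
      (\<integral>\<^sup>+\<omega>. ennreal (B t \<omega> + z) * indicator {..<z} (run_max B t \<omega> - B t \<omega>) \<partial>M) = ennreal z"
    using True by (simp add: max_cdf_def emeasure_space_1)
next
  case False
  then have "0 < t" using assms by simp
  have "(\<integral>\<^sup>+y. ennreal y * ennreal (gauss t (y - z) - gauss t (y + z)) * indicator {0<..} y \<partial>lborel)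
     = (\<integral>\<^sup>+y. ennreal (y * (gauss t (y - z) - gauss t (y + z))) * indicator {0<..} y \<partial>lborel)"
    by (intro nn_integral_cong) (auto simp: ennreal_mult' split: split_indicator)
  then show "(\<integral>\<^sup>+\<omega>. indicator {..<z} (run_max B t \<omega> - B t \<omega>) \<partial>M) = ennreal (max_cdf t z) \<and>
      (\<integral>\<^sup>+\<omega>. ennreal (B t \<omega> + z) * indicator {..<z} (run_max B t \<omega> - B t \<omega>) \<partial>M) = ennreal z"
    using nn_integral_B_gap_less[OF \<open>0 < t\<close> assms(2,3), of "\<lambda>_. 1"] nn_integral_gauss_diff[OF \<open>0 < t\<close> assms(3)] False
      nn_integral_B_gap_less[OF \<open>0 < t\<close> assms(2,3), of ennreal] nn_integral_mult_gauss_diff[OF \<open>0 < t\<close> assms(3)]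
    by (simp add: max_cdf_def)
qed

end

section \<open>The joint law of the argmax, the maximum and the final gap\<close>

text \<open>Complements turn closed lower half-lines into open upper ones; finiteness of
  \<open>\<mu>\<close> justifies the subtraction.\<close>

lemma measure_eqI_atMost_times:
  fixes \<mu> \<nu> :: "(real \<times> 'b) measure"
  assumes sets: "sets \<mu> = sets (borel \<Otimes>\<^sub>M N)" "sets \<nu> = sets (borel \<Otimes>\<^sub>M N)"
    and fin: "emeasure \<mu> (space \<mu>) < \<infinity>"
    and eq: "\<And>x D. D \<in> sets N \<Longrightarrow> emeasure \<mu> ({..x} \<times> D) = emeasure \<nu> ({..x} \<times> D)"
  shows "\<mu> = \<nu>"
proof (rule measure_eqI_halflines_times[OF sets fin])
  fix x :: real and D assume D: "D \<in> sets N"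
  have UD: "UNIV \<times> D \<in> sets (borel \<Otimes>\<^sub>M N)" and xD: "{..y} \<times> D \<in> sets (borel \<Otimes>\<^sub>M N)" for y :: real
    using D by auto
  have U: "(\<Union>n. {..real n} \<times> D) = UNIV \<times> D"
    using real_arch_simple by fastforce
  have inc: "incseq (\<lambda>n. {..real n} \<times> D)"
    unfolding incseq_def by auto
  have UNIV: "emeasure \<mu> (UNIV \<times> D) = emeasure \<nu> (UNIV \<times> D)"
    using SUP_emeasure_incseq[of "\<lambda>n. {..real n} \<times> D" \<mu>] SUP_emeasure_incseq[of "\<lambda>n. {..real n} \<times> D" \<nu>] inc
    unfolding U by (simp add: eq[OF D] xD sets image_subset_iff)
  have f: "emeasure \<mu> ({..x} \<times> D) \<noteq> \<infinity>"
    using emeasure_space[of \<mu> "{..x} \<times> D"] fin by auto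
  have d: "{x<..} \<times> D = UNIV \<times> D - {..x} \<times> D" by auto
  have "emeasure \<mu> ({x<..} \<times> D) = emeasure \<mu> (UNIV \<times> D) - emeasure \<mu> ({..x} \<times> D)"
    unfolding d by (rule emeasure_Diff) (use f UD xD in \<open>auto simp: sets\<close>)
  moreover have "emeasure \<nu> ({x<..} \<times> D) = emeasure \<nu> (UNIV \<times> D) - emeasure \<nu> ({..x} \<times> D)"
    unfolding d by (rule emeasure_Diff) (use f UD xD in \<open>auto simp: sets eq[OF D]\<close>)
  ultimately show "emeasure \<mu> ({x<..} \<times> D) = emeasure \<nu> ({x<..} \<times> D)"
    using UNIV eq[OF D] by simp
qed

text \<open>Seen from the argmax, the path descends by the maximum backwards to the start and by the
  gap forwards to the end. Each leg contributes its passage density, and the factor 2 makes the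
  total mass 1.\<close>

definition triple_density :: "real \<Rightarrow> real \<times> (real \<times> real) \<Rightarrow> ennreal" where
  "triple_density T p = ennreal (2 * passage_density (fst p) (fst (snd p)) * passage_density (T - fst p) (snd (snd p)))
     * indicator {0<..<T} (fst p) * indicator {0<..} (fst (snd p)) * indicator {0<..} (snd (snd p))"

lemma borel_measurable_passage_density_comp [measurable (raw)]:
  assumes "f \<in> borel_measurable M" "g \<in> borel_measurable M"
  shows "(\<lambda>x. passage_density (f x) (g x)) \<in> borel_measurable M"
  using measurable_compose[OF measurable_Pair[OF assms] borel_measurable_passage_density] by simp

lemma borel_measurable_gauss_comp [measurable (raw)]:
  assumes "f \<in> borel_measurable M" "g \<in> borel_measurable M"
  shows "(\<lambda>x. gauss (f x) (g x)) \<in> borel_measurable M"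
  unfolding normal_density_def using assms by measurable

lemma borel_measurable_triple_density [measurable]:
  "triple_density T \<in> borel_measurable (borel \<Otimes>\<^sub>M (borel \<Otimes>\<^sub>M borel))"
  unfolding triple_density_def[abs_def] by measurable

text \<open>For \<open>m \<ge> 0\<close> this is \<open>triple_density\<close> integrated over the
  maxima above \<open>m\<close>.\<close>

definition argmax_gap_density :: "real \<Rightarrow> real \<Rightarrow> real \<Rightarrow> real \<Rightarrow> ennreal" where
  "argmax_gap_density T m v z = ennreal (2 * (gauss v m * passage_density (T - v) z)) * indicator {0<..<T} v * indicator {0<..} z"

lemma borel_measurable_argmax_gap_density [measurable]:
  "(\<lambda>(v, z). argmax_gap_density T m v z) \<in> borel_measurable (borel \<Otimes>\<^sub>M borel)"
  unfolding argmax_gap_density_def by measurable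

context brownian
begin

text \<open>For \<open>0 < u < T\<close> the path is cut at \<open>u\<close>: the argmax is at most
  \<open>u\<close> exactly if the restarted path does not exceed the gap \<open>a\<close> at
  \<open>u\<close>. Integration over \<open>a\<close> gives \<open>split_weight\<close>, which
  \<open>nn_integral_passage\<close> rewrites as an integral over the argmax. For
  \<open>u \<ge> T\<close> the constraint is void and \<open>nn_integral_passage_T\<close> takes
  over.\<close>

lemma nn_integral_argmax_max_gap:
  assumes "0 < T" "0 \<le> m" and C [measurable]: "C \<in> sets borel"
  shows "(\<integral>\<^sup>+\<omega>. indicator {..u} (run_argmax B T \<omega>) * (indicator {m<..} (run_max B T \<omega>) * indicator C (run_max B T \<omega> - B T \<omega>)) \<partial>M)
    = (\<integral>\<^sup>+z. indicator C z * (\<integral>\<^sup>+v. argmax_gap_density T m v z * indicator {..u} v \<partial>lborel) \<partial>lborel)"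
proof -
  have T: "0 \<le> T" using assms by simp
  consider "u \<le> 0" | "0 < u" "u < T" | "T \<le> u" by linarith
  then show ?thesis
  proof cases
    case 1
    have "indicator {..u} (run_argmax B T \<omega>) * (indicator {m<..} (run_max B T \<omega>) * indicator C (run_max B T \<omega> - B T \<omega>)) = (0 :: ennreal)"
      if "\<omega> \<in> space M" for \<omega>
    proof (rule ccontr)
      assume "\<not> ?thesis"
      then have *: "run_argmax B T \<omega> \<le> u" "m < run_max B T \<omega>" by (auto split: split_indicator_asm)
      \<comment> \<open>An argmax at 0 would make the maximum equal to
        \<open>run_max B 0 = 0\<close>, which is not above \<open>m\<close>.\<close>
      then have "run_argmax B T \<omega> \<le> 0" using 1 by simp
      then have "run_max B T \<omega> \<le> 0"
        using run_argmax_le_iff[OF that order_refl T order_refl] run_max_0[OF that T] by simp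
      then show False using * assms by simp
    qed
    then have "(\<integral>\<^sup>+\<omega>. indicator {..u} (run_argmax B T \<omega>) * (indicator {m<..} (run_max B T \<omega>) * indicator C (run_max B T \<omega> - B T \<omega>)) \<partial>M)
        = (\<integral>\<^sup>+\<omega>. 0 \<partial>M)"
      by (intro nn_integral_cong) simp
    moreover have eq: "argmax_gap_density T m v z * indicator {..u} v = 0" for v z
      using 1 by (auto simp: argmax_gap_density_def split: split_indicator)
    ultimately show ?thesis unfolding eq by simp
  next
    case 2
    then have u: "0 \<le> u" "u \<le> T" "0 < T - u" by auto
    define s where "s = T - u"
    interpret R: brownian M "restart B u" s unfolding s_def using u(1,2) by (rule brownian_restart)
    have s: "0 < s" using u s_def by simp
    have [measurable]: "restart B u s \<in> borel_measurable M" "run_max (restart B u) s \<in> borel_measurable M"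
      using R.random_variable_B R.measurable_run_max s by auto
    \<comment> \<open>The probability that the future does not rise above the gap \<open>a\<close>
      and ends with a gap in \<open>C\<close>.\<close>
    define g :: "real \<Rightarrow> ennreal" where "g a = (\<integral>\<^sup>+\<omega>. indicator C (a - restart B u s \<omega>) * indicator {..a} (run_max (restart B u) s \<omega>) \<partial>M)" for a
    have g_meas [measurable]: "g \<in> borel_measurable borel"
      unfolding g_def[abs_def] indicator_def atMost_iff by measurable
    define F :: "(real \<times> real) \<times> (real \<times> real) \<Rightarrow> ennreal" where
      "F p = indicator {m<..} (fst (fst p)) * (indicator C (fst (fst p) - snd (fst p) - snd (snd p))
         * indicator {..fst (fst p) - snd (fst p)} (fst (snd p)))" for p
    have F: "F \<in> borel_measurable ((borel \<Otimes>\<^sub>M borel) \<Otimes>\<^sub>M (borel \<Otimes>\<^sub>M borel))"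
      unfolding F_def[abs_def] indicator_def atMost_iff greaterThan_iff by measurable
    have X: "(\<lambda>\<omega>. (run_max B u \<omega>, B u \<omega>)) \<in> measurable (generated M B u) (borel \<Otimes>\<^sub>M borel)"
      using u by (intro measurable_Pair measurable_run_max_generated measurable_generated) auto
    have Y: "(\<lambda>\<omega>. (run_max (restart B u) s \<omega>, restart B u s \<omega>)) \<in> measurable (generated M (restart B u) (T - u)) (borel \<Otimes>\<^sub>M borel)"
      using s unfolding s_def[symmetric] by (intro measurable_Pair R.measurable_run_max_generated measurable_generated) auto
    have "(\<integral>\<^sup>+\<omega>. indicator {..u} (run_argmax B T \<omega>) * (indicator {m<..} (run_max B T \<omega>) * indicator C (run_max B T \<omega> - B T \<omega>)) \<partial>M)
       = (\<integral>\<^sup>+\<omega>. F ((run_max B u \<omega>, B u \<omega>), (run_max (restart B u) s \<omega>, restart B u s \<omega>)) \<partial>M)"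
    proof (rule nn_integral_cong)
      fix \<omega> assume \<omega>: "\<omega> \<in> space M"
      have r: "run_argmax B T \<omega> \<le> u \<longleftrightarrow> run_max (restart B u) s \<omega> \<le> run_max B u \<omega> - B u \<omega>"
        unfolding s_def by (rule run_argmax_le_iff_restart[OF \<omega> u(1,2)])
      show "indicator {..u} (run_argmax B T \<omega>) * (indicator {m<..} (run_max B T \<omega>) * indicator C (run_max B T \<omega> - B T \<omega>))
         = F ((run_max B u \<omega>, B u \<omega>), (run_max (restart B u) s \<omega>, restart B u s \<omega>))"
      proof (cases "run_argmax B T \<omega> \<le> u")
        case True
        then show ?thesis
          using run_argmax_past(2)[OF \<omega> u(1,2) True] r by (simp add: F_def restart_def s_def)
      next
        case False
        then show ?thesis using r by (simp add: F_def)
      qed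
    qed
    also have "\<dots> = (\<integral>\<^sup>+\<omega>. (\<integral>\<^sup>+\<omega>'. F ((run_max B u \<omega>, B u \<omega>), (run_max (restart B u) s \<omega>', restart B u s \<omega>')) \<partial>M) \<partial>M)"
      by (rule nn_integral_past_future(1)[OF u(1,2) X Y F])
    also have "\<dots> = (\<integral>\<^sup>+\<omega>. g (run_max B u \<omega> - B u \<omega>) * indicator {m<..} (run_max B u \<omega>) \<partial>M)"
    proof (rule nn_integral_cong)
      fix \<omega>
      have "(\<integral>\<^sup>+\<omega>'. F ((run_max B u \<omega>, B u \<omega>), (run_max (restart B u) s \<omega>', restart B u s \<omega>')) \<partial>M)
         = indicator {m<..} (run_max B u \<omega>) * g (run_max B u \<omega> - B u \<omega>)"
        unfolding F_def fst_conv snd_conv g_def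
        by (rule nn_integral_cmult) (unfold indicator_def atMost_iff, measurable)
      then show "(\<integral>\<^sup>+\<omega>'. F ((run_max B u \<omega>, B u \<omega>), (run_max (restart B u) s \<omega>', restart B u s \<omega>')) \<partial>M)
         = g (run_max B u \<omega> - B u \<omega>) * indicator {m<..} (run_max B u \<omega>)"
        by (simp add: mult.commute)
    qed
    also have "\<dots> = (\<integral>\<^sup>+a. g a * ennreal (2 * gauss u (m + a)) * indicator {0<..} a \<partial>lborel)"
      using 2 assms by (intro nn_integral_gap_run_max_greater) auto
    also have "\<dots> = (\<integral>\<^sup>+a. (\<integral>\<^sup>+z. indicator C z * (ennreal 2 * (ennreal (gauss u (m + a) * (gauss s (a - z) - gauss s (a + z)))
         * indicator {0<..} a)) * indicator {0<..} z \<partial>lborel) \<partial>lborel)"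
    proof (rule nn_integral_cong)
      fix a :: real
      show "g a * ennreal (2 * gauss u (m + a)) * indicator {0<..} a
        = (\<integral>\<^sup>+z. indicator C z * (ennreal 2 * (ennreal (gauss u (m + a) * (gauss s (a - z) - gauss s (a + z)))
         * indicator {0<..} a)) * indicator {0<..} z \<partial>lborel)"
      proof (cases "0 < a")
        case True
        have "g a = (\<integral>\<^sup>+z. indicator C z * ennreal (gauss s (a - z) - gauss s (a + z)) * indicator {0<..} z \<partial>lborel)"
          unfolding g_def by (rule R.nn_integral_B_run_max_le) (use s True in auto)
        then have "g a * ennreal (2 * gauss u (m + a)) = (\<integral>\<^sup>+z. indicator C z * ennreal (gauss s (a - z) - gauss s (a + z)) * indicator {0<..} z
            * ennreal (2 * gauss u (m + a)) \<partial>lborel)"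
          by (simp add: nn_integral_multc)
        also have "\<dots> = (\<integral>\<^sup>+z. indicator C z * (ennreal 2 * (ennreal (gauss u (m + a) * (gauss s (a - z) - gauss s (a + z)))
           * indicator {0<..} a)) * indicator {0<..} z \<partial>lborel)"
          using True by (intro nn_integral_cong) (simp add: ennreal_mult' mult_ac)
        finally show ?thesis using True by simp
      qed simp
    qed
    also have "\<dots> = (\<integral>\<^sup>+z. (\<integral>\<^sup>+a. indicator C z * (ennreal 2 * (ennreal (gauss u (m + a) * (gauss s (a - z) - gauss s (a + z)))
         * indicator {0<..} a)) * indicator {0<..} z \<partial>lborel) \<partial>lborel)"
      by (rule lborel_pair.Fubini') measurable
    also have "\<dots> = (\<integral>\<^sup>+z. indicator C z * (\<integral>\<^sup>+v. argmax_gap_density T m v z * indicator {..u} v \<partial>lborel) \<partial>lborel)"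
    proof (rule nn_integral_cong)
      fix z :: real
      show "(\<integral>\<^sup>+a. indicator C z * (ennreal 2 * (ennreal (gauss u (m + a) * (gauss s (a - z) - gauss s (a + z)))
         * indicator {0<..} a)) * indicator {0<..} z \<partial>lborel)
        = indicator C z * (\<integral>\<^sup>+v. argmax_gap_density T m v z * indicator {..u} v \<partial>lborel)"
      proof (cases "0 < z")
        case True
        have "(\<integral>\<^sup>+a. indicator C z * (ennreal 2 * (ennreal (gauss u (m + a) * (gauss s (a - z) - gauss s (a + z)))
           * indicator {0<..} a)) * indicator {0<..} z \<partial>lborel)
          = indicator C z * (ennreal 2 * (\<integral>\<^sup>+a. ennreal (gauss u (m + a) * (gauss s (a - z) - gauss s (a + z))) * indicator {0<..} a \<partial>lborel))"
          using True by (simp add: nn_integral_cmult)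
        also have "(\<integral>\<^sup>+a. ennreal (gauss u (m + a) * (gauss s (a - z) - gauss s (a + z))) * indicator {0<..} a \<partial>lborel) = ennreal (split_weight T m z u)"
          unfolding s_def by (rule nn_integral_split_weight) (use 2 True in auto)
        \<comment> \<open>Here the fixed time \<open>u\<close> is traded for the position
          \<open>v < u\<close> of the argmax.\<close>
        also have "\<dots> = (\<integral>\<^sup>+v. ennreal (gauss v m * passage_density (T - v) z) * indicator {0<..<u} v \<partial>lborel)"
          by (rule nn_integral_passage[symmetric]) (use 2 True assms in auto)
        also have "ennreal 2 * \<dots> = (\<integral>\<^sup>+v. ennreal 2 * (ennreal (gauss v m * passage_density (T - v) z) * indicator {0<..<u} v) \<partial>lborel)"
          by (rule nn_integral_cmult[symmetric]) measurable
        also have "\<dots> = (\<integral>\<^sup>+v. argmax_gap_density T m v z * indicator {..u} v \<partial>lborel)"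
          using 2 True by (intro nn_integral_cong_AE eventually_mono[OF AE_lborel_singleton[of u]])
            (auto simp: argmax_gap_density_def ennreal_mult' split: split_indicator)
        finally show ?thesis .
      qed (simp add: argmax_gap_density_def)
    qed
    finally show ?thesis .
  next
    case 3
    have "(\<integral>\<^sup>+\<omega>. indicator {..u} (run_argmax B T \<omega>) * (indicator {m<..} (run_max B T \<omega>) * indicator C (run_max B T \<omega> - B T \<omega>)) \<partial>M)
       = (\<integral>\<^sup>+\<omega>. indicator C (run_max B T \<omega> - B T \<omega>) * indicator {m<..} (run_max B T \<omega>) \<partial>M)"
    proof (rule nn_integral_cong)
      fix \<omega> assume "\<omega> \<in> space M"
      then have "run_argmax B T \<omega> \<le> u" using run_argmax(2)[OF _ T order_refl] 3 by force
      then show "indicator {..u} (run_argmax B T \<omega>) * (indicator {m<..} (run_max B T \<omega>) * indicator C (run_max B T \<omega> - B T \<omega>))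
         = (indicator C (run_max B T \<omega> - B T \<omega>) * indicator {m<..} (run_max B T \<omega>) :: ennreal)"
        by (simp add: mult.commute)
    qed
    also have "\<dots> = (\<integral>\<^sup>+a. indicator C a * ennreal (2 * gauss T (m + a)) * indicator {0<..} a \<partial>lborel)"
      by (rule nn_integral_gap_run_max_greater) (use assms in auto)
    also have "\<dots> = (\<integral>\<^sup>+z. indicator C z * (\<integral>\<^sup>+v. argmax_gap_density T m v z * indicator {..u} v \<partial>lborel) \<partial>lborel)"
    proof (rule nn_integral_cong)
      fix z :: real
      show "indicator C z * ennreal (2 * gauss T (m + z)) * indicator {0<..} z
         = indicator C z * (\<integral>\<^sup>+v. argmax_gap_density T m v z * indicator {..u} v \<partial>lborel)"
      proof (cases "0 < z")
        case True
        have "(\<integral>\<^sup>+v. argmax_gap_density T m v z * indicator {..u} v \<partial>lborel)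
           = (\<integral>\<^sup>+v. ennreal 2 * (ennreal (gauss v m * passage_density (T - v) z) * indicator {0<..<T} v) \<partial>lborel)"
          using 3 True by (intro nn_integral_cong) (auto simp: argmax_gap_density_def ennreal_mult' split: split_indicator)
        also have "\<dots> = ennreal 2 * (\<integral>\<^sup>+v. ennreal (gauss v m * passage_density (T - v) z) * indicator {0<..<T} v \<partial>lborel)"
          by (rule nn_integral_cmult) measurable
        also have "\<dots> = ennreal 2 * ennreal (gauss T (m + z))"
          by (simp only: nn_integral_passage_T[OF assms(2) True assms(1)])
        finally show ?thesis using True by (simp add: ennreal_mult')
      qed (simp add: argmax_gap_density_def)
    qed
    finally show ?thesis .
  qed
qed

text \<open>Half-lines are used in two nested stages. For fixed \<open>u\<close>, the law of maximum
  and gap restricted to an argmax at most \<open>u\<close> is identified by half-lines of the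
  maximum; this yields all sets \<open>{..u} \<times> D\<close>, and these identify the law of the
  triple.\<close>

lemma distr_argmax_max_gap:
  assumes "0 < T"
  shows "distr M (borel \<Otimes>\<^sub>M (borel \<Otimes>\<^sub>M borel)) (\<lambda>\<omega>. (run_argmax B T \<omega>, (run_max B T \<omega>, run_max B T \<omega> - B T \<omega>)))
    = density (lborel \<Otimes>\<^sub>M (lborel \<Otimes>\<^sub>M lborel)) (triple_density T)" (is "?L = ?R")
proof (rule measure_eqI_atMost_times)
  have T: "0 \<le> T" using assms by simp
  have [measurable]: "B T \<in> borel_measurable M" "run_max B T \<in> borel_measurable M" "run_argmax B T \<in> borel_measurable M"
    using random_variable_B measurable_run_max measurable_run_argmax T by auto
  interpret P: pair_sigma_finite "lborel :: real measure" "(lborel :: real measure) \<Otimes>\<^sub>M (lborel :: real measure)"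
    unfolding lborel_prod by (rule lborel_pair.pair_sigma_finite_axioms)
  show "emeasure ?L (space ?L) < \<infinity>"
    by (subst emeasure_distr) (auto simp: less_top[symmetric])
  show "sets ?L = sets (borel \<Otimes>\<^sub>M (borel \<Otimes>\<^sub>M borel))"
    by simp
  show "sets ?R = sets (borel \<Otimes>\<^sub>M (borel \<Otimes>\<^sub>M borel))"
    by (simp cong: sets_pair_measure_cong)
  fix u :: real and D :: "(real \<times> real) set" assume D [measurable]: "D \<in> sets (borel \<Otimes>\<^sub>M borel)"
  define K where "K = density M (\<lambda>\<omega>. indicator {..u} (run_argmax B T \<omega>))"
  define Q where "Q q = (\<integral>\<^sup>+v. triple_density T (v, q) * indicator {..u} v \<partial>lborel)" for q
  have [measurable]: "(\<lambda>\<omega>. (run_max B T \<omega>, run_max B T \<omega> - B T \<omega>)) \<in> measurable K (borel \<Otimes>\<^sub>M borel)"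
    by (simp add: K_def)
  have Q [measurable]: "Q \<in> borel_measurable (borel \<Otimes>\<^sub>M borel)"
    unfolding Q_def[abs_def] by measurable
  have L: "emeasure (distr K (borel \<Otimes>\<^sub>M borel) (\<lambda>\<omega>. (run_max B T \<omega>, run_max B T \<omega> - B T \<omega>))) E
      = (\<integral>\<^sup>+\<omega>. indicator {..u} (run_argmax B T \<omega>) * indicator E (run_max B T \<omega>, run_max B T \<omega> - B T \<omega>) \<partial>M)"
    if [measurable]: "E \<in> sets (borel \<Otimes>\<^sub>M borel)" for E
  proof -
    have "emeasure (distr K (borel \<Otimes>\<^sub>M borel) (\<lambda>\<omega>. (run_max B T \<omega>, run_max B T \<omega> - B T \<omega>))) E
       = (\<integral>\<^sup>+\<omega>. indicator E (run_max B T \<omega>, run_max B T \<omega> - B T \<omega>) \<partial>K)"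
      by (subst nn_integral_indicator[symmetric], simp, subst nn_integral_distr) auto
    also have "\<dots> = (\<integral>\<^sup>+\<omega>. indicator {..u} (run_argmax B T \<omega>) * indicator E (run_max B T \<omega>, run_max B T \<omega> - B T \<omega>) \<partial>M)"
      unfolding K_def by (rule nn_integral_density) measurable
    finally show ?thesis .
  qed
  have "distr K (borel \<Otimes>\<^sub>M borel) (\<lambda>\<omega>. (run_max B T \<omega>, run_max B T \<omega> - B T \<omega>)) = density (lborel \<Otimes>\<^sub>M lborel) Q" (is "?L' = ?R'")
  proof (rule measure_eqI_halflines_times)
    show "sets ?L' = sets (borel \<Otimes>\<^sub>M borel)" by simp
    show "sets ?R' = sets (borel \<Otimes>\<^sub>M borel)" by (simp cong: sets_pair_measure_cong)
    have "emeasure ?L' (space ?L') = (\<integral>\<^sup>+\<omega>. indicator {..u} (run_argmax B T \<omega>)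
        * indicator (space (borel \<Otimes>\<^sub>M borel)) (run_max B T \<omega>, run_max B T \<omega> - B T \<omega>) \<partial>M)"
      by (subst L[OF sets.top, symmetric]) simp
    also have "\<dots> \<le> (\<integral>\<^sup>+\<omega>. 1 \<partial>M)"
      by (intro nn_integral_mono) (auto split: split_indicator)
    also have "\<dots> < \<infinity>" by (simp add: emeasure_space_1)
    finally show "emeasure ?L' (space ?L') < \<infinity>" .
    fix m :: real and C :: "real set" assume C [measurable]: "C \<in> sets borel"
    \<comment> \<open>The preceding formula is for nonnegative levels. The maximum is almost surely
      positive, so the level \<open>max 0 m\<close> gives the same event up to a null set.\<close>
    define m' where "m' = max 0 m"
    have m': "0 \<le> m'" by (simp add: m'_def)
    have "emeasure ?L' ({m<..} \<times> C)
        = (\<integral>\<^sup>+\<omega>. indicator {..u} (run_argmax B T \<omega>) * indicator ({m<..} \<times> C) (run_max B T \<omega>, run_max B T \<omega> - B T \<omega>) \<partial>M)"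
      by (rule L) simp
    also have "\<dots> = (\<integral>\<^sup>+\<omega>. indicator {..u} (run_argmax B T \<omega>) * (indicator {m'<..} (run_max B T \<omega>) * indicator C (run_max B T \<omega> - B T \<omega>)) \<partial>M)"
      using AE_run_max_pos[OF assms order_refl]
      by (intro nn_integral_cong_AE) (auto elim!: eventually_mono simp: m'_def split: split_indicator)
    also have "\<dots> = (\<integral>\<^sup>+z. indicator C z * (\<integral>\<^sup>+v. argmax_gap_density T m' v z * indicator {..u} v \<partial>lborel) \<partial>lborel)"
      by (rule nn_integral_argmax_max_gap[OF assms m' C])
    also have "\<dots> = (\<integral>\<^sup>+z. (\<integral>\<^sup>+k. Q (k, z) * indicator ({m<..} \<times> C) (k, z) \<partial>lborel) \<partial>lborel)"
    proof (rule nn_integral_cong)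
      fix z :: real
      define H where "H k v = indicator C z * (ennreal (passage_density (T - v) z) * indicator {0<..<T} v * indicator {..u} v * indicator {0<..} z)
        * (ennreal 2 * (ennreal (passage_density v k) * indicator {m'<..} k))" for k v
      have [measurable]: "(\<lambda>(k, v). H k v) \<in> borel_measurable (borel \<Otimes>\<^sub>M borel)"
        unfolding H_def[abs_def] by measurable
      have "(\<integral>\<^sup>+k. Q (k, z) * indicator ({m<..} \<times> C) (k, z) \<partial>lborel) = (\<integral>\<^sup>+k. (\<integral>\<^sup>+v. H k v \<partial>lborel) \<partial>lborel)"
      proof (rule nn_integral_cong)
        fix k :: real
        have "Q (k, z) * indicator ({m<..} \<times> C) (k, z)
            = (\<integral>\<^sup>+v. triple_density T (v, k, z) * indicator {..u} v * indicator ({m<..} \<times> C) (k, z) \<partial>lborel)"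
          unfolding Q_def by (rule nn_integral_multc[symmetric]) measurable
        also have "\<dots> = (\<integral>\<^sup>+v. H k v \<partial>lborel)"
        proof (rule nn_integral_cong)
          fix v :: real
          show "triple_density T (v, k, z) * indicator {..u} v * indicator ({m<..} \<times> C) (k, z) = H k v"
          proof (cases "0 < v \<and> v < T \<and> v \<le> u \<and> 0 < k \<and> m < k \<and> 0 < z \<and> z \<in> C")
            case True
            then have "0 \<le> passage_density v k" "0 \<le> passage_density (T - v) z"
              by (auto intro!: passage_density_nonneg)
            then show ?thesis
              using True by (simp add: triple_density_def H_def m'_def ennreal_mult' mult_ac)
          next
            case False
            then show ?thesis by (auto simp: triple_density_def H_def m'_def split: split_indicator)
          qed
        qed
        finally show "Q (k, z) * indicator ({m<..} \<times> C) (k, z) = (\<integral>\<^sup>+v. H k v \<partial>lborel)" .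
      qed
      also have "\<dots> = (\<integral>\<^sup>+v. (\<integral>\<^sup>+k. H k v \<partial>lborel) \<partial>lborel)"
        by (rule lborel_pair.Fubini'[symmetric]) simp
      also have "\<dots> = (\<integral>\<^sup>+v. indicator C z * (argmax_gap_density T m' v z * indicator {..u} v) \<partial>lborel)"
      proof (rule nn_integral_cong)
        fix v :: real
        show "(\<integral>\<^sup>+k. H k v \<partial>lborel) = indicator C z * (argmax_gap_density T m' v z * indicator {..u} v)"
        proof (cases "0 < v \<and> v < T \<and> 0 < z")
          case True
          have "(\<integral>\<^sup>+k. ennreal (passage_density v (k + 0)) * indicator {m'<..} k \<partial>lborel) = ennreal (gauss v (m' + 0))"
            using True m' by (intro nn_integral_passage_density_Ioi) auto
          then have "(\<integral>\<^sup>+k. H k v \<partial>lborel) = indicator C z * (ennreal (passage_density (T - v) z) * indicator {0<..<T} v * indicator {..u} v * indicator {0<..} z)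
              * (ennreal 2 * ennreal (gauss v m'))"
            unfolding H_def by (simp add: nn_integral_cmult)
          moreover have "ennreal (2 * (gauss v m' * passage_density (T - v) z)) = ennreal (passage_density (T - v) z) * (ennreal 2 * ennreal (gauss v m'))"
            using True by (subst mult.commute[of "gauss v m'"]) (simp add: ennreal_mult' passage_density_nonneg mult_ac)
          ultimately show ?thesis
            using True by (simp add: argmax_gap_density_def mult_ac)
        next
          case False
          then have "H k v = 0" for k by (auto simp: H_def split: split_indicator)
          moreover have "argmax_gap_density T m' v z = 0"
            using False by (auto simp: argmax_gap_density_def split: split_indicator)
          ultimately show ?thesis by simp
        qed
      qed
      also have "\<dots> = indicator C z * (\<integral>\<^sup>+v. argmax_gap_density T m' v z * indicator {..u} v \<partial>lborel)"
        by (rule nn_integral_cmult) measurable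
      finally show "indicator C z * (\<integral>\<^sup>+v. argmax_gap_density T m' v z * indicator {..u} v \<partial>lborel)
         = (\<integral>\<^sup>+k. Q (k, z) * indicator ({m<..} \<times> C) (k, z) \<partial>lborel)" by simp
    qed
    also have "\<dots> = (\<integral>\<^sup>+p. Q p * indicator ({m<..} \<times> C) p \<partial>(lborel \<Otimes>\<^sub>M lborel))"
      by (rule lborel_pair.nn_integral_snd) simp
    also have "\<dots> = emeasure ?R' ({m<..} \<times> C)"
      by (subst emeasure_density) auto
    finally show "emeasure ?L' ({m<..} \<times> C) = emeasure ?R' ({m<..} \<times> C)" .
  qed
  then have eq: "emeasure ?L' D = emeasure ?R' D" by simp
  have "emeasure ?L ({..u} \<times> D) = (\<integral>\<^sup>+\<omega>. indicator {..u} (run_argmax B T \<omega>) * indicator D (run_max B T \<omega>, run_max B T \<omega> - B T \<omega>) \<partial>M)"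
    by (subst nn_integral_indicator[symmetric], simp, subst nn_integral_distr) (auto simp: indicator_times)
  also have "\<dots> = emeasure ?R' D"
    using L[OF D] eq by simp
  also have "\<dots> = (\<integral>\<^sup>+q. Q q * indicator D q \<partial>(lborel \<Otimes>\<^sub>M lborel))"
    by (subst emeasure_density) auto
  also have "\<dots> = (\<integral>\<^sup>+q. (\<integral>\<^sup>+v. triple_density T (v, q) * indicator ({..u} \<times> D) (v, q) \<partial>lborel) \<partial>(lborel \<Otimes>\<^sub>M lborel))"
  proof (rule nn_integral_cong)
    fix q :: "real \<times> real"
    obtain a b where q: "q = (a, b)" by (cases q)
    have "Q q * indicator D q = (\<integral>\<^sup>+v. triple_density T (v, q) * indicator {..u} v * indicator D q \<partial>lborel)"
      unfolding Q_def q by (rule nn_integral_multc[symmetric]) measurable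
    then show "Q q * indicator D q = (\<integral>\<^sup>+v. triple_density T (v, q) * indicator ({..u} \<times> D) (v, q) \<partial>lborel)"
      by (simp add: indicator_times mult.assoc)
  qed
  also have "\<dots> = (\<integral>\<^sup>+p. triple_density T p * indicator ({..u} \<times> D) p \<partial>(lborel \<Otimes>\<^sub>M (lborel \<Otimes>\<^sub>M lborel)))"
    by (rule P.nn_integral_snd) measurable
  also have "\<dots> = emeasure ?R ({..u} \<times> D)"
    by (subst emeasure_density) auto
  finally show "emeasure ?L ({..u} \<times> D) = emeasure ?R ({..u} \<times> D)" .
qed

lemma nn_integral_argmax_max_end:
  assumes "0 < T" and F [measurable]: "F \<in> borel_measurable (borel \<Otimes>\<^sub>M (borel \<Otimes>\<^sub>M borel))"
  shows "(\<integral>\<^sup>+\<omega>. F (run_argmax B T \<omega>, (run_max B T \<omega>, run_max B T \<omega> - B T \<omega>)) \<partial>M)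
    = (\<integral>\<^sup>+u. (\<integral>\<^sup>+m. (\<integral>\<^sup>+z. triple_density T (u, (m, z)) * F (u, (m, z)) \<partial>lborel) \<partial>lborel) \<partial>lborel)"
proof -
  have T: "0 \<le> T" using assms by simp
  have [measurable]: "B T \<in> borel_measurable M" "run_max B T \<in> borel_measurable M" "run_argmax B T \<in> borel_measurable M"
    using random_variable_B measurable_run_max measurable_run_argmax T by auto
  have S: "sigma_finite_measure ((lborel :: real measure) \<Otimes>\<^sub>M (lborel :: real measure))"
    unfolding lborel_prod by (rule sigma_finite_lborel)
  have "(\<integral>\<^sup>+\<omega>. F (run_argmax B T \<omega>, (run_max B T \<omega>, run_max B T \<omega> - B T \<omega>)) \<partial>M)
    = (\<integral>\<^sup>+p. F p \<partial>distr M (borel \<Otimes>\<^sub>M (borel \<Otimes>\<^sub>M borel)) (\<lambda>\<omega>. (run_argmax B T \<omega>, (run_max B T \<omega>, run_max B T \<omega> - B T \<omega>))))"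
    by (subst nn_integral_distr) auto
  also have "\<dots> = (\<integral>\<^sup>+p. triple_density T p * F p \<partial>(lborel \<Otimes>\<^sub>M (lborel \<Otimes>\<^sub>M lborel)))"
    unfolding distr_argmax_max_gap[OF assms(1)] by (subst nn_integral_density) auto
  also have "\<dots> = (\<integral>\<^sup>+u. (\<integral>\<^sup>+q. triple_density T (u, q) * F (u, q) \<partial>(lborel \<Otimes>\<^sub>M lborel)) \<partial>lborel)"
    by (rule sigma_finite_measure.nn_integral_fst[OF S, symmetric]) measurable
  also have "\<dots> = (\<integral>\<^sup>+u. (\<integral>\<^sup>+m. (\<integral>\<^sup>+z. triple_density T (u, (m, z)) * F (u, (m, z)) \<partial>lborel) \<partial>lborel) \<partial>lborel)"
    by (intro nn_integral_cong lborel.nn_integral_fst[symmetric]) measurable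
  finally show ?thesis .
qed

text \<open>Integrating the gap out of the product density leaves the mass
  \<open>gauss (T - u) 0\<close> of the second leg.\<close>

lemma nn_integral_argmax_max:
  assumes "0 < T" and F [measurable]: "F \<in> borel_measurable (borel \<Otimes>\<^sub>M borel)"
  shows "(\<integral>\<^sup>+\<omega>. F (run_argmax B T \<omega>, run_max B T \<omega>) \<partial>M)
    = (\<integral>\<^sup>+u. (\<integral>\<^sup>+m. ennreal (2 * passage_density u m / sqrt (2 * pi * (T - u))) * indicator {0<..<T} u * indicator {0<..} m * F (u, m) \<partial>lborel) \<partial>lborel)"
proof -
  have "(\<integral>\<^sup>+\<omega>. F (run_argmax B T \<omega>, run_max B T \<omega>) \<partial>M)
     = (\<integral>\<^sup>+\<omega>. (\<lambda>p. F (fst p, fst (snd p))) (run_argmax B T \<omega>, (run_max B T \<omega>, run_max B T \<omega> - B T \<omega>)) \<partial>M)"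
    by simp
  also have "\<dots> = (\<integral>\<^sup>+u. (\<integral>\<^sup>+m. (\<integral>\<^sup>+z. triple_density T (u, (m, z)) * F (fst (u, (m, z)), fst (snd (u, (m, z)))) \<partial>lborel) \<partial>lborel) \<partial>lborel)"
    by (rule nn_integral_argmax_max_end[OF assms(1)]) measurable
  also have "\<dots> = (\<integral>\<^sup>+u. (\<integral>\<^sup>+m. ennreal (2 * passage_density u m / sqrt (2 * pi * (T - u))) * indicator {0<..<T} u * indicator {0<..} m * F (u, m) \<partial>lborel) \<partial>lborel)"
  proof (rule nn_integral_cong, rule nn_integral_cong)
    fix u m :: real
    show "(\<integral>\<^sup>+z. triple_density T (u, (m, z)) * F (fst (u, (m, z)), fst (snd (u, (m, z)))) \<partial>lborel)
      = ennreal (2 * passage_density u m / sqrt (2 * pi * (T - u))) * indicator {0<..<T} u * indicator {0<..} m * F (u, m)"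
    proof (cases "0 < u \<and> u < T \<and> 0 < m")
      case True
      then have p: "0 \<le> 2 * passage_density u m" by (simp add: passage_density_nonneg)
      have "(\<integral>\<^sup>+z. triple_density T (u, (m, z)) * F (fst (u, (m, z)), fst (snd (u, (m, z)))) \<partial>lborel)
        = (\<integral>\<^sup>+z. ennreal (2 * passage_density u m) * F (u, m) * (ennreal (passage_density (T - u) (z + 0)) * indicator {0<..} z) \<partial>lborel)"
        using True p by (intro nn_integral_cong) (auto simp: triple_density_def ennreal_mult' mult_ac split: split_indicator)
      also have "\<dots> = ennreal (2 * passage_density u m) * F (u, m) * (\<integral>\<^sup>+z. ennreal (passage_density (T - u) (z + 0)) * indicator {0<..} z \<partial>lborel)"
        by (rule nn_integral_cmult) measurable
      also have "(\<integral>\<^sup>+z. ennreal (passage_density (T - u) (z + 0)) * indicator {0<..} z \<partial>lborel) = ennreal (gauss (T - u) (0 + 0))"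
        by (rule nn_integral_passage_density_Ioi) (use True in auto)
      also have "gauss (T - u) (0 + 0) = 1 / sqrt (2 * pi * (T - u))"
        using True by (simp add: gauss_0)
      also have "ennreal (2 * passage_density u m) * F (u, m) * ennreal (1 / sqrt (2 * pi * (T - u)))
         = ennreal (2 * passage_density u m * (1 / sqrt (2 * pi * (T - u)))) * F (u, m)"
        unfolding ennreal_mult'[OF p] by (simp add: mult_ac)
      finally show ?thesis using True by simp
    next
      case False
      then have z: "triple_density T (u, (m, z)) = 0" for z
        by (auto simp: triple_density_def split: split_indicator)
      show ?thesis unfolding z using False by (auto split: split_indicator)
    qed
  qed
  finally show ?thesis .
qed

end

subsection \<open>Moments of the gap to the maximum, localised by the argmax\<close>

context brownian
begin

text \<open>If the argmax \<open>u\<close> lies after \<open>t\<close>, the restarted path has the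
  argmax \<open>u - t\<close> and a maximum \<open>z\<close>, and the maximum of the whole path is
  \<open>B t + z\<close>. The past enters only through \<open>B t\<close> and the condition that its
  gap at \<open>t\<close> is below \<open>z\<close>, which excludes an earlier maximum; for fixed
  \<open>z\<close> it contributes \<open>\<psi> z\<close>.\<close>

lemma nn_integral_before_argmax:
  assumes t: "0 \<le> t" "t < T"
    and [measurable]: "A \<in> sets borel" "a \<in> borel_measurable borel" "P \<in> borel_measurable borel"
    and \<psi>: "\<And>z. 0 < z \<Longrightarrow> (\<integral>\<^sup>+\<omega>. P (B t \<omega> + z) * indicator {..<z} (run_max B t \<omega> - B t \<omega>) \<partial>M) = \<psi> z"
    and A: "A \<subseteq> {t<..<T}"
  shows "(\<integral>\<^sup>+\<omega>. a (run_max B T \<omega> - B t \<omega>) * P (run_max B T \<omega>) * indicator A (run_argmax B T \<omega>) \<partial>M)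
    = (\<integral>\<^sup>+u. indicator A u * (ennreal (2 / sqrt (2 * pi * (T - u)))
         * (\<integral>\<^sup>+z. ennreal (passage_density (u - t) z) * (a z * \<psi> z) * indicator {0<..} z \<partial>lborel)) \<partial>lborel)"
proof -
  have t': "t \<le> T" using t by simp
  define s where "s = T - t"
  have s: "0 < s" using t by (simp add: s_def)
  interpret R: brownian M "restart B t" s unfolding s_def using t(1) t' by (rule brownian_restart)
  have [measurable]: "B t \<in> borel_measurable M" "run_max B t \<in> borel_measurable M"
    using random_variable_B measurable_run_max t t' by auto
  define G :: "(real \<times> real) \<times> (real \<times> real) \<Rightarrow> ennreal" where
    "G p = a (snd (snd p)) * P (snd (fst p) + snd (snd p)) * indicator A (t + fst (snd p))
       * indicator {..<snd (snd p)} (fst (fst p) - snd (fst p))" for p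
  have G: "G \<in> borel_measurable ((borel \<Otimes>\<^sub>M borel) \<Otimes>\<^sub>M (borel \<Otimes>\<^sub>M borel))"
    unfolding G_def[abs_def] indicator_def[of "{..<_}"] lessThan_iff by measurable
  have X: "(\<lambda>\<omega>. (run_max B t \<omega>, B t \<omega>)) \<in> measurable (generated M B t) (borel \<Otimes>\<^sub>M borel)"
    using t t' by (intro measurable_Pair measurable_run_max_generated measurable_generated) auto
  have Y: "(\<lambda>\<omega>. (run_argmax (restart B t) s \<omega>, run_max (restart B t) s \<omega>)) \<in> measurable (generated M (restart B t) (T - t)) (borel \<Otimes>\<^sub>M borel)"
    using s unfolding s_def[symmetric] by (intro measurable_Pair R.measurable_run_max_generated R.measurable_run_argmax_generated) auto
  define H where "H q = (\<integral>\<^sup>+\<omega>. G ((run_max B t \<omega>, B t \<omega>), q) \<partial>M)" for q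
  have [measurable]: "H \<in> borel_measurable (borel \<Otimes>\<^sub>M borel)"
    unfolding H_def[abs_def] using G by measurable
  have "(\<integral>\<^sup>+\<omega>. a (run_max B T \<omega> - B t \<omega>) * P (run_max B T \<omega>) * indicator A (run_argmax B T \<omega>) \<partial>M)
    = (\<integral>\<^sup>+\<omega>. G ((run_max B t \<omega>, B t \<omega>), (run_argmax (restart B t) s \<omega>, run_max (restart B t) s \<omega>)) \<partial>M)"
  proof (rule nn_integral_cong)
    fix \<omega> assume \<omega>: "\<omega> \<in> space M"
    have r: "run_argmax B T \<omega> \<le> t \<longleftrightarrow> run_max (restart B t) s \<omega> \<le> run_max B t \<omega> - B t \<omega>"
      unfolding s_def by (rule run_argmax_le_iff_restart[OF \<omega> t(1) t'])
    show "a (run_max B T \<omega> - B t \<omega>) * P (run_max B T \<omega>) * indicator A (run_argmax B T \<omega>)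
      = G ((run_max B t \<omega>, B t \<omega>), (run_argmax (restart B t) s \<omega>, run_max (restart B t) s \<omega>))"
    proof (cases "run_argmax B T \<omega> \<le> t")
      case True
      then have "run_argmax B T \<omega> \<notin> A" using A by auto
      then show ?thesis using True r by (simp add: G_def)
    next
      case False
      then have "t < run_argmax B T \<omega>" by simp
      from run_argmax_future[OF \<omega> t(1) t' this] show ?thesis
        using False r by (simp add: G_def s_def)
    qed
  qed
  \<comment> \<open>The past is the inner integral here, since the argmax and the maximum to be kept
    are those of the future.\<close>
  also have "\<dots> = (\<integral>\<^sup>+\<omega>. H (run_argmax (restart B t) s \<omega>, run_max (restart B t) s \<omega>) \<partial>M)"
    unfolding H_def by (rule nn_integral_past_future(2)[OF t(1) t' X Y G])
  also have "\<dots> = (\<integral>\<^sup>+v. (\<integral>\<^sup>+z. ennreal (2 * passage_density v z / sqrt (2 * pi * (s - v))) * indicator {0<..<s} v * indicator {0<..} z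
      * H (v, z) \<partial>lborel) \<partial>lborel)"
    by (rule R.nn_integral_argmax_max[OF s]) measurable
  also have "\<dots> = ennreal \<bar>1\<bar> * (\<integral>\<^sup>+u. (\<integral>\<^sup>+z. ennreal (2 * passage_density (- t + 1 * u) z / sqrt (2 * pi * (s - (- t + 1 * u))))
      * indicator {0<..<s} (- t + 1 * u) * indicator {0<..} z * H (- t + 1 * u, z) \<partial>lborel) \<partial>lborel)"
  proof (rule nn_integral_real_affine)
    show "(\<lambda>v. \<integral>\<^sup>+z. ennreal (2 * passage_density v z / sqrt (2 * pi * (s - v))) * indicator {0<..<s} v * indicator {0<..} z
      * H (v, z) \<partial>lborel) \<in> borel_measurable borel"
      by measurable
  qed simp
  also have "\<dots> = (\<integral>\<^sup>+u. indicator A u * (ennreal (2 / sqrt (2 * pi * (T - u)))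
         * (\<integral>\<^sup>+z. ennreal (passage_density (u - t) z) * (a z * \<psi> z) * indicator {0<..} z \<partial>lborel)) \<partial>lborel)"
    unfolding abs_one ennreal_1 mult_1
  proof (rule nn_integral_cong)
    fix u :: real
    \<comment> \<open>\<open>\<psi>\<close> is known at positive arguments only, so measurability is
      shown for the integral that it stands for.\<close>
    define h where "h z = ennreal (passage_density (u - t) z) * (a z * (\<integral>\<^sup>+\<omega>. P (B t \<omega> + z) * indicator {..<z} (run_max B t \<omega> - B t \<omega>) \<partial>M)) * indicator {0<..} z" for z
    have h: "h \<in> borel_measurable borel"
      unfolding h_def[abs_def] indicator_def[of "{..<_}"] lessThan_iff by measurable
    have h_eq: "h z = ennreal (passage_density (u - t) z) * (a z * \<psi> z) * indicator {0<..} z" for z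
      by (simp add: h_def \<psi> split: split_indicator)
    have Hz: "H (- t + u, z) = indicator A u * (a z * \<psi> z)" if "0 < z" for z
    proof -
      have "H (- t + u, z) = (\<integral>\<^sup>+\<omega>. (a z * indicator A u) * (P (B t \<omega> + z) * indicator {..<z} (run_max B t \<omega> - B t \<omega>)) \<partial>M)"
        unfolding H_def G_def by (intro nn_integral_cong) (simp add: mult_ac)
      also have "\<dots> = (a z * indicator A u) * (\<integral>\<^sup>+\<omega>. P (B t \<omega> + z) * indicator {..<z} (run_max B t \<omega> - B t \<omega>) \<partial>M)"
        by (rule nn_integral_cmult) measurable
      finally show ?thesis unfolding \<psi>[OF that] by (simp add: mult_ac)
    qed
    show "(\<integral>\<^sup>+z. ennreal (2 * passage_density (- t + u) z / sqrt (2 * pi * (s - (- t + u))))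
      * indicator {0<..<s} (- t + u) * indicator {0<..} z * H (- t + u, z) \<partial>lborel)
      = indicator A u * (ennreal (2 / sqrt (2 * pi * (T - u)))
         * (\<integral>\<^sup>+z. ennreal (passage_density (u - t) z) * (a z * \<psi> z) * indicator {0<..} z \<partial>lborel))"
    proof (cases "u \<in> A")
      case True
      then have u: "t < u" "u < T" using A by auto
      have "(\<integral>\<^sup>+z. ennreal (2 * passage_density (- t + u) z / sqrt (2 * pi * (s - (- t + u))))
        * indicator {0<..<s} (- t + u) * indicator {0<..} z * H (- t + u, z) \<partial>lborel)
        = (\<integral>\<^sup>+z. ennreal (2 / sqrt (2 * pi * (T - u))) * h z \<partial>lborel)"
      proof (rule nn_integral_cong)
        fix z :: real
        show "ennreal (2 * passage_density (- t + u) z / sqrt (2 * pi * (s - (- t + u))))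
          * indicator {0<..<s} (- t + u) * indicator {0<..} z * H (- t + u, z) = ennreal (2 / sqrt (2 * pi * (T - u))) * h z"
        proof (cases "0 < z")
          case z: True
          have p: "0 \<le> 2 / sqrt (2 * pi * (T - u))" using u by simp
          have "ennreal (2 * passage_density (- t + u) z / sqrt (2 * pi * (s - (- t + u))))
            = ennreal (2 / sqrt (2 * pi * (T - u)) * passage_density (u - t) z)"
            by (simp add: s_def)
          also have "\<dots> = ennreal (2 / sqrt (2 * pi * (T - u))) * ennreal (passage_density (u - t) z)"
            by (rule ennreal_mult'[OF p])
          finally show ?thesis
            using True u z Hz[OF z] by (simp add: h_eq s_def mult.assoc)
        qed (simp add: h_def)
      qed
      also have "\<dots> = ennreal (2 / sqrt (2 * pi * (T - u))) * (\<integral>\<^sup>+z. h z \<partial>lborel)"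
        using h by (intro nn_integral_cmult) simp
      finally show ?thesis using True unfolding h_eq by simp
    next
      case False
      have eq: "ennreal (2 * passage_density (- t + u) z / sqrt (2 * pi * (s - (- t + u))))
        * indicator {0<..<s} (- t + u) * indicator {0<..} z * H (- t + u, z) = 0" for z
        using False Hz[of z] by (cases "0 < z") simp_all
      show ?thesis unfolding eq using False by simp
    qed
  qed
  finally show ?thesis .
qed

text \<open>If the argmax lies before \<open>t\<close>, it and the maximum belong to the path
  stopped at \<open>t\<close>. The future enters only by not rising above the gap \<open>z\<close>,
  which has probability \<open>max_cdf (T - t) z\<close>. The product form of
  \<open>triple_density t\<close> is thereby preserved, and the integrals over \<open>m\<close> and
  \<open>z\<close> factor.\<close>

lemma nn_integral_after_argmax:
  assumes t: "0 < t" "t \<le> T"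
    and [measurable]: "A \<in> sets borel" "a \<in> borel_measurable borel" "b \<in> borel_measurable borel"
    and A: "A \<subseteq> {0<..<t}"
  shows "(\<integral>\<^sup>+\<omega>. b (run_max B T \<omega> - B t \<omega>) * a (run_max B T \<omega>) * indicator A (run_argmax B T \<omega>) \<partial>M)
    = (\<integral>\<^sup>+u. indicator A u * ((\<integral>\<^sup>+m. ennreal (2 * passage_density u m) * a m * indicator {0<..} m \<partial>lborel)
         * (\<integral>\<^sup>+z. ennreal (passage_density (t - u) z * max_cdf (T - t) z) * b z * indicator {0<..} z \<partial>lborel)) \<partial>lborel)"
proof -
  have t': "0 \<le> t" using t by simp
  define s where "s = T - t"
  have s: "0 \<le> s" using t by (simp add: s_def)
  interpret R: brownian M "restart B t" s unfolding s_def using t' t(2) by (rule brownian_restart)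
  interpret S: brownian M B t using t(2) by (rule brownian_stop)
  have [measurable]: "B t \<in> borel_measurable M" "run_max B t \<in> borel_measurable M" "run_argmax B t \<in> borel_measurable M"
      "run_max (restart B t) s \<in> borel_measurable M"
    using random_variable_B measurable_run_max measurable_run_argmax R.measurable_run_max t t' s by auto
  define c where "c z = (\<integral>\<^sup>+\<omega>. indicator {..z} (run_max (restart B t) s \<omega>) \<partial>M)" for z
  have c_meas [measurable]: "c \<in> borel_measurable borel"
    unfolding c_def[abs_def] indicator_def atMost_iff by measurable
  define F :: "real \<times> (real \<times> real) \<Rightarrow> ennreal" where
    "F p = b (snd (snd p)) * a (fst (snd p)) * indicator A (fst p)" for p
  have F_meas [measurable]: "F \<in> borel_measurable (borel \<Otimes>\<^sub>M (borel \<Otimes>\<^sub>M borel))"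
    unfolding F_def[abs_def] by measurable
  define G :: "(real \<times> (real \<times> real)) \<times> real \<Rightarrow> ennreal" where
    "G p = F (fst p) * indicator {..snd (snd (fst p))} (snd p)" for p
  have G: "G \<in> borel_measurable ((borel \<Otimes>\<^sub>M (borel \<Otimes>\<^sub>M borel)) \<Otimes>\<^sub>M borel)"
    unfolding G_def[abs_def] indicator_def atMost_iff by measurable
  have X: "(\<lambda>\<omega>. (run_argmax B t \<omega>, (run_max B t \<omega>, run_max B t \<omega> - B t \<omega>))) \<in> measurable (generated M B t) (borel \<Otimes>\<^sub>M (borel \<Otimes>\<^sub>M borel))"
    using t t' by (intro measurable_Pair borel_measurable_diff measurable_run_max_generated measurable_run_argmax_generated measurable_generated) auto
  have Y: "run_max (restart B t) s \<in> measurable (generated M (restart B t) (T - t)) borel"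
    using s unfolding s_def[symmetric] by (intro R.measurable_run_max_generated) auto
  have "(\<integral>\<^sup>+\<omega>. b (run_max B T \<omega> - B t \<omega>) * a (run_max B T \<omega>) * indicator A (run_argmax B T \<omega>) \<partial>M)
    = (\<integral>\<^sup>+\<omega>. G ((run_argmax B t \<omega>, (run_max B t \<omega>, run_max B t \<omega> - B t \<omega>)), run_max (restart B t) s \<omega>) \<partial>M)"
  proof (rule nn_integral_cong)
    fix \<omega> assume \<omega>: "\<omega> \<in> space M"
    have r: "run_argmax B T \<omega> \<le> t \<longleftrightarrow> run_max (restart B t) s \<omega> \<le> run_max B t \<omega> - B t \<omega>"
      unfolding s_def by (rule run_argmax_le_iff_restart[OF \<omega> t' t(2)])
    show "b (run_max B T \<omega> - B t \<omega>) * a (run_max B T \<omega>) * indicator A (run_argmax B T \<omega>)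
      = G ((run_argmax B t \<omega>, (run_max B t \<omega>, run_max B t \<omega> - B t \<omega>)), run_max (restart B t) s \<omega>)"
    proof (cases "run_argmax B T \<omega> \<le> t")
      case True
      then show ?thesis
        using run_argmax_past[OF \<omega> t' t(2) True] r by (simp add: G_def F_def)
    next
      case False
      then have "run_argmax B T \<omega> \<notin> A" using A by auto
      then show ?thesis using False r by (simp add: G_def)
    qed
  qed
  also have "\<dots> = (\<integral>\<^sup>+\<omega>. (\<integral>\<^sup>+\<omega>'. G ((run_argmax B t \<omega>, (run_max B t \<omega>, run_max B t \<omega> - B t \<omega>)), run_max (restart B t) s \<omega>') \<partial>M) \<partial>M)"
    by (rule nn_integral_past_future(1)[OF t' t(2) X Y G])
  also have "\<dots> = (\<integral>\<^sup>+\<omega>. (\<lambda>p. F p * c (snd (snd p))) (run_argmax B t \<omega>, (run_max B t \<omega>, run_max B t \<omega> - B t \<omega>)) \<partial>M)"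
    unfolding G_def fst_conv snd_conv c_def
    by (rule nn_integral_cong, rule nn_integral_cmult) (unfold indicator_def atMost_iff, measurable)
  also have "\<dots> = (\<integral>\<^sup>+u. (\<integral>\<^sup>+m. (\<integral>\<^sup>+z. triple_density t (u, (m, z)) * (F (u, (m, z)) * c (snd (snd (u, (m, z))))) \<partial>lborel) \<partial>lborel) \<partial>lborel)"
    by (rule S.nn_integral_argmax_max_end[OF t(1)]) measurable
  also have "\<dots> = (\<integral>\<^sup>+u. indicator A u * ((\<integral>\<^sup>+m. ennreal (2 * passage_density u m) * a m * indicator {0<..} m \<partial>lborel)
         * (\<integral>\<^sup>+z. ennreal (passage_density (t - u) z * max_cdf (T - t) z) * b z * indicator {0<..} z \<partial>lborel)) \<partial>lborel)"
  proof (rule nn_integral_cong)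
    fix u :: real
    define K where "K = (\<integral>\<^sup>+z. ennreal (passage_density (t - u) z * max_cdf (T - t) z) * b z * indicator {0<..} z \<partial>lborel)"
    show "(\<integral>\<^sup>+m. (\<integral>\<^sup>+z. triple_density t (u, (m, z)) * (F (u, (m, z)) * c (snd (snd (u, (m, z))))) \<partial>lborel) \<partial>lborel)
      = indicator A u * ((\<integral>\<^sup>+m. ennreal (2 * passage_density u m) * a m * indicator {0<..} m \<partial>lborel)
         * (\<integral>\<^sup>+z. ennreal (passage_density (t - u) z * max_cdf (T - t) z) * b z * indicator {0<..} z \<partial>lborel))"
    proof (cases "u \<in> A")
      case True
      then have u: "0 < u" "u < t" using A by auto
      have "(\<integral>\<^sup>+m. (\<integral>\<^sup>+z. triple_density t (u, (m, z)) * (F (u, (m, z)) * c (snd (snd (u, (m, z))))) \<partial>lborel) \<partial>lborel)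
        = (\<integral>\<^sup>+m. (ennreal (2 * passage_density u m) * a m * indicator {0<..} m) * K \<partial>lborel)"
      proof (rule nn_integral_cong)
        fix m :: real
        have "(\<integral>\<^sup>+z. triple_density t (u, (m, z)) * (F (u, (m, z)) * c (snd (snd (u, (m, z))))) \<partial>lborel)
          = (\<integral>\<^sup>+z. (ennreal (2 * passage_density u m) * a m * indicator {0<..} m)
              * (ennreal (passage_density (t - u) z * max_cdf (T - t) z) * b z * indicator {0<..} z) \<partial>lborel)"
        proof (rule nn_integral_cong)
          fix z :: real
          show "triple_density t (u, (m, z)) * (F (u, (m, z)) * c (snd (snd (u, (m, z)))))
            = (ennreal (2 * passage_density u m) * a m * indicator {0<..} m)
              * (ennreal (passage_density (t - u) z * max_cdf (T - t) z) * b z * indicator {0<..} z)"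
          proof (cases "0 < m \<and> 0 < z")
            case mz: True
            have p: "0 \<le> 2 * passage_density u m" "0 \<le> passage_density (t - u) z"
              using u mz by (auto intro!: passage_density_nonneg)
            have "c z = ennreal (max_cdf (T - t) z)"
              unfolding c_def using R.run_max_cdf[of s z] s mz by (simp add: s_def)
            moreover note ennreal_mult'[OF p(1), of "passage_density (t - u) z"] ennreal_mult'[OF p(2), of "max_cdf (T - t) z"]
            ultimately show ?thesis
              using True u mz unfolding triple_density_def F_def fst_conv snd_conv by (simp only:) (simp add: mult_ac)
          qed (auto simp: triple_density_def split: split_indicator)
        qed
        also have "\<dots> = (ennreal (2 * passage_density u m) * a m * indicator {0<..} m) * K"
          unfolding K_def by (rule nn_integral_cmult) measurable
        finally show "(\<integral>\<^sup>+z. triple_density t (u, (m, z)) * (F (u, (m, z)) * c (snd (snd (u, (m, z))))) \<partial>lborel)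
          = (ennreal (2 * passage_density u m) * a m * indicator {0<..} m) * K" .
      qed
      also have "\<dots> = (\<integral>\<^sup>+m. ennreal (2 * passage_density u m) * a m * indicator {0<..} m \<partial>lborel) * K"
        by (rule nn_integral_multc) measurable
      finally show ?thesis using True by (simp add: K_def)
    qed (simp add: F_def)
  qed
  finally show ?thesis .
qed

end

subsection \<open>Regular conditional distributions\<close>

lemma regular_cond_distr_kernel:
  assumes "regular_cond_distr M X Y \<kappa>"
  shows "\<kappa> \<in> measurable borel (subprob_algebra borel)" "prob_space (\<kappa> x)" "sets (\<kappa> x) = sets borel"
proof -
  have k: "\<kappa> \<in> measurable borel (prob_algebra borel)"
    using assms by (simp add: regular_cond_distr_def)
  then show "\<kappa> \<in> measurable borel (subprob_algebra borel)"
    by (rule measurable_prob_algebraD)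
  have "\<kappa> x \<in> space (prob_algebra borel)"
    using measurable_space[OF k, of x] by simp
  then show "prob_space (\<kappa> x)" "sets (\<kappa> x) = sets borel"
    by (auto simp: space_prob_algebra)
qed

lemma measurable_kernel_nn_integral:
  assumes "regular_cond_distr M X Y \<kappa>" "g \<in> borel_measurable borel"
  shows "(\<lambda>x. \<integral>\<^sup>+y. g y \<partial>\<kappa> x) \<in> borel_measurable borel"
  by (rule measurable_compose[OF regular_cond_distr_kernel(1)[OF assms(1)] nn_integral_measurable_subprob_algebra[OF assms(2)]])

text \<open>For sets this is the definition, which says that the law of \<open>Y\<close> on the
  event \<open>X \<in> A\<close> is the mixture \<open>N \<bind> \<kappa>\<close>. Integration
  against a mixture extends it to functions.\<close>

lemma nn_integral_regular_cond_distr: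
  assumes \<kappa>: "regular_cond_distr M X Y \<kappa>"
    and [measurable]: "X \<in> borel_measurable M" "Y \<in> borel_measurable M" "g \<in> borel_measurable borel" "A \<in> sets borel"
  shows "(\<integral>\<^sup>+\<omega>. g (Y \<omega>) * indicator A (X \<omega>) \<partial>M) = (\<integral>\<^sup>+x. (\<integral>\<^sup>+y. g y \<partial>\<kappa> x) * indicator A x \<partial>distr M borel X)"
proof -
  define K where "K = density M (\<lambda>\<omega>. indicator A (X \<omega>))"
  define N where "N = density (distr M borel X) (indicator A)"
  have \<kappa>_N: "\<kappa> \<in> measurable N (subprob_algebra borel)"
    using regular_cond_distr_kernel(1)[OF \<kappa>] by (simp add: N_def)
  have [measurable]: "Y \<in> borel_measurable K" by (simp add: K_def)
  have "distr K borel Y = N \<bind> \<kappa>"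
  proof (rule measure_eqI)
    have sN: "space N \<noteq> {}" by (simp add: N_def)
    show "sets (distr K borel Y) = sets (N \<bind> \<kappa>)"
      using sN regular_cond_distr_kernel(3)[OF \<kappa>] by (subst sets_bind) auto
    fix C assume "C \<in> sets (distr K borel Y)"
    then have C [measurable]: "C \<in> sets borel" by simp
    have "emeasure (distr K borel Y) C = (\<integral>\<^sup>+\<omega>. indicator C (Y \<omega>) \<partial>K)"
      by (subst nn_integral_indicator[symmetric], simp, subst nn_integral_distr) auto
    also have "\<dots> = (\<integral>\<^sup>+\<omega>. indicator A (X \<omega>) * indicator C (Y \<omega>) \<partial>M)"
      unfolding K_def by (rule nn_integral_density) measurable
    also have "\<dots> = (\<integral>\<^sup>+\<omega>. indicator {\<omega> \<in> space M. X \<omega> \<in> A \<and> Y \<omega> \<in> C} \<omega> \<partial>M)"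
      by (intro nn_integral_cong) (auto split: split_indicator)
    also have "\<dots> = emeasure M {\<omega> \<in> space M. X \<omega> \<in> A \<and> Y \<omega> \<in> C}"
      by (rule nn_integral_indicator) measurable
    also have "\<dots> = (\<integral>\<^sup>+x\<in>A. emeasure (\<kappa> x) C \<partial>distr M borel X)"
      using \<kappa> C \<open>A \<in> sets borel\<close> by (auto simp: regular_cond_distr_def)
    also have "\<dots> = (\<integral>\<^sup>+x. indicator A x * emeasure (\<kappa> x) C \<partial>distr M borel X)"
      by (simp add: mult.commute)
    also have "\<dots> = (\<integral>\<^sup>+x. emeasure (\<kappa> x) C \<partial>N)"
      unfolding N_def
      using measurable_compose[OF regular_cond_distr_kernel(1)[OF \<kappa>] measurable_emeasure_subprob_algebra[OF C]]
      by (intro nn_integral_density[symmetric]) auto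
    also have "\<dots> = emeasure (N \<bind> \<kappa>) C"
      by (rule emeasure_bind[OF sN \<kappa>_N C, symmetric])
    finally show "emeasure (distr K borel Y) C = emeasure (N \<bind> \<kappa>) C" .
  qed
  then have "(\<integral>\<^sup>+y. g y \<partial>distr K borel Y) = (\<integral>\<^sup>+y. g y \<partial>(N \<bind> \<kappa>))" by simp
  also have "(\<integral>\<^sup>+y. g y \<partial>distr K borel Y) = (\<integral>\<^sup>+\<omega>. g (Y \<omega>) * indicator A (X \<omega>) \<partial>M)"
    by (subst nn_integral_distr) (auto simp: K_def nn_integral_density mult.commute)
  also have "(\<integral>\<^sup>+y. g y \<partial>(N \<bind> \<kappa>)) = (\<integral>\<^sup>+x. (\<integral>\<^sup>+y. g y \<partial>\<kappa> x) \<partial>N)"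
    by (rule nn_integral_bind[OF _ \<kappa>_N]) simp
  also have "\<dots> = (\<integral>\<^sup>+x. (\<integral>\<^sup>+y. g y \<partial>\<kappa> x) * indicator A x \<partial>distr M borel X)"
    unfolding N_def using measurable_kernel_nn_integral[OF \<kappa>, of g]
    by (subst nn_integral_density) (auto simp: mult.commute)
  finally show ?thesis .
qed

text \<open>\<open>W\<close> has the regression function \<open>q\<close> on \<open>D\<close> with respect to a variable \<open>X\<close> with density \<open>f\<close>.\<close>
definition regression_on ::
  "'a measure \<Rightarrow> ('a \<Rightarrow> real) \<Rightarrow> (real \<Rightarrow> real) \<Rightarrow> real set \<Rightarrow> ('a \<Rightarrow> ennreal) \<Rightarrow> (real \<Rightarrow> ennreal) \<Rightarrow> bool" where
  "regression_on M X f D W q \<longleftrightarrow>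
     (\<forall>A\<in>sets borel. A \<subseteq> D \<longrightarrow> (\<integral>\<^sup>+\<omega>. W \<omega> * indicator A (X \<omega>) \<partial>M) = (\<integral>\<^sup>+u. ennreal (f u) * q u * indicator A u \<partial>lborel))"

text \<open>Integrating the pointwise identity over \<open>X \<in> A\<close> for all
  \<open>A\<close> in \<open>D\<close> gives two equal measures; uniqueness of densities and
  \<open>f > 0\<close> turn this into an identity at almost every \<open>u\<close>. Summands on both
  sides stand in for subtraction, so that no difference of possibly infinite integrals
  arises.\<close>

lemma AE_kernel_eq:
  assumes \<kappa>: "regular_cond_distr M X Y \<kappa>"
    and [measurable]: "X \<in> borel_measurable M" "Y \<in> borel_measurable M"
    and [measurable]: "f \<in> borel_measurable borel" "D \<in> sets borel"
    and law: "distr M borel X = density lborel (\<lambda>u. ennreal (f u))"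
    and pos: "\<And>u. u \<in> D \<Longrightarrow> 0 < f u"
    and [measurable]: "g1 \<in> borel_measurable borel" "g2 \<in> borel_measurable borel"
    and [measurable]: "W1 \<in> borel_measurable M" "W2 \<in> borel_measurable M" "q1 \<in> borel_measurable borel" "q2 \<in> borel_measurable borel"
    and W: "regression_on M X f D W1 q1" "regression_on M X f D W2 q2"
    and eq: "\<And>\<omega>. \<omega> \<in> space M \<Longrightarrow> g1 (Y \<omega>) + W1 \<omega> = g2 (Y \<omega>) + W2 \<omega>"
  shows "AE u in lborel. u \<in> D \<longrightarrow> (\<integral>\<^sup>+y. g1 y \<partial>\<kappa> u) + q1 u = (\<integral>\<^sup>+y. g2 y \<partial>\<kappa> u) + q2 u"
proof -
  have [measurable]: "(\<lambda>x. \<integral>\<^sup>+y. g1 y \<partial>\<kappa> x) \<in> borel_measurable borel" "(\<lambda>x. \<integral>\<^sup>+y. g2 y \<partial>\<kappa> x) \<in> borel_measurable borel"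
    by (rule measurable_kernel_nn_integral[OF \<kappa>], simp)+
  have int: "(\<integral>\<^sup>+\<omega>. (g (Y \<omega>) + V \<omega>) * indicator A (X \<omega>) \<partial>M) = (\<integral>\<^sup>+u. (ennreal (f u) * ((\<integral>\<^sup>+y. g y \<partial>\<kappa> u) + q u)) * indicator A u \<partial>lborel)"
    if [measurable]: "A \<in> sets borel" and "A \<subseteq> D" and [measurable]: "g \<in> borel_measurable borel" "V \<in> borel_measurable M" "q \<in> borel_measurable borel"
      and V: "regression_on M X f D V q" for A g V q
  proof -
    have [measurable]: "(\<lambda>x. \<integral>\<^sup>+y. g y \<partial>\<kappa> x) \<in> borel_measurable borel"
      by (rule measurable_kernel_nn_integral[OF \<kappa>]) simp
    have "(\<integral>\<^sup>+\<omega>. (g (Y \<omega>) + V \<omega>) * indicator A (X \<omega>) \<partial>M) = (\<integral>\<^sup>+\<omega>. g (Y \<omega>) * indicator A (X \<omega>) \<partial>M) + (\<integral>\<^sup>+\<omega>. V \<omega> * indicator A (X \<omega>) \<partial>M)"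
      unfolding distrib_right by (rule nn_integral_add) auto
    also have "(\<integral>\<^sup>+\<omega>. g (Y \<omega>) * indicator A (X \<omega>) \<partial>M) = (\<integral>\<^sup>+u. (\<integral>\<^sup>+y. g y \<partial>\<kappa> u) * indicator A u \<partial>density lborel (\<lambda>u. ennreal (f u)))"
      unfolding law[symmetric] by (rule nn_integral_regular_cond_distr[OF \<kappa>]) measurable
    also have "\<dots> = (\<integral>\<^sup>+u. ennreal (f u) * ((\<integral>\<^sup>+y. g y \<partial>\<kappa> u) * indicator A u) \<partial>lborel)"
      by (rule nn_integral_density) measurable
    also have "(\<integral>\<^sup>+\<omega>. V \<omega> * indicator A (X \<omega>) \<partial>M) = (\<integral>\<^sup>+u. ennreal (f u) * q u * indicator A u \<partial>lborel)"
      using V that(1,2) by (simp add: regression_on_def)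
    also have "(\<integral>\<^sup>+u. ennreal (f u) * ((\<integral>\<^sup>+y. g y \<partial>\<kappa> u) * indicator A u) \<partial>lborel) + (\<integral>\<^sup>+u. ennreal (f u) * q u * indicator A u \<partial>lborel)
       = (\<integral>\<^sup>+u. ennreal (f u) * ((\<integral>\<^sup>+y. g y \<partial>\<kappa> u) * indicator A u) + ennreal (f u) * q u * indicator A u \<partial>lborel)"
      by (rule nn_integral_add[symmetric]) measurable
    also have "\<dots> = (\<integral>\<^sup>+u. (ennreal (f u) * ((\<integral>\<^sup>+y. g y \<partial>\<kappa> u) + q u)) * indicator A u \<partial>lborel)"
      by (simp add: distrib_left distrib_right mult.assoc)
    finally show ?thesis .
  qed
  define F where "F g q u = ennreal (f u) * ((\<integral>\<^sup>+y. g y \<partial>\<kappa> u) + q u) * indicator D u" for g and q :: "real \<Rightarrow> ennreal" and u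
  have [measurable]: "F g1 q1 \<in> borel_measurable borel" "F g2 q2 \<in> borel_measurable borel"
    unfolding F_def[abs_def] by measurable
  have "density lborel (F g1 q1) = density lborel (F g2 q2)"
  proof (rule measure_eqI)
    fix A assume "A \<in> sets (density lborel (F g1 q1))"
    then have [measurable]: "A \<in> sets borel" by simp
    have em: "emeasure (density lborel (F g q)) A = (\<integral>\<^sup>+u. (ennreal (f u) * ((\<integral>\<^sup>+y. g y \<partial>\<kappa> u) + q u)) * indicator (A \<inter> D) u \<partial>lborel)"
      if "F g q \<in> borel_measurable borel" for g q
      using that by (subst emeasure_density) (auto simp: F_def intro!: nn_integral_cong split: split_indicator)
    have "(\<integral>\<^sup>+\<omega>. (g1 (Y \<omega>) + W1 \<omega>) * indicator (A \<inter> D) (X \<omega>) \<partial>M) = (\<integral>\<^sup>+\<omega>. (g2 (Y \<omega>) + W2 \<omega>) * indicator (A \<inter> D) (X \<omega>) \<partial>M)"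
      using eq by (intro nn_integral_cong) simp
    then show "emeasure (density lborel (F g1 q1)) A = emeasure (density lborel (F g2 q2)) A"
      using int[of "A \<inter> D" g1 W1 q1] int[of "A \<inter> D" g2 W2 q2] W by (simp add: em)
  qed simp
  then have "AE u in lborel. F g1 q1 u = F g2 q2 u"
    by (subst (asm) sigma_finite_measure.density_unique_iff[OF sigma_finite_lborel]) auto
  then show ?thesis
  proof (rule eventually_mono, intro impI)
    fix u assume "F g1 q1 u = F g2 q2 u" "u \<in> D"
    then have "ennreal (f u) * ((\<integral>\<^sup>+y. g1 y \<partial>\<kappa> u) + q1 u) = ennreal (f u) * ((\<integral>\<^sup>+y. g2 y \<partial>\<kappa> u) + q2 u)"
      by (simp add: F_def)
    then show "(\<integral>\<^sup>+y. g1 y \<partial>\<kappa> u) + q1 u = (\<integral>\<^sup>+y. g2 y \<partial>\<kappa> u) + q2 u"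
      using pos[OF \<open>u \<in> D\<close>] by (simp add: ennreal_mult_cancel_left)
  qed
qed

lemma regression_on_add:
  assumes "regression_on M X f D W q" "regression_on M X f D W' q'"
    and [measurable]: "X \<in> borel_measurable M" "W \<in> borel_measurable M" "W' \<in> borel_measurable M"
      "f \<in> borel_measurable borel" "q \<in> borel_measurable borel" "q' \<in> borel_measurable borel"
  shows "regression_on M X f D (\<lambda>\<omega>. W \<omega> + W' \<omega>) (\<lambda>u. q u + q' u)"
  unfolding regression_on_def
proof (intro ballI impI)
  fix A :: "real set" assume [measurable]: "A \<in> sets borel" and "A \<subseteq> D"
  have "(\<integral>\<^sup>+\<omega>. (W \<omega> + W' \<omega>) * indicator A (X \<omega>) \<partial>M) = (\<integral>\<^sup>+\<omega>. W \<omega> * indicator A (X \<omega>) \<partial>M) + (\<integral>\<^sup>+\<omega>. W' \<omega> * indicator A (X \<omega>) \<partial>M)"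
    unfolding distrib_right by (rule nn_integral_add) auto
  also have "\<dots> = (\<integral>\<^sup>+u. ennreal (f u) * q u * indicator A u \<partial>lborel) + (\<integral>\<^sup>+u. ennreal (f u) * q' u * indicator A u \<partial>lborel)"
    using assms(1,2) \<open>A \<subseteq> D\<close> by (simp add: regression_on_def)
  also have "\<dots> = (\<integral>\<^sup>+u. ennreal (f u) * q u * indicator A u + ennreal (f u) * q' u * indicator A u \<partial>lborel)"
    by (rule nn_integral_add[symmetric]) measurable
  finally show "(\<integral>\<^sup>+\<omega>. (W \<omega> + W' \<omega>) * indicator A (X \<omega>) \<partial>M) = (\<integral>\<^sup>+u. ennreal (f u) * (q u + q' u) * indicator A u \<partial>lborel)"
    by (simp add: distrib_left distrib_right)
qed

lemma regression_on_cmult: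
  assumes "regression_on M X f D W q"
    and [measurable]: "X \<in> borel_measurable M" "W \<in> borel_measurable M" "f \<in> borel_measurable borel" "q \<in> borel_measurable borel"
  shows "regression_on M X f D (\<lambda>\<omega>. c * W \<omega>) (\<lambda>u. c * q u)"
  unfolding regression_on_def
proof (intro ballI impI)
  fix A :: "real set" assume [measurable]: "A \<in> sets borel" and "A \<subseteq> D"
  have "(\<integral>\<^sup>+\<omega>. c * W \<omega> * indicator A (X \<omega>) \<partial>M) = c * (\<integral>\<^sup>+\<omega>. W \<omega> * indicator A (X \<omega>) \<partial>M)"
    unfolding mult.assoc by (rule nn_integral_cmult) measurable
  also have "\<dots> = c * (\<integral>\<^sup>+u. ennreal (f u) * q u * indicator A u \<partial>lborel)"
    using assms(1) \<open>A \<subseteq> D\<close> by (simp add: regression_on_def)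
  also have "\<dots> = (\<integral>\<^sup>+u. c * (ennreal (f u) * q u * indicator A u) \<partial>lborel)"
    by (rule nn_integral_cmult[symmetric]) measurable
  finally show "(\<integral>\<^sup>+\<omega>. c * W \<omega> * indicator A (X \<omega>) \<partial>M) = (\<integral>\<^sup>+u. ennreal (f u) * (c * q u) * indicator A u \<partial>lborel)"
    by (simp add: mult_ac)
qed

text \<open>The second balance bounds the second moment by the finite \<open>d\<close>. On a
  probability space the positive and negative parts of the mean are then finite too, and the
  balances may be solved for the moments.\<close>

lemma moments_from_balance:
  assumes "prob_space \<mu>" and sets: "sets \<mu> = sets borel"
    and nn: "0 \<le> p" "0 \<le> q" "0 \<le> c" "0 \<le> d"
    and first: "(\<integral>\<^sup>+b. ennreal b \<partial>\<mu>) + ennreal q = (\<integral>\<^sup>+b. ennreal (- b) \<partial>\<mu>) + ennreal p"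
    and second: "(\<integral>\<^sup>+b. ennreal (b\<^sup>2) \<partial>\<mu>) + ennreal c = ennreal d"
  shows "integrable \<mu> (\<lambda>b. b\<^sup>2)" "integrable \<mu> (\<lambda>b. b)" "mean \<mu> = p - q" "second_moment \<mu> = d - c"
    "var \<mu> = second_moment \<mu> - (mean \<mu>)\<^sup>2"
proof -
  interpret prob_space \<mu> by fact
  have [measurable]: "(\<lambda>b. b) \<in> borel_measurable \<mu>" "(\<lambda>b. b\<^sup>2) \<in> borel_measurable \<mu>"
    by (simp_all add: measurable_cong_sets[OF sets refl])
  have "(\<integral>\<^sup>+b. ennreal (b\<^sup>2) \<partial>\<mu>) \<le> ennreal d"
    unfolding second[symmetric] by simp
  then show sq: "integrable \<mu> (\<lambda>b. b\<^sup>2)"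
    by (intro integrableI_bounded) (auto simp: le_less_trans)
  then show i: "integrable \<mu> (\<lambda>b. b)"
    by (rule square_integrable_imp_integrable[rotated]) simp
  have "ennreal (\<integral>b. b\<^sup>2 \<partial>\<mu>) + ennreal c = ennreal d"
    using second nn_integral_eq_integral[OF sq] by simp
  then have "(\<integral>b. b\<^sup>2 \<partial>\<mu>) + c = d"
    using nn by (simp add: ennreal_plus[symmetric] del: ennreal_plus)
  then show sm: "second_moment \<mu> = d - c" by (simp add: second_moment_def)
  have fin: "(\<integral>\<^sup>+b. ennreal b \<partial>\<mu>) < \<infinity>" "(\<integral>\<^sup>+b. ennreal (- b) \<partial>\<mu>) < \<infinity>"
    using i by (auto simp: real_integrable_def less_top)
  then obtain x y where xy: "(\<integral>\<^sup>+b. ennreal b \<partial>\<mu>) = ennreal x" "0 \<le> x" "(\<integral>\<^sup>+b. ennreal (- b) \<partial>\<mu>) = ennreal y" "0 \<le> y"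
    by (metis ennreal_cases infinity_ennreal_def less_irrefl)
  then have "x + q = y + p"
    using first nn by (simp add: ennreal_plus[symmetric] del: ennreal_plus)
  then show "mean \<mu> = p - q"
    unfolding mean_def real_lebesgue_integral_def[OF i] xy using xy by simp
  show "var \<mu> = second_moment \<mu> - (mean \<mu>)\<^sup>2"
    using variance_eq[OF i sq] by (simp add: var_def second_moment_def mean_def)
qed

text \<open>Identities that hold almost everywhere for each half-line hold simultaneously for
  countably many of them. Right continuity of distribution functions makes the rational half-lines
  sufficient.\<close>

lemma real_distribution_eqI_Rats:
  assumes "real_distribution \<mu>" "real_distribution \<nu>"
    and eq: "\<And>q. q \<in> \<rat> \<Longrightarrow> emeasure \<mu> {..q} = emeasure \<nu> {..q}"
  shows "\<mu> = \<nu>"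
proof (rule cdf_unique[OF assms(1,2)], rule ext)
  interpret \<mu>: real_distribution \<mu> by fact
  interpret \<nu>: real_distribution \<nu> by fact
  fix x
  have "\<forall>n. \<exists>q\<in>\<rat>. x < q \<and> q < x + inverse (real (Suc n))"
    by (intro allI Rats_dense_in_real) simp
  then obtain r where r: "\<And>n. r n \<in> \<rat>" "\<And>n. x < r n" "\<And>n. r n < x + inverse (real (Suc n))"
    by metis
  have "(\<lambda>n. x + inverse (real (Suc n))) \<longlonglongrightarrow> x + 0"
    by (intro tendsto_intros LIMSEQ_inverse_real_of_nat)
  then have "r \<longlonglongrightarrow> x"
    using r(2,3) by (intro tendsto_sandwich[of "\<lambda>_. x" r sequentially "\<lambda>n. x + inverse (real (Suc n))"])
      (auto intro: always_eventually less_imp_le simp del: of_nat_Suc)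
  then have lim: "filterlim r (at_right x) sequentially"
    unfolding filterlim_at using r(2) by (auto intro!: always_eventually simp: less_imp_neq[symmetric])
  have "(\<lambda>n. cdf \<mu> (r n)) \<longlonglongrightarrow> cdf \<mu> x" "(\<lambda>n. cdf \<nu> (r n)) \<longlonglongrightarrow> cdf \<nu> x"
    using \<mu>.cdf_is_right_cont[of x] \<nu>.cdf_is_right_cont[of x] lim
    by (auto simp: continuous_within intro: filterlim_compose)
  moreover have "cdf \<mu> (r n) = cdf \<nu> (r n)" for n
    using eq[OF r(1)[of n]] by (simp add: cdf_def measure_def)
  ultimately show "cdf \<mu> x = cdf \<nu> x"
    using LIMSEQ_unique by auto
qed

section \<open>The arcsine law and disintegration along the argmax\<close>

definition argmax_density :: "real \<Rightarrow> real" where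
  "argmax_density u = (if 0 < u \<and> u < 1 then 1 / (pi * sqrt (u * (1 - u))) else 0)"

lemma borel_measurable_argmax_density [measurable]: "argmax_density \<in> borel_measurable borel"
  unfolding argmax_density_def[abs_def] by measurable

lemma argmax_density_pos: "0 < u \<Longrightarrow> u < 1 \<Longrightarrow> 0 < argmax_density u"
  by (simp add: argmax_density_def)

text \<open>The left-hand side is the factor 2 of \<open>triple_density\<close> times the masses of
  the two legs.\<close>

lemma argmax_density_eq:
  assumes "0 < u" "u < 1"
  shows "2 / sqrt (2 * pi * (1 - u)) * (1 / sqrt (2 * pi * u)) = argmax_density u"
proof -
  have "sqrt (2 * pi * (1 - u)) * sqrt (2 * pi * u) = sqrt ((2 * pi)\<^sup>2 * (u * (1 - u)))"
    by (simp add: real_sqrt_mult[symmetric] power2_eq_square ac_simps)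
  also have "\<dots> = 2 * pi * sqrt (u * (1 - u))"
    unfolding real_sqrt_mult[of "(2 * pi)\<^sup>2"] real_sqrt_abs by simp
  finally have e: "sqrt (2 * pi * (1 - u)) * sqrt (2 * pi * u) = 2 * pi * sqrt (u * (1 - u))" .
  have "2 / sqrt (2 * pi * (1 - u)) * (1 / sqrt (2 * pi * u)) = 2 / (sqrt (2 * pi * (1 - u)) * sqrt (2 * pi * u))"
    by simp
  then show ?thesis unfolding e using assms by (simp add: argmax_density_def)
qed

lemma borel_measurable_max_density_comp [measurable (raw)]:
  assumes "f \<in> borel_measurable M" "g \<in> borel_measurable M"
  shows "(\<lambda>x. max_density (f x) (g x)) \<in> borel_measurable M"
  using measurable_compose[OF measurable_Pair[OF assms] borel_measurable_max_density] by simp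

locale brownian_unit = brownian M B 1 for M :: "'a measure" and B
begin

abbreviation argmax :: "'a \<Rightarrow> real" where "argmax \<equiv> run_argmax B 1"
abbreviation maximum :: "'a \<Rightarrow> real" where "maximum \<equiv> run_max B 1"

lemma measurable_argmax [measurable]: "argmax \<in> borel_measurable M"
  and measurable_maximum [measurable]: "maximum \<in> borel_measurable M"
  using measurable_run_argmax measurable_run_max by auto

text \<open>Once the gap is integrated out, normalising the passage density of the maximum splits
  the joint density into the arcsine density and, for each argmax, the conditional density of the
  maximum.\<close>

lemma nn_integral_argmax_maximum:
  assumes F [measurable]: "F \<in> borel_measurable (borel \<Otimes>\<^sub>M borel)"
  shows "(\<integral>\<^sup>+\<omega>. F (argmax \<omega>, maximum \<omega>) \<partial>M)
    = (\<integral>\<^sup>+u. ennreal (argmax_density u) * (\<integral>\<^sup>+m. ennreal (max_density u m) * F (u, m) \<partial>lborel) \<partial>lborel)"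
proof -
  have "(\<integral>\<^sup>+\<omega>. F (argmax \<omega>, maximum \<omega>) \<partial>M)
    = (\<integral>\<^sup>+u. (\<integral>\<^sup>+m. ennreal (2 * passage_density u m / sqrt (2 * pi * (1 - u))) * indicator {0<..<1} u * indicator {0<..} m * F (u, m) \<partial>lborel) \<partial>lborel)"
    by (rule nn_integral_argmax_max) simp_all
  also have "\<dots> = (\<integral>\<^sup>+u. (\<integral>\<^sup>+m. ennreal (argmax_density u) * (ennreal (max_density u m) * F (u, m)) \<partial>lborel) \<partial>lborel)"
  proof (rule nn_integral_cong, rule nn_integral_cong)
    fix u m :: real
    show "ennreal (2 * passage_density u m / sqrt (2 * pi * (1 - u))) * indicator {0<..<1} u * indicator {0<..} m * F (u, m)
      = ennreal (argmax_density u) * (ennreal (max_density u m) * F (u, m))"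
    proof (cases "0 < u \<and> u < 1 \<and> 0 < m")
      case True
      then have u: "0 < u" "u < 1" and m: "0 < m" by auto
      have "argmax_density u * max_density u m = 2 / sqrt (2 * pi * (1 - u)) * passage_density u m"
        unfolding argmax_density_eq[OF u, symmetric] max_density_eq[OF u(1) m] using u by simp
      then have "ennreal (2 * passage_density u m / sqrt (2 * pi * (1 - u))) = ennreal (argmax_density u * max_density u m)"
        by simp
      also have "\<dots> = ennreal (argmax_density u) * ennreal (max_density u m)"
        using argmax_density_pos[OF u] by (intro ennreal_mult') simp
      finally show ?thesis using True by (simp add: mult.assoc)
    next
      case False
      then have "argmax_density u = 0 \<or> max_density u m = 0"
        by (auto simp: argmax_density_def max_density_def)
      moreover have "indicator {0<..<1} u * indicator {0<..} m = (0 :: ennreal)"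
        using False by (auto split: split_indicator)
      ultimately show ?thesis by (auto simp: mult.assoc)
    qed
  qed
  also have "\<dots> = (\<integral>\<^sup>+u. ennreal (argmax_density u) * (\<integral>\<^sup>+m. ennreal (max_density u m) * F (u, m) \<partial>lborel) \<partial>lborel)"
    by (rule nn_integral_cong, rule nn_integral_cmult) measurable
  finally show ?thesis .
qed

lemma distr_argmax: "distr M borel argmax = density lborel (\<lambda>u. ennreal (argmax_density u))"
proof (rule measure_eqI)
  fix A assume "A \<in> sets (distr M borel argmax)"
  then have A [measurable]: "A \<in> sets borel" by simp
  have "emeasure (distr M borel argmax) A = (\<integral>\<^sup>+\<omega>. (\<lambda>p. indicator A (fst p)) (argmax \<omega>, maximum \<omega>) \<partial>M)"
    by (subst nn_integral_indicator[symmetric], simp, subst nn_integral_distr) auto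
  also have "\<dots> = (\<integral>\<^sup>+u. ennreal (argmax_density u) * (\<integral>\<^sup>+m. ennreal (max_density u m) * indicator A (fst (u, m)) \<partial>lborel) \<partial>lborel)"
    by (rule nn_integral_argmax_maximum) measurable
  also have "\<dots> = (\<integral>\<^sup>+u. ennreal (argmax_density u) * indicator A u \<partial>lborel)"
  proof (rule nn_integral_cong)
    fix u :: real
    show "ennreal (argmax_density u) * (\<integral>\<^sup>+m. ennreal (max_density u m) * indicator A (fst (u, m)) \<partial>lborel) = ennreal (argmax_density u) * indicator A u"
    proof (cases "0 < u")
      case True
      have "(\<integral>\<^sup>+m. ennreal (max_density u m) * indicator A (fst (u, m)) \<partial>lborel) = (\<integral>\<^sup>+m. ennreal (max_density u m) \<partial>lborel) * indicator A u"
        unfolding fst_conv by (rule nn_integral_multc) measurable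
      then show ?thesis unfolding nn_integral_max_density(1)[OF True] by simp
    qed (simp add: argmax_density_def)
  qed
  also have "\<dots> = emeasure (density lborel (\<lambda>u. ennreal (argmax_density u))) A"
    by (subst emeasure_density) auto
  finally show "emeasure (distr M borel argmax) A = emeasure (density lborel (\<lambda>u. ennreal (argmax_density u))) A" .
qed simp

abbreviation "argmax_regression \<equiv> regression_on M argmax argmax_density"

lemma argmax_regression_maximum:
  assumes [measurable]: "P \<in> borel_measurable borel"
  shows "argmax_regression D (\<lambda>\<omega>. P (maximum \<omega>)) (\<lambda>u. \<integral>\<^sup>+m. ennreal (max_density u m) * P m \<partial>lborel)"
  unfolding regression_on_def
proof (intro ballI impI)
  fix A :: "real set" assume [measurable]: "A \<in> sets borel"
  have "(\<integral>\<^sup>+\<omega>. P (maximum \<omega>) * indicator A (argmax \<omega>) \<partial>M) = (\<integral>\<^sup>+\<omega>. (\<lambda>p. P (snd p) * indicator A (fst p)) (argmax \<omega>, maximum \<omega>) \<partial>M)"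
    by simp
  also have "\<dots> = (\<integral>\<^sup>+u. ennreal (argmax_density u) * (\<integral>\<^sup>+m. ennreal (max_density u m) * (P (snd (u, m)) * indicator A (fst (u, m))) \<partial>lborel) \<partial>lborel)"
    by (rule nn_integral_argmax_maximum) measurable
  also have "\<dots> = (\<integral>\<^sup>+u. ennreal (argmax_density u) * (\<integral>\<^sup>+m. ennreal (max_density u m) * P m \<partial>lborel) * indicator A u \<partial>lborel)"
  proof (rule nn_integral_cong)
    fix u :: real
    have "(\<integral>\<^sup>+m. ennreal (max_density u m) * (P (snd (u, m)) * indicator A (fst (u, m))) \<partial>lborel)
      = (\<integral>\<^sup>+m. ennreal (max_density u m) * P m * indicator A u \<partial>lborel)"
      by (simp add: mult.assoc)
    also have "\<dots> = (\<integral>\<^sup>+m. ennreal (max_density u m) * P m \<partial>lborel) * indicator A u"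
      by (rule nn_integral_multc) measurable
    finally show "ennreal (argmax_density u) * (\<integral>\<^sup>+m. ennreal (max_density u m) * (P (snd (u, m)) * indicator A (fst (u, m))) \<partial>lborel)
      = ennreal (argmax_density u) * (\<integral>\<^sup>+m. ennreal (max_density u m) * P m \<partial>lborel) * indicator A u"
      by (simp add: mult.assoc)
  qed
  finally show "(\<integral>\<^sup>+\<omega>. P (maximum \<omega>) * indicator A (argmax \<omega>) \<partial>M)
    = (\<integral>\<^sup>+u. ennreal (argmax_density u) * (\<integral>\<^sup>+m. ennreal (max_density u m) * P m \<partial>lborel) * indicator A u \<partial>lborel)" .
qed

lemma nn_integral_max_density_mult:
  assumes "0 < u"
  shows "(\<integral>\<^sup>+m. ennreal (max_density u m) * ennreal m \<partial>lborel) = ennreal (sqrt (pi * u / 2))"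
    and "(\<integral>\<^sup>+m. ennreal (max_density u m) * ennreal (m\<^sup>2) \<partial>lborel) = ennreal (2 * u)"
proof -
  have "ennreal (max_density u m) * ennreal x = ennreal (x * max_density u m)" for m x
    using ennreal_mult''[OF max_density_nonneg[OF assms, of m], of x] by (simp add: mult.commute)
  then show "(\<integral>\<^sup>+m. ennreal (max_density u m) * ennreal m \<partial>lborel) = ennreal (sqrt (pi * u / 2))"
    and "(\<integral>\<^sup>+m. ennreal (max_density u m) * ennreal (m\<^sup>2) \<partial>lborel) = ennreal (2 * u)"
    using nn_integral_max_density(2,3)[OF assms] by simp_all
qed

text \<open>\<open>AE_kernel_eq\<close> identifies the distribution function at each rational point,
  and the countably many null sets are discarded together.\<close>

lemma AE_max_given_argmax:
  assumes \<kappa>: "regular_cond_distr M argmax maximum \<kappa>"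
  shows "AE u in lborel. u \<in> {0<..<1} \<longrightarrow> \<kappa> u = density lborel (\<lambda>m. ennreal (max_density u m))"
proof -
  have "AE u in lborel. u \<in> {0<..<1} \<longrightarrow> (\<integral>\<^sup>+y. indicator {..q} y \<partial>\<kappa> u) + 0
      = (\<integral>\<^sup>+y. 0 \<partial>\<kappa> u) + (\<integral>\<^sup>+m. ennreal (max_density u m) * indicator {..q} m \<partial>lborel)" for q
  proof (rule AE_kernel_eq[OF \<kappa>, where f = argmax_density and ?W1.0 = "\<lambda>_. 0" and ?W2.0 = "\<lambda>\<omega>. indicator {..q} (maximum \<omega>)"])
    show "argmax_regression {0<..<1} (\<lambda>_. 0) (\<lambda>_. 0)"
      by (simp add: regression_on_def)
    show "argmax_regression {0<..<1} (\<lambda>\<omega>. indicator {..q} (maximum \<omega>)) (\<lambda>u. \<integral>\<^sup>+m. ennreal (max_density u m) * indicator {..q} m \<partial>lborel)"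
      by (rule argmax_regression_maximum) simp
  qed (auto simp: distr_argmax argmax_density_pos)
  then have "AE u in lborel. \<forall>q\<in>\<rat>. u \<in> {0<..<1} \<longrightarrow> (\<integral>\<^sup>+y. indicator {..q} y \<partial>\<kappa> u) + 0
      = (\<integral>\<^sup>+y. 0 \<partial>\<kappa> u) + (\<integral>\<^sup>+m. ennreal (max_density u m) * indicator {..q} m \<partial>lborel)"
    by (intro AE_ball_countable[THEN iffD2] countable_rat ballI)
  then show ?thesis
  proof (rule eventually_mono, intro impI)
    fix u :: real
    assume q: "\<forall>q\<in>\<rat>. u \<in> {0<..<1} \<longrightarrow> (\<integral>\<^sup>+y. indicator {..q} y \<partial>\<kappa> u) + 0
      = (\<integral>\<^sup>+y. 0 \<partial>\<kappa> u) + (\<integral>\<^sup>+m. ennreal (max_density u m) * indicator {..q} m \<partial>lborel)" and u: "u \<in> {0<..<1}"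
    have "prob_space (density lborel (\<lambda>m. ennreal (max_density u m)))"
      using nn_integral_max_density(1)[of u] u by (intro prob_spaceI) (simp add: emeasure_density)
    then have "real_distribution (density lborel (\<lambda>m. ennreal (max_density u m)))"
      by (simp add: real_distribution_def real_distribution_axioms_def)
    moreover have "real_distribution (\<kappa> u)"
      using regular_cond_distr_kernel(2,3)[OF \<kappa>, of u] sets_eq_imp_space_eq[OF regular_cond_distr_kernel(3)[OF \<kappa>, of u]]
      by (simp add: real_distribution_def real_distribution_axioms_def)
    moreover have "emeasure (\<kappa> u) {..r} = emeasure (density lborel (\<lambda>m. ennreal (max_density u m))) {..r}" if "r \<in> \<rat>" for r
      using q u that regular_cond_distr_kernel(3)[OF \<kappa>, of u] by (simp add: emeasure_density)
    ultimately show "\<kappa> u = density lborel (\<lambda>m. ennreal (max_density u m))"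
      by (intro real_distribution_eqI_Rats) auto
  qed
qed

text \<open>The argmax lies in \<open>A\<close> exactly if the pair lies in
  \<open>A \<times> UNIV\<close>. So the kernel given the pair can be tested on this event, and the
  law of the pair is already disintegrated along the argmax.\<close>

lemma AE_tower:
  assumes \<kappa>1: "regular_cond_distr M argmax Y \<kappa>1" and \<kappa>2: "regular_cond_distr M (\<lambda>\<omega>. (argmax \<omega>, maximum \<omega>)) Y \<kappa>2"
    and [measurable]: "Y \<in> borel_measurable M" "g \<in> borel_measurable borel"
  shows "AE u in lborel. u \<in> {0<..<1} \<longrightarrow>
    (\<integral>\<^sup>+y. g y \<partial>\<kappa>1 u) = (\<integral>\<^sup>+m. ennreal (max_density u m) * (\<integral>\<^sup>+y. g y \<partial>\<kappa>2 (u, m)) \<partial>lborel)"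
proof -
  have pair [measurable]: "(\<lambda>\<omega>. (argmax \<omega>, maximum \<omega>)) \<in> borel_measurable M"
    unfolding borel_prod[symmetric] by measurable
  have G [measurable]: "(\<lambda>x. \<integral>\<^sup>+y. g y \<partial>\<kappa>2 x) \<in> borel_measurable (borel \<Otimes>\<^sub>M borel)"
    unfolding borel_prod by (rule measurable_kernel_nn_integral[OF \<kappa>2]) simp
  have "AE u in lborel. u \<in> {0<..<1} \<longrightarrow> (\<integral>\<^sup>+y. g y \<partial>\<kappa>1 u) + 0
      = (\<integral>\<^sup>+y. 0 \<partial>\<kappa>1 u) + (\<integral>\<^sup>+m. ennreal (max_density u m) * (\<integral>\<^sup>+y. g y \<partial>\<kappa>2 (u, m)) \<partial>lborel)"
  proof (rule AE_kernel_eq[OF \<kappa>1, where f = argmax_density and ?W1.0 = "\<lambda>_. 0" and ?W2.0 = "\<lambda>\<omega>. g (Y \<omega>)"])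
    show "argmax_regression {0<..<1} (\<lambda>_. 0) (\<lambda>_. 0)"
      by (simp add: regression_on_def)
    show "argmax_regression {0<..<1} (\<lambda>\<omega>. g (Y \<omega>)) (\<lambda>u. \<integral>\<^sup>+m. ennreal (max_density u m) * (\<integral>\<^sup>+y. g y \<partial>\<kappa>2 (u, m)) \<partial>lborel)"
      unfolding regression_on_def
    proof (intro ballI impI)
      fix A :: "real set" assume [measurable]: "A \<in> sets borel"
      have AU: "A \<times> UNIV \<in> sets (borel :: (real \<times> real) measure)"
        unfolding borel_prod[symmetric] by simp
      have "(\<integral>\<^sup>+\<omega>. g (Y \<omega>) * indicator A (argmax \<omega>) \<partial>M) = (\<integral>\<^sup>+\<omega>. g (Y \<omega>) * indicator (A \<times> UNIV) (argmax \<omega>, maximum \<omega>) \<partial>M)"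
        by (simp add: indicator_times)
      also have "\<dots> = (\<integral>\<^sup>+x. (\<integral>\<^sup>+y. g y \<partial>\<kappa>2 x) * indicator (A \<times> UNIV) x \<partial>distr M borel (\<lambda>\<omega>. (argmax \<omega>, maximum \<omega>)))"
        by (rule nn_integral_regular_cond_distr[OF \<kappa>2 pair _ _ AU]) simp_all
      also have "\<dots> = (\<integral>\<^sup>+\<omega>. (\<lambda>x. (\<integral>\<^sup>+y. g y \<partial>\<kappa>2 x) * indicator A (fst x)) (argmax \<omega>, maximum \<omega>) \<partial>M)"
      proof -
        have "(\<lambda>x. (\<integral>\<^sup>+y. g y \<partial>\<kappa>2 x) * indicator (A \<times> UNIV) x) \<in> borel_measurable borel"
          using measurable_kernel_nn_integral[OF \<kappa>2, of g] AU by simp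
        then show ?thesis by (subst nn_integral_distr) (auto simp: indicator_times)
      qed
      also have "\<dots> = (\<integral>\<^sup>+u. ennreal (argmax_density u) * (\<integral>\<^sup>+m. ennreal (max_density u m) * ((\<integral>\<^sup>+y. g y \<partial>\<kappa>2 (u, m)) * indicator A (fst (u, m))) \<partial>lborel) \<partial>lborel)"
        by (rule nn_integral_argmax_maximum) measurable
      also have "\<dots> = (\<integral>\<^sup>+u. ennreal (argmax_density u) * (\<integral>\<^sup>+m. ennreal (max_density u m) * (\<integral>\<^sup>+y. g y \<partial>\<kappa>2 (u, m)) \<partial>lborel) * indicator A u \<partial>lborel)"
      proof (rule nn_integral_cong)
        fix u :: real
        have "(\<integral>\<^sup>+m. ennreal (max_density u m) * ((\<integral>\<^sup>+y. g y \<partial>\<kappa>2 (u, m)) * indicator A (fst (u, m))) \<partial>lborel)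
          = (\<integral>\<^sup>+m. ennreal (max_density u m) * (\<integral>\<^sup>+y. g y \<partial>\<kappa>2 (u, m)) * indicator A u \<partial>lborel)"
          by (simp add: mult.assoc)
        also have "\<dots> = (\<integral>\<^sup>+m. ennreal (max_density u m) * (\<integral>\<^sup>+y. g y \<partial>\<kappa>2 (u, m)) \<partial>lborel) * indicator A u"
          by (rule nn_integral_multc) measurable
        finally show "ennreal (argmax_density u) * (\<integral>\<^sup>+m. ennreal (max_density u m) * ((\<integral>\<^sup>+y. g y \<partial>\<kappa>2 (u, m)) * indicator A (fst (u, m))) \<partial>lborel)
          = ennreal (argmax_density u) * (\<integral>\<^sup>+m. ennreal (max_density u m) * (\<integral>\<^sup>+y. g y \<partial>\<kappa>2 (u, m)) \<partial>lborel) * indicator A u"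
          by (simp add: mult.assoc)
      qed
      finally show "(\<integral>\<^sup>+\<omega>. g (Y \<omega>) * indicator A (argmax \<omega>) \<partial>M)
        = (\<integral>\<^sup>+u. ennreal (argmax_density u) * (\<integral>\<^sup>+m. ennreal (max_density u m) * (\<integral>\<^sup>+y. g y \<partial>\<kappa>2 (u, m)) \<partial>lborel) * indicator A u \<partial>lborel)" .
    qed
  qed (auto simp: distr_argmax argmax_density_pos)
  then show ?thesis by simp
qed

subsection \<open>Conditional moments given the argmax\<close>

text \<open>\<open>J\<close> is the value of the integral over the gap, and \<open>Q\<close> is what
  remains of it, with the factor of the second leg, after division by the density of the
  argmax.\<close>

lemma regression_before:
  assumes t: "0 \<le> t" "t < 1"
    and [measurable]: "a \<in> borel_measurable borel" "P \<in> borel_measurable borel"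
    and \<psi>: "\<And>z. 0 < z \<Longrightarrow> (\<integral>\<^sup>+\<omega>. P (B t \<omega> + z) * indicator {..<z} (run_max B t \<omega> - B t \<omega>) \<partial>M) = \<psi> z"
    and J: "\<And>u. t < u \<Longrightarrow> u < 1 \<Longrightarrow>
      (\<integral>\<^sup>+z. ennreal (passage_density (u - t) z) * (a z * \<psi> z) * indicator {0<..} z \<partial>lborel) = ennreal (J u)"
    and Q: "\<And>u. t < u \<Longrightarrow> u < 1 \<Longrightarrow> 2 / sqrt (2 * pi * (1 - u)) * J u = argmax_density u * Q u"
  shows "argmax_regression {t<..<1} (\<lambda>\<omega>. a (maximum \<omega> - B t \<omega>) * P (maximum \<omega>)) (\<lambda>u. ennreal (Q u))"
  unfolding regression_on_def
proof (intro ballI impI)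
  fix A :: "real set" assume [measurable]: "A \<in> sets borel" and A: "A \<subseteq> {t<..<1}"
  have "(\<integral>\<^sup>+\<omega>. a (maximum \<omega> - B t \<omega>) * P (maximum \<omega>) * indicator A (argmax \<omega>) \<partial>M)
    = (\<integral>\<^sup>+u. indicator A u * (ennreal (2 / sqrt (2 * pi * (1 - u)))
         * (\<integral>\<^sup>+z. ennreal (passage_density (u - t) z) * (a z * \<psi> z) * indicator {0<..} z \<partial>lborel)) \<partial>lborel)"
    by (rule nn_integral_before_argmax[OF t _ _ _ \<psi> A]) simp_all
  also have "\<dots> = (\<integral>\<^sup>+u. ennreal (argmax_density u) * ennreal (Q u) * indicator A u \<partial>lborel)"
  proof (rule nn_integral_cong)
    fix u :: real
    show "indicator A u * (ennreal (2 / sqrt (2 * pi * (1 - u)))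
         * (\<integral>\<^sup>+z. ennreal (passage_density (u - t) z) * (a z * \<psi> z) * indicator {0<..} z \<partial>lborel))
      = ennreal (argmax_density u) * ennreal (Q u) * indicator A u"
    proof (cases "u \<in> A")
      case True
      then have u: "t < u" "u < 1" using A by auto
      have "ennreal (2 / sqrt (2 * pi * (1 - u))) * ennreal (J u) = ennreal (2 / sqrt (2 * pi * (1 - u)) * J u)"
        using u by (intro ennreal_mult'[symmetric]) simp
      also have "\<dots> = ennreal (argmax_density u) * ennreal (Q u)"
        unfolding Q[OF u] using argmax_density_pos[of u] t u by (intro ennreal_mult') simp
      finally show ?thesis using True J[OF u] by (simp add: mult.commute)
    qed simp
  qed
  finally show "(\<integral>\<^sup>+\<omega>. a (maximum \<omega> - B t \<omega>) * P (maximum \<omega>) * indicator A (argmax \<omega>) \<partial>M)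
    = (\<integral>\<^sup>+u. ennreal (argmax_density u) * ennreal (Q u) * indicator A u \<partial>lborel)" .
qed

text \<open>\<open>H\<close> is the conditional mean of the factor in the maximum and
  \<open>J\<close> the integral over the gap; they multiply because maximum and gap separate once
  \<open>t\<close> is past the argmax.\<close>

lemma regression_after:
  assumes t: "0 < t" "t \<le> 1"
    and [measurable]: "a \<in> borel_measurable borel" "b \<in> borel_measurable borel"
    and H: "\<And>u. 0 < u \<Longrightarrow> u < t \<Longrightarrow> (\<integral>\<^sup>+m. ennreal (max_density u m) * a m \<partial>lborel) = ennreal (H u)"
    and J: "\<And>u. 0 < u \<Longrightarrow> u < t \<Longrightarrow>
      (\<integral>\<^sup>+z. ennreal (passage_density (t - u) z * max_cdf (1 - t) z) * b z * indicator {0<..} z \<partial>lborel) = ennreal (J u)"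
    and H0: "\<And>u. 0 < u \<Longrightarrow> u < t \<Longrightarrow> 0 \<le> H u"
    and Q: "\<And>u. 0 < u \<Longrightarrow> u < t \<Longrightarrow> 2 / sqrt (2 * pi * u) * H u * J u = argmax_density u * Q u"
  shows "argmax_regression {0<..<t} (\<lambda>\<omega>. b (maximum \<omega> - B t \<omega>) * a (maximum \<omega>)) (\<lambda>u. ennreal (Q u))"
  unfolding regression_on_def
proof (intro ballI impI)
  fix A :: "real set" assume [measurable]: "A \<in> sets borel" and A: "A \<subseteq> {0<..<t}"
  have "(\<integral>\<^sup>+\<omega>. b (maximum \<omega> - B t \<omega>) * a (maximum \<omega>) * indicator A (argmax \<omega>) \<partial>M)
    = (\<integral>\<^sup>+u. indicator A u * ((\<integral>\<^sup>+m. ennreal (2 * passage_density u m) * a m * indicator {0<..} m \<partial>lborel)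
         * (\<integral>\<^sup>+z. ennreal (passage_density (t - u) z * max_cdf (1 - t) z) * b z * indicator {0<..} z \<partial>lborel)) \<partial>lborel)"
    by (rule nn_integral_after_argmax[OF t _ _ _ A]) simp_all
  also have "\<dots> = (\<integral>\<^sup>+u. ennreal (argmax_density u) * ennreal (Q u) * indicator A u \<partial>lborel)"
  proof (rule nn_integral_cong)
    fix u :: real
    show "indicator A u * ((\<integral>\<^sup>+m. ennreal (2 * passage_density u m) * a m * indicator {0<..} m \<partial>lborel)
         * (\<integral>\<^sup>+z. ennreal (passage_density (t - u) z * max_cdf (1 - t) z) * b z * indicator {0<..} z \<partial>lborel))
      = ennreal (argmax_density u) * ennreal (Q u) * indicator A u"
    proof (cases "u \<in> A")
      case True
      then have u: "0 < u" "u < t" using A by auto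
      have p: "0 \<le> 2 / sqrt (2 * pi * u)" using u by simp
      have "(\<integral>\<^sup>+m. ennreal (2 * passage_density u m) * a m * indicator {0<..} m \<partial>lborel)
        = (\<integral>\<^sup>+m. ennreal (2 / sqrt (2 * pi * u)) * (ennreal (max_density u m) * a m) \<partial>lborel)"
      proof (rule nn_integral_cong)
        fix m :: real
        show "ennreal (2 * passage_density u m) * a m * indicator {0<..} m = ennreal (2 / sqrt (2 * pi * u)) * (ennreal (max_density u m) * a m)"
        proof (cases "0 < m")
          case m: True
          have "2 * passage_density u m = 2 / sqrt (2 * pi * u) * max_density u m"
            unfolding max_density_eq[OF u(1) m] using u by simp
          then have "ennreal (2 * passage_density u m) = ennreal (2 / sqrt (2 * pi * u)) * ennreal (max_density u m)"
            by (simp only: ennreal_mult'[OF p])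
          then show ?thesis using m by (simp add: mult.assoc)
        qed (simp add: max_density_def)
      qed
      also have "\<dots> = ennreal (2 / sqrt (2 * pi * u)) * ennreal (H u)"
        unfolding H[OF u, symmetric] by (rule nn_integral_cmult) measurable
      finally have "(\<integral>\<^sup>+m. ennreal (2 * passage_density u m) * a m * indicator {0<..} m \<partial>lborel) * ennreal (J u)
        = ennreal (2 / sqrt (2 * pi * u) * H u * J u)"
        using p H0[OF u] by (simp only: ennreal_mult' mult_nonneg_nonneg)
      also have "\<dots> = ennreal (argmax_density u) * ennreal (Q u)"
        unfolding Q[OF u] using argmax_density_pos[of u] t u by (intro ennreal_mult') simp
      finally show ?thesis using True J[OF u] by (simp add: mult.commute)
    qed simp
  qed
  finally show "(\<integral>\<^sup>+\<omega>. b (maximum \<omega> - B t \<omega>) * a (maximum \<omega>) * indicator A (argmax \<omega>) \<partial>M)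
    = (\<integral>\<^sup>+u. ennreal (argmax_density u) * ennreal (Q u) * indicator A u \<partial>lborel)" .
qed

text \<open>The bridge integrals are taken at \<open>w = u - t\<close> and \<open>r = t\<close>, so
  that \<open>w / (w + r) = 1 - t / u\<close>. For the product with the maximum the past contributes
  the mean of \<open>B t + z\<close> on the event instead of a probability. By the martingale
  identity this is \<open>z\<close>, and a plain second moment of the passage density remains, free
  of \<open>erf\<close>.\<close>

lemma gap_regressions_before:
  assumes t: "0 \<le> t" "t < 1"
  shows "argmax_regression {t<..<1} (\<lambda>\<omega>. ennreal (maximum \<omega> - B t \<omega>)) (\<lambda>u. ennreal (sqrt u * G11 (1 - t / u)))"
    and "argmax_regression {t<..<1} (\<lambda>\<omega>. ennreal ((maximum \<omega> - B t \<omega>)\<^sup>2)) (\<lambda>u. ennreal (u * (3 * (1 - t / u) - (1 - t / u)\<^sup>2)))"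
    and "argmax_regression {t<..<1} (\<lambda>\<omega>. ennreal (maximum \<omega> - B t \<omega>) * ennreal (maximum \<omega>)) (\<lambda>u. ennreal (2 * (u * sqrt (1 - t / u))))"
proof -
  have cdf: "(\<integral>\<^sup>+\<omega>. 1 * indicator {..<z} (run_max B t \<omega> - B t \<omega>) \<partial>M) = ennreal (max_cdf t z)"
    "(\<integral>\<^sup>+\<omega>. ennreal (B t \<omega> + z) * indicator {..<z} (run_max B t \<omega> - B t \<omega>) \<partial>M) = ennreal z" if "0 < z" for z
    using gap_cdf[of t z] t that by simp_all
  have merge: "(\<integral>\<^sup>+z. ennreal (passage_density w z) * (ennreal (b z) * ennreal (c z)) * indicator {0<..} z \<partial>lborel)
      = (\<integral>\<^sup>+z. ennreal (b z * passage_density w z * c z) * indicator {0<..} z \<partial>lborel)"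
    if "0 < w" "\<And>z. 0 < z \<Longrightarrow> 0 \<le> b z" for w and b c :: "real \<Rightarrow> real"
  proof (rule nn_integral_cong)
    fix z :: real
    show "ennreal (passage_density w z) * (ennreal (b z) * ennreal (c z)) * indicator {0<..} z = ennreal (b z * passage_density w z * c z) * indicator {0<..} z"
    proof (cases "0 < z")
      case True
      have "ennreal (b z * passage_density w z * c z) = ennreal (b z * passage_density w z) * ennreal (c z)"
        using that True by (intro ennreal_mult' mult_nonneg_nonneg passage_density_nonneg) auto
      also have "\<dots> = ennreal (b z) * ennreal (passage_density w z) * ennreal (c z)"
        using that True by (subst ennreal_mult') auto
      finally show ?thesis using True by (simp add: mult_ac)
    qed simp
  qed
  have s: "(u - t) / (u - t + t) = 1 - t / u" if "t < u" for u
    using that t by (simp add: diff_divide_distrib)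
  have "argmax_regression {t<..<1} (\<lambda>\<omega>. ennreal (maximum \<omega> - B t \<omega>) * 1) (\<lambda>u. ennreal (sqrt u * G11 (1 - t / u)))"
  proof (rule regression_before[OF t, where \<psi> = "\<lambda>z. ennreal (max_cdf t z)" and J = "\<lambda>u. G11 (1 - t / u) / sqrt (2 * pi)"])
    fix u assume u: "t < u" "u < 1"
    show "(\<integral>\<^sup>+z. ennreal (passage_density (u - t) z) * (ennreal z * ennreal (max_cdf t z)) * indicator {0<..} z \<partial>lborel)
      = ennreal (G11 (1 - t / u) / sqrt (2 * pi))"
      using merge[of "u - t" "\<lambda>z. z" "max_cdf t"] nn_integral_bridge_max_1[of "u - t" t] s[OF u(1)] u t by simp
    have "sqrt u / sqrt (2 * pi * u) = 1 / sqrt (2 * pi)"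
      using u t by (simp add: real_sqrt_mult)
    then have "2 / sqrt (2 * pi * (1 - u)) * (1 / sqrt (2 * pi * u)) * (sqrt u * G11 (1 - t / u))
      = 2 / sqrt (2 * pi * (1 - u)) * (1 / sqrt (2 * pi) * G11 (1 - t / u))"
      by (metis (no_types, lifting) mult.assoc mult_1 times_divide_eq_left)
    moreover have "2 / sqrt (2 * pi * (1 - u)) * (1 / sqrt (2 * pi * u)) = argmax_density u"
      using u t by (intro argmax_density_eq) auto
    ultimately have "argmax_density u * (sqrt u * G11 (1 - t / u)) = 2 / sqrt (2 * pi * (1 - u)) * (1 / sqrt (2 * pi) * G11 (1 - t / u))"
      by (simp only:)
    then show "2 / sqrt (2 * pi * (1 - u)) * (G11 (1 - t / u) / sqrt (2 * pi)) = argmax_density u * (sqrt u * G11 (1 - t / u))"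
      by simp
  qed (auto simp: cdf[simplified])
  then show "argmax_regression {t<..<1} (\<lambda>\<omega>. ennreal (maximum \<omega> - B t \<omega>)) (\<lambda>u. ennreal (sqrt u * G11 (1 - t / u)))"
    by simp
  have "argmax_regression {t<..<1} (\<lambda>\<omega>. ennreal ((maximum \<omega> - B t \<omega>)\<^sup>2) * 1) (\<lambda>u. ennreal (u * (3 * (1 - t / u) - (1 - t / u)\<^sup>2)))"
  proof (rule regression_before[OF t, where \<psi> = "\<lambda>z. ennreal (max_cdf t z)" and J = "\<lambda>u. u * (3 * (1 - t / u) - (1 - t / u)\<^sup>2) / sqrt (2 * pi * u)"])
    fix u assume u: "t < u" "u < 1"
    show "(\<integral>\<^sup>+z. ennreal (passage_density (u - t) z) * (ennreal (z\<^sup>2) * ennreal (max_cdf t z)) * indicator {0<..} z \<partial>lborel)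
      = ennreal (u * (3 * (1 - t / u) - (1 - t / u)\<^sup>2) / sqrt (2 * pi * u))"
    proof -
      have "(\<integral>\<^sup>+z. ennreal (z\<^sup>2 * passage_density (u - t) z * max_cdf t z) * indicator {0<..} z \<partial>lborel)
        = ennreal (u * (3 * (1 - t / u) - (1 - t / u)\<^sup>2) / sqrt (2 * pi * u))"
        using nn_integral_bridge_max_2[of "u - t" t] u t
        unfolding s[OF u(1)] unfolding diff_add_cancel by (simp only: diff_gt_0_iff_gt)
      then show ?thesis
        using merge[of "u - t" "\<lambda>z. z\<^sup>2" "max_cdf t"] u by (simp only: zero_le_power2 diff_gt_0_iff_gt)
    qed
    show "2 / sqrt (2 * pi * (1 - u)) * (u * (3 * (1 - t / u) - (1 - t / u)\<^sup>2) / sqrt (2 * pi * u))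
      = argmax_density u * (u * (3 * (1 - t / u) - (1 - t / u)\<^sup>2))"
      using argmax_density_eq[of u, symmetric] u t by simp
  qed (auto simp: cdf[simplified])
  then show "argmax_regression {t<..<1} (\<lambda>\<omega>. ennreal ((maximum \<omega> - B t \<omega>)\<^sup>2)) (\<lambda>u. ennreal (u * (3 * (1 - t / u) - (1 - t / u)\<^sup>2)))"
    by simp
  show "argmax_regression {t<..<1} (\<lambda>\<omega>. ennreal (maximum \<omega> - B t \<omega>) * ennreal (maximum \<omega>)) (\<lambda>u. ennreal (2 * (u * sqrt (1 - t / u))))"
  proof (rule regression_before[OF t, where \<psi> = ennreal and J = "\<lambda>u. 2 * (u - t) / sqrt (2 * pi * (u - t))"])
    fix u assume u: "t < u" "u < 1"
    show "(\<integral>\<^sup>+z. ennreal (passage_density (u - t) z) * (ennreal z * ennreal z) * indicator {0<..} z \<partial>lborel)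
      = ennreal (2 * (u - t) / sqrt (2 * pi * (u - t)))"
      using merge[of "u - t" "\<lambda>z. z" "\<lambda>z. z"] nn_integral_sq_passage_density[of "u - t"] u
      by (simp add: power2_eq_square mult_ac)
    define w where "w = u - t"
    have w: "0 < w" "0 < u" "1 - t / u = w / u" using u t by (auto simp: w_def diff_divide_distrib)
    have "w / sqrt (2 * pi * w) = sqrt w / sqrt (2 * pi)"
      using w(1) by (simp add: real_sqrt_mult field_simps)
    moreover have "u * sqrt (w / u) / sqrt (2 * pi * u) = sqrt w / sqrt (2 * pi)"
    proof -
      have "u * sqrt (w / u) / sqrt (2 * pi * u) = u / (sqrt u * sqrt u) * (sqrt w / sqrt (2 * pi))"
        unfolding real_sqrt_divide real_sqrt_mult[of "2 * pi"] by simp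
      then show ?thesis using w(2) by simp
    qed
    ultimately have "w / sqrt (2 * pi * w) = 1 / sqrt (2 * pi * u) * (u * sqrt (w / u))"
      by simp
    then have "2 / sqrt (2 * pi * (1 - u)) * (2 * (w / sqrt (2 * pi * w))) = argmax_density u * (2 * (u * sqrt (w / u)))"
      unfolding argmax_density_eq[OF w(2) u(2), symmetric] by (simp only: mult_ac)
    then show "2 / sqrt (2 * pi * (1 - u)) * (2 * (u - t) / sqrt (2 * pi * (u - t))) = argmax_density u * (2 * (u * sqrt (1 - t / u)))"
      unfolding w(3) w_def[symmetric] by simp
  qed (auto simp: cdf)
qed

end

lemma G11_nonneg: "0 \<le> s \<Longrightarrow> s \<le> 1 \<Longrightarrow> 0 \<le> G11 s"
  by (auto simp: G11_def arctan_odds_def intro!: mult_nonneg_nonneg add_nonneg_nonneg)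

lemma borel_measurable_G11 [measurable]: "G11 \<in> borel_measurable borel"
  unfolding G11_def[abs_def] arctan_odds_def by measurable

context brownian_unit
begin

text \<open>Here \<open>w = t - u\<close> and \<open>r = 1 - t\<close>, so
  \<open>w + r = 1 - u\<close>. The third regression function is the product of the mean
  \<open>sqrt (pi * u / 2)\<close> of the maximum with the first one: given an argmax before
  \<open>t\<close>, maximum and gap are independent.\<close>

lemma gap_regressions_after:
  assumes t: "0 < t" "t \<le> 1"
  shows "argmax_regression {0<..<t} (\<lambda>\<omega>. ennreal (maximum \<omega> - B t \<omega>))
      (\<lambda>u. ennreal (sqrt (1 - u) * G11 ((t - u) / (1 - u))))"
    and "argmax_regression {0<..<t} (\<lambda>\<omega>. ennreal ((maximum \<omega> - B t \<omega>)\<^sup>2))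
      (\<lambda>u. ennreal ((1 - u) * (3 * ((t - u) / (1 - u)) - ((t - u) / (1 - u))\<^sup>2)))"
    and "argmax_regression {0<..<t} (\<lambda>\<omega>. ennreal (maximum \<omega> - B t \<omega>) * ennreal (maximum \<omega>))
      (\<lambda>u. ennreal (sqrt (pi * u / 2) * (sqrt (1 - u) * G11 ((t - u) / (1 - u)))))"
proof -
  have merge: "(\<integral>\<^sup>+z. ennreal (passage_density w z * c z) * ennreal (b z) * indicator {0<..} z \<partial>lborel)
      = (\<integral>\<^sup>+z. ennreal (b z * passage_density w z * c z) * indicator {0<..} z \<partial>lborel)"
    if "\<And>z. 0 < z \<Longrightarrow> 0 \<le> b z" for w and b c :: "real \<Rightarrow> real"
  proof (rule nn_integral_cong)
    fix z :: real
    show "ennreal (passage_density w z * c z) * ennreal (b z) * indicator {0<..} z = ennreal (b z * passage_density w z * c z) * indicator {0<..} z"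
    proof (cases "0 < z")
      case True
      have "ennreal (b z * (passage_density w z * c z)) = ennreal (b z) * ennreal (passage_density w z * c z)"
        using that True by (intro ennreal_mult') auto
      then show ?thesis using True by (simp add: mult_ac)
    qed simp
  qed
  have sum: "t - u + (1 - t) = 1 - u" for u by simp
  have bridge1: "(\<integral>\<^sup>+z. ennreal (passage_density (t - u) z * max_cdf (1 - t) z) * ennreal z * indicator {0<..} z \<partial>lborel)
      = ennreal (G11 ((t - u) / (1 - u)) / sqrt (2 * pi))" if "0 < u" "u < t" for u
    using merge[of "\<lambda>z. z" "t - u" "max_cdf (1 - t)"] nn_integral_bridge_max_1[of "t - u" "1 - t"] that t
    unfolding sum by simp
  have bridge2: "(\<integral>\<^sup>+z. ennreal (passage_density (t - u) z * max_cdf (1 - t) z) * ennreal (z\<^sup>2) * indicator {0<..} z \<partial>lborel)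
      = ennreal ((1 - u) * (3 * ((t - u) / (1 - u)) - ((t - u) / (1 - u))\<^sup>2) / sqrt (2 * pi * (1 - u)))" if "0 < u" "u < t" for u
    using merge[of "\<lambda>z. z\<^sup>2" "t - u" "max_cdf (1 - t)"] nn_integral_bridge_max_2[of "t - u" "1 - t"] that t
    unfolding sum by simp
  \<comment> \<open>\<open>H\<close> stands for the conditional mean of the factor in the maximum,
    which is 1 or \<open>sqrt (pi * u / 2)\<close>.\<close>
  have dens: "2 / sqrt (2 * pi * u) * H * (G / sqrt (2 * pi)) = argmax_density u * (H * (sqrt (1 - u) * G))" if "0 < u" "u < t" for u H G
  proof -
    have u: "0 < u" "u < 1" using that t by auto
    have "sqrt (1 - u) / sqrt (2 * pi * (1 - u)) = 1 / sqrt (2 * pi)"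
      using u by (simp add: real_sqrt_mult)
    then have e: "1 / sqrt (2 * pi * (1 - u)) * sqrt (1 - u) = 1 / sqrt (2 * pi)" by simp
    have "argmax_density u * (H * (sqrt (1 - u) * G))
       = 2 / sqrt (2 * pi * u) * H * (1 / sqrt (2 * pi * (1 - u)) * sqrt (1 - u)) * G"
      unfolding argmax_density_eq[OF u, symmetric] by (simp add: ac_simps)
    then show ?thesis unfolding e by simp
  qed
  have "argmax_regression {0<..<t} (\<lambda>\<omega>. ennreal (maximum \<omega> - B t \<omega>) * 1) (\<lambda>u. ennreal (1 * (sqrt (1 - u) * G11 ((t - u) / (1 - u)))))"
    by (rule regression_after[OF t _ _ _ bridge1, where H = "\<lambda>_. 1"])
       (auto simp: nn_integral_max_density(1) dens[of _ 1, simplified])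
  then show "argmax_regression {0<..<t} (\<lambda>\<omega>. ennreal (maximum \<omega> - B t \<omega>)) (\<lambda>u. ennreal (sqrt (1 - u) * G11 ((t - u) / (1 - u))))"
    by simp
  show "argmax_regression {0<..<t} (\<lambda>\<omega>. ennreal (maximum \<omega> - B t \<omega>) * ennreal (maximum \<omega>))
      (\<lambda>u. ennreal (sqrt (pi * u / 2) * (sqrt (1 - u) * G11 ((t - u) / (1 - u)))))"
    by (rule regression_after[OF t _ _ nn_integral_max_density_mult(1) bridge1 _ dens]) simp_all
  have "argmax_regression {0<..<t} (\<lambda>\<omega>. ennreal ((maximum \<omega> - B t \<omega>)\<^sup>2) * 1)
      (\<lambda>u. ennreal ((1 - u) * (3 * ((t - u) / (1 - u)) - ((t - u) / (1 - u))\<^sup>2)))"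
  proof (rule regression_after[OF t _ _ _ bridge2, where H = "\<lambda>_. 1"])
    fix u assume u: "0 < u" "u < t"
    show "2 / sqrt (2 * pi * u) * 1 * ((1 - u) * (3 * ((t - u) / (1 - u)) - ((t - u) / (1 - u))\<^sup>2) / sqrt (2 * pi * (1 - u)))
      = argmax_density u * ((1 - u) * (3 * ((t - u) / (1 - u)) - ((t - u) / (1 - u))\<^sup>2))"
      using argmax_density_eq[of u, symmetric] u t by simp
  qed (auto simp: nn_integral_max_density(1))
  then show "argmax_regression {0<..<t} (\<lambda>\<omega>. ennreal ((maximum \<omega> - B t \<omega>)\<^sup>2))
      (\<lambda>u. ennreal ((1 - u) * (3 * ((t - u) / (1 - u)) - ((t - u) / (1 - u))\<^sup>2)))"
    by simp
qed

text \<open>The balance equations \<open>B\<^sup>+ + Z = B\<^sup>- + h\<close> and \<open>B\<^sup>2 + 2 h Z = h\<^sup>2 + Z\<^sup>2\<close> for \<open>Z = h - B\<close>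
  determine the moments of \<open>B\<close> from those of nonnegative variables.\<close>
lemma AE_moments_given_argmax:
  assumes t: "0 \<le> t" "t \<le> 1" and \<kappa>: "regular_cond_distr M argmax (B t) \<kappa>"
    and D [measurable]: "D \<in> sets borel" "D \<subseteq> {0<..<1}"
    and [measurable]: "z1 \<in> borel_measurable borel" "z2 \<in> borel_measurable borel" "z3 \<in> borel_measurable borel"
    and z: "\<And>u. u \<in> D \<Longrightarrow> 0 \<le> z1 u" "\<And>u. u \<in> D \<Longrightarrow> 0 \<le> z2 u" "\<And>u. u \<in> D \<Longrightarrow> 0 \<le> z3 u"
    and r: "argmax_regression D (\<lambda>\<omega>. ennreal (maximum \<omega> - B t \<omega>)) (\<lambda>u. ennreal (z1 u))"
      "argmax_regression D (\<lambda>\<omega>. ennreal ((maximum \<omega> - B t \<omega>)\<^sup>2)) (\<lambda>u. ennreal (z2 u))"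
      "argmax_regression D (\<lambda>\<omega>. ennreal (maximum \<omega> - B t \<omega>) * ennreal (maximum \<omega>)) (\<lambda>u. ennreal (z3 u))"
  shows "AE u in lborel. u \<in> D \<longrightarrow> integrable (\<kappa> u) (\<lambda>b. b\<^sup>2) \<and> integrable (\<kappa> u) (\<lambda>b. b) \<and>
    mean (\<kappa> u) = sqrt (pi * u / 2) - z1 u \<and> second_moment (\<kappa> u) = 2 * u + z2 u - 2 * z3 u \<and>
    var (\<kappa> u) = second_moment (\<kappa> u) - (mean (\<kappa> u))\<^sup>2"
proof -
  have [measurable]: "B t \<in> borel_measurable M" using random_variable_B t by simp
  have h: "B t \<omega> \<le> maximum \<omega>" "0 \<le> maximum \<omega>" if "\<omega> \<in> space M" for \<omega>
    using le_run_max[OF that t] run_max_nonneg[OF that] by auto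
  have pos: "0 < argmax_density u" if "u \<in> D" for u using D(2) that by (intro argmax_density_pos) auto
  have 1: "AE u in lborel. u \<in> D \<longrightarrow> (\<integral>\<^sup>+b. ennreal b \<partial>\<kappa> u) + ennreal (z1 u)
      = (\<integral>\<^sup>+b. ennreal (- b) \<partial>\<kappa> u) + (\<integral>\<^sup>+m. ennreal (max_density u m) * ennreal m \<partial>lborel)"
  proof (rule AE_kernel_eq[OF \<kappa>, where f = argmax_density and ?W1.0 = "\<lambda>\<omega>. ennreal (maximum \<omega> - B t \<omega>)" and ?W2.0 = "\<lambda>\<omega>. ennreal (maximum \<omega>)"])
    show "ennreal (B t \<omega>) + ennreal (maximum \<omega> - B t \<omega>) = ennreal (- B t \<omega>) + ennreal (maximum \<omega>)" if "\<omega> \<in> space M" for \<omega>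
      using h[OF that] by (cases "0 \<le> B t \<omega>") (simp_all add: ennreal_plus[symmetric] ennreal_neg del: ennreal_plus)
    show "argmax_regression D (\<lambda>\<omega>. ennreal (maximum \<omega>)) (\<lambda>u. \<integral>\<^sup>+m. ennreal (max_density u m) * ennreal m \<partial>lborel)"
      by (rule argmax_regression_maximum) simp
  qed (use r pos in \<open>auto simp: distr_argmax\<close>)
  have 2: "AE u in lborel. u \<in> D \<longrightarrow> (\<integral>\<^sup>+b. ennreal (b\<^sup>2) \<partial>\<kappa> u) + 2 * ennreal (z3 u)
      = (\<integral>\<^sup>+b. 0 \<partial>\<kappa> u) + ((\<integral>\<^sup>+m. ennreal (max_density u m) * ennreal (m\<^sup>2) \<partial>lborel) + ennreal (z2 u))"
  proof (rule AE_kernel_eq[OF \<kappa>, where f = argmax_density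
        and ?W1.0 = "\<lambda>\<omega>. 2 * (ennreal (maximum \<omega> - B t \<omega>) * ennreal (maximum \<omega>))"
        and ?W2.0 = "\<lambda>\<omega>. ennreal ((maximum \<omega>)\<^sup>2) + ennreal ((maximum \<omega> - B t \<omega>)\<^sup>2)"])
    show "ennreal ((B t \<omega>)\<^sup>2) + 2 * (ennreal (maximum \<omega> - B t \<omega>) * ennreal (maximum \<omega>))
        = 0 + (ennreal ((maximum \<omega>)\<^sup>2) + ennreal ((maximum \<omega> - B t \<omega>)\<^sup>2))" if "\<omega> \<in> space M" for \<omega>
    proof -
      have "(B t \<omega>)\<^sup>2 + 2 * ((maximum \<omega> - B t \<omega>) * maximum \<omega>) = (maximum \<omega>)\<^sup>2 + (maximum \<omega> - B t \<omega>)\<^sup>2"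
        by (simp add: power2_eq_square algebra_simps)
      moreover have "2 * (ennreal (maximum \<omega> - B t \<omega>) * ennreal (maximum \<omega>)) = ennreal (2 * ((maximum \<omega> - B t \<omega>) * maximum \<omega>))"
        using h[OF that] by (simp add: ennreal_mult)
      ultimately show ?thesis
        using h[OF that] by (simp add: ennreal_plus[symmetric] del: ennreal_plus)
    qed
    show "argmax_regression D (\<lambda>\<omega>. 2 * (ennreal (maximum \<omega> - B t \<omega>) * ennreal (maximum \<omega>))) (\<lambda>u. 2 * ennreal (z3 u))"
      by (rule regression_on_cmult[OF r(3)]) measurable
    show "argmax_regression D (\<lambda>\<omega>. ennreal ((maximum \<omega>)\<^sup>2) + ennreal ((maximum \<omega> - B t \<omega>)\<^sup>2))
        (\<lambda>u. (\<integral>\<^sup>+m. ennreal (max_density u m) * ennreal (m\<^sup>2) \<partial>lborel) + ennreal (z2 u))"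
      by (rule regression_on_add[OF argmax_regression_maximum r(2)]) measurable
  qed (use pos in \<open>auto simp: distr_argmax\<close>)
  from 1 2 show ?thesis
  proof eventually_elim
    case (elim u)
    show ?case
    proof
      assume u: "u \<in> D"
      then have u0: "0 < u" using D(2) by auto
      have "2 * ennreal (z3 u) = ennreal (2 * z3 u)"
        using z(3)[OF u] by (simp add: ennreal_mult)
      then have "(\<integral>\<^sup>+b. ennreal (b\<^sup>2) \<partial>\<kappa> u) + ennreal (2 * z3 u) = ennreal (2 * u + z2 u)"
        using elim(2) u u0 z(2)[OF u] by (simp add: nn_integral_max_density_mult(2))
      moreover have "(\<integral>\<^sup>+b. ennreal b \<partial>\<kappa> u) + ennreal (z1 u) = (\<integral>\<^sup>+b. ennreal (- b) \<partial>\<kappa> u) + ennreal (sqrt (pi * u / 2))"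
        using elim(1) u nn_integral_max_density_mult(1)[OF u0] by simp
      moreover have "0 \<le> sqrt (pi * u / 2)" "0 \<le> 2 * z3 u" "0 \<le> 2 * u + z2 u" using u0 z[OF u] by auto
      ultimately show "integrable (\<kappa> u) (\<lambda>b. b\<^sup>2) \<and> integrable (\<kappa> u) (\<lambda>b. b) \<and>
          mean (\<kappa> u) = sqrt (pi * u / 2) - z1 u \<and> second_moment (\<kappa> u) = 2 * u + z2 u - 2 * z3 u \<and>
          var (\<kappa> u) = second_moment (\<kappa> u) - (mean (\<kappa> u))\<^sup>2"
        using moments_from_balance[OF regular_cond_distr_kernel(2,3)[OF \<kappa>], of "sqrt (pi * u / 2)" "z1 u" "2 * z3 u" "2 * u + z2 u" u]
          z(1)[OF u] by blast
    qed
  qed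
qed

end

section \<open>The moments of the maximum, averaging over it, and the theorem\<close>

text \<open>The measure lives on the positive half-line, so the negative part of the mean is 0 and
  the balance equations hold with \<open>q = c = 0\<close>.\<close>

lemma max_density_moments:
  assumes "0 < u"
  shows "integrable (density lborel (\<lambda>m. ennreal (max_density u m))) (\<lambda>h. h\<^sup>2)"
    and "var (density lborel (\<lambda>m. ennreal (max_density u m))) = (2 - pi / 2) * u"
proof -
  let ?\<mu> = "density lborel (\<lambda>m. ennreal (max_density u m))"
  have int: "(\<integral>\<^sup>+h. ennreal (g h) \<partial>?\<mu>) = (\<integral>\<^sup>+h. ennreal (g h * max_density u h) \<partial>lborel)" if "g \<in> borel_measurable borel" for g
  proof -
    have "(\<integral>\<^sup>+h. ennreal (g h) \<partial>?\<mu>) = (\<integral>\<^sup>+h. ennreal (max_density u h) * ennreal (g h) \<partial>lborel)"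
      using that by (intro nn_integral_density) auto
    then show ?thesis
      using max_density_nonneg[OF assms] by (simp add: ennreal_mult''[symmetric] ennreal_mult' mult.commute)
  qed
  have p: "prob_space ?\<mu>"
    using nn_integral_max_density(1)[OF assms] by (intro prob_spaceI) (simp add: emeasure_density)
  have "- h * max_density u h \<le> 0" for h
  proof (cases "0 < h")
    case True
    then have "0 \<le> h * max_density u h"
      using max_density_nonneg[OF assms] by (intro mult_nonneg_nonneg) auto
    then show ?thesis by simp
  qed (simp add: max_density_def)
  then have "(\<integral>\<^sup>+h. ennreal (- h) \<partial>?\<mu>) = (\<integral>\<^sup>+(h::real). 0 \<partial>lborel)"
    unfolding int[of uminus, simplified] by (intro nn_integral_cong) (auto simp: ennreal_neg)
  then have neg: "(\<integral>\<^sup>+h. ennreal (- h) \<partial>?\<mu>) = 0" by simp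
  have pos: "(\<integral>\<^sup>+h. ennreal h \<partial>?\<mu>) = ennreal (sqrt (pi * u / 2))"
    using int[of "\<lambda>h. h"] nn_integral_max_density(2)[OF assms] by simp
  have sq: "(\<integral>\<^sup>+h. ennreal (h\<^sup>2) \<partial>?\<mu>) = ennreal (2 * u)"
    using int[of "\<lambda>h. h\<^sup>2"] nn_integral_max_density(3)[OF assms] by simp
  note m = moments_from_balance[OF p, of "sqrt (pi * u / 2)" 0 0 "2 * u"]
  show "integrable ?\<mu> (\<lambda>h. h\<^sup>2)"
    by (rule m(1)) (use assms neg pos sq in simp_all)
  have "var ?\<mu> = second_moment ?\<mu> - (mean ?\<mu>)\<^sup>2" "mean ?\<mu> = sqrt (pi * u / 2) - 0" "second_moment ?\<mu> = 2 * u - 0"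
    by (rule m(5) m(3) m(4); use assms neg pos sq in simp)+
  then show "var ?\<mu> = (2 - pi / 2) * u"
    using assms by (simp add: algebra_simps)
qed

text \<open>The tower property is at hand for nonnegative functions, hence for the positive and the
  negative part separately. Both are finite by integrability under \<open>\<mu>\<close>. So almost
  every \<open>\<nu> m\<close> has a finite mean, and the difference of the two parts is a Bochner
  integral.\<close>

lemma mean_tower:
  fixes \<nu> :: "real \<Rightarrow> real measure"
  assumes "0 < u" and i: "integrable \<mu> (\<lambda>b. b)"
    and sets: "\<And>m. sets (\<nu> m) = sets borel"
    and meas [measurable]: "(\<lambda>m. \<integral>\<^sup>+b. ennreal b \<partial>\<nu> m) \<in> borel_measurable borel" "(\<lambda>m. \<integral>\<^sup>+b. ennreal (- b) \<partial>\<nu> m) \<in> borel_measurable borel"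
    and P: "(\<integral>\<^sup>+b. ennreal b \<partial>\<mu>) = (\<integral>\<^sup>+m. ennreal (max_density u m) * (\<integral>\<^sup>+b. ennreal b \<partial>\<nu> m) \<partial>lborel)"
    and N: "(\<integral>\<^sup>+b. ennreal (- b) \<partial>\<mu>) = (\<integral>\<^sup>+m. ennreal (max_density u m) * (\<integral>\<^sup>+b. ennreal (- b) \<partial>\<nu> m) \<partial>lborel)"
  shows "AE m in lborel. 0 < m \<longrightarrow> integrable (\<nu> m) (\<lambda>b. b)"
    and "set_integrable lborel {0<..} (\<lambda>m. mean (\<nu> m) * max_density u m)"
    and "(LBINT m:{0<..}. mean (\<nu> m) * max_density u m) = mean \<mu>"
proof -
  define p where "p m = (\<integral>\<^sup>+b. ennreal b \<partial>\<nu> m)" for m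
  define n where "n m = (\<integral>\<^sup>+b. ennreal (- b) \<partial>\<nu> m)" for m
  have [measurable]: "p \<in> borel_measurable borel" "n \<in> borel_measurable borel"
    unfolding p_def[abs_def] n_def[abs_def] by measurable
  have fin: "(\<integral>\<^sup>+m. ennreal (max_density u m) * p m \<partial>lborel) \<noteq> \<infinity>" "(\<integral>\<^sup>+m. ennreal (max_density u m) * n m \<partial>lborel) \<noteq> \<infinity>"
    using i P N by (auto simp: real_integrable_def p_def n_def)
  have integ: "integrable (\<nu> m) (\<lambda>b. b) \<longleftrightarrow> p m \<noteq> \<infinity> \<and> n m \<noteq> \<infinity>" for m
    unfolding real_integrable_def p_def n_def by (simp add: measurable_cong_sets[OF sets refl])
  have mean_eq: "mean (\<nu> m) = enn2real (p m) - enn2real (n m)" if "p m \<noteq> \<infinity>" "n m \<noteq> \<infinity>" for m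
    unfolding mean_def p_def n_def by (rule real_lebesgue_integral_def) (use that integ in blast)
  have ae: "AE m in lborel. 0 < m \<longrightarrow> p m \<noteq> \<infinity>" "AE m in lborel. 0 < m \<longrightarrow> n m \<noteq> \<infinity>"
  proof -
    have *: "AE m in lborel. 0 < m \<longrightarrow> f m \<noteq> \<infinity>"
      if [measurable]: "f \<in> borel_measurable borel" and "(\<integral>\<^sup>+m. ennreal (max_density u m) * f m \<partial>lborel) \<noteq> \<infinity>" for f
    proof -
      have "AE m in lborel. ennreal (max_density u m) * f m \<noteq> \<infinity>"
        by (rule nn_integral_PInf_AE) (use that in auto)
      then show ?thesis
      proof (rule eventually_mono, intro impI)
        fix m :: real assume *: "ennreal (max_density u m) * f m \<noteq> \<infinity>" and "0 < m"
        then have "0 < max_density u m" using assms(1) by (simp add: max_density_def)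
        then show "f m \<noteq> \<infinity>" using * by (auto simp: ennreal_mult_top ennreal_mult_eq_top_iff)
      qed
    qed
    show "AE m in lborel. 0 < m \<longrightarrow> p m \<noteq> \<infinity>" "AE m in lborel. 0 < m \<longrightarrow> n m \<noteq> \<infinity>"
      using * fin by auto
  qed
  show "AE m in lborel. 0 < m \<longrightarrow> integrable (\<nu> m) (\<lambda>b. b)"
    using ae by eventually_elim (simp add: integ)
  have hb: "has_bochner_integral lborel (\<lambda>m. max_density u m * enn2real (f m)) (enn2real (\<integral>\<^sup>+m. ennreal (max_density u m) * f m \<partial>lborel))"
    if [measurable]: "f \<in> borel_measurable borel" and f: "AE m in lborel. 0 < m \<longrightarrow> f m \<noteq> \<infinity>"
      and "(\<integral>\<^sup>+m. ennreal (max_density u m) * f m \<partial>lborel) \<noteq> \<infinity>" for f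
  proof (rule has_bochner_integral_nn_integral)
    have "(\<integral>\<^sup>+m. ennreal (max_density u m * enn2real (f m)) \<partial>lborel) = (\<integral>\<^sup>+m. ennreal (max_density u m) * f m \<partial>lborel)"
    proof (rule nn_integral_cong_AE)
      show "AE m in lborel. ennreal (max_density u m * enn2real (f m)) = ennreal (max_density u m) * f m"
        using f
      proof eventually_elim
        case (elim m)
        show ?case
        proof (cases "0 < m")
          case True
          then have "ennreal (enn2real (f m)) = f m" using elim by (simp add: less_top)
          then show ?thesis using max_density_nonneg[OF assms(1), of m] by (simp add: ennreal_mult')
        qed (simp add: max_density_def)
      qed
    qed
    then show "(\<integral>\<^sup>+m. ennreal (max_density u m * enn2real (f m)) \<partial>lborel) = ennreal (enn2real (\<integral>\<^sup>+m. ennreal (max_density u m) * f m \<partial>lborel))"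
      using that(3) by (simp add: less_top)
  qed (use max_density_nonneg[OF assms(1)] in auto)
  \<comment> \<open>This gives measurability of the mean of \<open>\<nu> m\<close> in
    \<open>m\<close>: where the identity is not integrable the Bochner integral is 0, and
    \<open>q\<close> has the same default.\<close>
  define q where "q m = (if p m \<noteq> \<infinity> \<and> n m \<noteq> \<infinity> then enn2real (p m) - enn2real (n m) else 0)" for m
  have q_mean: "mean (\<nu> m) = q m" for m
  proof (cases "p m \<noteq> \<infinity> \<and> n m \<noteq> \<infinity>")
    case False
    then have "\<not> integrable (\<nu> m) (\<lambda>b. b)" using integ by blast
    then show ?thesis using False by (auto simp: q_def mean_def not_integrable_integral_eq)
  qed (simp add: q_def mean_eq)
  have [measurable]: "q \<in> borel_measurable borel"
    unfolding q_def[abs_def] by measurable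
  have "has_bochner_integral lborel (\<lambda>m. max_density u m * enn2real (p m) - max_density u m * enn2real (n m))
      (enn2real (\<integral>\<^sup>+m. ennreal (max_density u m) * p m \<partial>lborel) - enn2real (\<integral>\<^sup>+m. ennreal (max_density u m) * n m \<partial>lborel))"
    using ae fin by (intro has_bochner_integral_diff hb) auto
  also have "enn2real (\<integral>\<^sup>+m. ennreal (max_density u m) * p m \<partial>lborel) - enn2real (\<integral>\<^sup>+m. ennreal (max_density u m) * n m \<partial>lborel) = mean \<mu>"
    unfolding mean_def real_lebesgue_integral_def[OF i] P N p_def n_def ..
  finally have i1: "has_bochner_integral lborel (\<lambda>m. max_density u m * enn2real (p m) - max_density u m * enn2real (n m)) (mean \<mu>)" .
  have "AE m in lborel. max_density u m * enn2real (p m) - max_density u m * enn2real (n m) = indicator {0<..} m *\<^sub>R (mean (\<nu> m) * max_density u m)"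
    using ae
  proof eventually_elim
    case (elim m)
    show ?case
    proof (cases "0 < m")
      case True
      then show ?thesis using elim by (simp add: mean_eq right_diff_distrib mult.commute[of "_ - _"])
    qed (simp add: max_density_def)
  qed
  then have "has_bochner_integral lborel (\<lambda>m. indicator {0<..} m *\<^sub>R (mean (\<nu> m) * max_density u m)) (mean \<mu>)"
    using i1 unfolding q_mean by (subst (asm) has_bochner_integral_cong_AE) auto
  then show "set_integrable lborel {0<..} (\<lambda>m. mean (\<nu> m) * max_density u m)"
    and "(LBINT m:{0<..}. mean (\<nu> m) * max_density u m) = mean \<mu>"
    by (simp_all add: set_integrable_def set_lebesgue_integral_def has_bochner_integral_iff)
qed

text \<open>The integrand is nonnegative and its nonnegative integral is finite, so that value is
  also its Bochner integral.\<close>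

lemma M1_integral:
  assumes "0 < s" "s \<le> 1" "\<theta> > 0"
  shows "set_integrable lborel {0<..} (\<lambda>h. M1 s (h / sqrt \<theta>) * (h / sqrt \<theta>) * exp (- h\<^sup>2 / (2 * \<theta>)))"
    and "(LBINT h:{0<..}. M1 s (h / sqrt \<theta>) * (h / sqrt \<theta>) * exp (- h\<^sup>2 / (2 * \<theta>))) = sqrt \<theta> * G11 s"
proof -
  define f where "f h = M1 s (h / sqrt \<theta>) * (h / sqrt \<theta>) * exp (- h\<^sup>2 / (2 * \<theta>))" for h
  have [measurable]: "M1 s \<in> borel_measurable borel"
    unfolding M1_def[abs_def] by measurable
  have [measurable]: "f \<in> borel_measurable borel"
    unfolding f_def[abs_def] by measurable
  have "0 \<le> f h" if "0 < h" for h
    unfolding f_def using that assms by (intro mult_nonneg_nonneg M1_nonneg) auto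
  then have nn: "0 \<le> indicator {0<..} h *\<^sub>R f h" for h
    by (auto split: split_indicator)
  have "(\<integral>\<^sup>+h. ennreal (indicator {0<..} h *\<^sub>R f h) \<partial>lborel) = (\<integral>\<^sup>+h. ennreal (f h) * indicator {0<..} h \<partial>lborel)"
    by (intro nn_integral_cong) (auto split: split_indicator)
  also have "\<dots> = ennreal (sqrt \<theta> * G11 s)"
    unfolding f_def by (rule nn_integral_M1_scale[OF assms])
  finally have "has_bochner_integral lborel (\<lambda>h. indicator {0<..} h *\<^sub>R f h) (sqrt \<theta> * G11 s)"
    using nn G11_nonneg[of s] assms by (intro has_bochner_integral_nn_integral) auto
  then show "set_integrable lborel {0<..} (\<lambda>h. M1 s (h / sqrt \<theta>) * (h / sqrt \<theta>) * exp (- h\<^sup>2 / (2 * \<theta>)))"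
    and "(LBINT h:{0<..}. M1 s (h / sqrt \<theta>) * (h / sqrt \<theta>) * exp (- h\<^sup>2 / (2 * \<theta>))) = sqrt \<theta> * G11 s"
    by (simp_all add: set_integrable_def set_lebesgue_integral_def has_bochner_integral_iff f_def)
qed

lemma sqrt_mult_G11: "sqrt x * G11 s = sqrt (2 * x / pi) * (arctan_odds s + sqrt (s * (1 - s)))"
proof -
  have "sqrt x * sqrt (2 / pi) = sqrt (2 * x / pi)"
    unfolding real_sqrt_mult[symmetric] by (simp add: mult.commute)
  then show ?thesis unfolding G11_def by (simp only: mult.assoc[symmetric])
qed

theorem theorem6p1:
  fixes M :: "'a measure" and B :: "real \<Rightarrow> 'a \<Rightarrow> real" and t :: real
    and B_given_argmax max_given_argmax :: "real \<Rightarrow> real measure"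
    and B_given_argmax_max :: "real \<times> real \<Rightarrow> real measure"
  assumes "brownian_motion_01 M B"
    and "0 \<le> t" and "t \<le> 1"
    and "regular_cond_distr M (first_argmax B) (B t) B_given_argmax"
    and "regular_cond_distr M (first_argmax B) (path_max B) max_given_argmax"
    and "regular_cond_distr M (\<lambda>\<omega>. (first_argmax B \<omega>, path_max B \<omega>)) (B t) B_given_argmax_max"
  shows "AE \<theta> in lborel. 0 < \<theta> \<and> \<theta> < 1 \<longrightarrow>
    max_given_argmax \<theta> = density lborel (\<lambda>h. ennreal (max_density \<theta> h)) \<and>
    integrable (max_given_argmax \<theta>) (\<lambda>h. h\<^sup>2) \<and>
    integrable (B_given_argmax \<theta>) (\<lambda>b. b\<^sup>2) \<and>
    (AE h in lborel. 0 < h \<longrightarrow> integrable (B_given_argmax_max (\<theta>, h)) (\<lambda>b. b)) \<and>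
    (t < \<theta> \<longrightarrow> (let s = 1 - t / \<theta> in
       set_integrable lborel {0<..} (\<lambda>h. mean (B_given_argmax_max (\<theta>, h)) * max_density \<theta> h) \<and>
       set_integrable lborel {0<..}
         (\<lambda>h. M1 (1 - t / \<theta>) (h / sqrt \<theta>) * (h / sqrt \<theta>) * exp (- h\<^sup>2 / (2 * \<theta>))) \<and>
       mean (B_given_argmax \<theta>)
         = (LBINT h:{0<..}. mean (B_given_argmax_max (\<theta>, h)) * max_density \<theta> h) \<and>
       (LBINT h:{0<..}. mean (B_given_argmax_max (\<theta>, h)) * max_density \<theta> h)
         = sqrt (pi * \<theta> / 2)
           - (LBINT h:{0<..}. M1 (1 - t / \<theta>) (h / sqrt \<theta>) * (h / sqrt \<theta>) * exp (- h\<^sup>2 / (2 * \<theta>))) \<and>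
       sqrt (pi * \<theta> / 2)
           - (LBINT h:{0<..}. M1 (1 - t / \<theta>) (h / sqrt \<theta>) * (h / sqrt \<theta>) * exp (- h\<^sup>2 / (2 * \<theta>)))
         = sqrt (pi * \<theta> / 2) - sqrt \<theta> * G11 s \<and>
       sqrt (pi * \<theta> / 2) - sqrt \<theta> * G11 s
         = sqrt (pi * \<theta> / 2) - sqrt (2 * \<theta> / pi) * (arctan_odds s + sqrt (s * (1 - s))))) \<and>
    (\<theta> \<le> t \<longrightarrow> (let s = (t - \<theta>) / (1 - \<theta>) in
       mean (B_given_argmax \<theta>)
         = sqrt (pi * \<theta> / 2) - sqrt (2 * (1 - \<theta>) / pi) * (arctan_odds s + sqrt (s * (1 - s))))) \<and>
    (t \<le> \<theta> \<longrightarrow> (let s = 1 - t / \<theta> in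
       second_moment (B_given_argmax \<theta>) = 2 * \<theta> - 4 * \<theta> * sqrt s + \<theta> * (3 * s - s\<^sup>2) \<and>
       var (B_given_argmax \<theta>)
         = second_moment (B_given_argmax \<theta>) - (mean (B_given_argmax \<theta>))\<^sup>2)) \<and>
    (\<theta> \<le> t \<longrightarrow> (let s = (t - \<theta>) / (1 - \<theta>) in
       var (B_given_argmax \<theta>)
         = var (max_given_argmax \<theta>) + (1 - \<theta>) * (3 * s - s\<^sup>2 - (G11 s)\<^sup>2))) \<and>
    var (max_given_argmax \<theta>) = (2 - pi / 2) * \<theta>"
proof -
  interpret brownian_unit M B
    unfolding brownian_unit_def by (rule brownian_of_brownian_motion_01[OF assms(1)])
  note t = assms(2,3)
  have [measurable]: "B t \<in> borel_measurable M" using random_variable_B t by simp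
  have eqs: "first_argmax B = argmax" "path_max B = maximum"
    by (simp_all add: fun_eq_iff first_argmax_def run_argmax_def path_max_def run_max_def)
  note \<kappa> = assms(4-6)[unfolded eqs]
  have sq: "0 \<le> 3 * s - s\<^sup>2" if "0 \<le> s" "s \<le> 1" for s :: real
  proof -
    have "s * s \<le> s * 1" using that by (intro mult_left_mono) auto
    then show ?thesis using that by (simp add: power2_eq_square)
  qed
  \<comment> \<open>For \<open>t = 1\<close> the range of \<open>u\<close> is empty, as it is for
    \<open>t = 0\<close> in the next claim.\<close>
  have before: "AE u in lborel. t < u \<and> u < 1 \<longrightarrow> integrable (B_given_argmax u) (\<lambda>b. b\<^sup>2) \<and> integrable (B_given_argmax u) (\<lambda>b. b) \<and>
      mean (B_given_argmax u) = sqrt (pi * u / 2) - sqrt u * G11 (1 - t / u) \<and>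
      second_moment (B_given_argmax u) = 2 * u + u * (3 * (1 - t / u) - (1 - t / u)\<^sup>2) - 2 * (2 * (u * sqrt (1 - t / u))) \<and>
      var (B_given_argmax u) = second_moment (B_given_argmax u) - (mean (B_given_argmax u))\<^sup>2"
  proof (cases "t < 1")
    case True
    have s: "0 \<le> 1 - t / u" "1 - t / u \<le> 1" "0 \<le> u" if "u \<in> {t<..<1}" for u
      using that t by (auto simp: divide_le_eq_1)
    have "AE u in lborel. u \<in> {t<..<1} \<longrightarrow> integrable (B_given_argmax u) (\<lambda>b. b\<^sup>2) \<and> integrable (B_given_argmax u) (\<lambda>b. b) \<and>
      mean (B_given_argmax u) = sqrt (pi * u / 2) - sqrt u * G11 (1 - t / u) \<and>
      second_moment (B_given_argmax u) = 2 * u + u * (3 * (1 - t / u) - (1 - t / u)\<^sup>2) - 2 * (2 * (u * sqrt (1 - t / u))) \<and>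
      var (B_given_argmax u) = second_moment (B_given_argmax u) - (mean (B_given_argmax u))\<^sup>2"
    proof (rule AE_moments_given_argmax[OF t \<kappa>(1) _ _ _ _ _ _ _ _ gap_regressions_before[OF t(1) True]])
      fix u assume u: "u \<in> {t<..<1}"
      show "0 \<le> sqrt u * G11 (1 - t / u)" "0 \<le> u * (3 * (1 - t / u) - (1 - t / u)\<^sup>2)" "0 \<le> 2 * (u * sqrt (1 - t / u))"
        using G11_nonneg[OF s(1,2)[OF u]] sq[OF s(1,2)[OF u]] s[OF u] by (auto intro!: mult_nonneg_nonneg)
    qed (use t in auto)
    then show ?thesis by simp
  qed (use t in auto)
  have after: "AE u in lborel. 0 < u \<and> u < t \<longrightarrow> integrable (B_given_argmax u) (\<lambda>b. b\<^sup>2) \<and> integrable (B_given_argmax u) (\<lambda>b. b) \<and>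
      mean (B_given_argmax u) = sqrt (pi * u / 2) - sqrt (1 - u) * G11 ((t - u) / (1 - u)) \<and>
      second_moment (B_given_argmax u) = 2 * u + (1 - u) * (3 * ((t - u) / (1 - u)) - ((t - u) / (1 - u))\<^sup>2)
        - 2 * (sqrt (pi * u / 2) * (sqrt (1 - u) * G11 ((t - u) / (1 - u)))) \<and>
      var (B_given_argmax u) = second_moment (B_given_argmax u) - (mean (B_given_argmax u))\<^sup>2"
  proof (cases "0 < t")
    case True
    have s: "0 \<le> (t - u) / (1 - u)" "(t - u) / (1 - u) \<le> 1" "0 \<le> 1 - u" "0 \<le> u" if "u \<in> {0<..<t}" for u
      using that t by (auto simp: divide_le_eq_1)
    have "AE u in lborel. u \<in> {0<..<t} \<longrightarrow> integrable (B_given_argmax u) (\<lambda>b. b\<^sup>2) \<and> integrable (B_given_argmax u) (\<lambda>b. b) \<and>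
      mean (B_given_argmax u) = sqrt (pi * u / 2) - sqrt (1 - u) * G11 ((t - u) / (1 - u)) \<and>
      second_moment (B_given_argmax u) = 2 * u + (1 - u) * (3 * ((t - u) / (1 - u)) - ((t - u) / (1 - u))\<^sup>2)
        - 2 * (sqrt (pi * u / 2) * (sqrt (1 - u) * G11 ((t - u) / (1 - u)))) \<and>
      var (B_given_argmax u) = second_moment (B_given_argmax u) - (mean (B_given_argmax u))\<^sup>2"
    proof (rule AE_moments_given_argmax[OF t \<kappa>(1) _ _ _ _ _ _ _ _ gap_regressions_after[OF True t(2)]])
      fix u assume u: "u \<in> {0<..<t}"
      show "0 \<le> sqrt (1 - u) * G11 ((t - u) / (1 - u))" "0 \<le> (1 - u) * (3 * ((t - u) / (1 - u)) - ((t - u) / (1 - u))\<^sup>2)"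
        "0 \<le> sqrt (pi * u / 2) * (sqrt (1 - u) * G11 ((t - u) / (1 - u)))"
        using G11_nonneg[OF s(1,2)[OF u]] sq[OF s(1,2)[OF u]] s(3,4)[OF u] by (auto intro!: mult_nonneg_nonneg)
    qed (use t in auto)
    then show ?thesis by simp
  qed (use t in auto)
  have pos: "AE u in lborel. u \<in> {0<..<1} \<longrightarrow>
      (\<integral>\<^sup>+b. ennreal b \<partial>B_given_argmax u) = (\<integral>\<^sup>+m. ennreal (max_density u m) * (\<integral>\<^sup>+b. ennreal b \<partial>B_given_argmax_max (u, m)) \<partial>lborel)"
    by (rule AE_tower[OF \<kappa>(1,3)]) simp_all
  have neg: "AE u in lborel. u \<in> {0<..<1} \<longrightarrow>
      (\<integral>\<^sup>+b. ennreal (- b) \<partial>B_given_argmax u) = (\<integral>\<^sup>+m. ennreal (max_density u m) * (\<integral>\<^sup>+b. ennreal (- b) \<partial>B_given_argmax_max (u, m)) \<partial>lborel)"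
    by (rule AE_tower[OF \<kappa>(1,3)]) simp_all
  have meas: "(\<lambda>m. \<integral>\<^sup>+b. g b \<partial>B_given_argmax_max (u, m)) \<in> borel_measurable borel" if "g \<in> borel_measurable borel" for u g
  proof -
    have "(\<lambda>x. \<integral>\<^sup>+b. g b \<partial>B_given_argmax_max x) \<in> borel_measurable (borel \<Otimes>\<^sub>M borel)"
      unfolding borel_prod by (rule measurable_kernel_nn_integral[OF \<kappa>(3) that])
    then show ?thesis by (rule measurable_compose[rotated]) measurable
  qed
  \<comment> \<open>The value \<open>u = t\<close>, where the two regimes meet, is discarded as a
    null set. The non-strict inequalities of the statement thus reduce to strict ones.\<close>
  from before after pos neg AE_max_given_argmax[OF \<kappa>(2)] AE_lborel_singleton[of t]
  show ?thesis
  proof eventually_elim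
    case (elim u)
    show ?case
    proof
      assume "0 < u \<and> u < 1"
      then have u: "0 < u" "u < 1" by auto
      have \<mu>: "max_given_argmax u = density lborel (\<lambda>h. ennreal (max_density u h))"
        using elim(5) u by simp
      have int: "integrable (B_given_argmax u) (\<lambda>b. b\<^sup>2)" "integrable (B_given_argmax u) (\<lambda>b. b)"
        using elim(1,2,6) u by (cases "t < u"; simp)+
      note tower = mean_tower[OF u(1) int(2), of "\<lambda>m. B_given_argmax_max (u, m)", OF regular_cond_distr_kernel(3)[OF \<kappa>(3)] meas meas]
      have tower: "AE h in lborel. 0 < h \<longrightarrow> integrable (B_given_argmax_max (u, h)) (\<lambda>b. b)"
        "set_integrable lborel {0<..} (\<lambda>h. mean (B_given_argmax_max (u, h)) * max_density u h)"
        "(LBINT h:{0<..}. mean (B_given_argmax_max (u, h)) * max_density u h) = mean (B_given_argmax u)"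
        using tower elim(3,4) u by simp_all
      have M1: "set_integrable lborel {0<..} (\<lambda>h. M1 (1 - t / u) (h / sqrt u) * (h / sqrt u) * exp (- h\<^sup>2 / (2 * u)))"
        "(LBINT h:{0<..}. M1 (1 - t / u) (h / sqrt u) * (h / sqrt u) * exp (- h\<^sup>2 / (2 * u))) = sqrt u * G11 (1 - t / u)" if "t < u"
      proof -
        have s: "0 < 1 - t / u" "1 - t / u \<le> 1" using that u t by auto
        show "set_integrable lborel {0<..} (\<lambda>h. M1 (1 - t / u) (h / sqrt u) * (h / sqrt u) * exp (- h\<^sup>2 / (2 * u)))"
          "(LBINT h:{0<..}. M1 (1 - t / u) (h / sqrt u) * (h / sqrt u) * exp (- h\<^sup>2 / (2 * u))) = sqrt u * G11 (1 - t / u)"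
          by (rule M1_integral[OF s u(1)])+
      qed
      have var_max: "var (max_given_argmax u) = (2 - pi / 2) * u"
        unfolding \<mu> by (rule max_density_moments(2)[OF u(1)])
      \<comment> \<open>\<open>a\<close> and \<open>b * G11 s\<close> are the conditional means of h
        and Z. In the second moment minus the squared mean the mixed terms
        \<open>2 * a * b * G11 s\<close> cancel, as they must for independent variables.\<close>
      have var_after: "var (B_given_argmax u) = var (max_given_argmax u) + (1 - u) * (3 * s - s\<^sup>2 - (G11 s)\<^sup>2)"
        if "u < t" and s: "s = (t - u) / (1 - u)" for s
      proof -
        define a where "a = sqrt (pi * u / 2)"
        define b where "b = sqrt (1 - u)"
        have ab: "a\<^sup>2 = pi * u / 2" "b\<^sup>2 = 1 - u" using u by (auto simp: a_def b_def)
        have "var (B_given_argmax u) = 2 * u + (1 - u) * (3 * s - s\<^sup>2) - 2 * (a * (b * G11 s)) - (a - b * G11 s)\<^sup>2"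
          using elim(2) that u by (simp only: a_def b_def simp_thms)
        also have "\<dots> = 2 * u + (1 - u) * (3 * s - s\<^sup>2) - a\<^sup>2 - b\<^sup>2 * (G11 s)\<^sup>2"
          by (simp add: power2_eq_square algebra_simps)
        also have "\<dots> = (2 - pi / 2) * u + (1 - u) * (3 * s - s\<^sup>2 - (G11 s)\<^sup>2)"
          unfolding ab by (simp add: algebra_simps)
        finally show ?thesis unfolding var_max .
      qed
      have before_u: "mean (B_given_argmax u) = sqrt (pi * u / 2) - sqrt u * G11 (1 - t / u)"
        "second_moment (B_given_argmax u) = 2 * u - 4 * u * sqrt (1 - t / u) + u * (3 * (1 - t / u) - (1 - t / u)\<^sup>2)"
        "var (B_given_argmax u) = second_moment (B_given_argmax u) - (mean (B_given_argmax u))\<^sup>2" if "t < u"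
        using elim(1) that u by simp_all
      have after_u: "mean (B_given_argmax u) = sqrt (pi * u / 2) - sqrt (1 - u) * G11 ((t - u) / (1 - u))" if "u < t"
        using elim(2) that u by simp
      show "max_given_argmax u = density lborel (\<lambda>h. ennreal (max_density u h)) \<and>
        integrable (max_given_argmax u) (\<lambda>h. h\<^sup>2) \<and>
        integrable (B_given_argmax u) (\<lambda>b. b\<^sup>2) \<and>
        (AE h in lborel. 0 < h \<longrightarrow> integrable (B_given_argmax_max (u, h)) (\<lambda>b. b)) \<and>
        (t < u \<longrightarrow> (let s = 1 - t / u in
           set_integrable lborel {0<..} (\<lambda>h. mean (B_given_argmax_max (u, h)) * max_density u h) \<and>
           set_integrable lborel {0<..}
             (\<lambda>h. M1 (1 - t / u) (h / sqrt u) * (h / sqrt u) * exp (- h\<^sup>2 / (2 * u))) \<and>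
           mean (B_given_argmax u)
             = (LBINT h:{0<..}. mean (B_given_argmax_max (u, h)) * max_density u h) \<and>
           (LBINT h:{0<..}. mean (B_given_argmax_max (u, h)) * max_density u h)
             = sqrt (pi * u / 2)
               - (LBINT h:{0<..}. M1 (1 - t / u) (h / sqrt u) * (h / sqrt u) * exp (- h\<^sup>2 / (2 * u))) \<and>
           sqrt (pi * u / 2)
               - (LBINT h:{0<..}. M1 (1 - t / u) (h / sqrt u) * (h / sqrt u) * exp (- h\<^sup>2 / (2 * u)))
             = sqrt (pi * u / 2) - sqrt u * G11 s \<and>
           sqrt (pi * u / 2) - sqrt u * G11 s
             = sqrt (pi * u / 2) - sqrt (2 * u / pi) * (arctan_odds s + sqrt (s * (1 - s))))) \<and>
        (u \<le> t \<longrightarrow> (let s = (t - u) / (1 - u) in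
           mean (B_given_argmax u)
             = sqrt (pi * u / 2) - sqrt (2 * (1 - u) / pi) * (arctan_odds s + sqrt (s * (1 - s))))) \<and>
        (t \<le> u \<longrightarrow> (let s = 1 - t / u in
           second_moment (B_given_argmax u) = 2 * u - 4 * u * sqrt s + u * (3 * s - s\<^sup>2) \<and>
           var (B_given_argmax u)
             = second_moment (B_given_argmax u) - (mean (B_given_argmax u))\<^sup>2)) \<and>
        (u \<le> t \<longrightarrow> (let s = (t - u) / (1 - u) in
           var (B_given_argmax u)
             = var (max_given_argmax u) + (1 - u) * (3 * s - s\<^sup>2 - (G11 s)\<^sup>2))) \<and>
        var (max_given_argmax u) = (2 - pi / 2) * u"
        unfolding Let_def sqrt_mult_G11[symmetric]
      proof (intro conjI impI)
        show "max_given_argmax u = density lborel (\<lambda>h. ennreal (max_density u h))" by (rule \<mu>)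
        show "integrable (max_given_argmax u) (\<lambda>h. h\<^sup>2)"
          unfolding \<mu> by (rule max_density_moments(1)[OF u(1)])
      qed (use tower M1 before_u after_u var_after var_max int elim(6) in \<open>simp_all add: less_le\<close>)
    qed
  qed
qed

end
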